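(* Let $\Lambda$ be a finite $k$-graph with no sources and suppose that we have a $\Lambda$-semibranching function system on a measure space $(X, \mu)$, with prefixing maps $\tau_\lambda:D_\lambda\to X$, ranges $R_\lambda=\tau_\lambda(D_\lambda)$ and coding maps $\tau^m$. For each $\lambda \in \Lambda$, define $S_\lambda \in B(L^2(X, \mu))$ by $$S_\lambda \xi(x) = \chi_{R_\lambda}(x)\,(\Phi_{\tau_\lambda}(\tau^{d(\lambda)}(x)))^{-1/2}\,\xi(\tau^{d(\lambda)}(x)).$$ Then the operators $\{S_\lambda\}_{\lambda \in \Lambda}$ generate a representation of $C^*(\Lambda)$ (that is, $\{S_\lambda\}$ is a Cuntz-Krieger $\Lambda$-family, so there is a representation of $C^*(\Lambda)$ on $L^2(X,\mu)$ sending each generator $s_\lambda$ to $S_\lambda$). If $\Lambda$ is aperiodic then this representation is faithful.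
   Context: Notation: $\mathbb N=\{0,1,2,\dots\}$, $k\ge 1$. $k$-graphs: A $k$-graph is a countable category $\Lambda$ with a functor $d:\Lambda\to\mathbb N^k$ satisfying the factorization property: whenever $d(\lambda)=m+n$ there are unique $\mu,\nu\in\Lambda$ with $\lambda=\mu\nu$, $d(\mu)=m$, $d(\nu)=n$. $\Lambda^0$ is the set of identity morphisms (vertices), $r,s:\Lambda\to\Lambda^0$ are the range and source maps, $\Lambda^n=\{\lambda: d(\lambda)=n\}$, $v\Lambda^n=\{\lambda\in\Lambda^n: r(\lambda)=v\}$, $v\Lambda=\{\lambda: r(\lambda)=v\}$. $\Lambda$ is finite if every $\Lambda^n$ is finite; it has no sources if $v\Lambda^n\ne\emptyset$ for all $v\in\Lambda^0$, $n\in\mathbb N^k$. Infinite paths and aperiodicity: $\Omega_k=\{(p,q)\in\mathbb N^k\times\mathbb N^k: p\le q\}$ is the $k$-graph with $r(p,q)=p$, $s(p,q)=q$, $(p,q)(q,m)=(p,m)$, $d(p,q)=q-p$. An infinite path is a $k$-graph morphism (degree-preserving functor) $x:\Omega_k\to\Lambda$; $\Lambda^\infty$ is the set of them; $Z(\lambda)=\{x\in\Lambda^\infty: x(0,d(\lambda))=\lambda\}$; $\sigma^p(x)(m,n)=x(m+p,n+p)$. $\Lambda$ is aperiodic if for each $v\in\Lambda^0$ there is $x\in Z(v)$ such that $\sigma^m(x)\ne\sigma^n(x)$ for all $m\ne n\in\mathbb N^k$. $C^*(\Lambda)$: For $\Lambda$ finite with no sources, a Cuntz-Krieger $\Lambda$-family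 is a collection $\{t_\lambda:\lambda\in\Lambda\}$ of partial isometries in a $C^*$-algebra with (CK1) $\{t_v:v\in\Lambda^0\}$ mutually orthogonal projections; (CK2) $t_\mu t_\lambda=t_{\mu\lambda}$ whenever $s(\mu)=r(\lambda)$; (CK3) $t_\mu^*t_\mu=t_{s(\mu)}$ for all $\mu$; (CK4) $t_v=\sum_{\lambda\in v\Lambda^n}t_\lambda t_\lambda^*$ for all $v\in\Lambda^0$, $n\in\mathbb N^k$. $C^*(\Lambda)$ is the $C^*$-algebra generated by a universal Cuntz-Krieger $\Lambda$-family $\{s_\lambda\}$. Semibranching function system: Let $(X,\mu)$ be a measure space and $I$ a finite index set. A family of measurable maps $\sigma_i:D_i\to X$ ($i\in I$, $D_i\subset X$ measurable) is a semibranching function system if, with $R_i=\sigma_i(D_i)$: $\mu(X\setminus\bigcup_iR_i)=0$ and $\mu(R_i\cap R_j)=0$ for $i\ne j$; and there is a Radon-Nikodym derivative $\Phi_{\sigma_i}=\frac{d(\mu\circ\sigma_i)}{d\mu}$ with $\Phi_{\sigma_i}>0$ $\mu$-a.e. on $D_i$. A measurable $\sigma:X\to X$ is a coding map for $\{\sigma_i\}$ if $\sigma\circ\sigma_i(x)=x$ for all $x\in D_i$. $\Lambda$-semibranching function system: For a finite $k$-graph $\Lambda$ and a measure space $(X,\mu)$, this is a collection $\{D_\lambda\}_{\lambda\in\Lambda}$ of measurable subsets of $X$, prefixing maps $\{\tau_\lambda:D_\lambda\to X\}_{\lambda\in\Lambda}$, and coding maps $\{\tau^m:X\to X\}_{m\in\mathbb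 N^k}$ such that: (a) for each $m\in\mathbb N^k$, $\{\tau_\lambda: d(\lambda)=m\}$ is a semibranching function system with coding map $\tau^m$; (b) if $v\in\Lambda^0$ then $\tau_v=\mathrm{id}$ and $\mu(D_v)>0$; (c) with $R_\lambda=\tau_\lambda(D_\lambda)$, for each $\lambda\in\Lambda$ and $\nu\in s(\lambda)\Lambda$ we have $R_\nu\subseteq D_\lambda$ (up to a set of measure $0$) and $\tau_\lambda\tau_\nu=\tau_{\lambda\nu}$ a.e.; (d) $\tau^m\circ\tau^n=\tau^{m+n}$ for all $m,n\in\mathbb N^k$. $\Phi_{\tau_\lambda}=\frac{d(\mu\circ\tau_\lambda)}{d\mu}$ denotes the Radon-Nikodym derivative on $D_\lambda$.
   Formalization: Faithfulness is proved for semifinite μ (e.g. σ-finite); it fails if every nonempty set has infinite measure, since then L²=0. In (c), τ_λτ_ν=τ_{λν} a.e. is read as including a.e. equality of domains, without which (CK3) can fail. *)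

theory Defs
  imports "HOL-Analysis.Analysis" "HOL-Algebra.Module"
begin

section \<open>Higher-rank graphs\<close>

text \<open>
  Degrees live in \<open>nat ^ 'k\<close> with \<open>'k\<close> finite, so \<open>k = CARD('k) \<ge> 1\<close>; its order and addition are
  componentwise. Categories are presented by their arrows only: \<open>rng\<close> and \<open>src\<close> take values in the
  identity morphisms, and \<open>cmp\<close> is meaningful only on composable pairs.
\<close>

record ('p, 'k::finite) kgraph =
  mor :: "'p set"
  rng :: "'p \<Rightarrow> 'p"
  src :: "'p \<Rightarrow> 'p"
  cmp :: "'p \<Rightarrow> 'p \<Rightarrow> 'p"
  deg :: "'p \<Rightarrow> nat ^ 'k"

locale k_graph =
  fixes \<Lambda> :: "('p, 'k::finite) kgraph"
  assumes countable_mor: "countable (mor \<Lambda>)"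
    and rng_closed: "\<mu> \<in> mor \<Lambda> \<Longrightarrow> rng \<Lambda> \<mu> \<in> mor \<Lambda>"
    and src_closed: "\<mu> \<in> mor \<Lambda> \<Longrightarrow> src \<Lambda> \<mu> \<in> mor \<Lambda>"
    and rng_rng: "\<mu> \<in> mor \<Lambda> \<Longrightarrow> rng \<Lambda> (rng \<Lambda> \<mu>) = rng \<Lambda> \<mu>"
    and src_rng: "\<mu> \<in> mor \<Lambda> \<Longrightarrow> src \<Lambda> (rng \<Lambda> \<mu>) = rng \<Lambda> \<mu>"
    and rng_src: "\<mu> \<in> mor \<Lambda> \<Longrightarrow> rng \<Lambda> (src \<Lambda> \<mu>) = src \<Lambda> \<mu>"
    and src_src: "\<mu> \<in> mor \<Lambda> \<Longrightarrow> src \<Lambda> (src \<Lambda> \<mu>) = src \<Lambda> \<mu>"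
    and cmp_closed: "\<lbrakk>\<mu> \<in> mor \<Lambda>; \<nu> \<in> mor \<Lambda>; src \<Lambda> \<mu> = rng \<Lambda> \<nu>\<rbrakk> \<Longrightarrow> cmp \<Lambda> \<mu> \<nu> \<in> mor \<Lambda>"
    and rng_cmp: "\<lbrakk>\<mu> \<in> mor \<Lambda>; \<nu> \<in> mor \<Lambda>; src \<Lambda> \<mu> = rng \<Lambda> \<nu>\<rbrakk> \<Longrightarrow> rng \<Lambda> (cmp \<Lambda> \<mu> \<nu>) = rng \<Lambda> \<mu>"
    and src_cmp: "\<lbrakk>\<mu> \<in> mor \<Lambda>; \<nu> \<in> mor \<Lambda>; src \<Lambda> \<mu> = rng \<Lambda> \<nu>\<rbrakk> \<Longrightarrow> src \<Lambda> (cmp \<Lambda> \<mu> \<nu>) = src \<Lambda> \<nu>"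
    and cmp_assoc: "\<lbrakk>\<mu> \<in> mor \<Lambda>; \<nu> \<in> mor \<Lambda>; \<kappa> \<in> mor \<Lambda>; src \<Lambda> \<mu> = rng \<Lambda> \<nu>; src \<Lambda> \<nu> = rng \<Lambda> \<kappa>\<rbrakk>
          \<Longrightarrow> cmp \<Lambda> (cmp \<Lambda> \<mu> \<nu>) \<kappa> = cmp \<Lambda> \<mu> (cmp \<Lambda> \<nu> \<kappa>)"
    and cmp_rng: "\<mu> \<in> mor \<Lambda> \<Longrightarrow> cmp \<Lambda> (rng \<Lambda> \<mu>) \<mu> = \<mu>"
    and cmp_src: "\<mu> \<in> mor \<Lambda> \<Longrightarrow> cmp \<Lambda> \<mu> (src \<Lambda> \<mu>) = \<mu>"
    and deg_ident: "\<mu> \<in> mor \<Lambda> \<Longrightarrow> deg \<Lambda> (rng \<Lambda> \<mu>) = 0" "\<mu> \<in> mor \<Lambda> \<Longrightarrow> deg \<Lambda> (src \<Lambda> \<mu>) = 0"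
    and deg_cmp: "\<lbrakk>\<mu> \<in> mor \<Lambda>; \<nu> \<in> mor \<Lambda>; src \<Lambda> \<mu> = rng \<Lambda> \<nu>\<rbrakk>
          \<Longrightarrow> deg \<Lambda> (cmp \<Lambda> \<mu> \<nu>) = deg \<Lambda> \<mu> + deg \<Lambda> \<nu>"
    and factorization: "\<lbrakk>\<kappa> \<in> mor \<Lambda>; deg \<Lambda> \<kappa> = m + n\<rbrakk>
          \<Longrightarrow> \<exists>!(\<mu>, \<nu>). \<mu> \<in> mor \<Lambda> \<and> \<nu> \<in> mor \<Lambda> \<and> src \<Lambda> \<mu> = rng \<Lambda> \<nu> \<and>
                cmp \<Lambda> \<mu> \<nu> = \<kappa> \<and> deg \<Lambda> \<mu> = m \<and> deg \<Lambda> \<nu> = n"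

text \<open>In an arrows-only category the identity morphisms are the arrows equal to their own range.\<close>

definition vertices :: "('p, 'k::finite) kgraph \<Rightarrow> 'p set" where
  "vertices \<Lambda> = {v \<in> mor \<Lambda>. rng \<Lambda> v = v}"

definition paths :: "('p, 'k::finite) kgraph \<Rightarrow> nat ^ 'k \<Rightarrow> 'p set" where
  "paths \<Lambda> n = {\<mu> \<in> mor \<Lambda>. deg \<Lambda> \<mu> = n}"

definition paths_to :: "('p, 'k::finite) kgraph \<Rightarrow> 'p \<Rightarrow> nat ^ 'k \<Rightarrow> 'p set" where
  "paths_to \<Lambda> v n = {\<mu> \<in> paths \<Lambda> n. rng \<Lambda> \<mu> = v}"

definition finite_kgraph :: "('p, 'k::finite) kgraph \<Rightarrow> bool" where
  "finite_kgraph \<Lambda> \<longleftrightarrow> (\<forall>n. finite (paths \<Lambda> n))"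

definition no_sources :: "('p, 'k::finite) kgraph \<Rightarrow> bool" where
  "no_sources \<Lambda> \<longleftrightarrow> (\<forall>v\<in>vertices \<Lambda>. \<forall>n. paths_to \<Lambda> v n \<noteq> {})"

subsection \<open>Infinite paths and aperiodicity\<close>

text \<open>The object \<open>p\<close> of \<open>\<Omega>\<^sub>k\<close> is represented by its identity morphism \<open>(p, p)\<close>.\<close>

definition Omega :: "((nat ^ 'k) \<times> (nat ^ 'k), 'k::finite) kgraph" where
  "Omega = \<lparr> mor = {(p, q). p \<le> q}, rng = (\<lambda>(p, q). (p, p)), src = (\<lambda>(p, q). (q, q)),
             cmp = (\<lambda>(p, q) (q', m). (p, m)), deg = (\<lambda>(p, q). q - p) \<rparr>"

definition kgraph_morphism ::
  "('p, 'k::finite) kgraph \<Rightarrow> ('q, 'k) kgraph \<Rightarrow> ('p \<Rightarrow> 'q) \<Rightarrow> bool" where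
  "kgraph_morphism \<Lambda> \<Gamma> x \<longleftrightarrow>
     (\<forall>\<mu>\<in>mor \<Lambda>. x \<mu> \<in> mor \<Gamma> \<and> rng \<Gamma> (x \<mu>) = x (rng \<Lambda> \<mu>) \<and> src \<Gamma> (x \<mu>) = x (src \<Lambda> \<mu>) \<and>
                 deg \<Gamma> (x \<mu>) = deg \<Lambda> \<mu>) \<and>
     (\<forall>\<mu>\<in>mor \<Lambda>. \<forall>\<nu>\<in>mor \<Lambda>. src \<Lambda> \<mu> = rng \<Lambda> \<nu> \<longrightarrow> x (cmp \<Lambda> \<mu> \<nu>) = cmp \<Gamma> (x \<mu>) (x \<nu>))"

text \<open>
  Infinite paths are extensional outside \<open>\<Omega>\<^sub>k\<close>, so that equality of HOL functions is equality of
  infinite paths.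
\<close>

definition infinite_paths :: "('p, 'k::finite) kgraph \<Rightarrow> ((nat ^ 'k) \<times> (nat ^ 'k) \<Rightarrow> 'p) set" where
  "infinite_paths \<Lambda> = {x \<in> extensional (mor Omega). kgraph_morphism Omega \<Lambda> x}"

definition cylinder :: "('p, 'k::finite) kgraph \<Rightarrow> 'p \<Rightarrow> ((nat ^ 'k) \<times> (nat ^ 'k) \<Rightarrow> 'p) set" where
  "cylinder \<Lambda> \<mu> = {x \<in> infinite_paths \<Lambda>. x (0, deg \<Lambda> \<mu>) = \<mu>}"

definition shift ::
  "nat ^ 'k::finite \<Rightarrow> ((nat ^ 'k) \<times> (nat ^ 'k) \<Rightarrow> 'p) \<Rightarrow> ((nat ^ 'k) \<times> (nat ^ 'k) \<Rightarrow> 'p)" where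
  "shift p x = (\<lambda>(m, n)\<in>mor Omega. x (m + p, n + p))"

definition aperiodic :: "('p, 'k::finite) kgraph \<Rightarrow> bool" where
  "aperiodic \<Lambda> \<longleftrightarrow>
     (\<forall>v\<in>vertices \<Lambda>. \<exists>x\<in>cylinder \<Lambda> v. \<forall>m n. m \<noteq> n \<longrightarrow> shift m x \<noteq> shift n x)"


section \<open>C*-algebras\<close>

text \<open>
  C*-algebras have explicit carriers, so that the universal property can quantify over them.
  They need not be unital: the field \<open>one\<close> inherited from the ring record is unconstrained and is
  not required to be preserved by homomorphisms.
\<close>

record 'a cstar = "(complex, 'a) module" +
  star :: "'a \<Rightarrow> 'a"
  nrm :: "'a \<Rightarrow> real"

locale cstar_algebra = abelian_group A for A :: "'a cstar" (structure) +
  assumes smult_closed: "x \<in> carrier A \<Longrightarrow> c \<odot> x \<in> carrier A"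
    and smult_l_distr: "x \<in> carrier A \<Longrightarrow> (c + d) \<odot> x = c \<odot> x \<oplus> d \<odot> x"
    and smult_r_distr: "\<lbrakk>x \<in> carrier A; y \<in> carrier A\<rbrakk> \<Longrightarrow> c \<odot> (x \<oplus> y) = c \<odot> x \<oplus> c \<odot> y"
    and smult_assoc: "x \<in> carrier A \<Longrightarrow> (c * d) \<odot> x = c \<odot> (d \<odot> x)"
    and smult_one: "x \<in> carrier A \<Longrightarrow> 1 \<odot> x = x"
    and mult_closed: "\<lbrakk>x \<in> carrier A; y \<in> carrier A\<rbrakk> \<Longrightarrow> x \<otimes> y \<in> carrier A"
    and mult_assoc: "\<lbrakk>x \<in> carrier A; y \<in> carrier A; z \<in> carrier A\<rbrakk> \<Longrightarrow> (x \<otimes> y) \<otimes> z = x \<otimes> (y \<otimes> z)"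
    and mult_l_distr: "\<lbrakk>x \<in> carrier A; y \<in> carrier A; z \<in> carrier A\<rbrakk>
          \<Longrightarrow> (x \<oplus> y) \<otimes> z = x \<otimes> z \<oplus> y \<otimes> z"
    and mult_r_distr: "\<lbrakk>x \<in> carrier A; y \<in> carrier A; z \<in> carrier A\<rbrakk>
          \<Longrightarrow> z \<otimes> (x \<oplus> y) = z \<otimes> x \<oplus> z \<otimes> y"
    and mult_smult_l: "\<lbrakk>x \<in> carrier A; y \<in> carrier A\<rbrakk> \<Longrightarrow> (c \<odot> x) \<otimes> y = c \<odot> (x \<otimes> y)"
    and mult_smult_r: "\<lbrakk>x \<in> carrier A; y \<in> carrier A\<rbrakk> \<Longrightarrow> x \<otimes> (c \<odot> y) = c \<odot> (x \<otimes> y)"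
    and star_closed: "x \<in> carrier A \<Longrightarrow> star A x \<in> carrier A"
    and star_star: "x \<in> carrier A \<Longrightarrow> star A (star A x) = x"
    and star_add: "\<lbrakk>x \<in> carrier A; y \<in> carrier A\<rbrakk> \<Longrightarrow> star A (x \<oplus> y) = star A x \<oplus> star A y"
    and star_smult: "x \<in> carrier A \<Longrightarrow> star A (c \<odot> x) = cnj c \<odot> star A x"
    and star_mult: "\<lbrakk>x \<in> carrier A; y \<in> carrier A\<rbrakk> \<Longrightarrow> star A (x \<otimes> y) = star A y \<otimes> star A x"
    and nrm_nonneg: "x \<in> carrier A \<Longrightarrow> 0 \<le> nrm A x"
    and nrm_eq_0: "x \<in> carrier A \<Longrightarrow> nrm A x = 0 \<longleftrightarrow> x = \<zero>"
    and nrm_triangle: "\<lbrakk>x \<in> carrier A; y \<in> carrier A\<rbrakk> \<Longrightarrow> nrm A (x \<oplus> y) \<le> nrm A x + nrm A y"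
    and nrm_smult: "x \<in> carrier A \<Longrightarrow> nrm A (c \<odot> x) = cmod c * nrm A x"
    and nrm_mult: "\<lbrakk>x \<in> carrier A; y \<in> carrier A\<rbrakk> \<Longrightarrow> nrm A (x \<otimes> y) \<le> nrm A x * nrm A y"
    and cstar_identity: "x \<in> carrier A \<Longrightarrow> nrm A (star A x \<otimes> x) = (nrm A x)\<^sup>2"
    and complete: "\<lbrakk>\<And>n::nat. a n \<in> carrier A;
           \<forall>e>0. \<exists>N. \<forall>m\<ge>N. \<forall>n\<ge>N. nrm A (a m \<ominus> a n) < e\<rbrakk>
          \<Longrightarrow> \<exists>l\<in>carrier A. (\<lambda>n. nrm A (a n \<ominus> l)) \<longlonglongrightarrow> 0"

definition star_hom :: "'a cstar \<Rightarrow> 'b cstar \<Rightarrow> ('a \<Rightarrow> 'b) \<Rightarrow> bool" where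
  "star_hom A B \<pi> \<longleftrightarrow>
     (\<forall>x\<in>carrier A. \<pi> x \<in> carrier B \<and> \<pi> (star A x) = star B (\<pi> x) \<and>
        (\<forall>c. \<pi> (c \<odot>\<^bsub>A\<^esub> x) = c \<odot>\<^bsub>B\<^esub> \<pi> x) \<and>
        (\<forall>y\<in>carrier A. \<pi> (x \<oplus>\<^bsub>A\<^esub> y) = \<pi> x \<oplus>\<^bsub>B\<^esub> \<pi> y \<and> \<pi> (x \<otimes>\<^bsub>A\<^esub> y) = \<pi> x \<otimes>\<^bsub>B\<^esub> \<pi> y))"

definition cstar_subalgebra :: "'a cstar \<Rightarrow> 'a set \<Rightarrow> bool" where
  "cstar_subalgebra A C \<longleftrightarrow> C \<subseteq> carrier A \<and> \<zero>\<^bsub>A\<^esub> \<in> C \<and>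
     (\<forall>x\<in>C. star A x \<in> C \<and> (\<forall>c. c \<odot>\<^bsub>A\<^esub> x \<in> C) \<and> (\<forall>y\<in>C. x \<oplus>\<^bsub>A\<^esub> y \<in> C \<and> x \<otimes>\<^bsub>A\<^esub> y \<in> C)) \<and>
     (\<forall>a::nat \<Rightarrow> 'a. \<forall>l\<in>carrier A. (\<forall>n. a n \<in> C) \<longrightarrow> (\<lambda>n. nrm A (a n \<ominus>\<^bsub>A\<^esub> l)) \<longlonglongrightarrow> 0 \<longrightarrow> l \<in> C)"

definition cstar_generated :: "'a cstar \<Rightarrow> 'a set \<Rightarrow> 'a set" where
  "cstar_generated A G = \<Inter>{C. cstar_subalgebra A C \<and> G \<subseteq> C}"

subsection \<open>Cuntz--Krieger families\<close>

definition partial_isometry :: "'a cstar \<Rightarrow> 'a \<Rightarrow> bool" where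
  "partial_isometry A t \<longleftrightarrow> t \<in> carrier A \<and> t \<otimes>\<^bsub>A\<^esub> star A t \<otimes>\<^bsub>A\<^esub> t = t"

definition projection :: "'a cstar \<Rightarrow> 'a \<Rightarrow> bool" where
  "projection A q \<longleftrightarrow> q \<in> carrier A \<and> star A q = q \<and> q \<otimes>\<^bsub>A\<^esub> q = q"

definition CK_family :: "('p, 'k::finite) kgraph \<Rightarrow> 'a cstar \<Rightarrow> ('p \<Rightarrow> 'a) \<Rightarrow> bool" where
  "CK_family \<Lambda> A t \<longleftrightarrow> cstar_algebra A \<and>
     (\<forall>\<mu>\<in>mor \<Lambda>. partial_isometry A (t \<mu>)) \<and>
     (\<forall>v\<in>vertices \<Lambda>. projection A (t v)) \<and>
     (\<forall>v\<in>vertices \<Lambda>. \<forall>w\<in>vertices \<Lambda>. v \<noteq> w \<longrightarrow> t v \<otimes>\<^bsub>A\<^esub> t w = \<zero>\<^bsub>A\<^esub>) \<and>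
     (\<forall>\<mu>\<in>mor \<Lambda>. \<forall>\<nu>\<in>mor \<Lambda>. src \<Lambda> \<mu> = rng \<Lambda> \<nu> \<longrightarrow> t \<mu> \<otimes>\<^bsub>A\<^esub> t \<nu> = t (cmp \<Lambda> \<mu> \<nu>)) \<and>
     (\<forall>\<mu>\<in>mor \<Lambda>. star A (t \<mu>) \<otimes>\<^bsub>A\<^esub> t \<mu> = t (src \<Lambda> \<mu>)) \<and>
     (\<forall>v\<in>vertices \<Lambda>. \<forall>n. t v = (\<Oplus>\<^bsub>A\<^esub>\<mu>\<in>paths_to \<Lambda> v n. t \<mu> \<otimes>\<^bsub>A\<^esub> star A (t \<mu>)))"

text \<open>
  \<open>(A, s)\<close> is \<open>C\<^sup>*(\<Lambda>)\<close> with its generating family. HOL cannot quantify over types inside a formula,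
  so the universal property refers to all Cuntz--Krieger families in C*-algebras whose elements
  have the type \<open>'b\<close> given by the first argument. The actual \<open>C\<^sup>*(\<Lambda>)\<close> satisfies this predicate for
  every \<open>'b\<close>.
\<close>

definition is_graph_cstar ::
  "'b itself \<Rightarrow> ('p, 'k::finite) kgraph \<Rightarrow> 'a cstar \<Rightarrow> ('p \<Rightarrow> 'a) \<Rightarrow> bool" where
  "is_graph_cstar TYPE('b) \<Lambda> A s \<longleftrightarrow>
     CK_family \<Lambda> A s \<and> cstar_generated A (s ` mor \<Lambda>) = carrier A \<and>
     (\<forall>(B :: 'b cstar) t. CK_family \<Lambda> B t \<longrightarrow>
        (\<exists>\<pi>. star_hom A B \<pi> \<and> (\<forall>\<mu>\<in>mor \<Lambda>. \<pi> (s \<mu>) = t \<mu>)))"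


section \<open>Bounded operators on a Hilbert space\<close>

text \<open>The inner product is linear in its first argument.\<close>

record 'h inner_space = "'h partial_object" +
  vzero :: 'h
  vadd :: "'h \<Rightarrow> 'h \<Rightarrow> 'h"
  vscale :: "complex \<Rightarrow> 'h \<Rightarrow> 'h"
  vinner :: "'h \<Rightarrow> 'h \<Rightarrow> complex"

definition vnorm :: "'h inner_space \<Rightarrow> 'h \<Rightarrow> real" where
  "vnorm H x = sqrt (Re (vinner H x x))"

definition bounded_operators :: "'h inner_space \<Rightarrow> ('h \<Rightarrow> 'h) set" where
  "bounded_operators H = {T \<in> carrier H \<rightarrow>\<^sub>E carrier H.
     (\<forall>x\<in>carrier H. \<forall>y\<in>carrier H. T (vadd H x y) = vadd H (T x) (T y)) \<and>
     (\<forall>c. \<forall>x\<in>carrier H. T (vscale H c x) = vscale H c (T x)) \<and>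
     (\<exists>K. \<forall>x\<in>carrier H. vnorm H (T x) \<le> K * vnorm H x)}"

definition adjoint_op :: "'h inner_space \<Rightarrow> ('h \<Rightarrow> 'h) \<Rightarrow> ('h \<Rightarrow> 'h)" where
  "adjoint_op H T = (THE U. U \<in> bounded_operators H \<and>
     (\<forall>x\<in>carrier H. \<forall>y\<in>carrier H. vinner H (T x) y = vinner H x (U y)))"

definition B_of :: "'h inner_space \<Rightarrow> ('h \<Rightarrow> 'h) cstar" where
  "B_of H = \<lparr> carrier = bounded_operators H,
     mult = compose (carrier H),
     one = (\<lambda>x\<in>carrier H. x),
     zero = (\<lambda>x\<in>carrier H. vzero H),
     add = (\<lambda>T U. \<lambda>x\<in>carrier H. vadd H (T x) (U x)),
     smult = (\<lambda>c T. \<lambda>x\<in>carrier H. vscale H c (T x)),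
     star = adjoint_op H,
     nrm = (\<lambda>T. SUP x\<in>{x \<in> carrier H. vnorm H x \<le> 1}. vnorm H (T x)) \<rparr>"

subsection \<open>The space \<open>L\<^sup>2(X, \<mu>)\<close>\<close>

text \<open>
  Elements are the equivalence classes of square integrable functions modulo equality almost
  everywhere; operations are lifted to classes as in \<open>HOL.Equiv_Relations\<close>, by a union over
  representatives.
\<close>

definition L2_fun :: "'x measure \<Rightarrow> ('x \<Rightarrow> complex) set" where
  "L2_fun M = {f \<in> borel_measurable M. integrable M (\<lambda>x. (cmod (f x))\<^sup>2)}"

definition L2_rel :: "'x measure \<Rightarrow> (('x \<Rightarrow> complex) \<times> ('x \<Rightarrow> complex)) set" where
  "L2_rel M = {(f, g). f \<in> L2_fun M \<and> g \<in> L2_fun M \<and> (AE x in M. f x = g x)}"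

definition L2_class :: "'x measure \<Rightarrow> ('x \<Rightarrow> complex) \<Rightarrow> ('x \<Rightarrow> complex) set" where
  "L2_class M f = L2_rel M `` {f}"

definition L2 :: "'x measure \<Rightarrow> ('x \<Rightarrow> complex) set inner_space" where
  "L2 M = \<lparr> carrier = L2_fun M // L2_rel M,
     vzero = L2_class M (\<lambda>x. 0),
     vadd = (\<lambda>P Q. \<Union>f\<in>P. \<Union>g\<in>Q. L2_class M (\<lambda>x. f x + g x)),
     vscale = (\<lambda>c P. \<Union>f\<in>P. L2_class M (\<lambda>x. c * f x)),
     vinner = (\<lambda>P Q. the_elem (\<Union>f\<in>P. \<Union>g\<in>Q. {\<integral>x. f x * cnj (g x) \<partial>M})) \<rparr>"

type_synonym 'x L2_op = "('x \<Rightarrow> complex) set \<Rightarrow> ('x \<Rightarrow> complex) set"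


section \<open>Semibranching function systems\<close>

text \<open>
  \<open>\<Phi>\<close> is a (finite) version of the Radon--Nikodym derivative \<open>d(\<mu> \<circ> \<sigma>)/d\<mu>\<close> on \<open>D\<close>, where
  \<open>(\<mu> \<circ> \<sigma>)(E) = \<mu>(\<sigma>(E))\<close>. For \<open>\<mu> \<circ> \<sigma>\<close> to be a measure on \<open>D\<close>, images of measurable sets have to be
  measurable. \<open>\<sigma>\<close> is a total HOL function of which only the values on \<open>D\<close> matter.
\<close>

definition RN_derivative_of_map ::
  "'x measure \<Rightarrow> 'x set \<Rightarrow> ('x \<Rightarrow> 'x) \<Rightarrow> ('x \<Rightarrow> real) \<Rightarrow> bool" where
  "RN_derivative_of_map M D \<sigma> \<Phi> \<longleftrightarrow>
     \<Phi> \<in> borel_measurable (restrict_space M D) \<and>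
     (\<forall>E\<in>sets M. E \<subseteq> D \<longrightarrow>
        \<sigma> ` E \<in> sets M \<and> emeasure M (\<sigma> ` E) = (\<integral>\<^sup>+x\<in>E. ennreal (\<Phi> x) \<partial>M))"

definition semibranching_system ::
  "'x measure \<Rightarrow> 'i set \<Rightarrow> ('i \<Rightarrow> 'x set) \<Rightarrow> ('i \<Rightarrow> 'x \<Rightarrow> 'x) \<Rightarrow> ('i \<Rightarrow> 'x \<Rightarrow> real) \<Rightarrow> bool" where
  "semibranching_system M I D \<sigma> \<Phi> \<longleftrightarrow> finite I \<and>
     (\<forall>i\<in>I. D i \<in> sets M \<and> \<sigma> i \<in> restrict_space M (D i) \<rightarrow>\<^sub>M M) \<and>
     (\<forall>i\<in>I. RN_derivative_of_map M (D i) (\<sigma> i) (\<Phi> i) \<and> (AE x in M. x \<in> D i \<longrightarrow> \<Phi> i x > 0)) \<and>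
     emeasure M (space M - (\<Union>i\<in>I. \<sigma> i ` D i)) = 0 \<and>
     (\<forall>i\<in>I. \<forall>j\<in>I. i \<noteq> j \<longrightarrow> emeasure M (\<sigma> i ` D i \<inter> \<sigma> j ` D j) = 0)"

definition coding_map ::
  "'x measure \<Rightarrow> 'i set \<Rightarrow> ('i \<Rightarrow> 'x set) \<Rightarrow> ('i \<Rightarrow> 'x \<Rightarrow> 'x) \<Rightarrow> ('x \<Rightarrow> 'x) \<Rightarrow> bool" where
  "coding_map M I D \<sigma> c \<longleftrightarrow> c \<in> M \<rightarrow>\<^sub>M M \<and> (\<forall>i\<in>I. \<forall>x\<in>D i. c (\<sigma> i x) = x)"

text \<open>
  In \<open>prefix_comp\<close> the equation \<open>\<tau>\<^sub>\<mu> \<tau>\<^sub>\<nu> = \<tau>\<^sub>\<mu>\<^sub>\<nu>\<close> a.e. is an equation of partially defined maps: the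
  domains \<open>{x \<in> D\<^sub>\<nu>. \<tau>\<^sub>\<nu> x \<in> D\<^sub>\<mu>}\<close> and \<open>D\<^sub>\<mu>\<^sub>\<nu>\<close> agree a.e., and on them so do the values. Agreement of
  the domains cannot be dropped: it is what gives \<open>D\<^sub>\<mu> = D\<^bsub>s(\<mu>)\<^esub>\<close> a.e.
\<close>

locale Lambda_semibranching_system =
  fixes \<Lambda> :: "('p, 'k::finite) kgraph" and M :: "'x measure"
    and D :: "'p \<Rightarrow> 'x set" and \<tau> :: "'p \<Rightarrow> 'x \<Rightarrow> 'x" and code :: "nat ^ 'k \<Rightarrow> 'x \<Rightarrow> 'x"
    and \<Phi> :: "'p \<Rightarrow> 'x \<Rightarrow> real"
  assumes system: "semibranching_system M (paths \<Lambda> m) D \<tau> \<Phi>"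
    and coding: "coding_map M (paths \<Lambda> m) D \<tau> (code m)"
    and vertex_id: "\<lbrakk>v \<in> vertices \<Lambda>; x \<in> D v\<rbrakk> \<Longrightarrow> \<tau> v x = x"
    and vertex_pos: "v \<in> vertices \<Lambda> \<Longrightarrow> 0 < emeasure M (D v)"
    and prefix_range: "\<lbrakk>\<mu> \<in> mor \<Lambda>; \<nu> \<in> mor \<Lambda>; src \<Lambda> \<mu> = rng \<Lambda> \<nu>\<rbrakk>
          \<Longrightarrow> emeasure M (\<tau> \<nu> ` D \<nu> - D \<mu>) = 0"
    and prefix_comp: "\<lbrakk>\<mu> \<in> mor \<Lambda>; \<nu> \<in> mor \<Lambda>; src \<Lambda> \<mu> = rng \<Lambda> \<nu>\<rbrakk>
          \<Longrightarrow> AE x in M. (x \<in> D \<nu> \<and> \<tau> \<nu> x \<in> D \<mu> \<longleftrightarrow> x \<in> D (cmp \<Lambda> \<mu> \<nu>)) \<and>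
                         (x \<in> D (cmp \<Lambda> \<mu> \<nu>) \<longrightarrow> \<tau> \<mu> (\<tau> \<nu> x) = \<tau> (cmp \<Lambda> \<mu> \<nu>) x)"
    and code_comp: "x \<in> space M \<Longrightarrow> code m (code n x) = code (m + n) x"

definition S_fun ::
  "('p, 'k::finite) kgraph \<Rightarrow> ('p \<Rightarrow> 'x set) \<Rightarrow> ('p \<Rightarrow> 'x \<Rightarrow> 'x) \<Rightarrow> (nat ^ 'k \<Rightarrow> 'x \<Rightarrow> 'x) \<Rightarrow>
   ('p \<Rightarrow> 'x \<Rightarrow> real) \<Rightarrow> 'p \<Rightarrow> ('x \<Rightarrow> complex) \<Rightarrow> 'x \<Rightarrow> complex" where
  "S_fun \<Lambda> D \<tau> code \<Phi> \<mu> \<xi> x =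
     indicator (\<tau> \<mu> ` D \<mu>) x *
     complex_of_real (\<Phi> \<mu> (code (deg \<Lambda> \<mu>) x) powr (-1/2)) * \<xi> (code (deg \<Lambda> \<mu>) x)"

definition S_op ::
  "('p, 'k::finite) kgraph \<Rightarrow> 'x measure \<Rightarrow> ('p \<Rightarrow> 'x set) \<Rightarrow> ('p \<Rightarrow> 'x \<Rightarrow> 'x) \<Rightarrow>
   (nat ^ 'k \<Rightarrow> 'x \<Rightarrow> 'x) \<Rightarrow> ('p \<Rightarrow> 'x \<Rightarrow> real) \<Rightarrow> 'p \<Rightarrow> 'x L2_op" where
  "S_op \<Lambda> M D \<tau> code \<Phi> \<mu> =
     (\<lambda>P\<in>carrier (L2 M). \<Union>\<xi>\<in>P. L2_class M (S_fun \<Lambda> D \<tau> code \<Phi> \<mu> \<xi>))"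

text \<open>
  Semifiniteness, which every \<open>\<sigma>\<close>-finite measure has. On a measure space all of whose nonnull sets
  have infinite measure, \<open>L\<^sup>2\<close> vanishes and no nonzero algebra acts faithfully on it.
\<close>

definition semifinite :: "'x measure \<Rightarrow> bool" where
  "semifinite M \<longleftrightarrow> (\<forall>E\<in>sets M. emeasure M E = \<infinity> \<longrightarrow>
     (\<exists>F\<in>sets M. F \<subseteq> E \<and> 0 < emeasure M F \<and> emeasure M F < \<infinity>))"

end

theory Submission
  imports Defs
begin

text \<open>
  The Cuntz--Krieger relations follow from the change of variables
  \<open>\<integral>\<^sub>R f(\<tau>\<^sup>n x) d\<mu> = \<integral>\<^sub>D f \<Phi> d\<mu>\<close>, which also gives the adjoint
  \<open>S\<^sup>* \<eta> = \<chi>\<^sub>D \<Phi>\<^sup>1\<^sup>/\<^sup>2 (\<eta> \<circ> \<tau>)\<close>.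

  For faithfulness let \<open>N a = \<parallel>\<pi> a\<parallel>\<close>. The span of the \<open>s\<^sub>\<mu> s\<^sub>\<nu>\<^sup>*\<close> is graded by \<open>d(\<mu>) - d(\<nu>)\<close>. Compressing
  with projections built from a long segment of an aperiodic path kills all components of nonzero degree but
  keeps matrix coefficients of the component of degree 0; hence each homogeneous component \<open>x\<^sub>d\<close> of \<open>x\<close> satisfies
  \<open>\<parallel>x\<^sub>d\<parallel> \<le> C N x\<close>, so \<open>\<parallel>x\<parallel>\<close> is at most \<open>C N x\<close> times the number of components. For \<open>x = (b\<^sup>* b)\<^sup>n\<close> that number
  grows polynomially in \<open>n\<close>, and taking \<open>n\<close>-th roots gives \<open>\<parallel>b\<parallel> \<le> N b\<close> on a dense subalgebra. This replaces
  the usual averaging over the gauge action.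
\<close>

section \<open>Hilbert spaces with explicit carrier\<close>

text \<open>The abstract algebra is never represented on a Hilbert space, so facts that are evident
  for operators must come out of the norm axioms. Two of them shape the proof. Orthogonality of s_mu
  and s_nu for distinct paths of equal degree is not part of the Cuntz-Krieger relations: CK4 only
  says that certain projections add up to a projection, and the norm is needed to conclude that they
  are orthogonal. Boundedness of a star-homomorphism comes from a square root of 1 - h for small h
  only, which yields \<open>N\<close> <= 2 \<open>nrm\<close>; the lost constant is harmless, since
  later estimates are sharpened by taking roots of powers.

  The two norms are compared in degree 0. Once all left degrees have been raised to one n, s_mu^* w
  s_nu is a scalar multiple of a vertex projection, where \<open>nrm\<close> is at most 1 while
  \<open>N\<close> is nonzero, hence 1. This nonvanishing is what semifiniteness and positive
  measure of the sets \<open>D v\<close> provide. A component x_d of nonzero degree is brought to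
  degree 0 by multiplying with its own adjoint.\<close>

locale hilbert =
  fixes H :: "'h inner_space"
  assumes zero_closed [simp]: "vzero H \<in> carrier H"
    and add_closed [simp]: "\<lbrakk>x \<in> carrier H; y \<in> carrier H\<rbrakk> \<Longrightarrow> vadd H x y \<in> carrier H"
    and scale_closed [simp]: "x \<in> carrier H \<Longrightarrow> vscale H c x \<in> carrier H"
    and inner_zero_left [simp]: "z \<in> carrier H \<Longrightarrow> vinner H (vzero H) z = 0"
    and inner_add_left: "\<lbrakk>x \<in> carrier H; y \<in> carrier H; z \<in> carrier H\<rbrakk>
          \<Longrightarrow> vinner H (vadd H x y) z = vinner H x z + vinner H y z"
    and inner_scale_left: "\<lbrakk>x \<in> carrier H; z \<in> carrier H\<rbrakk>
          \<Longrightarrow> vinner H (vscale H c x) z = c * vinner H x z"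
    and inner_commute: "\<lbrakk>x \<in> carrier H; y \<in> carrier H\<rbrakk> \<Longrightarrow> vinner H x y = cnj (vinner H y x)"
    and inner_ge_zero: "x \<in> carrier H \<Longrightarrow> 0 \<le> Re (vinner H x x)"
    and inner_ext: "\<lbrakk>x \<in> carrier H; y \<in> carrier H;
          \<And>z. z \<in> carrier H \<Longrightarrow> vinner H x z = vinner H y z\<rbrakk> \<Longrightarrow> x = y"
    and complete: "\<lbrakk>\<And>n::nat. a n \<in> carrier H;
          \<forall>e>0. \<exists>N. \<forall>m\<ge>N. \<forall>n\<ge>N. vnorm H (vadd H (a m) (vscale H (-1) (a n))) < e\<rbrakk>
          \<Longrightarrow> \<exists>l\<in>carrier H. (\<lambda>n. vnorm H (vadd H (a n) (vscale H (-1) l))) \<longlonglongrightarrow> 0"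
begin

abbreviation vdiff where "vdiff x y \<equiv> vadd H x (vscale H (-1) y)"

lemma inner_zero_right [simp]: "z \<in> carrier H \<Longrightarrow> vinner H z (vzero H) = 0"
  by (subst inner_commute) auto

lemma inner_add_right: "\<lbrakk>x \<in> carrier H; y \<in> carrier H; z \<in> carrier H\<rbrakk>
          \<Longrightarrow> vinner H z (vadd H x y) = vinner H z x + vinner H z y"
  by (simp add: inner_commute[of z] inner_add_left)

lemma inner_scale_right: "\<lbrakk>x \<in> carrier H; z \<in> carrier H\<rbrakk>
          \<Longrightarrow> vinner H z (vscale H c x) = cnj c * vinner H z x"
  by (simp add: inner_commute[of z] inner_scale_left)

lemmas inner_simps = inner_add_left inner_add_right inner_scale_left inner_scale_right

lemma Re_inner_commute: "\<lbrakk>x \<in> carrier H; y \<in> carrier H\<rbrakk> \<Longrightarrow> Re (vinner H x y) = Re (vinner H y x)"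
  by (subst inner_commute) auto

lemma inner_self: "x \<in> carrier H \<Longrightarrow> vinner H x x = complex_of_real (Re (vinner H x x))"
  using inner_commute[of x x] by (simp add: complex_eq_iff)

lemma vnorm_nonneg [simp]: "x \<in> carrier H \<Longrightarrow> 0 \<le> vnorm H x"
  by (simp add: vnorm_def inner_ge_zero)

lemma vnorm_sq: "x \<in> carrier H \<Longrightarrow> (vnorm H x)\<^sup>2 = Re (vinner H x x)"
  by (simp add: vnorm_def inner_ge_zero)

lemma vnorm_zero [simp]: "vnorm H (vzero H) = 0"
  by (simp add: vnorm_def)

lemma cauchy_schwarz:
  assumes x: "x \<in> carrier H" and y: "y \<in> carrier H"
  shows "cmod (vinner H x y) \<le> vnorm H x * vnorm H y"
proof -
  define a b c q where "a = Re (vinner H x x)" and "b = Re (vinner H y y)"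
    and "c = vinner H x y" and "q = (cmod c)\<^sup>2"
  have a0: "a \<ge> 0" and b0: "b \<ge> 0" using x y by (auto simp: a_def b_def inner_ge_zero)
  \<comment> \<open>The squared norm of x - s c y. The phase of \<open>c\<close> is built into the
    coefficient, so that a real s suffices.\<close>
  have key: "a - 2 * s * q + s\<^sup>2 * q * b \<ge> 0" for s
  proof -
    let ?t = "- complex_of_real s * c"
    have "0 \<le> Re (vinner H (vadd H x (vscale H ?t y)) (vadd H x (vscale H ?t y)))"
      using x y by (intro inner_ge_zero) auto
    also have "vinner H (vadd H x (vscale H ?t y)) (vadd H x (vscale H ?t y)) =
        vinner H x x + ?t * cnj c + (cnj ?t * c + ?t * cnj ?t * vinner H y y)"
      using x y inner_commute[OF y x] by (simp add: inner_simps c_def algebra_simps)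
    also have "\<dots> = complex_of_real (a - 2 * s * q + s\<^sup>2 * q * b)"
      using inner_self[OF x] inner_self[OF y] complex_norm_square[of c]
      by (simp add: a_def[symmetric] b_def[symmetric] q_def algebra_simps power2_eq_square)
    finally show ?thesis by simp
  qed
  have "q \<le> a * b"
  proof (cases "q = 0")
    case True then show ?thesis using a0 b0 by simp
  next
    case False
    then have q: "q > 0" by (simp add: q_def)
    show ?thesis
    proof (cases "b = 0")
      case True
      \<comment> \<open>For b = 0 the bound is linear in s and takes the value -1 at this s.\<close>
      then show ?thesis using key[of "(a + 1) / (2 * q)"] q by (simp add: field_simps)
    next
      case False
      then have "b > 0" using b0 by simp
      then show ?thesis using key[of "1 / b"] by (simp add: field_simps power2_eq_square)
    qed
  qed
  then have "(cmod c)\<^sup>2 \<le> (vnorm H x * vnorm H y)\<^sup>2"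
    using x y by (simp add: power_mult_distrib vnorm_sq a_def b_def q_def)
  then show ?thesis unfolding c_def
    by (rule power2_le_imp_le) (use x y in auto)
qed

lemma vnorm_triangle:
  assumes x: "x \<in> carrier H" and y: "y \<in> carrier H"
  shows "vnorm H (vadd H x y) \<le> vnorm H x + vnorm H y"
proof (rule power2_le_imp_le)
  have "Re (vinner H x y) \<le> vnorm H x * vnorm H y"
    using cauchy_schwarz[OF x y] complex_Re_le_cmod order_trans by blast
  then show "(vnorm H (vadd H x y))\<^sup>2 \<le> (vnorm H x + vnorm H y)\<^sup>2"
    using x y Re_inner_commute[OF x y] by (simp add: vnorm_sq power2_sum inner_simps)
qed (use x y in simp)

lemma vnorm_scale:
  assumes x: "x \<in> carrier H" shows "vnorm H (vscale H c x) = cmod c * vnorm H x"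
proof (rule power2_eq_imp_eq)
  have "vinner H (vscale H c x) (vscale H c x) = complex_of_real ((cmod c)\<^sup>2 * Re (vinner H x x))"
    using x inner_self[OF x] complex_norm_square[of c] by (simp add: inner_simps power2_eq_square ac_simps)
  then show "(vnorm H (vscale H c x))\<^sup>2 = (cmod c * vnorm H x)\<^sup>2"
    using x by (simp add: vnorm_sq power_mult_distrib)
qed (use x in auto)

lemma vnorm_eq_0:
  assumes x: "x \<in> carrier H" and "vnorm H x = 0" shows "x = vzero H"
proof (rule inner_ext)
  fix z assume z: "z \<in> carrier H"
  then show "vinner H x z = vinner H (vzero H) z"
    using cauchy_schwarz[OF x z] assms by simp
qed (use x in auto)

lemma vnorm_diff_commute:
  assumes x: "x \<in> carrier H" and y: "y \<in> carrier H"
  shows "vnorm H (vdiff x y) = vnorm H (vdiff y x)"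
proof -
  \<comment> \<open>No vector space laws are assumed of the carrier: an identity between vectors is
    tested against all inner products, where it becomes an identity of complex numbers.\<close>
  have "vdiff x y = vscale H (-1) (vdiff y x)"
    by (rule inner_ext) (use x y in \<open>auto simp: inner_simps\<close>)
  then show ?thesis using x y by (simp add: vnorm_scale)
qed

lemma inner_tendsto:
  assumes a: "\<And>n::nat. a n \<in> carrier H" and l: "l \<in> carrier H" and z: "z \<in> carrier H"
    and lim: "(\<lambda>n. vnorm H (vdiff (a n) l)) \<longlonglongrightarrow> 0"
  shows "(\<lambda>n. vinner H (a n) z) \<longlonglongrightarrow> vinner H l z"
proof (rule Lim_transform2[OF tendsto_const])
  show "(\<lambda>n. vinner H l z - vinner H (a n) z) \<longlonglongrightarrow> 0"
  proof (rule Lim_null_comparison[where g="\<lambda>n. vnorm H (vdiff (a n) l) * vnorm H z"])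
    show "\<forall>\<^sub>F n in sequentially. norm (vinner H l z - vinner H (a n) z) \<le> vnorm H (vdiff (a n) l) * vnorm H z"
    proof (intro always_eventually allI)
      fix n
      show "norm (vinner H l z - vinner H (a n) z) \<le> vnorm H (vdiff (a n) l) * vnorm H z"
        using cauchy_schwarz[of "vdiff (a n) l" z] a l z by (simp add: inner_simps norm_minus_commute)
    qed
    show "(\<lambda>n. vnorm H (vdiff (a n) l) * vnorm H z) \<longlonglongrightarrow> 0"
      using tendsto_mult_left_zero[OF lim] by simp
  qed
qed

lemma vnorm_tendsto:
  assumes a: "\<And>n::nat. a n \<in> carrier H" and l: "l \<in> carrier H"
    and lim: "(\<lambda>n. vnorm H (vdiff (a n) l)) \<longlonglongrightarrow> 0"
  shows "(\<lambda>n. vnorm H (a n)) \<longlonglongrightarrow> vnorm H l"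
proof (rule Lim_transform2[OF tendsto_const])
  have *: "vnorm H x \<le> vnorm H y + vnorm H (vdiff x y)" if "x \<in> carrier H" "y \<in> carrier H" for x y
  proof -
    have "x = vadd H y (vdiff x y)" by (rule inner_ext) (use that in \<open>auto simp: inner_simps\<close>)
    then show ?thesis using vnorm_triangle[of y "vdiff x y"] that by simp
  qed
  show "(\<lambda>n. vnorm H l - vnorm H (a n)) \<longlonglongrightarrow> 0"
    by (rule Lim_null_comparison[OF _ lim])
       (use *[OF a l] *[OF l a] vnorm_diff_commute[OF a l] in \<open>auto intro!: always_eventually simp: abs_le_iff algebra_simps\<close>)
qed

text \<open>The representing vector minimises \<open>\<parallel>x\<parallel>\<^sup>2 - 2 Re (f x)\<close>.\<close>

lemma riesz:
  assumes add: "\<And>x y. \<lbrakk>x \<in> carrier H; y \<in> carrier H\<rbrakk> \<Longrightarrow> f (vadd H x y) = f x + f y"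
    and scale: "\<And>c x. x \<in> carrier H \<Longrightarrow> f (vscale H c x) = c * f x"
    and bdd: "\<And>x. x \<in> carrier H \<Longrightarrow> cmod (f x) \<le> K * vnorm H x"
  shows "\<exists>z\<in>carrier H. \<forall>x\<in>carrier H. f x = vinner H x z"
proof -
  define J where "J x = Re (vinner H x x) - 2 * Re (f x)" for x
  have J_low: "J x \<ge> - K\<^sup>2" if x: "x \<in> carrier H" for x
  proof -
    have "Re (f x) \<le> K * vnorm H x" using bdd[OF x] complex_Re_le_cmod order_trans by blast
    moreover have "0 \<le> (vnorm H x - K)\<^sup>2" by simp
    ultimately show ?thesis using x unfolding J_def vnorm_sq[OF x, symmetric]
      by (simp add: power2_diff algebra_simps)
  qed
  define m where "m = Inf (J ` carrier H)"
  have bb: "bdd_below (J ` carrier H)" using J_low by (auto simp: bdd_below_def)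
  have ne: "J ` carrier H \<noteq> {}" using zero_closed by blast
  have m_le: "m \<le> J x" if "x \<in> carrier H" for x
    unfolding m_def using bb that by (auto intro: cInf_lower)
  have "\<exists>x\<in>carrier H. J x < m + 1 / (real n + 1)" for n :: nat
    using cInf_lessD[OF ne, of "m + 1 / (real n + 1)"] by (auto simp: m_def)
  then obtain a where a: "\<And>n::nat. a n \<in> carrier H" and Ja: "\<And>n. J (a n) < m + 1 / (real n + 1)"
    by metis
  \<comment> \<open>Parallelogram law; the linear part of \<open>J\<close> cancels. Near-minimisers
    are therefore close to each other.\<close>
  have mid: "Re (vinner H (vdiff x y) (vdiff x y)) = 2 * (J x + J y - 2 * J (vscale H (1/2) (vadd H x y)))"
    if "x \<in> carrier H" "y \<in> carrier H" for x y
    using that Re_inner_commute[OF that]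
    by (simp add: J_def inner_simps add scale algebra_simps)
  have dist: "(vnorm H (vdiff (a i) (a j)))\<^sup>2 \<le> 2 / (real i + 1) + 2 / (real j + 1)" for i j
    using mid[OF a[of i] a[of j]] m_le[of "vscale H (1/2) (vadd H (a i) (a j))"] Ja[of i] Ja[of j] a
    by (simp add: vnorm_sq)
  have cauchy: "\<forall>e>0. \<exists>N. \<forall>i\<ge>N. \<forall>j\<ge>N. vnorm H (vdiff (a i) (a j)) < e"
  proof (intro allI impI)
    fix e :: real assume e: "e > 0"
    obtain N where N: "real N > 4 / e\<^sup>2" using reals_Archimedean2 by blast
    show "\<exists>N. \<forall>i\<ge>N. \<forall>j\<ge>N. vnorm H (vdiff (a i) (a j)) < e"
    proof (intro exI[of _ N] allI impI)
      fix i j assume ij: "i \<ge> N" "j \<ge> N"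
      have "4 / (real N + 1) < e\<^sup>2" using N e by (simp add: field_simps add_strict_increasing2)
      moreover have "2 / (real i + 1) \<le> 2 / (real N + 1)" "2 / (real j + 1) \<le> 2 / (real N + 1)"
        using ij by (auto intro!: divide_left_mono)
      ultimately have "(vnorm H (vdiff (a i) (a j)))\<^sup>2 < e\<^sup>2" using dist[of i j] by simp
      then show "vnorm H (vdiff (a i) (a j)) < e"
        using e by (simp add: power_less_imp_less_base)
    qed
  qed
  obtain z where z: "z \<in> carrier H" and lim: "(\<lambda>n. vnorm H (vdiff (a n) z)) \<longlonglongrightarrow> 0"
    using complete[OF a cauchy] by blast
  have Re_eq: "Re (f y) = Re (vinner H y z)" if y: "y \<in> carrier H" for y
  proof -
    define b where "b = Re (vinner H y y)"
    define c where "c = Re (vinner H z y) - Re (f y)"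
    have b0: "b \<ge> 0" using y by (simp add: b_def inner_ge_zero)
    \<comment> \<open>Moving a near-minimiser by t y cannot lower \<open>J\<close> by more than the
      excess of its value over \<open>m\<close>; in the limit only the first and second variation at
      z remain.\<close>
    have ge: "t\<^sup>2 * b + 2 * t * c \<ge> 0" for t :: real
    proof (rule LIMSEQ_le[OF _ _ exI[of _ 0]])
      show "(\<lambda>n. - (1 / (real n + 1))) \<longlonglongrightarrow> 0" by real_asymp
      show "(\<lambda>n. t\<^sup>2 * b + 2 * t * (Re (vinner H (a n) y) - Re (f y))) \<longlonglongrightarrow> t\<^sup>2 * b + 2 * t * c"
        unfolding c_def by (intro tendsto_intros inner_tendsto a z y lim)
      show "\<forall>n\<ge>0. - (1 / (real n + 1)) \<le> t\<^sup>2 * b + 2 * t * (Re (vinner H (a n) y) - Re (f y))"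
      proof (intro allI impI)
        fix n :: nat
        have "m \<le> J (vadd H (a n) (vscale H (complex_of_real t) y))" using a y by (intro m_le) auto
        also have "\<dots> = J (a n) + t\<^sup>2 * b + 2 * t * (Re (vinner H (a n) y) - Re (f y))"
          using a[of n] y Re_inner_commute[OF y a[of n]]
          by (simp add: J_def inner_simps add scale b_def algebra_simps power2_eq_square)
        finally show "- (1 / (real n + 1)) \<le> t\<^sup>2 * b + 2 * t * (Re (vinner H (a n) y) - Re (f y))"
          using Ja[of n] by simp
      qed
    qed
    have "c = 0"
    proof (rule ccontr)
      assume "c \<noteq> 0"
      \<comment> \<open>The denominator b + 1 in place of b covers the case that y has norm
        zero.\<close>
      have "(- c / (b + 1))\<^sup>2 * b + 2 * (- c / (b + 1)) * c = - c\<^sup>2 * (b + 2) / (b + 1)\<^sup>2"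
        using b0 by (simp add: divide_simps power2_eq_square) (simp add: algebra_simps)
      also have "\<dots> < 0" using b0 \<open>c \<noteq> 0\<close>
        by (intro divide_neg_pos mult_neg_pos) auto
      finally show False using ge[of "- c / (b + 1)"] by simp
    qed
    then show ?thesis using Re_inner_commute[OF y z] by (simp add: c_def)
  qed
  have "f x = vinner H x z" if x: "x \<in> carrier H" for x
  proof (rule complex_eqI)
    show "Re (f x) = Re (vinner H x z)" by (rule Re_eq[OF x])
    show "Im (f x) = Im (vinner H x z)"
      \<comment> \<open>Replacing x by -\<i> x turns imaginary parts into real parts.\<close>
      using Re_eq[of "vscale H (-\<i>) x"] x z by (simp add: scale inner_simps)
  qed
  then show ?thesis using z by blast
qed

section \<open>Bounded operators\<close>

lemma opI:
  assumes "\<And>x. x \<in> carrier H \<Longrightarrow> T x \<in> carrier H" "\<And>x. x \<notin> carrier H \<Longrightarrow> T x = undefined"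
    and "\<And>x y. \<lbrakk>x \<in> carrier H; y \<in> carrier H\<rbrakk> \<Longrightarrow> T (vadd H x y) = vadd H (T x) (T y)"
    and "\<And>c x. x \<in> carrier H \<Longrightarrow> T (vscale H c x) = vscale H c (T x)"
    and "\<And>x. x \<in> carrier H \<Longrightarrow> vnorm H (T x) \<le> K * vnorm H x"
  shows "T \<in> bounded_operators H"
  using assms exI[of "\<lambda>K. \<forall>x\<in>carrier H. vnorm H (T x) \<le> K * vnorm H x" K] unfolding bounded_operators_def by (auto simp: PiE_def extensional_def)

lemma op_closed [simp]: "\<lbrakk>T \<in> bounded_operators H; x \<in> carrier H\<rbrakk> \<Longrightarrow> T x \<in> carrier H"
  unfolding bounded_operators_def by auto

lemma op_undefined: "\<lbrakk>T \<in> bounded_operators H; x \<notin> carrier H\<rbrakk> \<Longrightarrow> T x = undefined"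
  unfolding bounded_operators_def by auto

lemma op_add [simp]: "\<lbrakk>T \<in> bounded_operators H; x \<in> carrier H; y \<in> carrier H\<rbrakk>
    \<Longrightarrow> T (vadd H x y) = vadd H (T x) (T y)"
  unfolding bounded_operators_def by auto

lemma op_scale [simp]: "\<lbrakk>T \<in> bounded_operators H; x \<in> carrier H\<rbrakk>
    \<Longrightarrow> T (vscale H c x) = vscale H c (T x)"
  unfolding bounded_operators_def by auto

lemma op_bound: "T \<in> bounded_operators H \<Longrightarrow> \<exists>K\<ge>0. \<forall>x\<in>carrier H. vnorm H (T x) \<le> K * vnorm H x"
proof -
  assume "T \<in> bounded_operators H"
  then obtain K where K: "\<forall>x\<in>carrier H. vnorm H (T x) \<le> K * vnorm H x"
    unfolding bounded_operators_def by auto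
  have "vnorm H (T x) \<le> max K 0 * vnorm H x" if "x \<in> carrier H" for x
    using K that mult_right_mono[of K "max K 0" "vnorm H x"] by fastforce
  then show ?thesis by (intro exI[of _ "max K 0"]) auto
qed

lemma op_ext: "\<lbrakk>T \<in> bounded_operators H; U \<in> bounded_operators H;
    \<And>x. x \<in> carrier H \<Longrightarrow> T x = U x\<rbrakk> \<Longrightarrow> T = U"
  by (metis ext op_undefined)

lemma op_ext_inner: "\<lbrakk>T \<in> bounded_operators H; U \<in> bounded_operators H;
    \<And>x y. \<lbrakk>x \<in> carrier H; y \<in> carrier H\<rbrakk> \<Longrightarrow> vinner H (T x) y = vinner H (U x) y\<rbrakk> \<Longrightarrow> T = U"
  by (intro op_ext inner_ext) auto

lemma op_zero [simp]: "T \<in> bounded_operators H \<Longrightarrow> T (vzero H) = vzero H"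
proof -
  assume T: "T \<in> bounded_operators H"
  have "vzero H = vscale H 0 (vzero H)" by (rule inner_ext) (auto simp: inner_simps)
  then have "T (vzero H) = vscale H 0 (T (vzero H))" using T op_scale zero_closed by metis
  also have "\<dots> = vzero H" using T by (intro inner_ext) (auto simp: inner_simps)
  finally show ?thesis .
qed

text \<open>The Riesz vector of x \<mapsto> <T x, y> is taken for each y. Linearity in y is
  inherited from uniqueness of that vector, and |U y|^2 = <y, T U y> gives U the same bound as
  T.\<close>

lemma adjoint_ex:
  assumes T: "T \<in> bounded_operators H"
  shows "\<exists>U. U \<in> bounded_operators H \<and> (\<forall>x\<in>carrier H. \<forall>y\<in>carrier H. vinner H (T x) y = vinner H x (U y))"
proof -
  obtain K where K0: "K \<ge> 0" and K: "\<And>x. x\<in>carrier H \<Longrightarrow> vnorm H (T x) \<le> K * vnorm H x"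
    using op_bound[OF T] by blast
  have "\<exists>z\<in>carrier H. \<forall>x\<in>carrier H. vinner H (T x) y = vinner H x z" if y: "y \<in> carrier H" for y
  proof (rule riesz[where K="K * vnorm H y"])
    fix x assume x: "x \<in> carrier H"
    have "cmod (vinner H (T x) y) \<le> vnorm H (T x) * vnorm H y" using T x y by (intro cauchy_schwarz) auto
    also have "\<dots> \<le> K * vnorm H x * vnorm H y" using K[OF x] y by (intro mult_right_mono) auto
    finally show "cmod (vinner H (T x) y) \<le> K * vnorm H y * vnorm H x" by (simp add: ac_simps)
  qed (use T y in \<open>auto simp: inner_simps\<close>)
  then obtain U0 where U0: "\<And>y. y \<in> carrier H \<Longrightarrow> U0 y \<in> carrier H"
      "\<And>x y. \<lbrakk>x \<in> carrier H; y \<in> carrier H\<rbrakk> \<Longrightarrow> vinner H (T x) y = vinner H x (U0 y)"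
    by metis
  define U where "U = (\<lambda>y\<in>carrier H. U0 y)"
  have U1: "vinner H (U y) x = vinner H y (T x)" if "x \<in> carrier H" "y \<in> carrier H" for x y
    using U0 that T inner_commute[of "U y" x] inner_commute[of y "T x"] by (auto simp: U_def)
  have U2: "U y \<in> carrier H" if "y \<in> carrier H" for y using that U0 by (auto simp: U_def)
  have "U \<in> bounded_operators H"
  proof (rule opI[where K=K])
    fix x assume x: "x \<in> carrier H"
    have "(vnorm H (U x))\<^sup>2 = Re (vinner H x (T (U x)))"
      using x U2[OF x] by (simp add: vnorm_sq U1)
    also have "\<dots> \<le> vnorm H x * vnorm H (T (U x))"
      using cauchy_schwarz[of x "T (U x)"] complex_Re_le_cmod[of "vinner H x (T (U x))"] x U2[OF x] T by simp
    also have "\<dots> \<le> vnorm H x * (K * vnorm H (U x))" using K[OF U2[OF x]] x by (intro mult_left_mono) auto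
    finally have "vnorm H (U x) * vnorm H (U x) \<le> (K * vnorm H x) * vnorm H (U x)"
      by (simp add: power2_eq_square ac_simps)
    then show "vnorm H (U x) \<le> K * vnorm H x"
      using K0 x vnorm_nonneg[OF U2[OF x]] by (cases "vnorm H (U x) = 0") (auto simp: mult_le_cancel_right)
  next
    fix x y assume "x \<in> carrier H" "y \<in> carrier H"
    then show "U (vadd H x y) = vadd H (U x) (U y)"
      by (intro inner_ext) (auto simp: U1 U2 T inner_simps)
  next
    fix c x assume "x \<in> carrier H"
    then show "U (vscale H c x) = vscale H c (U x)"
      by (intro inner_ext) (auto simp: U1 U2 T inner_simps)
  qed (use U2 in \<open>auto simp: U_def\<close>)
  then show ?thesis using U0 by (auto simp: U_def)
qed

lemma adjoint_eqI:
  assumes U: "U \<in> bounded_operators H"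
    and eq: "\<And>x y. \<lbrakk>x \<in> carrier H; y \<in> carrier H\<rbrakk> \<Longrightarrow> vinner H (T x) y = vinner H x (U y)"
  shows "adjoint_op H T = U"
  unfolding adjoint_op_def
proof (rule the_equality)
  fix V assume V: "V \<in> bounded_operators H \<and> (\<forall>x\<in>carrier H. \<forall>y\<in>carrier H. vinner H (T x) y = vinner H x (V y))"
  show "V = U"
  proof (rule op_ext_inner)
    fix x y assume "x \<in> carrier H" "y \<in> carrier H"
    then show "vinner H (V x) y = vinner H (U x) y"
      using V U eq[of y x] inner_commute[of "V x" y] inner_commute[of "U x" y] by auto
  qed (use V U in auto)
qed (use U eq in auto)

lemma adjoint_closed [simp]: "T \<in> bounded_operators H \<Longrightarrow> adjoint_op H T \<in> bounded_operators H"
  using adjoint_ex adjoint_eqI by metis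

lemma adjoint_right:
  "\<lbrakk>T \<in> bounded_operators H; x \<in> carrier H; y \<in> carrier H\<rbrakk>
    \<Longrightarrow> vinner H x (adjoint_op H T y) = vinner H (T x) y"
  using adjoint_ex[of T] adjoint_eqI by metis

lemma adjoint_left:
  "\<lbrakk>T \<in> bounded_operators H; x \<in> carrier H; y \<in> carrier H\<rbrakk>
    \<Longrightarrow> vinner H (adjoint_op H T x) y = vinner H x (T y)"
  using adjoint_right[of T y x] by (metis adjoint_closed op_closed inner_commute)

definition opnorm :: "('h \<Rightarrow> 'h) \<Rightarrow> real" where
  "opnorm T = (SUP x\<in>{x \<in> carrier H. vnorm H x \<le> 1}. vnorm H (T x))"

lemma unit_ball_nonempty: "{x \<in> carrier H. vnorm H x \<le> 1} \<noteq> {}"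
  using zero_closed vnorm_zero by (metis (mono_tags, lifting) empty_iff mem_Collect_eq zero_le_one)

lemma opnorm_bdd:
  assumes T: "T \<in> bounded_operators H"
  shows "bdd_above ((\<lambda>x. vnorm H (T x)) ` {x \<in> carrier H. vnorm H x \<le> 1})"
proof -
  obtain K where K0: "K \<ge> 0" and K: "\<And>x. x\<in>carrier H \<Longrightarrow> vnorm H (T x) \<le> K * vnorm H x"
    using op_bound[OF T] by blast
  show ?thesis
  proof (rule bdd_aboveI2)
    fix x assume "x \<in> {x \<in> carrier H. vnorm H x \<le> 1}"
    then show "vnorm H (T x) \<le> K" using K[of x] mult_left_le[of "vnorm H x" K] K0 by auto
  qed
qed

lemma opnorm_nonneg: "T \<in> bounded_operators H \<Longrightarrow> 0 \<le> opnorm T"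
  using cSUP_upper[OF _ opnorm_bdd, of "vzero H" T] by (simp add: opnorm_def)

lemma opnorm_le:
  assumes T: "T \<in> bounded_operators H" and x: "x \<in> carrier H"
  shows "vnorm H (T x) \<le> opnorm T * vnorm H x"
proof (cases "vnorm H x = 0")
  case True
  then have "x = vzero H" using vnorm_eq_0 x by blast
  then show ?thesis using T by simp
next
  case False
  then have p: "vnorm H x > 0" using vnorm_nonneg[OF x] by linarith
  let ?y = "vscale H (complex_of_real (1 / vnorm H x)) x"
  have "vnorm H (T ?y) \<le> opnorm T" unfolding opnorm_def
    by (rule cSUP_upper[OF _ opnorm_bdd[OF T]]) (use x p in \<open>auto simp: vnorm_scale norm_divide\<close>)
  moreover have "vnorm H (T ?y) = vnorm H (T x) / vnorm H x"
    using T x p by (subst op_scale[OF T x]) (simp add: vnorm_scale norm_divide)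
  ultimately have "vnorm H (T x) / vnorm H x \<le> opnorm T" by simp
  then show ?thesis using p by (simp add: field_simps)
qed

lemma opnorm_leI:
  assumes "K \<ge> 0" and K: "\<And>x. x \<in> carrier H \<Longrightarrow> vnorm H (T x) \<le> K * vnorm H x"
  shows "opnorm T \<le> K"
  unfolding opnorm_def
proof (rule cSUP_least[OF unit_ball_nonempty])
  fix x assume "x \<in> {x \<in> carrier H. vnorm H x \<le> 1}"
  then show "vnorm H (T x) \<le> K" using K[of x] mult_left_le[of "vnorm H x" K] assms(1) by auto
qed

lemma B_sel [simp]:
  "carrier (B_of H) = bounded_operators H" "mult (B_of H) = compose (carrier H)"
  "zero (B_of H) = (\<lambda>x\<in>carrier H. vzero H)"
  "add (B_of H) T U = (\<lambda>x\<in>carrier H. vadd H (T x) (U x))"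
  "smult (B_of H) c T = (\<lambda>x\<in>carrier H. vscale H c (T x))"
  "star (B_of H) = adjoint_op H" "nrm (B_of H) = opnorm"
  by (simp_all add: B_of_def opnorm_def fun_eq_iff)

lemma op_zero_closed: "(\<lambda>x\<in>carrier H. vzero H) \<in> bounded_operators H"
  by (rule opI[where K=0]) (auto intro!: inner_ext simp: inner_simps)

lemma op_add_closed:
  assumes T: "T \<in> bounded_operators H" and U: "U \<in> bounded_operators H"
  shows "(\<lambda>x\<in>carrier H. vadd H (T x) (U x)) \<in> bounded_operators H"
proof (rule opI[where K="opnorm T + opnorm U"])
  fix x assume x: "x \<in> carrier H"
  show "vnorm H ((\<lambda>x\<in>carrier H. vadd H (T x) (U x)) x) \<le> (opnorm T + opnorm U) * vnorm H x"
    using vnorm_triangle[of "T x" "U x"] opnorm_le[OF T x] opnorm_le[OF U x] T U x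
    by (simp add: distrib_right)
qed (use T U in \<open>auto intro!: inner_ext simp: inner_simps ring_distribs\<close>)

lemma op_scale_closed:
  assumes T: "T \<in> bounded_operators H"
  shows "(\<lambda>x\<in>carrier H. vscale H c (T x)) \<in> bounded_operators H"
proof (rule opI[where K="cmod c * opnorm T"])
  fix x assume x: "x \<in> carrier H"
  show "vnorm H ((\<lambda>x\<in>carrier H. vscale H c (T x)) x) \<le> cmod c * opnorm T * vnorm H x"
    using mult_left_mono[OF opnorm_le[OF T x], of "cmod c"] T x
    by (simp add: vnorm_scale mult.assoc)
qed (use T in \<open>auto intro!: inner_ext simp: inner_simps ring_distribs\<close>)

lemma op_comp_closed:
  assumes T: "T \<in> bounded_operators H" and U: "U \<in> bounded_operators H"
  shows "compose (carrier H) T U \<in> bounded_operators H"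
    and "opnorm (compose (carrier H) T U) \<le> opnorm T * opnorm U"
proof -
  have *: "vnorm H (compose (carrier H) T U x) \<le> opnorm T * opnorm U * vnorm H x" if x: "x \<in> carrier H" for x
  proof -
    have "vnorm H (compose (carrier H) T U x) \<le> opnorm T * vnorm H (U x)"
      using opnorm_le[OF T, of "U x"] U x by (simp add: compose_def)
    also have "\<dots> \<le> opnorm T * (opnorm U * vnorm H x)"
      by (intro mult_left_mono opnorm_le opnorm_nonneg T U x)
    finally show ?thesis by (simp add: mult.assoc)
  qed
  show "compose (carrier H) T U \<in> bounded_operators H"
    by (rule opI[OF _ _ _ _ *]) (use T U in \<open>auto simp: compose_def\<close>)
  show "opnorm (compose (carrier H) T U) \<le> opnorm T * opnorm U"
    by (rule opnorm_leI[OF _ *]) (use opnorm_nonneg T U in auto)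
qed

lemma B_closed [simp]:
  assumes "T \<in> bounded_operators H" "U \<in> bounded_operators H"
  shows "\<zero>\<^bsub>B_of H\<^esub> \<in> bounded_operators H" "T \<oplus>\<^bsub>B_of H\<^esub> U \<in> bounded_operators H"
    "c \<odot>\<^bsub>B_of H\<^esub> T \<in> bounded_operators H" "T \<otimes>\<^bsub>B_of H\<^esub> U \<in> bounded_operators H"
  using assms by (auto simp: op_zero_closed op_add_closed op_scale_closed op_comp_closed simp del: restrict_apply)

lemma B_apply [simp]:
  assumes "x \<in> carrier H"
  shows "\<zero>\<^bsub>B_of H\<^esub> x = vzero H" "(T \<oplus>\<^bsub>B_of H\<^esub> U) x = vadd H (T x) (U x)"
    "(c \<odot>\<^bsub>B_of H\<^esub> T) x = vscale H c (T x)" "(T \<otimes>\<^bsub>B_of H\<^esub> U) x = T (U x)"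
  using assms by (simp_all add: compose_def)

lemma B_zero_closed [simp]: "\<zero>\<^bsub>B_of H\<^esub> \<in> bounded_operators H"
  by (simp add: op_zero_closed del: restrict_apply)

lemma opnorm_mult: "\<lbrakk>T \<in> bounded_operators H; U \<in> bounded_operators H\<rbrakk>
    \<Longrightarrow> opnorm (T \<otimes>\<^bsub>B_of H\<^esub> U) \<le> opnorm T * opnorm U"
  by (simp add: op_comp_closed)

declare B_sel(2-5) [simp del]

lemma abelian_group_B: "abelian_group (B_of H)"
proof (rule abelian_groupI)
  fix T assume "T \<in> carrier (B_of H)"
  then have T: "T \<in> bounded_operators H" by simp
  show "\<exists>U\<in>carrier (B_of H). U \<oplus>\<^bsub>B_of H\<^esub> T = \<zero>\<^bsub>B_of H\<^esub>"
    by (rule bexI[of _ "(-1) \<odot>\<^bsub>B_of H\<^esub> T"]) (use T in \<open>auto intro!: op_ext_inner simp: inner_simps\<close>)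
qed (auto intro!: op_ext_inner simp: inner_simps)

lemma B_uminus:
  assumes T: "T \<in> bounded_operators H"
  shows "\<ominus>\<^bsub>B_of H\<^esub> T = (-1) \<odot>\<^bsub>B_of H\<^esub> T"
  by (rule abelian_group.minus_equality[OF abelian_group_B])
     (use T in \<open>auto intro!: op_ext_inner simp: inner_simps\<close>)

lemma B_minus:
  assumes T: "T \<in> bounded_operators H" and U: "U \<in> bounded_operators H"
  shows "T \<ominus>\<^bsub>B_of H\<^esub> U = (\<lambda>x\<in>carrier H. vdiff (T x) (U x))"
  unfolding a_minus_def B_uminus[OF U] B_sel(4,5) by (simp cong: restrict_cong)

lemma op_minus_closed:
  assumes T: "T \<in> bounded_operators H" and U: "U \<in> bounded_operators H"
  shows "(\<lambda>x\<in>carrier H. vdiff (T x) (U x)) \<in> bounded_operators H"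
  using op_add_closed[OF T op_scale_closed[OF U, of "-1"]] U by (simp cong: restrict_cong)

text \<open>The limit is formed pointwise, by completeness of the space. Letting n tend to infinity
  in the Cauchy bound for \<open>T m\<close> and \<open>T n\<close> yields both boundedness of the
  limit and convergence in operator norm.\<close>

lemma B_complete:
  assumes T: "\<And>n::nat. T n \<in> bounded_operators H"
    and cauchy: "\<forall>e>0. \<exists>N. \<forall>m\<ge>N. \<forall>n\<ge>N. opnorm (\<lambda>x\<in>carrier H. vdiff (T m x) (T n x)) < e"
  shows "\<exists>L\<in>bounded_operators H. (\<lambda>n. opnorm (\<lambda>x\<in>carrier H. vdiff (T n x) (L x))) \<longlonglongrightarrow> 0"
proof -
  have le: "vnorm H (vdiff (T m x) (T n x)) \<le> opnorm (\<lambda>x\<in>carrier H. vdiff (T m x) (T n x)) * vnorm H x"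
    if "x \<in> carrier H" for m n x
    using opnorm_le[OF op_minus_closed[OF T T] that, of m n] that by simp
  have "\<exists>l\<in>carrier H. (\<lambda>n. vnorm H (vdiff (T n x) l)) \<longlonglongrightarrow> 0" if x: "x \<in> carrier H" for x
  proof (rule complete)
    show "\<forall>e>0. \<exists>N. \<forall>m\<ge>N. \<forall>n\<ge>N. vnorm H (vdiff (T m x) (T n x)) < e"
    proof (intro allI impI)
      fix e :: real assume e: "e > 0"
      then have "e / (vnorm H x + 1) > 0" using x by (simp add: add_nonneg_pos)
      then obtain N where N: "\<forall>m\<ge>N. \<forall>n\<ge>N. opnorm (\<lambda>x\<in>carrier H. vdiff (T m x) (T n x)) < e / (vnorm H x + 1)"
        using cauchy by blast
      show "\<exists>N. \<forall>m\<ge>N. \<forall>n\<ge>N. vnorm H (vdiff (T m x) (T n x)) < e"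
      proof (intro exI[of _ N] allI impI)
        fix m n assume "m \<ge> N" "n \<ge> N"
        then have "vnorm H (vdiff (T m x) (T n x)) \<le> e / (vnorm H x + 1) * vnorm H x"
          using N x by (intro order_trans[OF le[OF x]] mult_right_mono) (auto simp: less_imp_le)
        also have "\<dots> < e" using e vnorm_nonneg[OF x] by (simp add: divide_simps add_pos_nonneg)
        finally show "vnorm H (vdiff (T m x) (T n x)) < e" .
      qed
    qed
  qed (use T x in auto)
  then obtain L0 where L0: "\<And>x. x \<in> carrier H \<Longrightarrow> L0 x \<in> carrier H"
    "\<And>x. x \<in> carrier H \<Longrightarrow> (\<lambda>n. vnorm H (vdiff (T n x) (L0 x))) \<longlonglongrightarrow> 0" by metis
  define L where "L = (\<lambda>x\<in>carrier H. L0 x)"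
  have L1: "L x \<in> carrier H" if "x \<in> carrier H" for x using that L0 by (simp add: L_def)
  have L2: "(\<lambda>n. vnorm H (vdiff (T n x) (L x))) \<longlonglongrightarrow> 0" if "x \<in> carrier H" for x
    using that L0 by (simp add: L_def)
  have lim: "(\<lambda>n. vinner H (T n x) z) \<longlonglongrightarrow> vinner H (L x) z" if "x \<in> carrier H" "z \<in> carrier H" for x z
    by (rule inner_tendsto) (use that T L1 L2 in auto)
  have close: "vnorm H (vdiff (T m x) (L x)) \<le> e * vnorm H x"
    if x: "x \<in> carrier H" and N: "\<forall>n\<ge>N. opnorm (\<lambda>x\<in>carrier H. vdiff (T m x) (T n x)) < e" for m e N x
  proof (rule LIMSEQ_le[OF _ tendsto_const])
    show "(\<lambda>n. vnorm H (vdiff (T m x) (T n x))) \<longlonglongrightarrow> vnorm H (vdiff (T m x) (L x))"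
    proof (rule vnorm_tendsto)
      have "vdiff (vdiff (T m x) (T n x)) (vdiff (T m x) (L x)) = vdiff (L x) (T n x)" for n
        by (rule inner_ext) (use x T L1 in \<open>auto simp: inner_simps\<close>)
      then show "(\<lambda>n. vnorm H (vdiff (vdiff (T m x) (T n x)) (vdiff (T m x) (L x)))) \<longlonglongrightarrow> 0"
        using L2[OF x] vnorm_diff_commute[OF op_closed[OF T x] L1[OF x]] by simp
    qed (use x T L1 in auto)
    show "\<exists>N. \<forall>n\<ge>N. vnorm H (vdiff (T m x) (T n x)) \<le> e * vnorm H x"
      using N x by (intro exI[of _ N] allI impI order_trans[OF le[OF x]] mult_right_mono) (auto simp: less_imp_le)
  qed
  have L: "L \<in> bounded_operators H"
  proof -
    obtain N where N: "\<forall>n\<ge>N. opnorm (\<lambda>x\<in>carrier H. vdiff (T N x) (T n x)) < 1"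
      using cauchy[rule_format, of 1] by auto
    show ?thesis
    proof (rule opI[where K="opnorm (T N) + 1"])
      fix x assume x: "x \<in> carrier H"
      have "L x = vdiff (T N x) (vdiff (T N x) (L x))"
        by (rule inner_ext) (use x T L1 in \<open>auto simp: inner_simps\<close>)
      then have "vnorm H (L x) \<le> vnorm H (T N x) + vnorm H (vscale H (-1) (vdiff (T N x) (L x)))"
        using vnorm_triangle[of "T N x" "vscale H (-1) (vdiff (T N x) (L x))"] x T L1 by simp
      then show "vnorm H (L x) \<le> (opnorm (T N) + 1) * vnorm H x"
        using close[OF x N] opnorm_le[OF T x, of N] x T L1 by (simp add: vnorm_scale distrib_right)
    next
      fix x y assume xy: "x \<in> carrier H" "y \<in> carrier H"
      show "L (vadd H x y) = vadd H (L x) (L y)"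
      proof (rule inner_ext)
        fix z assume z: "z \<in> carrier H"
        have "(\<lambda>n. vinner H (T n (vadd H x y)) z) \<longlonglongrightarrow> vinner H (L x) z + vinner H (L y) z"
          using tendsto_add[OF lim[OF xy(1) z] lim[OF xy(2) z]] xy z T by (simp add: inner_simps)
        then show "vinner H (L (vadd H x y)) z = vinner H (vadd H (L x) (L y)) z"
          using lim[of "vadd H x y" z] xy z L1 by (simp add: inner_simps LIMSEQ_unique)
      qed (use xy L1 in auto)
    next
      fix c x assume x: "x \<in> carrier H"
      show "L (vscale H c x) = vscale H c (L x)"
      proof (rule inner_ext)
        fix z assume z: "z \<in> carrier H"
        have "(\<lambda>n. vinner H (T n (vscale H c x)) z) \<longlonglongrightarrow> c * vinner H (L x) z"
          using tendsto_mult_left[OF lim[OF x z], of c] x z T by (simp add: inner_simps)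
        then show "vinner H (L (vscale H c x)) z = vinner H (vscale H c (L x)) z"
          using lim[of "vscale H c x" z] x z L1 by (simp add: inner_simps LIMSEQ_unique)
      qed (use x L1 in auto)
    qed (use L1 in \<open>auto simp: L_def\<close>)
  qed
  moreover have "(\<lambda>n. opnorm (\<lambda>x\<in>carrier H. vdiff (T n x) (L x))) \<longlonglongrightarrow> 0"
  proof (rule LIMSEQ_I)
    fix e :: real assume e: "e > 0"
    then obtain N where N: "\<forall>m\<ge>N. \<forall>n\<ge>N. opnorm (\<lambda>x\<in>carrier H. vdiff (T m x) (T n x)) < e / 2"
      using cauchy half_gt_zero by blast
    have "opnorm (\<lambda>x\<in>carrier H. vdiff (T m x) (L x)) \<le> e / 2" if "m \<ge> N" for m
      by (rule opnorm_leI) (use e N that close[of _ N m "e/2"] in auto)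
    then have "norm (opnorm (\<lambda>x\<in>carrier H. vdiff (T m x) (L x)) - 0) < e" if "m \<ge> N" for m
      using opnorm_nonneg[OF op_minus_closed[OF T L, of m]] that e by fastforce
    then show "\<exists>N. \<forall>n\<ge>N. norm (opnorm (\<lambda>x\<in>carrier H. vdiff (T n x) (L x)) - 0) < e"
      by blast
  qed
  ultimately show ?thesis by blast
qed

text \<open>The half of the C*-identity that needs the inner product: |T x|^2 = <T^* T x,
  x>.\<close>

lemma opnorm_adjoint_le:
  assumes T: "T \<in> bounded_operators H"
  shows "(opnorm T)\<^sup>2 \<le> opnorm (compose (carrier H) (adjoint_op H T) T)" (is "_ \<le> ?r")
proof -
  let ?TT = "compose (carrier H) (adjoint_op H T) T"
  have TT: "?TT \<in> bounded_operators H" using T by (intro op_comp_closed) auto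
  have "opnorm T \<le> sqrt ?r" 
  proof (rule opnorm_leI)
    fix x assume x: "x \<in> carrier H"
    have "(vnorm H (T x))\<^sup>2 = Re (vinner H (?TT x) x)"
      using T x by (simp add: vnorm_sq compose_def adjoint_left)
    also have "\<dots> \<le> vnorm H (?TT x) * vnorm H x"
      using cauchy_schwarz[of "?TT x" x] complex_Re_le_cmod[of "vinner H (?TT x) x"] x TT by force
    also have "\<dots> \<le> ?r * vnorm H x * vnorm H x"
      using opnorm_le[OF TT x] x by (intro mult_right_mono) auto
    finally have "(vnorm H (T x))\<^sup>2 \<le> (sqrt ?r * vnorm H x)\<^sup>2"
      using opnorm_nonneg[OF TT] by (simp add: power_mult_distrib mult.assoc flip: power2_eq_square)
    then show "vnorm H (T x) \<le> sqrt ?r * vnorm H x"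
      by (rule power2_le_imp_le) (use x opnorm_nonneg[OF TT] in auto)
  qed (use opnorm_nonneg[OF TT] in simp)
  then show ?thesis
    using opnorm_nonneg[OF T] opnorm_nonneg[OF TT] by (metis power_mono real_sqrt_pow2)
qed

theorem cstar_algebra_B: "cstar_algebra (B_of H)"
proof -
  interpret abelian_group "B_of H" by (rule abelian_group_B)
  have adj2: "adjoint_op H (adjoint_op H T) = T" if "T \<in> bounded_operators H" for T
    by (rule adjoint_eqI) (use that in \<open>auto simp: adjoint_left\<close>)
  \<comment> \<open>One factor \<open>opnorm T\<close> is cancelled in |T|^2 <= |T^*| |T|. Applied
    to the adjoint as well, this makes the adjoint isometric.\<close>
  have nrm_adj_le: "opnorm T \<le> opnorm (adjoint_op H T)" if T: "T \<in> bounded_operators H" for T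
  proof -
    have "opnorm T * opnorm T \<le> opnorm (adjoint_op H T) * opnorm T"
      using opnorm_adjoint_le[OF T] op_comp_closed(2)[OF adjoint_closed[OF T] T] by (simp add: power2_eq_square)
    then show ?thesis using opnorm_nonneg[OF T] opnorm_nonneg[OF adjoint_closed[OF T]]
      by (cases "opnorm T = 0") (auto simp: mult_le_cancel_right)
  qed
  show ?thesis
  proof unfold_locales
    fix T assume "T \<in> carrier (B_of H)"
    then have T: "T \<in> bounded_operators H" by simp
    show "nrm (B_of H) (star (B_of H) T \<otimes>\<^bsub>B_of H\<^esub> T) = (nrm (B_of H) T)\<^sup>2"
    proof (rule antisym)
      have "opnorm (adjoint_op H T) = opnorm T"
        using nrm_adj_le[OF T] nrm_adj_le[OF adjoint_closed[OF T]] adj2[OF T] by simp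
      then show "nrm (B_of H) (star (B_of H) T \<otimes>\<^bsub>B_of H\<^esub> T) \<le> (nrm (B_of H) T)\<^sup>2"
        using op_comp_closed(2)[OF adjoint_closed[OF T] T] by (simp add: power2_eq_square B_sel)
    qed (use opnorm_adjoint_le[OF T] in \<open>simp add: B_sel\<close>)
    show "nrm (B_of H) T = 0 \<longleftrightarrow> T = \<zero>\<^bsub>B_of H\<^esub>"
    proof
      assume "nrm (B_of H) T = 0"
      then have "vnorm H (T x) = 0" if "x \<in> carrier H" for x
        using opnorm_le[OF T that] vnorm_nonneg[OF op_closed[OF T that]] by simp
      then show "T = \<zero>\<^bsub>B_of H\<^esub>"
        using T by (auto intro!: op_ext[OF T] vnorm_eq_0)
    next
      assume "T = \<zero>\<^bsub>B_of H\<^esub>"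
      then have "opnorm T \<le> 0" by (intro opnorm_leI) auto
      then show "nrm (B_of H) T = 0" using opnorm_nonneg[OF T] by simp
    qed
    fix c :: complex
    have le: "opnorm (c \<odot>\<^bsub>B_of H\<^esub> U) \<le> cmod c * opnorm U" if U: "U \<in> bounded_operators H" for c U
      by (rule opnorm_leI) (use U opnorm_nonneg[OF U] opnorm_le[OF U] in \<open>auto simp: vnorm_scale mult.assoc intro!: mult_left_mono\<close>)
    show "nrm (B_of H) (c \<odot>\<^bsub>B_of H\<^esub> T) = cmod c * nrm (B_of H) T"
    proof (cases "c = 0")
      case True
      then show ?thesis using le[OF T, of 0] opnorm_nonneg[of "0 \<odot>\<^bsub>B_of H\<^esub> T"] T by simp
    next
      case False
      let ?U = "c \<odot>\<^bsub>B_of H\<^esub> T"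
      have U: "?U \<in> bounded_operators H" using T by simp
      have "T = (1 / c) \<odot>\<^bsub>B_of H\<^esub> ?U"
        by (rule op_ext_inner) (use T False in \<open>auto simp: inner_simps\<close>)
      then have "opnorm T \<le> cmod (1 / c) * opnorm ?U" using le[OF U, of "1/c"] by simp
      then have "cmod c * opnorm T \<le> opnorm ?U" using False by (simp add: norm_divide field_simps)
      then show ?thesis using le[OF T, of c] by simp
    qed
  next
    fix T U assume "T \<in> carrier (B_of H)" "U \<in> carrier (B_of H)"
    then have T: "T \<in> bounded_operators H" and U: "U \<in> bounded_operators H" by auto
    show "nrm (B_of H) (T \<oplus>\<^bsub>B_of H\<^esub> U) \<le> nrm (B_of H) T + nrm (B_of H) U"
      unfolding B_sel(1,6,7)
    proof (rule opnorm_leI)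
      fix x assume x: "x \<in> carrier H"
      show "vnorm H ((T \<oplus>\<^bsub>B_of H\<^esub> U) x) \<le> (opnorm T + opnorm U) * vnorm H x"
        using vnorm_triangle[of "T x" "U x"] opnorm_le[OF T x] opnorm_le[OF U x] T U x
        by (simp add: distrib_right)
    qed (use opnorm_nonneg T U in auto)
    show "star (B_of H) (T \<otimes>\<^bsub>B_of H\<^esub> U) = star (B_of H) U \<otimes>\<^bsub>B_of H\<^esub> star (B_of H) T"
      unfolding B_sel(1,6,7)
      by (rule adjoint_eqI) (use T U in \<open>auto simp: adjoint_right\<close>)
    show "star (B_of H) (T \<oplus>\<^bsub>B_of H\<^esub> U) = star (B_of H) T \<oplus>\<^bsub>B_of H\<^esub> star (B_of H) U"
      unfolding B_sel(1,6,7)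
      by (rule adjoint_eqI) (use T U in \<open>auto simp: inner_simps adjoint_right\<close>)
  next
    fix T c assume "T \<in> carrier (B_of H)"
    then have T: "T \<in> bounded_operators H" by simp
    show "star (B_of H) (c \<odot>\<^bsub>B_of H\<^esub> T) = cnj c \<odot>\<^bsub>B_of H\<^esub> star (B_of H) T"
      unfolding B_sel(1,6,7)
      by (rule adjoint_eqI) (use T in \<open>auto simp: inner_simps adjoint_right\<close>)
  next
    fix T :: "nat \<Rightarrow> 'h \<Rightarrow> 'h"
    assume "\<And>n. T n \<in> carrier (B_of H)"
    then have T: "T n \<in> bounded_operators H" for n by simp
    assume "\<forall>e>0. \<exists>N. \<forall>m\<ge>N. \<forall>n\<ge>N. nrm (B_of H) (T m \<ominus>\<^bsub>B_of H\<^esub> T n) < e"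
    then have "\<forall>e>0. \<exists>N. \<forall>m\<ge>N. \<forall>n\<ge>N. opnorm (\<lambda>x\<in>carrier H. vdiff (T m x) (T n x)) < e"
      by (simp add: B_minus T)
    from B_complete[OF T this] show "\<exists>l\<in>carrier (B_of H). (\<lambda>n. nrm (B_of H) (T n \<ominus>\<^bsub>B_of H\<^esub> l)) \<longlonglongrightarrow> 0"
      by (auto simp: B_minus T)
  next
    fix T U V assume "T \<in> carrier (B_of H)" "U \<in> carrier (B_of H)" "V \<in> carrier (B_of H)"
    then have *: "T \<in> bounded_operators H" "U \<in> bounded_operators H" "V \<in> bounded_operators H" by simp_all
    show "T \<otimes>\<^bsub>B_of H\<^esub> U \<otimes>\<^bsub>B_of H\<^esub> V = T \<otimes>\<^bsub>B_of H\<^esub> (U \<otimes>\<^bsub>B_of H\<^esub> V)"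
      by (rule op_ext_inner) (use * in simp_all)
    show "(T \<oplus>\<^bsub>B_of H\<^esub> U) \<otimes>\<^bsub>B_of H\<^esub> V = T \<otimes>\<^bsub>B_of H\<^esub> V \<oplus>\<^bsub>B_of H\<^esub> U \<otimes>\<^bsub>B_of H\<^esub> V"
      by (rule op_ext_inner) (use * in simp_all)
    show "V \<otimes>\<^bsub>B_of H\<^esub> (T \<oplus>\<^bsub>B_of H\<^esub> U) = V \<otimes>\<^bsub>B_of H\<^esub> T \<oplus>\<^bsub>B_of H\<^esub> V \<otimes>\<^bsub>B_of H\<^esub> U"
      by (rule op_ext_inner) (use * in simp_all)
  next
    fix T c d assume "T \<in> carrier (B_of H)"
    then have *: "T \<in> bounded_operators H" by simp
    show "(c + d) \<odot>\<^bsub>B_of H\<^esub> T = c \<odot>\<^bsub>B_of H\<^esub> T \<oplus>\<^bsub>B_of H\<^esub> d \<odot>\<^bsub>B_of H\<^esub> T"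
      by (rule op_ext_inner) (use * in \<open>simp_all add: inner_simps ring_distribs\<close>)
    show "(c * d) \<odot>\<^bsub>B_of H\<^esub> T = c \<odot>\<^bsub>B_of H\<^esub> (d \<odot>\<^bsub>B_of H\<^esub> T)"
      by (rule op_ext_inner) (use * in \<open>simp_all add: inner_simps\<close>)
    show "1 \<odot>\<^bsub>B_of H\<^esub> T = T"
      by (rule op_ext_inner) (use * in \<open>simp_all add: inner_simps\<close>)
  next
    fix T U c assume "T \<in> carrier (B_of H)" "U \<in> carrier (B_of H)"
    then have *: "T \<in> bounded_operators H" "U \<in> bounded_operators H" by simp_all
    show "c \<odot>\<^bsub>B_of H\<^esub> (T \<oplus>\<^bsub>B_of H\<^esub> U) = c \<odot>\<^bsub>B_of H\<^esub> T \<oplus>\<^bsub>B_of H\<^esub> c \<odot>\<^bsub>B_of H\<^esub> U"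
      by (rule op_ext_inner) (use * in \<open>simp_all add: inner_simps ring_distribs\<close>)
    show "c \<odot>\<^bsub>B_of H\<^esub> T \<otimes>\<^bsub>B_of H\<^esub> U = c \<odot>\<^bsub>B_of H\<^esub> (T \<otimes>\<^bsub>B_of H\<^esub> U)"
      by (rule op_ext_inner) (use * in \<open>simp_all add: inner_simps\<close>)
    show "T \<otimes>\<^bsub>B_of H\<^esub> (c \<odot>\<^bsub>B_of H\<^esub> U) = c \<odot>\<^bsub>B_of H\<^esub> (T \<otimes>\<^bsub>B_of H\<^esub> U)"
      by (rule op_ext_inner) (use * in \<open>simp_all add: inner_simps\<close>)
  qed (simp_all add: adj2 opnorm_nonneg opnorm_mult)
qed

end

section \<open>The Hilbert space of square integrable functions\<close>

lemma L2_fun_measurable [measurable_dest]: "f \<in> L2_fun M \<Longrightarrow> f \<in> borel_measurable M"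
  by (simp add: L2_fun_def)

lemma borel_measurable_cnj [measurable]:
  "f \<in> borel_measurable M \<Longrightarrow> (\<lambda>x. cnj (f x)) \<in> borel_measurable M"
  by (rule borel_measurable_continuous_on[where f=cnj]) (intro continuous_intros)

lemma L2_fun_iff:
  "f \<in> L2_fun M \<longleftrightarrow> f \<in> borel_measurable M \<and> (\<integral>\<^sup>+x. ennreal ((cmod (f x))\<^sup>2) \<partial>M) < \<infinity>"
  unfolding L2_fun_def by (auto simp: integrable_iff_bounded)

lemma L2_fun_bound:
  assumes "f \<in> borel_measurable M" "integrable M h" "\<And>x. (cmod (f x))\<^sup>2 \<le> h x"
  shows "f \<in> L2_fun M"
  unfolding L2_fun_def using assms
  by (auto intro!: Bochner_Integration.integrable_bound[OF assms(2)] AE_I2 order_trans[OF assms(3) abs_ge_self])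

lemma L2_fun_zero [simp]: "(\<lambda>x. 0) \<in> L2_fun M"
  by (simp add: L2_fun_def)

lemma L2_fun_add [simp]:
  assumes f: "f \<in> L2_fun M" and g: "g \<in> L2_fun M"
  shows "(\<lambda>x. f x + g x) \<in> L2_fun M"
proof (rule L2_fun_bound)
  show "integrable M (\<lambda>x. 2 * (cmod (f x))\<^sup>2 + 2 * (cmod (g x))\<^sup>2)"
    using f g by (auto simp: L2_fun_def)
  fix x
  have "(cmod (f x + g x))\<^sup>2 \<le> (cmod (f x) + cmod (g x))\<^sup>2"
    by (intro power_mono norm_triangle_ineq) auto
  also have "\<dots> \<le> 2 * (cmod (f x))\<^sup>2 + 2 * (cmod (g x))\<^sup>2"
    using sum_squares_bound[of "cmod (f x)" "cmod (g x)"] by (simp add: power2_sum)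
  finally show "(cmod (f x + g x))\<^sup>2 \<le> 2 * (cmod (f x))\<^sup>2 + 2 * (cmod (g x))\<^sup>2" .
qed (use f g in measurable)

lemma L2_fun_scale [simp]: "f \<in> L2_fun M \<Longrightarrow> (\<lambda>x. c * f x) \<in> L2_fun M"
  by (auto simp: L2_fun_def norm_mult power_mult_distrib)

lemma L2_fun_diff: "f \<in> L2_fun M \<Longrightarrow> g \<in> L2_fun M \<Longrightarrow> (\<lambda>x. f x - g x) \<in> L2_fun M"
  using L2_fun_add[OF _ L2_fun_scale, of f M g "-1"] by simp

lemma L2_inner_integrable:
  assumes f: "f \<in> L2_fun M" and g: "g \<in> L2_fun M"
  shows "integrable M (\<lambda>x. f x * cnj (g x))"
proof (rule Bochner_Integration.integrable_bound)
  show "integrable M (\<lambda>x. (cmod (f x))\<^sup>2 + (cmod (g x))\<^sup>2)"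
    using f g by (auto simp: L2_fun_def)
  have "cmod (f x) * cmod (g x) \<le> (cmod (f x))\<^sup>2 + (cmod (g x))\<^sup>2" for x
    using sum_squares_bound[of "cmod (f x)" "cmod (g x)"] mult_nonneg_nonneg[of "cmod (f x)" "cmod (g x)"]
    unfolding mult.assoc by (simp del: mult_nonneg_nonneg)
  then show "AE x in M. norm (f x * cnj (g x)) \<le> norm ((cmod (f x))\<^sup>2 + (cmod (g x))\<^sup>2)"
    by (simp add: norm_mult)
qed (use f g in measurable)

lemma L2_rel_equiv: "equiv (L2_fun M) (L2_rel M)"
proof (rule equivI)
  show "sym (L2_rel M)"
    by (auto simp: L2_rel_def sym_def eq_commute)
  show "trans (L2_rel M)"
  proof (rule transI)
    fix f g h assume "(f, g) \<in> L2_rel M" "(g, h) \<in> L2_rel M"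
    then have "AE x in M. f x = g x" "AE x in M. g x = h x" and *: "f \<in> L2_fun M" "h \<in> L2_fun M"
      by (auto simp: L2_rel_def)
    from this(1,2) have "AE x in M. f x = h x" by eventually_elim simp
    with * show "(f, h) \<in> L2_rel M" by (simp add: L2_rel_def)
  qed
qed (auto simp: L2_rel_def refl_on_def)

lemma L2_class_eq: "\<lbrakk>f \<in> L2_fun M; g \<in> L2_fun M\<rbrakk> \<Longrightarrow> L2_class M f = L2_class M g \<longleftrightarrow> (AE x in M. f x = g x)"
  unfolding L2_class_def by (subst eq_equiv_class_iff[OF L2_rel_equiv]) (auto simp: L2_rel_def)

lemma L2_carrier: "carrier (L2 M) = L2_class M ` L2_fun M"
  by (auto simp: L2_def quotient_def L2_class_def)

lemma L2_class_carrier [simp]: "f \<in> L2_fun M \<Longrightarrow> L2_class M f \<in> carrier (L2 M)"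
  by (simp add: L2_carrier)

text \<open>Evaluates the operations that are defined by a union over representatives: a set-valued
  function that is constant on the class has its common value as union.\<close>

lemma UN_L2_class:
  assumes "f \<in> L2_fun M"
    and "\<And>g. \<lbrakk>g \<in> L2_fun M; AE x in M. f x = g x\<rbrakk> \<Longrightarrow> h g = h f"
  shows "(\<Union>g\<in>L2_class M f. h g) = h f"
proof -
  have "L2_class M f \<noteq> {}" using assms(1) by (auto simp: L2_class_def L2_rel_def)
  moreover have "h g = h f" if "g \<in> L2_class M f" for g
    using that assms(2)[of g] by (simp add: L2_class_def L2_rel_def)
  ultimately show ?thesis by simp
qed

lemma L2_zero: "vzero (L2 M) = L2_class M (\<lambda>x. 0)"
  by (simp add: L2_def)

lemma L2_add:
  assumes "f \<in> L2_fun M" "g \<in> L2_fun M"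
  shows "vadd (L2 M) (L2_class M f) (L2_class M g) = L2_class M (\<lambda>x. f x + g x)"
proof -
  have cong: "L2_class M (\<lambda>x. f' x + g' x) = L2_class M (\<lambda>x. f x + g x)"
    if "f \<in> L2_fun M" "f' \<in> L2_fun M" "g \<in> L2_fun M" "g' \<in> L2_fun M"
      "AE x in M. f x = f' x" "AE x in M. g x = g' x" for f f' g g'
  proof -
    from that(5,6) have "AE x in M. f' x + g' x = f x + g x" by eventually_elim simp
    with that show ?thesis by (simp only: L2_class_eq L2_fun_add)
  qed
  have *: "(\<Union>g'\<in>L2_class M g. L2_class M (\<lambda>x. f' x + g' x)) = L2_class M (\<lambda>x. f' x + g x)"
    if "f' \<in> L2_fun M" for f'
    by (rule UN_L2_class, fact, rule cong) (use that assms in auto)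
  have "vadd (L2 M) (L2_class M f) (L2_class M g) = (\<Union>f'\<in>L2_class M f. L2_class M (\<lambda>x. f' x + g x))"
    unfolding L2_def inner_space.simps by (intro SUP_cong refl *) (auto simp: L2_class_def L2_rel_def)
  also have "\<dots> = L2_class M (\<lambda>x. f x + g x)"
    by (rule UN_L2_class, fact, rule cong) (use assms in auto)
  finally show ?thesis .
qed

lemma L2_scale:
  assumes "f \<in> L2_fun M"
  shows "vscale (L2 M) c (L2_class M f) = L2_class M (\<lambda>x. c * f x)"
proof -
  have "(\<Union>g\<in>L2_class M f. L2_class M (\<lambda>x. c * g x)) = L2_class M (\<lambda>x. c * f x)"
    using assms
  proof (rule UN_L2_class)
    fix g assume g: "g \<in> L2_fun M" and eq: "AE x in M. f x = g x"
    from eq have "AE x in M. c * g x = c * f x" by (rule eventually_mono) simp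
    then show "L2_class M (\<lambda>x. c * g x) = L2_class M (\<lambda>x. c * f x)"
      using assms g by (simp only: L2_class_eq L2_fun_scale)
  qed
  then show ?thesis by (simp add: L2_def)
qed

lemma L2_inner:
  assumes f: "f \<in> L2_fun M" and g: "g \<in> L2_fun M"
  shows "vinner (L2 M) (L2_class M f) (L2_class M g) = (\<integral>x. f x * cnj (g x) \<partial>M)"
proof -
  have *: "(\<Union>g'\<in>L2_class M g. {\<integral>x. f' x * cnj (g' x) \<partial>M}) = {\<integral>x. f' x * cnj (g x) \<partial>M}"
    if f': "f' \<in> L2_fun M" for f'
    using g
  proof (rule UN_L2_class)
    fix h assume "h \<in> L2_fun M" "AE x in M. g x = h x"
    then have "(\<integral>x. f' x * cnj (h x) \<partial>M) = (\<integral>x. f' x * cnj (g x) \<partial>M)"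
      using f' g by (intro integral_cong_AE) (auto elim: eventually_mono)
    then show "{\<integral>x. f' x * cnj (h x) \<partial>M} = {\<integral>x. f' x * cnj (g x) \<partial>M}" by simp
  qed
  have **: "(\<Union>f'\<in>L2_class M f. {\<integral>x. f' x * cnj (g x) \<partial>M}) = {\<integral>x. f x * cnj (g x) \<partial>M}"
    using f
  proof (rule UN_L2_class)
    fix h assume "h \<in> L2_fun M" "AE x in M. f x = h x"
    then have "(\<integral>x. h x * cnj (g x) \<partial>M) = (\<integral>x. f x * cnj (g x) \<partial>M)"
      using f g by (intro integral_cong_AE) (auto elim: eventually_mono)
    then show "{\<integral>x. h x * cnj (g x) \<partial>M} = {\<integral>x. f x * cnj (g x) \<partial>M}" by simp
  qed
  have "(\<Union>f'\<in>L2_class M f. \<Union>g'\<in>L2_class M g. {\<integral>x. f' x * cnj (g' x) \<partial>M})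
      = (\<Union>f'\<in>L2_class M f. {\<integral>x. f' x * cnj (g x) \<partial>M})"
    by (intro SUP_cong refl *) (auto simp: L2_class_def L2_rel_def)
  then show ?thesis unfolding L2_def inner_space.simps ** by simp
qed

lemma L2_inner_self:
  assumes f: "f \<in> L2_fun M"
  shows "vinner (L2 M) (L2_class M f) (L2_class M f) = complex_of_real (\<integral>x. (cmod (f x))\<^sup>2 \<partial>M)"
proof -
  have "vinner (L2 M) (L2_class M f) (L2_class M f) = (\<integral>x. complex_of_real ((cmod (f x))\<^sup>2) \<partial>M)"
    unfolding L2_inner[OF f f] by (intro Bochner_Integration.integral_cong refl) (simp only: complex_norm_square)
  then show ?thesis by (simp only: integral_complex_of_real)
qed

lemma vnorm_L2:
  "f \<in> L2_fun M \<Longrightarrow> vnorm (L2 M) (L2_class M f) = sqrt (\<integral>x. (cmod (f x))\<^sup>2 \<partial>M)"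
  by (simp add: vnorm_def L2_inner_self)

lemma L2_sq_integral:
  "f \<in> L2_fun M \<Longrightarrow> ennreal (\<integral>x. (cmod (f x))\<^sup>2 \<partial>M) = (\<integral>\<^sup>+x. ennreal ((cmod (f x))\<^sup>2) \<partial>M)"
  by (rule nn_integral_eq_integral[symmetric]) (auto simp: L2_fun_def)

lemma L2_diff:
  "\<lbrakk>f \<in> L2_fun M; g \<in> L2_fun M\<rbrakk> \<Longrightarrow>
    vadd (L2 M) (L2_class M f) (vscale (L2 M) (-1) (L2_class M g)) = L2_class M (\<lambda>x. f x - g x)"
  using L2_add[of f M "\<lambda>x. -1 * g x"] L2_scale[of g M "-1"] L2_fun_scale[of g M "-1"] by simp

text \<open>
  Along a subsequence with \<open>\<integral>|g\<^sub>k\<^sub>+\<^sub>1 - g\<^sub>k|\<^sup>2 \<le> 8\<^sup>-\<^sup>k\<close> the series \<open>\<Sum>\<^sub>k 2\<^sup>k |g\<^sub>k\<^sub>+\<^sub>1 - g\<^sub>k|\<^sup>2\<close> is integrable, so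
  almost everywhere the increments decay geometrically.
\<close>

lemma L2_increments_converge:
  fixes g :: "nat \<Rightarrow> 'x \<Rightarrow> complex"
  assumes g: "\<And>k. g k \<in> L2_fun M"
    and inc: "\<And>k. (\<integral>x. (cmod (g (Suc k) x - g k x))\<^sup>2 \<partial>M) \<le> (1/8) ^ k"
  shows "AE x in M. convergent (\<lambda>k. g k x)"
proof -
  define u where "u k x = 2 ^ k * (cmod (g (Suc k) x - g k x))\<^sup>2" for k x
  have [measurable]: "g k \<in> borel_measurable M" for k using g L2_fun_measurable by blast
  have "(\<integral>\<^sup>+x. ennreal (u k x) \<partial>M) \<le> ennreal ((1/4) ^ k)" for k
  proof -
    have "(\<integral>\<^sup>+x. ennreal (u k x) \<partial>M) = ennreal (2 ^ k) * (\<integral>\<^sup>+x. ennreal ((cmod (g (Suc k) x - g k x))\<^sup>2) \<partial>M)"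
      by (subst nn_integral_cmult[symmetric]) (auto simp: u_def ennreal_mult)
    also have "\<dots> = ennreal (2 ^ k * (\<integral>x. (cmod (g (Suc k) x - g k x))\<^sup>2 \<partial>M))"
      using L2_sq_integral[OF L2_fun_diff[OF g[of "Suc k"] g[of k]]] by (simp add: ennreal_mult)
    also have "\<dots> \<le> ennreal (2 ^ k * (1/8) ^ k)"
      by (intro ennreal_leI mult_left_mono inc) auto
    finally show ?thesis by (simp add: power_mult_distrib[symmetric])
  qed
  then have "(\<Sum>k. \<integral>\<^sup>+x. ennreal (u k x) \<partial>M) \<le> (\<Sum>k. ennreal ((1/4) ^ k))"
    by (intro suminf_le) auto
  also have "\<dots> < \<infinity>" by (subst suminf_ennreal2) (auto intro!: summable_geometric)
  finally have "(\<integral>\<^sup>+x. (\<Sum>k. ennreal (u k x)) \<partial>M) \<noteq> \<infinity>"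
    by (subst nn_integral_suminf) (auto simp: u_def)
  then have "AE x in M. (\<Sum>k. ennreal (u k x)) \<noteq> \<infinity>"
    by (intro nn_integral_PInf_AE) (auto simp: u_def)
  then show ?thesis
  proof eventually_elim
    case (elim x)
    then have "summable (\<lambda>k. u k x)"
      by (intro summable_suminf_not_top) (auto simp: u_def)
    then have "Bseq (\<lambda>k. u k x)"
      by (intro convergent_imp_Bseq) (use summable_LIMSEQ_zero in \<open>unfold convergent_def, blast\<close>)
    then obtain C where "C > 0" "\<And>k. norm (u k x) \<le> C"
      unfolding Bseq_def by blast
    then have C: "C > 0" "\<And>k. u k x \<le> C"
      using abs_le_D1 by auto
    \<comment> \<open>A bound C for the weighted squares makes the k-th increment at most
      \<open>sqrt C\<close> times 2^(-k/2).\<close>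
    have "summable (\<lambda>k. g (Suc k) x - g k x)"
    proof (rule summable_comparison_test'[where N=0])
      show "summable (\<lambda>k. sqrt C * (sqrt (1/2)) ^ k)"
        by (intro summable_mult summable_geometric) simp
      fix k
      have "(cmod (g (Suc k) x - g k x))\<^sup>2 \<le> C * (1/2) ^ k"
        using C(2)[of k] by (simp add: u_def field_simps)
      also have "\<dots> = (sqrt C)\<^sup>2 * ((sqrt (1/2))\<^sup>2) ^ k"
        using C(1) by simp
      also have "\<dots> = (sqrt C * (sqrt (1/2)) ^ k)\<^sup>2"
        unfolding power_mult_distrib by (metis power_even_eq power_mult)
      finally show "norm (g (Suc k) x - g k x) \<le> sqrt C * (sqrt (1/2)) ^ k"
        by (rule power2_le_imp_le) (use C(1) in auto)
    qed
    then have "(\<lambda>n. \<Sum>k<n. g (Suc k) x - g k x) \<longlonglongrightarrow> (\<Sum>k. g (Suc k) x - g k x)"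
      by (rule summable_LIMSEQ)
    then have "(\<lambda>n. g n x - g 0 x) \<longlonglongrightarrow> (\<Sum>k. g (Suc k) x - g k x)"
      by (simp only: sum_lessThan_telescope[of "\<lambda>k. g k x"])
    from tendsto_add[OF this tendsto_const[of "g 0 x"]]
    have "(\<lambda>n. g n x) \<longlonglongrightarrow> (\<Sum>k. g (Suc k) x - g k x) + g 0 x"
      by (simp only: diff_add_cancel)
    then show ?case by (rule convergentI)
  qed
qed

lemma L2_complete:
  fixes f :: "nat \<Rightarrow> 'x \<Rightarrow> complex"
  assumes f: "\<And>n. f n \<in> L2_fun M"
    and cauchy: "\<And>e. e > 0 \<Longrightarrow> \<exists>N. \<forall>m\<ge>N. \<forall>n\<ge>N. (\<integral>x. (cmod (f m x - f n x))\<^sup>2 \<partial>M) < e"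
  shows "\<exists>l\<in>L2_fun M. (\<lambda>n. \<integral>x. (cmod (f n x - l x))\<^sup>2 \<partial>M) \<longlonglongrightarrow> 0"
proof -
  have [measurable]: "f k \<in> borel_measurable M" for k using f L2_fun_measurable by blast
  have "\<forall>k. \<exists>N. \<forall>m\<ge>N. \<forall>n\<ge>N. (\<integral>x. (cmod (f m x - f n x))\<^sup>2 \<partial>M) < (1/8) ^ k"
    using cauchy by simp
  then obtain N where N: "\<And>k m n. \<lbrakk>m \<ge> N k; n \<ge> N k\<rbrakk> \<Longrightarrow> (\<integral>x. (cmod (f m x - f n x))\<^sup>2 \<partial>M) < (1/8) ^ k"
    by metis
  \<comment> \<open>\<open>r k\<close> lies beyond \<open>N k\<close> and all earlier thresholds, so
    that two consecutive terms of the subsequence are past \<open>N k\<close>, and beyond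
    \<open>k\<close> itself.\<close>
  define r where "r k = k + (\<Sum>j\<le>k. N j)" for k
  have rN: "r k \<ge> N k" "r (Suc k) \<ge> N k" "r k \<ge> k" for k
    unfolding r_def by (auto intro: trans_le_add2 member_le_sum simp: lessThan_Suc_atMost[symmetric])
  have conv: "AE x in M. convergent (\<lambda>k. f (r k) x)"
  proof (rule L2_increments_converge)
    show "(\<integral>x. (cmod (f (r (Suc k)) x - f (r k) x))\<^sup>2 \<partial>M) \<le> (1/8) ^ k" for k
      using N[OF rN(2) rN(1)] by (rule less_imp_le)
  qed (rule f)
  define l where "l x = lim (\<lambda>k. f (r k) x)" for x
  have l_meas [measurable]: "l \<in> borel_measurable M"
    unfolding l_def by (rule borel_measurable_lim_metric) auto
  \<comment> \<open>Fatou's lemma along the subsequence turns the Cauchy estimate into an estimate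
    for the distance to \<open>l\<close>.\<close>
  have bound: "(\<integral>\<^sup>+x. ennreal ((cmod (f n x - l x))\<^sup>2) \<partial>M) \<le> ennreal e"
    if e: "e > 0" and K: "\<forall>m\<ge>K. \<forall>n\<ge>K. (\<integral>x. (cmod (f m x - f n x))\<^sup>2 \<partial>M) < e" and n: "n \<ge> K" for e K n
  proof -
    have "(\<integral>\<^sup>+x. ennreal ((cmod (f n x - l x))\<^sup>2) \<partial>M) =
        (\<integral>\<^sup>+x. liminf (\<lambda>k. ennreal ((cmod (f n x - f (r k) x))\<^sup>2)) \<partial>M)"
    proof (rule nn_integral_cong_AE, use conv in eventually_elim)
      case (elim x)
      then have "(\<lambda>k. f (r k) x) \<longlonglongrightarrow> l x" by (simp add: l_def convergent_LIMSEQ_iff)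
      then have "(\<lambda>k. ennreal ((cmod (f n x - f (r k) x))\<^sup>2)) \<longlonglongrightarrow> ennreal ((cmod (f n x - l x))\<^sup>2)"
        by (intro tendsto_intros)
      then show ?case by (rule lim_imp_Liminf[symmetric, OF sequentially_bot])
    qed
    also have "\<dots> \<le> liminf (\<lambda>k. \<integral>\<^sup>+x. ennreal ((cmod (f n x - f (r k) x))\<^sup>2) \<partial>M)"
      by (rule nn_integral_liminf) auto
    also have "\<dots> \<le> liminf (\<lambda>k. ennreal e)"
    proof (rule Liminf_mono, rule eventually_sequentiallyI[of K])
      fix k assume "k \<ge> K"
      then have "r k \<ge> K" using rN(3)[of k] by simp
      then show "(\<integral>\<^sup>+x. ennreal ((cmod (f n x - f (r k) x))\<^sup>2) \<partial>M) \<le> ennreal e"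
        using K n by (subst L2_sq_integral[OF L2_fun_diff[OF f f], symmetric]) (intro ennreal_leI less_imp_le, auto)
    qed
    finally show ?thesis by (simp add: Liminf_const)
  qed
  obtain K where K: "\<forall>m\<ge>K. \<forall>n\<ge>K. (\<integral>x. (cmod (f m x - f n x))\<^sup>2 \<partial>M) < 1"
    using cauchy[of 1] by auto
  have "(\<lambda>x. f K x - l x) \<in> L2_fun M"
    unfolding L2_fun_iff using bound[OF _ K order_refl] by (auto intro: le_less_trans)
  from L2_fun_diff[OF f[of K] this] have l: "l \<in> L2_fun M" by simp
  moreover have "(\<lambda>n. \<integral>x. (cmod (f n x - l x))\<^sup>2 \<partial>M) \<longlonglongrightarrow> 0"
  proof (rule LIMSEQ_I)
    fix e :: real assume e: "e > 0"
    obtain K where K: "\<forall>m\<ge>K. \<forall>n\<ge>K. (\<integral>x. (cmod (f m x - f n x))\<^sup>2 \<partial>M) < e / 2"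
      using cauchy[of "e/2"] e by auto
    have "norm ((\<integral>x. (cmod (f n x - l x))\<^sup>2 \<partial>M) - 0) < e" if n: "n \<ge> K" for n
    proof -
      have "ennreal (\<integral>x. (cmod (f n x - l x))\<^sup>2 \<partial>M) \<le> ennreal (e / 2)"
        using bound[OF _ K n] e by (simp add: L2_sq_integral[OF L2_fun_diff[OF f l]])
      then show ?thesis using e by (simp add: ennreal_le_iff)
    qed
    then show "\<exists>K. \<forall>n\<ge>K. norm ((\<integral>x. (cmod (f n x - l x))\<^sup>2 \<partial>M) - 0) < e" by blast
  qed
  ultimately show ?thesis by blast
qed

theorem hilbert_L2: "hilbert (L2 M)"
proof
  show "vzero (L2 M) \<in> carrier (L2 M)" by (simp add: L2_zero)
next
  fix P Q assume "P \<in> carrier (L2 M)" "Q \<in> carrier (L2 M)"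
  then obtain f g where fg: "f \<in> L2_fun M" "P = L2_class M f" "g \<in> L2_fun M" "Q = L2_class M g"
    unfolding L2_carrier by blast
  then show "vadd (L2 M) P Q \<in> carrier (L2 M)" by (simp add: L2_add)
  have "(\<integral>x. f x * cnj (g x) \<partial>M) = (\<integral>x. cnj (g x * cnj (f x)) \<partial>M)" by (intro Bochner_Integration.integral_cong) simp_all
  also have "\<dots> = cnj (\<integral>x. g x * cnj (f x) \<partial>M)" by (rule Bochner_Integration.integral_cnj)
  finally show "vinner (L2 M) P Q = cnj (vinner (L2 M) Q P)" by (simp add: fg L2_inner)
  assume *: "\<And>z. z \<in> carrier (L2 M) \<Longrightarrow> vinner (L2 M) P z = vinner (L2 M) Q z"
  let ?h = "\<lambda>x. f x - g x"
  have h: "?h \<in> L2_fun M" using fg by (simp add: L2_fun_diff)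
  have "vinner (L2 M) (L2_class M ?h) (L2_class M ?h) = vinner (L2 M) P (L2_class M ?h) - vinner (L2 M) Q (L2_class M ?h)"
    using fg h L2_inner_integrable[OF fg(1) h] L2_inner_integrable[OF fg(3) h]
    by (simp add: L2_inner left_diff_distrib)
  also have "\<dots> = 0" using * h by simp
  finally have "(\<integral>x. (cmod (?h x))\<^sup>2 \<partial>M) = 0" by (simp only: L2_inner_self[OF h] of_real_eq_0_iff)
  then have "AE x in M. (cmod (?h x))\<^sup>2 = 0"
    using h by (subst (asm) integral_nonneg_eq_0_iff_AE) (auto simp: L2_fun_def)
  then show "P = Q" using fg by (auto simp: L2_class_eq)
next
  fix P c assume "P \<in> carrier (L2 M)"
  then obtain f where f: "f \<in> L2_fun M" "P = L2_class M f" unfolding L2_carrier by blast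
  then show "vscale (L2 M) c P \<in> carrier (L2 M)" by (simp add: L2_scale)
next
  fix P assume "P \<in> carrier (L2 M)"
  then obtain f where f: "f \<in> L2_fun M" "P = L2_class M f" unfolding L2_carrier by blast
  then show "vinner (L2 M) (vzero (L2 M)) P = 0" by (simp add: L2_zero L2_inner)
  show "0 \<le> Re (vinner (L2 M) P P)" using f by (simp add: L2_inner_self)
next
  fix P Q R assume "P \<in> carrier (L2 M)" "Q \<in> carrier (L2 M)" "R \<in> carrier (L2 M)"
  then obtain f g h where fgh: "f \<in> L2_fun M" "P = L2_class M f" "g \<in> L2_fun M" "Q = L2_class M g"
      "h \<in> L2_fun M" "R = L2_class M h"
    unfolding L2_carrier by blast
  then show "vinner (L2 M) (vadd (L2 M) P Q) R = vinner (L2 M) P R + vinner (L2 M) Q R"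
    using L2_inner_integrable[OF fgh(1,5)] L2_inner_integrable[OF fgh(3,5)]
    by (simp add: L2_add L2_inner distrib_right)
next
  fix P R c assume "P \<in> carrier (L2 M)" "R \<in> carrier (L2 M)"
  then obtain f h where fh: "f \<in> L2_fun M" "P = L2_class M f" "h \<in> L2_fun M" "R = L2_class M h"
    unfolding L2_carrier by blast
  then show "vinner (L2 M) (vscale (L2 M) c P) R = c * vinner (L2 M) P R"
    by (simp add: L2_scale L2_inner mult.assoc)
next
  fix a :: "nat \<Rightarrow> ('a \<Rightarrow> complex) set"
  assume "\<And>n. a n \<in> carrier (L2 M)"
    and cauchy: "\<forall>e>0. \<exists>N. \<forall>m\<ge>N. \<forall>n\<ge>N.
      vnorm (L2 M) (vadd (L2 M) (a m) (vscale (L2 M) (-1) (a n))) < e"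
  then have "\<forall>n. \<exists>f. f \<in> L2_fun M \<and> a n = L2_class M f" unfolding L2_carrier by blast
  then obtain f where f: "\<And>n. f n \<in> L2_fun M" "\<And>n. a n = L2_class M (f n)"
    by metis
  have "\<exists>N. \<forall>m\<ge>N. \<forall>n\<ge>N. (\<integral>x. (cmod (f m x - f n x))\<^sup>2 \<partial>M) < e" if "e > 0" for e
    using cauchy[rule_format, of "sqrt e"] that f by (simp add: L2_diff vnorm_L2 L2_fun_diff)
  from L2_complete[OF f(1) this] obtain l where l: "l \<in> L2_fun M"
    "(\<lambda>n. \<integral>x. (cmod (f n x - l x))\<^sup>2 \<partial>M) \<longlonglongrightarrow> 0" by blast
  show "\<exists>l\<in>carrier (L2 M). (\<lambda>n. vnorm (L2 M) (vadd (L2 M) (a n) (vscale (L2 M) (-1) l))) \<longlonglongrightarrow> 0"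
    using tendsto_real_sqrt[OF l(2)] l(1) f
    by (intro bexI[of _ "L2_class M l"]) (auto simp: L2_diff vnorm_L2 L2_fun_diff)
qed

section \<open>C*-algebras\<close>

text \<open>If a > t > 0, the powers of a/t would outgrow every fixed power of the exponent; t = 0
  is settled by j = 0. Only exponents 2^j occur, so that repeated squaring suffices in the
  applications.\<close>

lemma le_of_power_le:
  fixes a t c :: real
  assumes t: "t \<ge> 0" and le: "\<And>j. a ^ (2 ^ j) \<le> (c * 2 ^ j) ^ k * t ^ (2 ^ j)"
  shows "a \<le> t"
proof (rule ccontr)
  assume "\<not> a \<le> t"
  then have at: "t < a" by simp
  show False
  proof (cases "t = 0")
    case True then show ?thesis using le[of 0] at by simp
  next
    case False
    then have t: "t > 0" using t by simp
    define q where "q = a / t"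
    have q: "q > 1" using at t by (simp add: q_def)
    have "(\<lambda>n. (c * real n) ^ k / q ^ n) \<longlonglongrightarrow> 0"
    proof -
      have "(\<lambda>n. c ^ k * (real n ^ k / q ^ n)) \<longlonglongrightarrow> c ^ k * 0"
        by (intro tendsto_mult tendsto_const) (use q in real_asymp)
      then show ?thesis by (simp add: power_mult_distrib)
    qed
    then have "eventually (\<lambda>n. (c * real n) ^ k / q ^ n < 1) sequentially"
      by (rule order_tendstoD) simp
    then obtain M where M: "\<And>n. n \<ge> M \<Longrightarrow> (c * real n) ^ k / q ^ n < 1"
      by (auto simp: eventually_sequentially)
    have "M \<le> 2 ^ M" using less_exp[of M] by simp
    from M[OF this] have "(c * 2 ^ M) ^ k < q ^ (2 ^ M)"
      using q by (simp add: divide_less_eq)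
    then have "(c * 2 ^ M) ^ k * t ^ (2 ^ M) < a ^ (2 ^ M)"
      using t by (simp add: q_def power_divide pos_less_divide_eq)
    then show False using le[of M] by simp
  qed
qed

context cstar_algebra begin

declare smult_closed [simp] mult_closed [simp] star_closed [simp] star_star [simp] nrm_nonneg [simp]

text \<open>The laws for zero scalars and zero factors are not axioms of the locale. They are read
  off from the norm, starting with homogeneity.\<close>

lemma smult_zero_left [simp]: "x \<in> carrier A \<Longrightarrow> 0 \<odot> x = \<zero>"
  using nrm_eq_0[of "0 \<odot> x"] nrm_smult[of x 0] by simp

lemma smult_zero_right [simp]: "c \<odot> \<zero> = \<zero>"
  using nrm_eq_0[of "c \<odot> \<zero>"] nrm_smult[of \<zero> c] nrm_eq_0[of \<zero>] by simp

lemma nrm_zero [simp]: "nrm A \<zero> = 0"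
  using nrm_eq_0[of \<zero>] by simp

lemma mult_zero_left [simp]: "x \<in> carrier A \<Longrightarrow> \<zero> \<otimes> x = \<zero>"
  using mult_smult_l[of \<zero> x 0] by simp

lemma mult_zero_right [simp]: "x \<in> carrier A \<Longrightarrow> x \<otimes> \<zero> = \<zero>"
  using mult_smult_r[of x \<zero> 0] by simp

lemma star_zero [simp]: "star A \<zero> = \<zero>"
  using star_smult[of \<zero> 0] by simp

lemma uminus_smult: "x \<in> carrier A \<Longrightarrow> \<ominus> x = (-1) \<odot> x"
proof (rule minus_equality)
  assume "x \<in> carrier A"
  then show "(-1) \<odot> x \<oplus> x = \<zero>"
    using smult_l_distr[of x "-1" 1] by (simp add: smult_one)
qed auto

lemma minus_smult: "y \<in> carrier A \<Longrightarrow> x \<ominus> y = x \<oplus> (-1) \<odot> y"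
  by (simp add: a_minus_def uminus_smult)

lemma nrm_star [simp]:
  assumes x: "x \<in> carrier A" shows "nrm A (star A x) = nrm A x"
proof -
  have le: "nrm A y \<le> nrm A (star A y)" if y: "y \<in> carrier A" for y
  proof (cases "nrm A y = 0")
    case False
    have "nrm A y * nrm A y \<le> nrm A (star A y) * nrm A y"
      using cstar_identity[OF y] nrm_mult[of "star A y" y] y by (simp add: power2_eq_square)
    moreover have "nrm A y > 0" using False nrm_nonneg[OF y] by linarith
    ultimately show ?thesis by simp
  qed (use y in simp)
  show ?thesis using le[OF x] le[of "star A x"] x by simp
qed

lemma finsum_mult_left:
  assumes "finite I" "f \<in> I \<rightarrow> carrier A" "x \<in> carrier A"
  shows "x \<otimes> (\<Oplus>i\<in>I. f i) = (\<Oplus>i\<in>I. x \<otimes> f i)"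
  using assms by (induction I) (auto simp: mult_r_distr Pi_iff)

lemma finsum_mult_right:
  assumes "finite I" "f \<in> I \<rightarrow> carrier A" "x \<in> carrier A"
  shows "(\<Oplus>i\<in>I. f i) \<otimes> x = (\<Oplus>i\<in>I. f i \<otimes> x)"
  using assms by (induction I) (auto simp: mult_l_distr Pi_iff)

lemma star_finsum:
  assumes "finite I" "f \<in> I \<rightarrow> carrier A"
  shows "star A (\<Oplus>i\<in>I. f i) = (\<Oplus>i\<in>I. star A (f i))"
  using assms by (induction I) (auto simp: star_add Pi_iff)

lemma nrm_finsum_le:
  assumes "finite I" "f \<in> I \<rightarrow> carrier A"
  shows "nrm A (\<Oplus>i\<in>I. f i) \<le> (\<Sum>i\<in>I. nrm A (f i))"
  using assms
proof (induction I)
  case (insert i I)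
  then have "nrm A (\<Oplus>i\<in>insert i I. f i) \<le> nrm A (f i) + nrm A (\<Oplus>i\<in>I. f i)"
    by (simp add: nrm_triangle Pi_iff)
  then show ?case using insert by (simp add: Pi_iff)
qed simp

lemma finsum_single:
  assumes "i \<in> I" "finite I" "f i \<in> carrier A" "\<And>j. \<lbrakk>j \<in> I; j \<noteq> i\<rbrakk> \<Longrightarrow> f j = \<zero>"
  shows "(\<Oplus>j\<in>I. f j) = f i"
proof -
  have f: "f \<in> I \<rightarrow> carrier A" using assms by (metis Pi_I zero_closed)
  have "(\<Oplus>j\<in>I. f j) = (\<Oplus>j\<in>I. if i = j then f j else \<zero>)"
    using assms f by (intro finsum_cong') auto
  also have "\<dots> = f i" using add.finprod_singleton[of i I f] assms f by simp
  finally show ?thesis .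
qed

section \<open>Projections and extreme points of the unit ball\<close>

lemma projection_nrm_le:
  assumes "projection A p" shows "nrm A p \<le> 1"
proof -
  have "(nrm A p)\<^sup>2 = nrm A p" using assms cstar_identity[of p] by (simp add: projection_def)
  then show ?thesis using assms by (auto simp: power2_eq_square projection_def)
qed

text \<open>Evaluation of polynomials at \<open>h\<close>, with constant term in the corner whose unit is \<open>e\<close>.\<close>

definition ev :: "'a \<Rightarrow> 'a \<Rightarrow> complex poly \<Rightarrow> 'a" where
  "ev e h p = fold_coeffs (\<lambda>a x. a \<odot> e \<oplus> h \<otimes> x) p \<zero>"

context
  fixes e h assumes e: "projection A e" and h: "h \<in> carrier A" and eh: "e \<otimes> h = h"
    and hs: "star A h = h"
begin

lemma e_closed [simp]: "e \<in> carrier A" "star A e = e" "e \<otimes> e = e"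
  using e by (auto simp: projection_def)

lemma ev_0 [simp]: "ev e h 0 = \<zero>" by (simp add: ev_def)

lemma ev_pCons: "ev e h (pCons a p) = a \<odot> e \<oplus> h \<otimes> ev e h p"
  by (cases "a = 0 \<and> p = 0") (use h in \<open>auto simp: ev_def\<close>)

lemma ev_closed [simp]: "ev e h p \<in> carrier A"
  by (induction p) (use h in \<open>auto simp: ev_pCons\<close>)

lemma ev_add: "ev e h (p + q) = ev e h p \<oplus> ev e h q"
  by (induction p q rule: poly_induct2) (use h in \<open>auto simp: ev_pCons smult_l_distr mult_r_distr a_ac\<close>)

lemma ev_smult: "ev e h (Polynomial.smult c p) = c \<odot> ev e h p"
  by (induction p) (use h in \<open>auto simp: ev_pCons smult_r_distr smult_assoc mult_smult_r\<close>)

lemma e_ev: "e \<otimes> ev e h p = ev e h p"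
  by (induction p)
     (use h eh mult_assoc[of e h, symmetric] in \<open>auto simp: ev_pCons mult_r_distr mult_smult_r\<close>)

lemma ev_mult: "ev e h (p * q) = ev e h p \<otimes> ev e h q"
  by (induction p)
     (use h in \<open>auto simp: ev_pCons ev_add ev_smult mult_l_distr mult_smult_l e_ev mult_assoc\<close>)

lemma nrm_ev_add: "nrm A (ev e h (p + q)) \<le> nrm A (ev e h p) + nrm A (ev e h q)"
  by (simp add: ev_add nrm_triangle)

lemma nrm_ev_smult: "nrm A (ev e h (Polynomial.smult c p)) = cmod c * nrm A (ev e h p)"
  by (simp add: ev_smult nrm_smult)

lemma nrm_ev_mult: "nrm A (ev e h (p * q)) \<le> nrm A (ev e h p) * nrm A (ev e h q)"
  by (simp add: ev_mult nrm_mult)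

lemma nrm_ev_mult_le_1: "\<lbrakk>nrm A (ev e h p) \<le> 1; nrm A (ev e h q) \<le> 1\<rbrakk> \<Longrightarrow> nrm A (ev e h (p * q)) \<le> 1"
  by (rule order_trans[OF nrm_ev_mult]) (simp add: mult_le_one)

lemma ev_linear: "ev e h [:a, b:] = a \<odot> e \<oplus> b \<odot> h"
proof -
  have "h \<otimes> e = h" using star_mult[of e h] h eh hs by simp
  then show ?thesis using h by (simp add: ev_pCons mult_smult_r mult_r_distr)
qed

text \<open>
  The element \<open>g\<close> comes from \<open>4 (e \<plusminus> g) = 2 (e \<plusminus> h)\<^sup>3 + (e + \<i> h)\<^sup>3 + (e - \<i> h)\<^sup>3\<close>: it inherits the hypotheses on \<open>h\<close>
  and is larger by the factor \<open>5/4\<close>, which can be iterated only if \<open>h = 0\<close>.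
\<close>

lemma unit_extreme_step:
  assumes plus: "nrm A (ev e h [:1, 1:]) \<le> 1" and minus: "nrm A (ev e h [:1, -1:]) \<le> 1"
  defines "g \<equiv> ev e h [:0, 3/2, 0, 1/2:]"
  shows "nrm A (e \<oplus> g) \<le> 1" "nrm A (e \<ominus> g) \<le> 1" "nrm A h \<le> 1 / 2" "5/4 * nrm A h \<le> nrm A g"
    "g \<in> carrier A" "e \<otimes> g = g" "star A g = g"
proof -
  let ?n = "\<lambda>p. nrm A (ev e h p)"
  have ev1: "ev e h [:1:] = e" using h by (simp add: ev_pCons smult_one)
  have evX: "ev e h [:0, 1:] = h" using h by (simp add: ev_linear smult_one)
  \<comment> \<open>1 + X^2 is the mean of the squares of 1 + X and 1 - X.\<close>
  have sq: "?n [:1, 0, 1:] \<le> 1"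
  proof -
    have "2 * ?n [:1, 0, 1:] = ?n (Polynomial.smult 2 [:1, 0, 1:])"
      by (simp only: nrm_ev_smult norm_numeral)
    also have "Polynomial.smult 2 [:1, 0, 1:] = [:1, 1:] * [:1, 1:] + [:1, -1:] * [:1, -1::complex:]" by simp
    also have "?n \<dots> \<le> 1 + 1"
      by (intro order_trans[OF nrm_ev_add] add_mono nrm_ev_mult_le_1 plus minus)
    finally show ?thesis by simp
  qed
  have star_lin: "star A (ev e h [:1, \<i>:]) = ev e h [:1, -\<i>:]"
    using h hs by (simp add: ev_linear star_add star_smult)
  \<comment> \<open>Since \<open>h\<close> is self-adjoint, 1 + \<i> X evaluates to an element whose
    adjoint is the value of 1 - \<i> X, and the product of the two is 1 + X^2.\<close>
  have "(?n [:1, \<i>:])\<^sup>2 = ?n ([:1, -\<i>:] * [:1, \<i>:])"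
    by (simp only: cstar_identity[OF ev_closed, symmetric] star_lin ev_mult)
  also have "[:1, -\<i>:] * [:1, \<i>:] = [:1, 0, 1::complex:]" by simp
  finally have "(?n [:1, \<i>:])\<^sup>2 \<le> 1" using sq by simp
  then have i1: "?n [:1, \<i>:] \<le> 1" by (simp add: power_le_one_iff)
  then have i2: "?n [:1, -\<i>:] \<le> 1" by (metis star_lin nrm_star ev_closed)
  have cube: "?n (p * (p * p)) \<le> 1" if "?n p \<le> 1" for p
    using that by (intro nrm_ev_mult_le_1)
  have main: "?n (1 + Polynomial.smult c [:0, 3/2, 0, 1/2:]) \<le> 1"
    if c: "c = 1 \<or> c = -1" and le: "?n [:1, c:] \<le> 1" for c
  proof -
    have "4 * ?n (1 + Polynomial.smult c [:0, 3/2, 0, 1/2:]) = ?n (Polynomial.smult 4 (1 + Polynomial.smult c [:0, 3/2, 0, 1/2:]))"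
      by (simp only: nrm_ev_smult) simp
    also have "Polynomial.smult 4 (1 + Polynomial.smult c [:0, 3/2, 0, 1/2:]) =
      Polynomial.smult 2 ([:1, c:] * ([:1, c:] * [:1, c:])) + ([:1, \<i>:] * ([:1, \<i>:] * [:1, \<i>:]) + [:1, -\<i>:] * ([:1, -\<i>:] * [:1, -\<i>:]))"
      using c by (auto simp: one_pCons)
    also have "?n \<dots> \<le> 2 * 1 + (1 + 1)"
      by (intro order_trans[OF nrm_ev_add] add_mono cube i1 i2)
         (use cube[OF le] in \<open>simp only: nrm_ev_smult norm_numeral\<close>)
    finally show ?thesis by simp
  qed
  have evc: "ev e h (1 + Polynomial.smult c [:0, 3/2, 0, 1/2:]) = e \<oplus> c \<odot> g" for c
    by (simp only: ev_add ev_smult g_def ev1[unfolded one_pCons[symmetric]])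
  show "g \<in> carrier A" "e \<otimes> g = g" by (simp_all add: g_def e_ev)
  have G: "g = (3/2) \<odot> h \<oplus> (1/2) \<odot> (h \<otimes> (h \<otimes> h))"
  proof -
    have "[:0, 3/2, 0, 1/2:] = Polynomial.smult (3/2) [:0, 1:] + Polynomial.smult (1/2) ([:0, 1:] * ([:0, 1:] * [:0, 1::complex:]))" by simp
    then show ?thesis unfolding g_def by (simp only: ev_add ev_smult ev_mult evX)
  qed
  show "star A g = g" using h hs by (simp add: G star_add star_smult star_mult mult_assoc)
  show "nrm A (e \<oplus> g) \<le> 1" using main[of 1] plus \<open>g \<in> carrier A\<close> by (simp only: evc smult_one) simp
  show "nrm A (e \<ominus> g) \<le> 1" using main[of "-1"] minus \<open>g \<in> carrier A\<close> by (simp only: evc minus_smult) simp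
  have neg: "?n (Polynomial.smult (-1) p) = ?n p" for p
    using nrm_ev_smult[of "-1" p] by simp
  \<comment> \<open>4 X is the difference of the squares of 1 + X and 1 - X.\<close>
  have "4 * nrm A h = ?n (Polynomial.smult 4 [:0, 1:])" by (simp only: nrm_ev_smult evX) simp
  also have "Polynomial.smult 4 [:0, 1:] = [:1, 1:] * [:1, 1:] + Polynomial.smult (-1) ([:1, -1:] * [:1, -1::complex:])" by simp
  also have "?n \<dots> \<le> 1 + 1"
    by (intro order_trans[OF nrm_ev_add] add_mono nrm_ev_mult_le_1 plus) (simp only: neg nrm_ev_mult_le_1[OF minus minus])
  finally show half: "nrm A h \<le> 1 / 2" by simp
  \<comment> \<open>With norm at most 1/2, the cubic term costs at most 1/8 of the norm of
    \<open>h\<close>. This leaves the factor 11/8, more than the required 5/4.\<close>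
  have "3/2 * nrm A h = ?n (Polynomial.smult (3/2) [:0, 1:])" by (simp only: nrm_ev_smult evX) (simp add: norm_divide)
  also have "Polynomial.smult (3/2) [:0, 1:] = [:0, 3/2, 0, 1/2:] + Polynomial.smult (-1/2) ([:0, 1:] * ([:0, 1:] * [:0, 1::complex:]))" by simp
  also have "?n \<dots> \<le> nrm A g + 1/2 * (nrm A h * (nrm A h * nrm A h))"
  proof (rule order_trans[OF nrm_ev_add], rule add_mono)
    have "nrm A (h \<otimes> (h \<otimes> h)) \<le> nrm A h * (nrm A h * nrm A h)"
      using h by (intro order_trans[OF nrm_mult] mult_left_mono nrm_mult) auto
    then show "?n (Polynomial.smult (-1/2) ([:0, 1:] * ([:0, 1:] * [:0, 1::complex:]))) \<le> 1/2 * (nrm A h * (nrm A h * nrm A h))"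
      by (simp only: nrm_ev_smult ev_mult evX) (simp add: norm_divide)
  qed (simp add: g_def)
  also have "nrm A h * (nrm A h * nrm A h) \<le> nrm A h * (1/2 * (1/2))"
    using half h by (intro mult_left_mono mult_mono) auto
  finally show "5/4 * nrm A h \<le> nrm A g" using nrm_nonneg[OF h] by simp
qed

end

text \<open>The unit of a corner is an extreme point of the unit ball, here for self-adjoint
  perturbations. By \<open>unit_extreme_step\<close> the norm of \<open>h\<close> could be
  multiplied by 5/4 arbitrarily often while staying at most 1/2.\<close>

lemma unit_extreme:
  assumes e: "projection A e" and h: "h \<in> carrier A" "star A h = h" "e \<otimes> h = h"
    and le: "nrm A (e \<oplus> h) \<le> 1" "nrm A (e \<ominus> h) \<le> 1"
  shows "h = \<zero>"
proof -
  have evh: "ev e h [:1, 1:] = e \<oplus> h" "ev e h [:1, -1:] = e \<ominus> h"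
    if "h \<in> carrier A" "star A h = h" "e \<otimes> h = h" for h
    using that e by (simp_all add: ev_linear smult_one minus_smult)
  have iter: "(5/4) ^ n * nrm A h \<le> 1 / 2"
    if "h \<in> carrier A" "star A h = h" "e \<otimes> h = h" "nrm A (e \<oplus> h) \<le> 1" "nrm A (e \<ominus> h) \<le> 1" for n h
    using that
  proof (induction n arbitrary: h)
    case 0
    then show ?case using unit_extreme_step(3)[OF e] evh by simp
  next
    case (Suc n)
    note step = unit_extreme_step[OF e Suc.prems(1,3,2), unfolded evh[OF Suc.prems(1-3)], OF Suc.prems(4,5)]
    have "(5/4) ^ Suc n * nrm A h = (5/4) ^ n * (5/4 * nrm A h)" by simp
    also have "\<dots> \<le> (5/4) ^ n * nrm A (ev e h [:0, 3/2, 0, 1/2:])" by (intro mult_left_mono step(4)) auto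
    also have "\<dots> \<le> 1/2" by (intro Suc.IH step)
    finally show ?case .
  qed
  have "nrm A h \<le> 0"
  proof (rule ccontr)
    assume "\<not> nrm A h \<le> 0"
    then obtain n where "(1 / 2) / nrm A h < (5/4) ^ n" using real_arch_pow[of "5/4"] by auto
    then show False using iter[OF h(1,2,3) le, of n] \<open>\<not> nrm A h \<le> 0\<close> by (simp add: divide_less_eq)
  qed
  then show ?thesis using nrm_nonneg[OF h(1)] nrm_eq_0[OF h(1)] by simp
qed

lemma diff_eq_0: "\<lbrakk>x \<in> carrier A; y \<in> carrier A; x \<ominus> y = \<zero>\<rbrakk> \<Longrightarrow> x = y"
  by (metis a_minus_def a_inv_closed minus_equality minus_minus)

text \<open>For x = (1 - q) p, the element p - p q p equals both x^* x and p x. Hence |x|^2 = |p x|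
  <= |x|, so |x| <= 1.\<close>

lemma compression_contraction:
  assumes p: "projection A p" and q: "projection A q"
  shows "nrm A (p \<ominus> p \<otimes> q \<otimes> p) \<le> 1"
proof -
  have [simp]: "p \<in> carrier A" "q \<in> carrier A" "star A p = p" "star A q = q" "p \<otimes> p = p" "q \<otimes> q = q"
    using p q unfolding projection_def by blast+
  have qq: "q \<otimes> (q \<otimes> z) = q \<otimes> z" "p \<otimes> (p \<otimes> z) = p \<otimes> z" if "z \<in> carrier A" for z
    using that by (simp_all add: mult_assoc[symmetric])
  define x where "x = p \<ominus> q \<otimes> p"
  have x: "x \<in> carrier A" by (simp add: x_def)
  have px: "p \<otimes> x = p \<ominus> p \<otimes> q \<otimes> p"
    by (simp add: x_def minus_smult mult_r_distr mult_smult_r mult_assoc)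
  have qx: "q \<otimes> x = \<zero>"
    using smult_l_distr[of "q \<otimes> p" 1 "-1"]
    by (simp add: x_def minus_smult mult_r_distr mult_smult_r qq(1) smult_one)
  have "star A x = p \<ominus> p \<otimes> q"
    by (simp add: x_def minus_smult star_add star_smult star_mult)
  then have "star A x \<otimes> x = (p \<ominus> p \<otimes> q) \<otimes> x" by simp
  also have "\<dots> = p \<otimes> x \<ominus> p \<otimes> (q \<otimes> x)"
    using x by (simp add: minus_smult mult_l_distr mult_smult_l mult_assoc)
  also have "\<dots> = p \<otimes> x" using x by (simp add: qx minus_smult)
  finally have "(nrm A x)\<^sup>2 = nrm A (p \<otimes> x)" using cstar_identity[OF x] by simp
  also have "\<dots> \<le> 1 * nrm A x"
    using x by (intro order_trans[OF nrm_mult] mult_right_mono projection_nrm_le p) auto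
  finally have "nrm A x * nrm A x \<le> 1 * nrm A x" by (simp add: power2_eq_square)
  then have "nrm A x \<le> 1" using nrm_nonneg[OF x] by (metis mult_right_le_imp_le not_le order_refl zero_le_one less_eq_real_def)
  then have "(nrm A x)\<^sup>2 \<le> 1" using nrm_nonneg[OF x] by (rule power_le_one[rotated])
  then show ?thesis by (simp only: px \<open>(nrm A x)\<^sup>2 = nrm A (p \<otimes> x)\<close>)
qed

text \<open>
  In a \<open>C\<^sup>*\<close>-algebra not known to act on a Hilbert space this needs an argument: in the corner of
  \<open>q i\<close>, the unit \<open>q i\<close> is a mean of the contractions \<open>q i - q i q j q i\<close>, hence equal to each of them.
\<close>

lemma projections_orthogonal:
  assumes fin: "finite J" and q: "\<And>j. j \<in> J \<Longrightarrow> projection A (q j)"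
    and i: "i \<in> J" and k: "k \<in> J" "k \<noteq> i" and sum: "(\<Oplus>j\<in>J. q j) \<otimes> q i = q i"
  shows "q k \<otimes> q i = \<zero>"
proof -
  have q' [simp]: "q j \<in> carrier A" "star A (q j) = q j" "q j \<otimes> q j = q j" if "j \<in> J" for j
    using q[OF that] unfolding projection_def by blast+
  define e where "e = q i"
  have e: "e \<in> carrier A" "e \<otimes> e = e" "star A e = e" using i by (auto simp: e_def)
  have ee: "e \<otimes> (e \<otimes> z) = e \<otimes> z" if "z \<in> carrier A" for z using e that by (simp add: mult_assoc[symmetric])
  define c where "c j = e \<otimes> q j \<otimes> e" for j
  have c [simp]: "c j \<in> carrier A" "star A (c j) = c j" "e \<otimes> c j = c j" if "j \<in> J" for j
    using that e ee by (auto simp: c_def star_mult mult_assoc)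
  have le1: "nrm A (e \<ominus> c j) \<le> 1" if "j \<in> J" for j
    unfolding c_def e_def by (intro compression_contraction q i that)
  define K where "K = J - {i, k}"
  have K: "finite K" "K \<subseteq> J" "i \<notin> K" "k \<notin> K" "J = insert i (insert k K)" using fin i k by (auto simp: K_def)
  have cK: "c \<in> K \<rightarrow> carrier A" and cK': "\<And>j. j \<in> K \<Longrightarrow> c j \<in> carrier A" using c K by auto
  have eK: "(\<Oplus>j\<in>K. e \<ominus> c j) \<in> carrier A" using cK' e by (intro finsum_closed) auto
  have "(\<Oplus>j\<in>J. c j) = (\<Oplus>j\<in>J. e \<otimes> q j) \<otimes> e"
    using fin e by (subst finsum_mult_right) (auto simp: c_def[abs_def])
  also have "(\<Oplus>j\<in>J. e \<otimes> q j) = e \<otimes> (\<Oplus>j\<in>J. q j)"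
    using fin e by (subst finsum_mult_left) auto
  also have "e \<otimes> (\<Oplus>j\<in>J. q j) \<otimes> e = e"
    using sum e by (simp add: mult_assoc e_def[symmetric])
  finally have "(\<Oplus>j\<in>J. c j) = e" .
  moreover have "(\<Oplus>j\<in>J. c j) = e \<oplus> (c k \<oplus> (\<Oplus>j\<in>K. c j))"
    unfolding K(5) using K k i cK e by (simp add: c_def e_def[symmetric])
  ultimately have "e \<oplus> (c k \<oplus> (\<Oplus>j\<in>K. c j)) = e \<oplus> \<zero>" using e by simp
  then have "\<ominus> e \<oplus> (e \<oplus> (c k \<oplus> (\<Oplus>j\<in>K. c j))) = \<ominus> e \<oplus> (e \<oplus> \<zero>)" by (rule arg_cong)
  \<comment> \<open>The summand at i is e itself, so the remaining compressions add up to
    zero.\<close>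
  then have zero: "c k \<oplus> (\<Oplus>j\<in>K. c j) = \<zero>" using cK c k e by (simp add: r_neg1 l_neg)
  \<comment> \<open>e + c_k / m is the mean of the m contractions e and e - c_j with j in K, while e
    - c_k / m is a convex combination of e and e - c_k. These are the two bounds that
    \<open>unit_extreme\<close> asks for.\<close>
  define m where "m = card K + 1"
  define r where "r = complex_of_real (1 / real m)"
  have m: "real m > 0" by (simp add: m_def)
  then have mr: "of_nat m * r = 1" "cmod r = 1 / real m"
    by (auto simp: r_def norm_divide)
  have csum: "(\<Oplus>j\<in>L. e) = of_nat (card L) \<odot> e" if "finite L" for L :: "'b set"
    using that by (induction L) (use e smult_l_distr[of e 1] in \<open>auto simp: smult_one\<close>)
  have "r \<odot> c k = \<zero>"
  proof (rule unit_extreme)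
    show "projection A e" unfolding e_def by (rule q[OF i])
    show "r \<odot> c k \<in> carrier A" "star A (r \<odot> c k) = r \<odot> c k" "e \<otimes> (r \<odot> c k) = r \<odot> c k"
      using c k e by (auto simp: star_smult mult_smult_r r_def)
    have "e \<oplus> r \<odot> c k = r \<odot> (e \<oplus> (\<Oplus>j\<in>K. e \<ominus> c j))"
    proof -
      have "(\<Oplus>j\<in>K. e \<ominus> c j) \<oplus> (\<Oplus>j\<in>K. c j) = (\<Oplus>j\<in>K. (e \<ominus> c j) \<oplus> c j)"
        using cK cK' e by (intro finsum_addf[symmetric]) auto
      also have "\<dots> = (\<Oplus>j\<in>K. e)"
        using cK' e by (intro finsum_cong') (auto simp: a_minus_def a_assoc l_neg)
      also have "\<dots> = of_nat (card K) \<odot> e" using K by (intro csum)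
      finally have *: "(\<Oplus>j\<in>K. e \<ominus> c j) \<oplus> (\<Oplus>j\<in>K. c j) = of_nat (card K) \<odot> e" .
      have "(\<Oplus>j\<in>K. e \<ominus> c j) = (\<Oplus>j\<in>K. e \<ominus> c j) \<oplus> ((\<Oplus>j\<in>K. c j) \<oplus> c k)"
        using zero cK eK k by (subst a_comm[of _ "c k"]) auto
      also have "\<dots> = of_nat (card K) \<odot> e \<oplus> c k"
        unfolding *[symmetric] using cK eK k by (intro a_assoc[symmetric]) auto
      finally have "e \<oplus> (\<Oplus>j\<in>K. e \<ominus> c j) = of_nat m \<odot> e \<oplus> c k"
        using e k smult_l_distr[of e 1 "of_nat (card K)"] by (simp add: m_def smult_one a_assoc)
      then show ?thesis using e k mr smult_assoc[of e r "of_nat m"] eK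
        by (simp add: smult_r_distr mult.commute smult_one)
    qed
    also have "nrm A \<dots> \<le> cmod r * (1 + (\<Sum>j\<in>K. 1))"
    proof -
      have "nrm A (\<Oplus>j\<in>K. e \<ominus> c j) \<le> (\<Sum>j\<in>K. 1)"
        using K cK e by (intro order_trans[OF nrm_finsum_le] sum_mono le1) auto
      moreover have "nrm A e \<le> 1" unfolding e_def by (intro projection_nrm_le q i)
      ultimately have "nrm A (e \<oplus> (\<Oplus>j\<in>K. e \<ominus> c j)) \<le> 1 + (\<Sum>j\<in>K. 1)"
        using cK e by (intro order_trans[OF nrm_triangle] add_mono) (auto simp: Pi_iff)
      then show ?thesis using cK e by (subst nrm_smult) (auto simp: Pi_iff intro!: mult_left_mono)
    qed
    also have "\<dots> = 1" using m by (simp add: mr m_def)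
    finally show "nrm A (e \<oplus> r \<odot> c k) \<le> 1" .
    have "e \<ominus> r \<odot> c k = (1 - r) \<odot> e \<oplus> r \<odot> (e \<ominus> c k)"
    proof -
      have "(1 - r) \<odot> e \<oplus> r \<odot> (e \<ominus> c k) = ((1 - r) \<odot> e \<oplus> r \<odot> e) \<oplus> (- r) \<odot> c k"
        using e k smult_assoc[of "c k" r "-1"] by (simp add: minus_smult smult_r_distr a_assoc)
      also have "(1 - r) \<odot> e \<oplus> r \<odot> e = e" using smult_l_distr[of e "1 - r" r] e by (simp add: smult_one)
      finally show ?thesis using e k smult_assoc[of "c k" "-1" r] by (simp add: minus_smult)
    qed
    also have "nrm A \<dots> \<le> cmod (1 - r) * 1 + cmod r * 1"
    proof -
      have "nrm A e \<le> 1" unfolding e_def by (intro projection_nrm_le q i)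
      then show ?thesis using e k le1[of k]
        by (intro order_trans[OF nrm_triangle] add_mono) (auto simp: nrm_smult intro!: mult_left_le)
    qed
    also have "cmod (1 - r) = 1 - 1 / real m"
    proof -
      have "1 - r = complex_of_real (1 - 1 / real m)" by (simp add: r_def)
      then show ?thesis using m by (simp only: norm_of_real) (simp add: m_def)
    qed
    finally show "nrm A (e \<ominus> r \<odot> c k) \<le> 1" by (simp add: mr)
  qed
  then have "c k = \<zero>" using smult_assoc[of "c k" "of_nat m" r] k mr by (simp add: smult_one)
  \<comment> \<open>The compression vanishes as the square of q_k e, and the C*-identity passes from
    the square to q_k e.\<close>
  moreover have "c k = star A (q k \<otimes> e) \<otimes> (q k \<otimes> e)"
    using k e mult_assoc[of "q k" "q k" e, symmetric] by (simp add: c_def star_mult mult_assoc)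
  ultimately have "(nrm A (q k \<otimes> e))\<^sup>2 = 0" using cstar_identity[of "q k \<otimes> e"] k e by simp
  then show ?thesis using k e nrm_eq_0[of "q k \<otimes> e"] by (simp add: e_def)
qed

section \<open>Linear spans and iterated squares\<close>

inductive_set lin :: "'a set \<Rightarrow> 'a set" for G where
  lin_zero: "\<zero> \<in> lin G"
| lin_step: "\<lbrakk>g \<in> G; y \<in> lin G\<rbrakk> \<Longrightarrow> c \<odot> g \<oplus> y \<in> lin G"

lemma lin_closed: "\<lbrakk>G \<subseteq> carrier A; x \<in> lin G\<rbrakk> \<Longrightarrow> x \<in> carrier A"
  by (rotate_tac, induction rule: lin.induct) auto

lemma lin_base: "\<lbrakk>G \<subseteq> carrier A; g \<in> G\<rbrakk> \<Longrightarrow> g \<in> lin G"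
  using lin_step[OF _ lin_zero, of g G 1] by (auto simp: smult_one)

lemma lin_add:
  assumes G: "G \<subseteq> carrier A" and x: "x \<in> lin G" and y: "y \<in> lin G" shows "x \<oplus> y \<in> lin G"
  using x
proof (induction rule: lin.induct)
  case lin_zero
  then show ?case using lin_closed[OF G y] y by simp
next
  case (lin_step g z c)
  have "c \<odot> g \<oplus> z \<oplus> y = c \<odot> g \<oplus> (z \<oplus> y)"
    using lin_step G lin_closed[OF G] y by (intro a_assoc) auto
  then show ?case using lin.lin_step[OF lin_step(1,3)] by simp
qed

lemma lin_smult:
  assumes G: "G \<subseteq> carrier A" and x: "x \<in> lin G" shows "c \<odot> x \<in> lin G"
  using x
proof (induction rule: lin.induct)
  case (lin_step g z d)
  have "c \<odot> (d \<odot> g \<oplus> z) = (c * d) \<odot> g \<oplus> c \<odot> z"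
    using lin_step G lin_closed[OF G] by (auto simp: smult_r_distr smult_assoc)
  then show ?case using lin.lin_step[OF lin_step(1,3)] by simp
qed (simp add: lin.lin_zero)

lemma lin_finsum:
  assumes "G \<subseteq> carrier A" "finite I" "\<And>i. i \<in> I \<Longrightarrow> f i \<in> lin G"
  shows "(\<Oplus>i\<in>I. f i) \<in> lin G"
  using assms(2,3)
proof (induction I)
  case (insert i I)
  then have "f \<in> insert i I \<rightarrow> carrier A" using lin_closed[OF assms(1)] by auto
  then show ?case using insert by (simp add: lin_add[OF assms(1)] Pi_iff)
qed (simp add: lin_zero)

text \<open>Scaling is only asked for up to some scalar d that may differ from c. This admits
  conjugate-linear maps such as \<open>star A\<close> along with left and right
  multiplications.\<close>

lemma lin_map:
  assumes G: "G \<subseteq> carrier A" and K: "K \<subseteq> carrier A" and x: "x \<in> lin G"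
    and add: "\<And>y z. \<lbrakk>y \<in> carrier A; z \<in> carrier A\<rbrakk> \<Longrightarrow> f (y \<oplus> z) = f y \<oplus> f z"
    and scale: "\<And>c y. y \<in> carrier A \<Longrightarrow> \<exists>d. f (c \<odot> y) = d \<odot> f y"
    and closed: "\<And>y. y \<in> carrier A \<Longrightarrow> f y \<in> carrier A"
    and gen: "\<And>g. g \<in> G \<Longrightarrow> f g \<in> lin K"
  shows "f x \<in> lin K"
  using x
proof (induction rule: lin.induct)
  case lin_zero
  have "f \<zero> = \<zero>" using scale[of \<zero> 0] add[of \<zero> \<zero>] closed[of \<zero>]
    by (simp add: add.r_cancel_one')
  then show ?case by (simp add: lin.lin_zero)
next
  case (lin_step g z c)
  obtain d where d: "f (c \<odot> g) = d \<odot> f g" using scale[of g c] lin_step(1) G by auto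
  have "f (c \<odot> g \<oplus> z) = d \<odot> f g \<oplus> f z"
    using lin_step G lin_closed[OF G, of z] by (subst add) (auto simp: d)
  then show ?case using lin_add[OF K lin_smult[OF K gen[OF lin_step(1)]] lin_step(3)] by simp
qed

lemma lin_mono:
  assumes "G \<subseteq> carrier A" "K \<subseteq> carrier A" "x \<in> lin G" "\<And>g. g \<in> G \<Longrightarrow> g \<in> lin K"
  shows "x \<in> lin K"
  using lin_map[where f="\<lambda>x. x", OF assms(1-3)] assms(4) by blast

lemma lin_star:
  assumes "G \<subseteq> carrier A" "K \<subseteq> carrier A" "x \<in> lin G" "\<And>g. g \<in> G \<Longrightarrow> star A g \<in> lin K"
  shows "star A x \<in> lin K"
  by (rule lin_map[OF assms(1-3)]) (use star_smult in \<open>auto simp: star_add assms(4)\<close>)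

lemma lin_mult:
  assumes G: "G \<subseteq> carrier A" and G': "G' \<subseteq> carrier A" and K: "K \<subseteq> carrier A"
    and x: "x \<in> lin G" and y: "y \<in> lin G'" and gen: "\<And>g h. \<lbrakk>g \<in> G; h \<in> G'\<rbrakk> \<Longrightarrow> g \<otimes> h \<in> lin K"
  shows "x \<otimes> y \<in> lin K"
proof (rule lin_map[OF G K x, where f="\<lambda>x. x \<otimes> y"])
  have yc: "y \<in> carrier A" by (rule lin_closed[OF G' y])
  fix g assume g: "g \<in> G"
  then have gc: "g \<in> carrier A" using G by blast
  show "g \<otimes> y \<in> lin K"
  proof (rule lin_map[OF G' K y])
    show "\<exists>d. g \<otimes> (c \<odot> z) = d \<odot> (g \<otimes> z)" if "z \<in> carrier A" for c z
      using mult_smult_r[OF gc that] by blast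
  qed (simp_all add: gc mult_r_distr gen[OF g])
next
  have y: "y \<in> carrier A" by (rule lin_closed[OF G' y])
  show "\<exists>d. (c \<odot> z) \<otimes> y = d \<odot> (z \<otimes> y)" if "z \<in> carrier A" for c z
    using mult_smult_l[OF that y] by blast
qed (simp_all add: lin_closed[OF G' y] mult_l_distr)

text \<open>Each new term is absorbed into the summand of one index whose set contains its
  generator. The sets may overlap, and the decomposition is not claimed to be unique.\<close>

lemma lin_Union:
  assumes G: "\<And>d. d \<in> S \<Longrightarrow> G d \<subseteq> carrier A" and S: "finite S" and x: "x \<in> lin (\<Union>d\<in>S. G d)"
  shows "\<exists>f. (\<forall>d\<in>S. f d \<in> lin (G d)) \<and> x = (\<Oplus>d\<in>S. f d)"
  using x
proof (induction rule: lin.induct)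
  case lin_zero
  then show ?case by (intro exI[of _ "\<lambda>d. \<zero>"]) (auto simp: lin.lin_zero)
next
  case (lin_step g y c)
  then obtain f d where f: "\<forall>d\<in>S. f d \<in> lin (G d)" "y = (\<Oplus>d\<in>S. f d)" and d: "d \<in> S" "g \<in> G d" by auto
  have fc: "f d \<in> carrier A" if "d \<in> S" for d using f that G lin_closed by blast
  have gc: "g \<in> carrier A" using d G by blast
  define f' where "f' = f(d := c \<odot> g \<oplus> f d)"
  have S': "S = insert d (S - {d})" using d by auto
  have "(\<Oplus>d\<in>S. f' d) = c \<odot> g \<oplus> f d \<oplus> (\<Oplus>d\<in>S - {d}. f' d)"
    by (subst S', subst finsum_insert) (use S fc gc d in \<open>auto simp: f'_def\<close>)
  also have "(\<Oplus>d\<in>S - {d}. f' d) = (\<Oplus>d\<in>S - {d}. f d)"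
    by (rule finsum_cong') (use fc in \<open>auto simp: f'_def\<close>)
  also have "c \<odot> g \<oplus> f d \<oplus> (\<Oplus>d\<in>S - {d}. f d) = c \<odot> g \<oplus> (f d \<oplus> (\<Oplus>d\<in>S - {d}. f d))"
    using fc gc d by (intro a_assoc) (auto intro!: finsum_closed)
  also have "f d \<oplus> (\<Oplus>d\<in>S - {d}. f d) = y"
    unfolding f(2) by (subst (2) S', subst finsum_insert) (use S fc d in auto)
  finally have "c \<odot> g \<oplus> y = (\<Oplus>d\<in>S. f' d)" by simp
  moreover have "\<forall>d\<in>S. f' d \<in> lin (G d)"
    using f(1) d lin.lin_step[of g "G d" "f d" c] by (simp add: f'_def)
  ultimately show ?case by blast
qed

text \<open>The power h^(2^j). Squaring keeps a self-adjoint element self-adjoint, so the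
  C*-identity computes the norm of each of these powers.\<close>

definition sqi :: "nat \<Rightarrow> 'a \<Rightarrow> 'a" where
  "sqi j h = ((\<lambda>x. x \<otimes> x) ^^ j) h"

lemma sqi_simps [simp]: "sqi 0 h = h" "sqi (Suc j) h = sqi j h \<otimes> sqi j h"
  by (simp_all add: sqi_def)

lemma sqi_self_adjoint: "\<lbrakk>h \<in> carrier A; star A h = h\<rbrakk> \<Longrightarrow> sqi j h \<in> carrier A \<and> star A (sqi j h) = sqi j h"
  by (induction j) (auto simp: star_mult)

lemma nrm_sqi:
  assumes "h \<in> carrier A" "star A h = h" shows "nrm A (sqi j h) = nrm A h ^ (2 ^ j)"
proof (induction j)
  case (Suc j)
  have "nrm A (sqi (Suc j) h) = (nrm A (sqi j h))\<^sup>2"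
    using sqi_self_adjoint[OF assms, of j] cstar_identity[of "sqi j h"] by simp
  then show ?case using Suc by (simp add: power_mult[symmetric] mult.commute)
qed simp

lemma sqi_invariant: "\<lbrakk>h \<in> P; \<And>x y. \<lbrakk>x \<in> P; y \<in> P\<rbrakk> \<Longrightarrow> x \<otimes> y \<in> P\<rbrakk> \<Longrightarrow> sqi j h \<in> P"
  by (induction j) auto

end

section \<open>Paths in a higher-rank graph\<close>

context k_graph begin

abbreviation kcomp (infixr "\<diamondop>" 75) where "\<mu> \<diamondop> \<nu> \<equiv> cmp \<Lambda> \<mu> \<nu>"

declare rng_closed [simp] src_closed [simp] rng_rng [simp] src_rng [simp] rng_src [simp] src_src [simp]
  cmp_closed [simp] rng_cmp [simp] src_cmp [simp] cmp_rng [simp] cmp_src [simp] deg_ident [simp] deg_cmp [simp]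

lemma factor_unique:
  assumes "\<mu> \<in> mor \<Lambda>" "\<nu> \<in> mor \<Lambda>" "src \<Lambda> \<mu> = rng \<Lambda> \<nu>"
    and "\<mu>' \<in> mor \<Lambda>" "\<nu>' \<in> mor \<Lambda>" "src \<Lambda> \<mu>' = rng \<Lambda> \<nu>'"
    and eq: "\<mu> \<diamondop> \<nu> = \<mu>' \<diamondop> \<nu>'" and deg: "deg \<Lambda> \<mu> = deg \<Lambda> \<mu>'"
  shows "\<mu> = \<mu>'" "\<nu> = \<nu>'"
proof -
  have "deg \<Lambda> \<mu> + deg \<Lambda> \<nu> = deg \<Lambda> \<mu>' + deg \<Lambda> \<nu>'"
    using assms deg_cmp[of \<mu> \<nu>] deg_cmp[of \<mu>' \<nu>'] by simp
  then have "deg \<Lambda> \<nu> = deg \<Lambda> \<nu>'" using deg by simp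
  then have "(\<mu>, \<nu>) = (\<mu>', \<nu>')"
    using factorization[of "\<mu> \<diamondop> \<nu>" "deg \<Lambda> \<mu>" "deg \<Lambda> \<nu>"] assms by (auto simp: Ex1_def)
  then show "\<mu> = \<mu>'" "\<nu> = \<nu>'" by auto
qed

lemma factorE:
  assumes "\<kappa> \<in> mor \<Lambda>" "m \<le> deg \<Lambda> \<kappa>"
  obtains \<mu> \<nu> where "\<mu> \<in> mor \<Lambda>" "\<nu> \<in> mor \<Lambda>" "src \<Lambda> \<mu> = rng \<Lambda> \<nu>" "\<mu> \<diamondop> \<nu> = \<kappa>"
    "deg \<Lambda> \<mu> = m" "deg \<Lambda> \<nu> = deg \<Lambda> \<kappa> - m"
proof -
  have "deg \<Lambda> \<kappa> = m + (deg \<Lambda> \<kappa> - m)"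
    using assms(2) by (simp add: vec_eq_iff less_eq_vec_def)
  from factorization[OF assms(1) this] that show ?thesis by auto
qed

lemma middle_unique:
  assumes "u \<in> mor \<Lambda>" "y \<in> mor \<Lambda>" "w \<in> mor \<Lambda>" "src \<Lambda> u = rng \<Lambda> y" "src \<Lambda> y = rng \<Lambda> w"
    and "u' \<in> mor \<Lambda>" "y' \<in> mor \<Lambda>" "w' \<in> mor \<Lambda>" "src \<Lambda> u' = rng \<Lambda> y'" "src \<Lambda> y' = rng \<Lambda> w'"
    and eq: "u \<diamondop> y \<diamondop> w = u' \<diamondop> y' \<diamondop> w'" and deg: "deg \<Lambda> u = deg \<Lambda> u'" "deg \<Lambda> y = deg \<Lambda> y'"
  shows "y = y'"
proof -
  have "y \<diamondop> w = y' \<diamondop> w'"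
    by (rule factor_unique(2)[of u "y \<diamondop> w" u' "y' \<diamondop> w'"]) (use assms in auto)
  then show ?thesis
    by (rule factor_unique(1)[of y w y' w', rotated 6]) (use assms in auto)
qed

text \<open>r(\<mu>) \<mu> and \<mu> s(\<mu>) are two factorizations of \<mu> with the same degrees,
  so their first factors agree.\<close>

lemma deg_0_vertex:
  assumes \<mu>: "\<mu> \<in> mor \<Lambda>" "deg \<Lambda> \<mu> = 0" shows "rng \<Lambda> \<mu> = \<mu>"
  by (rule factor_unique(1)[of "rng \<Lambda> \<mu>" \<mu> \<mu> "src \<Lambda> \<mu>"]) (use assms in auto)

lemma vertices_iff: "v \<in> vertices \<Lambda> \<longleftrightarrow> v \<in> mor \<Lambda> \<and> deg \<Lambda> v = 0"
  using deg_0_vertex[of v] deg_ident(1)[of v] unfolding vertices_def by (metis (mono_tags, lifting) mem_Collect_eq)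

lemma vertices_paths: "vertices \<Lambda> = paths \<Lambda> 0"
  by (auto simp: vertices_iff paths_def)

lemma rng_vertex [simp]: "\<mu> \<in> mor \<Lambda> \<Longrightarrow> rng \<Lambda> \<mu> \<in> vertices \<Lambda>"
  and src_vertex [simp]: "\<mu> \<in> mor \<Lambda> \<Longrightarrow> src \<Lambda> \<mu> \<in> vertices \<Lambda>"
  by (simp_all add: vertices_def)

lemma vertexD [simp]: "v \<in> vertices \<Lambda> \<Longrightarrow> rng \<Lambda> v = v" "v \<in> vertices \<Lambda> \<Longrightarrow> src \<Lambda> v = v"
  "v \<in> vertices \<Lambda> \<Longrightarrow> v \<in> mor \<Lambda>"
  using src_rng[of v] by (simp_all add: vertices_def)

lemma infinite_pathD:
  assumes x: "x \<in> infinite_paths \<Lambda>"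
  shows "p \<le> q \<Longrightarrow> x (p, q) \<in> mor \<Lambda>" "p \<le> q \<Longrightarrow> deg \<Lambda> (x (p, q)) = q - p"
    "p \<le> q \<Longrightarrow> rng \<Lambda> (x (p, q)) = x (p, p)" "p \<le> q \<Longrightarrow> src \<Lambda> (x (p, q)) = x (q, q)"
    "\<lbrakk>p \<le> q; q \<le> m\<rbrakk> \<Longrightarrow> x (p, m) = x (p, q) \<diamondop> x (q, m)"
proof -
  have Om: "(p, q) \<in> mor Omega \<longleftrightarrow> p \<le> q" "rng Omega (p, q) = (p, p)" "src Omega (p, q) = (q, q)"
    "deg Omega (p, q) = q - p" "cmp Omega (p, q) (q, m) = (p, m)" for p q m :: "nat ^ 'k"
    by (simp_all add: Omega_def)
  have m: "kgraph_morphism Omega \<Lambda> x" using x by (simp add: infinite_paths_def)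
  have *: "x \<mu> \<in> mor \<Lambda> \<and> rng \<Lambda> (x \<mu>) = x (rng Omega \<mu>) \<and> src \<Lambda> (x \<mu>) = x (src Omega \<mu>) \<and> deg \<Lambda> (x \<mu>) = deg Omega \<mu>"
    if "\<mu> \<in> mor Omega" for \<mu>
    by (rule m[unfolded kgraph_morphism_def, THEN conjunct1, rule_format, OF that])
  have **: "x (cmp Omega \<mu> \<nu>) = x \<mu> \<diamondop> x \<nu>"
    if "\<mu> \<in> mor Omega" "\<nu> \<in> mor Omega" "src Omega \<mu> = rng Omega \<nu>" for \<mu> \<nu>
    by (rule m[unfolded kgraph_morphism_def, THEN conjunct2, rule_format, OF that])
  show "p \<le> q \<Longrightarrow> x (p, q) \<in> mor \<Lambda>" "p \<le> q \<Longrightarrow> deg \<Lambda> (x (p, q)) = q - p"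
    "p \<le> q \<Longrightarrow> rng \<Lambda> (x (p, q)) = x (p, p)" "p \<le> q \<Longrightarrow> src \<Lambda> (x (p, q)) = x (q, q)"
    using *[of "(p, q)"] unfolding Om by blast+
  show "\<lbrakk>p \<le> q; q \<le> m\<rbrakk> \<Longrightarrow> x (p, m) = x (p, q) \<diamondop> x (q, m)"
    using **[of "(p, q)" "(q, m)"] unfolding Om by blast
qed

text \<open>
  A long initial segment \<open>\<lambda>\<close> of an aperiodic path: in a common extension of \<open>\<beta> \<lambda>\<close> and \<open>\<nu> \<lambda>\<close> with \<open>d(\<beta>) = p\<close>,
  \<open>d(\<nu>) = q\<close>, the segment of degree \<open>b - a\<close> at position \<open>a + p + q\<close> would be both \<open>x(a + q, b + q)\<close> and
  \<open>x(a + p, b + p)\<close>.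
\<close>

lemma aperiodic_segment:
  assumes ap: "aperiodic \<Lambda>" and v: "v \<in> vertices \<Lambda>" and P: "finite P" "\<forall>z\<in>P. fst z \<noteq> snd z"
  shows "\<exists>\<kappa>\<in>mor \<Lambda>. rng \<Lambda> \<kappa> = v \<and> (\<forall>\<beta>\<in>mor \<Lambda>. \<forall>\<nu>\<in>mor \<Lambda>. \<forall>\<rho>\<in>mor \<Lambda>. \<forall>\<rho>'\<in>mor \<Lambda>.
    (deg \<Lambda> \<beta>, deg \<Lambda> \<nu>) \<in> P \<longrightarrow> src \<Lambda> \<beta> = v \<longrightarrow> src \<Lambda> \<nu> = v \<longrightarrow> rng \<Lambda> \<rho> = src \<Lambda> \<kappa> \<longrightarrow> rng \<Lambda> \<rho>' = src \<Lambda> \<kappa> \<longrightarrow>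
    (\<beta> \<diamondop> \<kappa>) \<diamondop> \<rho> \<noteq> (\<nu> \<diamondop> \<kappa>) \<diamondop> \<rho>')"
proof -
  obtain x where "x \<in> cylinder \<Lambda> v" and "\<forall>m n. m \<noteq> n \<longrightarrow> shift m x \<noteq> shift n x"
    using bspec[OF ap[unfolded aperiodic_def] v] by (rule bexE)
  then have x: "x \<in> infinite_paths \<Lambda>" "x (0, deg \<Lambda> v) = v"
    and sh: "\<And>m n. m \<noteq> n \<Longrightarrow> shift m x \<noteq> shift n x"
    unfolding cylinder_def by simp_all
  have x0: "x (0, 0) = v" using x v by (simp add: vertices_iff)
  note xD = infinite_pathD[OF x(1)]
  have "\<exists>ab. fst ab \<le> snd ab \<and> x (fst ab + p, snd ab + p) \<noteq> x (fst ab + q, snd ab + q)" if "p \<noteq> q" for p q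
  proof -
    obtain z where z: "shift p x z \<noteq> shift q x z" using sh[OF \<open>p \<noteq> q\<close>] by blast
    then have "z \<in> mor Omega" by (intro ccontr[of "z \<in> mor Omega"]) (simp add: shift_def)
    with z show ?thesis by (intro exI[of _ z]) (auto simp: shift_def Omega_def case_prod_unfold)
  qed
  then obtain ab where ab: "\<And>p q. p \<noteq> q \<Longrightarrow> fst (ab p q) \<le> snd (ab p q)"
      "\<And>p q. p \<noteq> q \<Longrightarrow> x (fst (ab p q) + p, snd (ab p q) + p) \<noteq> x (fst (ab p q) + q, snd (ab p q) + q)"
    by metis
  \<comment> \<open>Componentwise above b + p + q for every (p, q) in P, b being the end of the
    segment chosen for the pair. Both of the segments that tell the two shifts apart therefore lie
    inside \<kappa>.\<close>
  define L where "L = (\<Sum>(p, q)\<in>P. snd (ab p q) + p + q)"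
  define \<kappa> where "\<kappa> = x (0, L)"
  have L0: "0 \<le> n" for n :: "nat ^ 'k" by (simp add: less_eq_vec_def)
  have \<kappa>: "\<kappa> \<in> mor \<Lambda>" "rng \<Lambda> \<kappa> = v" "src \<Lambda> \<kappa> = x (L, L)" 
    unfolding \<kappa>_def using xD(1,3,4)[OF L0[of L]] x0 by simp_all
  have "False"
    if m: "\<beta> \<in> mor \<Lambda>" "\<nu> \<in> mor \<Lambda>" "\<rho> \<in> mor \<Lambda>" "\<rho>' \<in> mor \<Lambda>" and inP: "(deg \<Lambda> \<beta>, deg \<Lambda> \<nu>) \<in> P"
      and s: "src \<Lambda> \<beta> = v" "src \<Lambda> \<nu> = v" "rng \<Lambda> \<rho> = src \<Lambda> \<kappa>" "rng \<Lambda> \<rho>' = src \<Lambda> \<kappa>"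
      and eq: "(\<beta> \<diamondop> \<kappa>) \<diamondop> \<rho> = (\<nu> \<diamondop> \<kappa>) \<diamondop> \<rho>'" for \<beta> \<nu> \<rho> \<rho>'
  proof -
    define p q where "p = deg \<Lambda> \<beta>" and "q = deg \<Lambda> \<nu>"
    have pq: "p \<noteq> q" using bspec[OF P(2) inP] by (simp add: p_def q_def)
    define a b where "a = fst (ab p q)" and "b = snd (ab p q)"
    have ab': "a \<le> b" "x (a + p, b + p) \<noteq> x (a + q, b + q)" using ab[OF pq] by (auto simp: a_def b_def)
    have "b + p + q \<le> L"
      unfolding L_def less_eq_vec_def
    proof
      fix i
      have "(b + p + q) $ i = (\<lambda>(p, q). (snd (ab p q) + p + q) $ i) (p, q)" by (simp add: b_def)
      also have "\<dots> \<le> (\<Sum>z\<in>P. (\<lambda>(p, q). (snd (ab p q) + p + q) $ i) z)"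
        by (rule member_le_sum) (use inP P(1) in \<open>auto simp: p_def q_def\<close>)
      finally show "(b + p + q) $ i \<le> (\<Sum>(p, q)\<in>P. snd (ab p q) + p + q) $ i"
        by (simp add: sum_component case_prod_unfold)
    qed
    then have le: "a + p \<le> b + p" "b + p \<le> L" "a + q \<le> b + q" "b + q \<le> L" "0 \<le> a + p" "0 \<le> a + q"
    proof -
      have c: "b $ i + p $ i + q $ i \<le> L $ i" "a $ i \<le> b $ i" for i
        using \<open>b + p + q \<le> L\<close> ab'(1) by (simp_all add: less_eq_vec_def)
      show "a + p \<le> b + p" "a + q \<le> b + q" "0 \<le> a + p" "0 \<le> a + q"
        using c by (simp_all add: less_eq_vec_def)
      have "b $ i + p $ i \<le> L $ i" "b $ i + q $ i \<le> L $ i" for i using c(1)[of i] by linarith+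
      then show "b + p \<le> L" "b + q \<le> L" by (simp_all add: less_eq_vec_def)
    qed
    have split: "(\<mu> \<diamondop> \<kappa>) \<diamondop> \<sigma> = (\<mu> \<diamondop> x (0, a + n)) \<diamondop> (x (a + n, b + n) \<diamondop> (x (b + n, L) \<diamondop> \<sigma>))"
      "src \<Lambda> (\<mu> \<diamondop> x (0, a + n)) = rng \<Lambda> (x (a + n, b + n))"
      "src \<Lambda> (x (a + n, b + n)) = rng \<Lambda> (x (b + n, L) \<diamondop> \<sigma>)"
      "\<mu> \<diamondop> x (0, a + n) \<in> mor \<Lambda>" "x (a + n, b + n) \<in> mor \<Lambda>" "x (b + n, L) \<diamondop> \<sigma> \<in> mor \<Lambda>"
      "deg \<Lambda> (\<mu> \<diamondop> x (0, a + n)) = deg \<Lambda> \<mu> + a + n" "deg \<Lambda> (x (a + n, b + n)) = b - a"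
      if "a + n \<le> b + n" "b + n \<le> L" "\<mu> \<in> mor \<Lambda>" "\<sigma> \<in> mor \<Lambda>" "src \<Lambda> \<mu> = v" "rng \<Lambda> \<sigma> = src \<Lambda> \<kappa>" for \<mu> \<sigma> n
    proof -
      have anL: "a + n \<le> L" using that by (meson order_trans)
      have "\<kappa> = x (0, a + n) \<diamondop> (x (a + n, b + n) \<diamondop> x (b + n, L))"
        unfolding \<kappa>_def using xD(5)[OF L0 anL] xD(5)[OF that(1,2)] by simp
      then show "(\<mu> \<diamondop> \<kappa>) \<diamondop> \<sigma> = (\<mu> \<diamondop> x (0, a + n)) \<diamondop> (x (a + n, b + n) \<diamondop> (x (b + n, L) \<diamondop> \<sigma>))"
        using that xD(1,3,4)[OF L0, of "a + n"] xD(1,3,4)[OF that(1)] xD(1,3,4)[OF that(2)] x0 \<kappa>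
        by (simp add: cmp_assoc)
      show "src \<Lambda> (\<mu> \<diamondop> x (0, a + n)) = rng \<Lambda> (x (a + n, b + n))"
        "src \<Lambda> (x (a + n, b + n)) = rng \<Lambda> (x (b + n, L) \<diamondop> \<sigma>)"
        "\<mu> \<diamondop> x (0, a + n) \<in> mor \<Lambda>" "x (a + n, b + n) \<in> mor \<Lambda>" "x (b + n, L) \<diamondop> \<sigma> \<in> mor \<Lambda>"
        "deg \<Lambda> (\<mu> \<diamondop> x (0, a + n)) = deg \<Lambda> \<mu> + a + n"
        using that xD(1-4)[OF L0, of "a + n"] xD(1,3,4)[OF that(1)] xD(1,3,4)[OF that(2)] x0 \<kappa>
        by (simp_all add: add.assoc)
      show "deg \<Lambda> (x (a + n, b + n)) = b - a"
        using xD(2)[OF that(1)] by (simp add: vec_eq_iff)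
    qed
    note s1 = split[OF le(3,4) m(1,3) s(1,3)] and s2 = split[OF le(1,2) m(2,4) s(2,4)]
    have "x (a + q, b + q) = x (a + p, b + p)"
      by (rule middle_unique[OF s1(4-6,2,3) s2(4-6,2,3)])
         (use s1 s2 eq in \<open>simp_all add: p_def q_def ac_simps\<close>)
    then show False using ab'(2) by simp
  qed
  then show ?thesis using \<kappa> by (intro bexI[of _ \<kappa>]) blast+
qed

end

section \<open>Cuntz--Krieger families\<close>

text \<open>The difference of the degrees of the two legs of s_mu s_nu^* may have negative entries,
  hence the passage to integer vectors.\<close>

definition zdeg :: "nat ^ 'k::finite \<Rightarrow> int ^ 'k" where "zdeg n = (\<chi> i. int (n $ i))"

lemma zdeg_add [simp]: "zdeg (m + n) = zdeg m + zdeg n"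
  by (simp add: zdeg_def vec_eq_iff)

lemma zdeg_inj [simp]: "zdeg m = zdeg n \<longleftrightarrow> m = n"
  by (simp add: zdeg_def vec_eq_iff)

lemma CK_familyD:
  assumes "CK_family \<Lambda> A t"
  shows "\<forall>\<mu>\<in>mor \<Lambda>. partial_isometry A (t \<mu>)" "\<forall>v\<in>vertices \<Lambda>. projection A (t v)"
    "\<forall>v\<in>vertices \<Lambda>. \<forall>w\<in>vertices \<Lambda>. v \<noteq> w \<longrightarrow> t v \<otimes>\<^bsub>A\<^esub> t w = \<zero>\<^bsub>A\<^esub>"
    "\<forall>\<mu>\<in>mor \<Lambda>. \<forall>\<nu>\<in>mor \<Lambda>. src \<Lambda> \<mu> = rng \<Lambda> \<nu> \<longrightarrow> t \<mu> \<otimes>\<^bsub>A\<^esub> t \<nu> = t (cmp \<Lambda> \<mu> \<nu>)"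
    "\<forall>\<mu>\<in>mor \<Lambda>. star A (t \<mu>) \<otimes>\<^bsub>A\<^esub> t \<mu> = t (src \<Lambda> \<mu>)"
    "\<forall>v\<in>vertices \<Lambda>. \<forall>n. t v = (\<Oplus>\<^bsub>A\<^esub>\<mu>\<in>paths_to \<Lambda> v n. t \<mu> \<otimes>\<^bsub>A\<^esub> star A (t \<mu>))"
  using assms unfolding CK_family_def by - (elim conjE, assumption)+

locale CK_rep = k_graph \<Lambda> + cstar_algebra A
  for \<Lambda> :: "('p, 'k::finite) kgraph" and A :: "'a cstar" (structure) +
  fixes s :: "'p \<Rightarrow> 'a"
  assumes fin: "finite_kgraph \<Lambda>" and CK: "CK_family \<Lambda> A s"
begin

lemma finite_paths [simp]: "finite (paths \<Lambda> n)"
  using fin by (simp add: finite_kgraph_def)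

lemma finite_paths_to [simp]: "finite (paths_to \<Lambda> v n)"
  by (simp add: paths_to_def)

lemma s_closed [simp]: "\<mu> \<in> mor \<Lambda> \<Longrightarrow> s \<mu> \<in> carrier A"
  using bspec[OF CK_familyD(1)[OF CK]] by (simp add: partial_isometry_def)

lemma s_comp: "\<lbrakk>\<mu> \<in> mor \<Lambda>; \<nu> \<in> mor \<Lambda>; src \<Lambda> \<mu> = rng \<Lambda> \<nu>\<rbrakk> \<Longrightarrow> s (\<mu> \<diamondop> \<nu>) = s \<mu> \<otimes> s \<nu>"
  by (rule CK_familyD(4)[OF CK, rule_format, symmetric])

lemma star_s_s: "\<mu> \<in> mor \<Lambda> \<Longrightarrow> star A (s \<mu>) \<otimes> s \<mu> = s (src \<Lambda> \<mu>)"
  by (rule CK_familyD(5)[OF CK, rule_format])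

lemma s_vertex: "v \<in> vertices \<Lambda> \<Longrightarrow> projection A (s v)"
  by (rule CK_familyD(2)[OF CK, rule_format])

lemma s_vertex_sum: "v \<in> vertices \<Lambda> \<Longrightarrow> s v = (\<Oplus>\<mu>\<in>paths_to \<Lambda> v n. s \<mu> \<otimes> star A (s \<mu>))"
  by (rule CK_familyD(6)[OF CK, rule_format])

lemma s_vertex_orth: "\<lbrakk>v \<in> vertices \<Lambda>; w \<in> vertices \<Lambda>; v \<noteq> w\<rbrakk> \<Longrightarrow> s v \<otimes> s w = \<zero>"
  by (rule CK_familyD(3)[OF CK, rule_format])

lemma star_s_vertex [simp]: "v \<in> vertices \<Lambda> \<Longrightarrow> star A (s v) = s v"
  using s_vertex[of v] unfolding projection_def by blast

lemma s_src [simp]: "\<mu> \<in> mor \<Lambda> \<Longrightarrow> s \<mu> \<otimes> s (src \<Lambda> \<mu>) = s \<mu>"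
  using s_comp[of \<mu> "src \<Lambda> \<mu>"] by simp

lemma s_rng [simp]: "\<mu> \<in> mor \<Lambda> \<Longrightarrow> s (rng \<Lambda> \<mu>) \<otimes> s \<mu> = s \<mu>"
  using s_comp[of "rng \<Lambda> \<mu>" \<mu>] by simp

lemma star_s_rng [simp]: "\<mu> \<in> mor \<Lambda> \<Longrightarrow> star A (s \<mu>) \<otimes> s (rng \<Lambda> \<mu>) = star A (s \<mu>)"
  using star_mult[of "s (rng \<Lambda> \<mu>)" "s \<mu>"] by simp

lemma star_s_src [simp]: "\<mu> \<in> mor \<Lambda> \<Longrightarrow> s (src \<Lambda> \<mu>) \<otimes> star A (s \<mu>) = star A (s \<mu>)"
  using star_mult[of "s \<mu>" "s (src \<Lambda> \<mu>)"] by simp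

lemma s_star_projection: "\<mu> \<in> mor \<Lambda> \<Longrightarrow> projection A (s \<mu> \<otimes> star A (s \<mu>))"
proof -
  assume \<mu>: "\<mu> \<in> mor \<Lambda>"
  have "s \<mu> \<otimes> star A (s \<mu>) \<otimes> (s \<mu> \<otimes> star A (s \<mu>)) = s \<mu> \<otimes> ((star A (s \<mu>) \<otimes> s \<mu>) \<otimes> star A (s \<mu>))"
    using \<mu> by (simp only: mult_assoc s_closed star_closed mult_closed)
  also have "\<dots> = s \<mu> \<otimes> star A (s \<mu>)" using \<mu> by (simp only: star_s_s star_s_src)
  finally show ?thesis
    using \<mu> star_mult[OF s_closed[OF \<mu>] star_closed[OF s_closed[OF \<mu>]]] star_star[OF s_closed[OF \<mu>]]
    unfolding projection_def by (simp only: s_closed star_closed mult_closed simp_thms)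
qed

lemma nrm_s_le: "\<mu> \<in> mor \<Lambda> \<Longrightarrow> nrm A (s \<mu>) \<le> 1"
proof -
  assume \<mu>: "\<mu> \<in> mor \<Lambda>"
  have "(nrm A (s \<mu>))\<^sup>2 = nrm A (s (src \<Lambda> \<mu>))"
    unfolding star_s_s[OF \<mu>, symmetric] by (rule cstar_identity[OF s_closed[OF \<mu>], symmetric])
  also have "\<dots> \<le> 1" by (rule projection_nrm_le[OF s_vertex[OF src_vertex[OF \<mu>]]])
  finally show ?thesis using \<mu> by (simp add: power_le_one_iff)
qed

text \<open>If the ranges differ, the vertex projections are orthogonal. If they agree, CK4 writes
  one vertex projection as the sum of the range projections of all paths of this degree, and
  \<open>projections_orthogonal\<close> applies.\<close>

lemma s_orth:
  assumes m: "\<mu> \<in> mor \<Lambda>" "\<nu> \<in> mor \<Lambda>" and deg: "deg \<Lambda> \<mu> = deg \<Lambda> \<nu>" and ne: "\<mu> \<noteq> \<nu>"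
  shows "star A (s \<mu>) \<otimes> s \<nu> = \<zero>"
proof (cases "rng \<Lambda> \<mu> = rng \<Lambda> \<nu>")
  case False
  have "star A (s \<mu>) \<otimes> s \<nu> = (star A (s \<mu>) \<otimes> s (rng \<Lambda> \<mu>)) \<otimes> (s (rng \<Lambda> \<nu>) \<otimes> s \<nu>)" using m by simp
  also have "\<dots> = star A (s \<mu>) \<otimes> ((s (rng \<Lambda> \<mu>) \<otimes> s (rng \<Lambda> \<nu>)) \<otimes> s \<nu>)"
    using m by (simp only: mult_assoc s_closed star_closed mult_closed rng_closed)
  finally show ?thesis using m False by (simp add: s_vertex_orth)
next
  case True
  let ?q = "\<lambda>\<mu>. s \<mu> \<otimes> star A (s \<mu>)"
  have "?q \<mu> \<otimes> ?q \<nu> = \<zero>"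
  proof (rule projections_orthogonal[where J="paths_to \<Lambda> (rng \<Lambda> \<nu>) (deg \<Lambda> \<nu>)" and q="?q"])
    show "(\<Oplus>j\<in>paths_to \<Lambda> (rng \<Lambda> \<nu>) (deg \<Lambda> \<nu>). ?q j) \<otimes> ?q \<nu> = ?q \<nu>"
      using m mult_assoc[of "s (rng \<Lambda> \<nu>)" "s \<nu>" "star A (s \<nu>)"] by (subst s_vertex_sum[symmetric]) auto
    show "finite (paths_to \<Lambda> (rng \<Lambda> \<nu>) (deg \<Lambda> \<nu>))" by simp
    show "projection A (?q j)" if "j \<in> paths_to \<Lambda> (rng \<Lambda> \<nu>) (deg \<Lambda> \<nu>)" for j
      using that by (intro s_star_projection) (simp add: paths_to_def paths_def)
  qed (simp_all add: m deg True ne paths_to_def paths_def)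
  \<comment> \<open>Multiplication by s_mu^* from the left and s_nu from the right recovers s_mu^*
    s_nu from the product of the range projections.\<close>
  then have "star A (s \<mu>) \<otimes> (?q \<mu> \<otimes> ?q \<nu>) \<otimes> s \<nu> = \<zero>" using m by simp
  also have "star A (s \<mu>) \<otimes> (?q \<mu> \<otimes> ?q \<nu>) \<otimes> s \<nu>
      = (star A (s \<mu>) \<otimes> s \<mu>) \<otimes> (star A (s \<mu>) \<otimes> (s \<nu> \<otimes> (star A (s \<nu>) \<otimes> s \<nu>)))"
    using m by (simp only: mult_assoc s_closed star_closed mult_closed)
  also have "\<dots> = (s (src \<Lambda> \<mu>) \<otimes> star A (s \<mu>)) \<otimes> s \<nu>"
    using m by (simp only: star_s_s s_src mult_assoc s_closed star_closed mult_closed src_closed)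
  finally show ?thesis using m by simp
qed

text \<open>\<kappa> is cut at the degree of \<mu>. Its initial segment is either \<mu> itself,
  which cancels, or another path of the same degree, which is orthogonal to \<mu>.\<close>

lemma star_s_long:
  assumes m: "\<mu> \<in> mor \<Lambda>" "\<kappa> \<in> mor \<Lambda>" and le: "deg \<Lambda> \<mu> \<le> deg \<Lambda> \<kappa>"
  shows "star A (s \<mu>) \<otimes> s \<kappa> = \<zero> \<or>
    (\<exists>\<rho>\<in>mor \<Lambda>. src \<Lambda> \<mu> = rng \<Lambda> \<rho> \<and> \<kappa> = \<mu> \<diamondop> \<rho> \<and> star A (s \<mu>) \<otimes> s \<kappa> = s \<rho>)"
proof -
  obtain \<alpha> \<rho> where ar: "\<alpha> \<in> mor \<Lambda>" "\<rho> \<in> mor \<Lambda>" "src \<Lambda> \<alpha> = rng \<Lambda> \<rho>" "\<alpha> \<diamondop> \<rho> = \<kappa>" "deg \<Lambda> \<alpha> = deg \<Lambda> \<mu>"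
    using factorE[OF m(2) le] by metis
  have eq: "star A (s \<mu>) \<otimes> s \<kappa> = (star A (s \<mu>) \<otimes> s \<alpha>) \<otimes> s \<rho>"
    using m ar s_comp[of \<alpha> \<rho>] by (simp add: mult_assoc)
  show ?thesis
  proof (cases "\<alpha> = \<mu>")
    case True
    then have "star A (s \<mu>) \<otimes> s \<kappa> = s \<rho>" using eq m ar s_rng[of \<rho>] by (simp add: star_s_s)
    then show ?thesis using True ar by blast
  next
    case False
    then have "star A (s \<mu>) \<otimes> s \<alpha> = \<zero>" using m ar by (intro s_orth) auto
    then show ?thesis using eq ar by simp
  qed
qed

definition cext :: "'p \<Rightarrow> 'p \<Rightarrow> 'a set" where
  "cext \<mu> \<nu> = {s \<rho> \<otimes> star A (s \<sigma>) | \<rho> \<sigma>. \<rho> \<in> mor \<Lambda> \<and> \<sigma> \<in> mor \<Lambda> \<and> src \<Lambda> \<rho> = src \<Lambda> \<sigma> \<and>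
     src \<Lambda> \<mu> = rng \<Lambda> \<rho> \<and> src \<Lambda> \<nu> = rng \<Lambda> \<sigma> \<and> \<mu> \<diamondop> \<rho> = \<nu> \<diamondop> \<sigma>}"

lemma cext_closed: "cext \<mu> \<nu> \<subseteq> carrier A"
  by (auto simp: cext_def)

lemma star_s_s_cext:
  assumes m: "\<mu> \<in> mor \<Lambda>" "\<nu> \<in> mor \<Lambda>"
  shows "star A (s \<mu>) \<otimes> s \<nu> \<in> lin (cext \<mu> \<nu>)"
proof -
  \<comment> \<open>CK4 may be inserted in any degree above both \<open>deg \<Lambda> \<mu>\<close>
    and \<open>deg \<Lambda> \<nu>\<close>; the sum is such a degree and avoids forming a
    join.\<close>
  define T where "T = paths_to \<Lambda> (rng \<Lambda> \<nu>) (deg \<Lambda> \<mu> + deg \<Lambda> \<nu>)"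
  have T: "\<kappa> \<in> mor \<Lambda>" "deg \<Lambda> \<mu> \<le> deg \<Lambda> \<kappa>" "deg \<Lambda> \<nu> \<le> deg \<Lambda> \<kappa>" if "\<kappa> \<in> T" for \<kappa>
    using that by (auto simp: T_def paths_to_def paths_def less_eq_vec_def)
  have "star A (s \<mu>) \<otimes> s \<nu> = star A (s \<mu>) \<otimes> ((\<Oplus>\<kappa>\<in>T. s \<kappa> \<otimes> star A (s \<kappa>)) \<otimes> s \<nu>)"
    using m unfolding T_def by (subst s_vertex_sum[symmetric]) simp_all
  also have "\<dots> = (\<Oplus>\<kappa>\<in>T. star A (s \<mu>) \<otimes> ((s \<kappa> \<otimes> star A (s \<kappa>)) \<otimes> s \<nu>))"
    using m T by (simp add: finsum_mult_left finsum_mult_right T_def Pi_iff)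
  also have "\<dots> \<in> lin (cext \<mu> \<nu>)"
  proof (rule lin_finsum[OF cext_closed])
    fix \<kappa> assume \<kappa>: "\<kappa> \<in> T"
    have eq: "star A (s \<mu>) \<otimes> ((s \<kappa> \<otimes> star A (s \<kappa>)) \<otimes> s \<nu>) = (star A (s \<mu>) \<otimes> s \<kappa>) \<otimes> star A (star A (s \<nu>) \<otimes> s \<kappa>)"
      using m T[OF \<kappa>] by (simp add: mult_assoc star_mult)
    show "star A (s \<mu>) \<otimes> ((s \<kappa> \<otimes> star A (s \<kappa>)) \<otimes> s \<nu>) \<in> lin (cext \<mu> \<nu>)"
      using star_s_long[OF m(1) T(1)[OF \<kappa>] T(2)[OF \<kappa>]]
    proof
      assume "star A (s \<mu>) \<otimes> s \<kappa> = \<zero>"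
      then show ?thesis using m T[OF \<kappa>] by (simp add: eq lin_zero)
    next
      assume "\<exists>\<rho>\<in>mor \<Lambda>. src \<Lambda> \<mu> = rng \<Lambda> \<rho> \<and> \<kappa> = \<mu> \<diamondop> \<rho> \<and> star A (s \<mu>) \<otimes> s \<kappa> = s \<rho>"
      then obtain \<rho> where \<rho>: "\<rho> \<in> mor \<Lambda>" "src \<Lambda> \<mu> = rng \<Lambda> \<rho>" "\<kappa> = \<mu> \<diamondop> \<rho>" "star A (s \<mu>) \<otimes> s \<kappa> = s \<rho>" by blast
      show ?thesis using star_s_long[OF m(2) T(1)[OF \<kappa>] T(3)[OF \<kappa>]]
      proof
        assume "star A (s \<nu>) \<otimes> s \<kappa> = \<zero>"
        then show ?thesis using m T[OF \<kappa>] by (simp add: eq lin_zero)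
      next
        assume "\<exists>\<rho>\<in>mor \<Lambda>. src \<Lambda> \<nu> = rng \<Lambda> \<rho> \<and> \<kappa> = \<nu> \<diamondop> \<rho> \<and> star A (s \<nu>) \<otimes> s \<kappa> = s \<rho>"
        then obtain \<sigma> where \<sigma>: "\<sigma> \<in> mor \<Lambda>" "src \<Lambda> \<nu> = rng \<Lambda> \<sigma>" "\<kappa> = \<nu> \<diamondop> \<sigma>" "star A (s \<nu>) \<otimes> s \<kappa> = s \<sigma>" by blast
        have "src \<Lambda> \<rho> = src \<Lambda> \<sigma>" using src_cmp[of \<mu> \<rho>] src_cmp[of \<nu> \<sigma>] \<rho>(1-3) \<sigma>(1-3) m by metis
        then have "s \<rho> \<otimes> star A (s \<sigma>) \<in> cext \<mu> \<nu>"
          using \<rho>(1-3) \<sigma>(1-3) unfolding cext_def by blast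
        then show ?thesis unfolding eq \<rho>(4) \<sigma>(4) by (rule lin_base[OF cext_closed])
      qed
    qed
  qed (simp add: T_def)
  finally show ?thesis .
qed

section \<open>The grading by degree and its alignment\<close>

definition G :: "int ^ 'k \<Rightarrow> 'a set" where
  "G d = {s \<mu> \<otimes> star A (s \<nu>) | \<mu> \<nu>. \<mu> \<in> mor \<Lambda> \<and> \<nu> \<in> mor \<Lambda> \<and> src \<Lambda> \<mu> = src \<Lambda> \<nu> \<and>
     zdeg (deg \<Lambda> \<mu>) - zdeg (deg \<Lambda> \<nu>) = d}"

text \<open>The left leg has the fixed degree n, so products with generators of degree n from the
  left are decided by equality of paths. For d = 0 both legs have degree n, and the elements
  multiply like matrix units.\<close>

definition GN :: "nat ^ 'k \<Rightarrow> int ^ 'k \<Rightarrow> 'a set" where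
  "GN n d = {s \<mu> \<otimes> star A (s \<nu>) | \<mu> \<nu>. \<mu> \<in> mor \<Lambda> \<and> \<nu> \<in> mor \<Lambda> \<and> src \<Lambda> \<mu> = src \<Lambda> \<nu> \<and>
     deg \<Lambda> \<mu> = n \<and> zdeg n - zdeg (deg \<Lambda> \<nu>) = d}"

lemma G_closed: "G d \<subseteq> carrier A" by (auto simp: G_def)
lemma GN_closed: "GN n d \<subseteq> carrier A" by (auto simp: GN_def)

lemma G_star: "g \<in> G d \<Longrightarrow> star A g \<in> G (- d)"
proof -
  assume "g \<in> G d"
  then obtain \<mu> \<nu> where mn: "\<mu> \<in> mor \<Lambda>" "\<nu> \<in> mor \<Lambda>" "src \<Lambda> \<mu> = src \<Lambda> \<nu>"
    "zdeg (deg \<Lambda> \<mu>) - zdeg (deg \<Lambda> \<nu>) = d" "g = s \<mu> \<otimes> star A (s \<nu>)" by (auto simp: G_def)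
  then have "star A g = s \<nu> \<otimes> star A (s \<mu>)" by (simp add: star_mult)
  with mn show ?thesis unfolding G_def by (intro CollectI exI[of _ \<nu>] exI[of _ \<mu>]) auto
qed

lemma G_mult:
  assumes g: "g \<in> G d" and h: "h \<in> G d'" shows "g \<otimes> h \<in> lin (G (d + d'))"
proof -
  obtain \<mu> \<nu> where mn: "\<mu> \<in> mor \<Lambda>" "\<nu> \<in> mor \<Lambda>" "src \<Lambda> \<mu> = src \<Lambda> \<nu>"
    "zdeg (deg \<Lambda> \<mu>) - zdeg (deg \<Lambda> \<nu>) = d" "g = s \<mu> \<otimes> star A (s \<nu>)" using g by (auto simp: G_def)
  obtain \<alpha> \<beta> where ab: "\<alpha> \<in> mor \<Lambda>" "\<beta> \<in> mor \<Lambda>" "src \<Lambda> \<alpha> = src \<Lambda> \<beta>"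
    "zdeg (deg \<Lambda> \<alpha>) - zdeg (deg \<Lambda> \<beta>) = d'" "h = s \<alpha> \<otimes> star A (s \<beta>)" using h by (auto simp: G_def)
  have "s \<mu> \<otimes> (star A (s \<nu>) \<otimes> s \<alpha>) \<otimes> star A (s \<beta>) \<in> lin (G (d + d'))"
  proof (rule lin_map[OF cext_closed G_closed star_s_s_cext[OF mn(2) ab(1)], where f="\<lambda>x. s \<mu> \<otimes> x \<otimes> star A (s \<beta>)"])
    fix x assume "x \<in> cext \<nu> \<alpha>"
    then obtain \<rho> \<sigma> where rs: "\<rho> \<in> mor \<Lambda>" "\<sigma> \<in> mor \<Lambda>" "src \<Lambda> \<rho> = src \<Lambda> \<sigma>"
      "src \<Lambda> \<nu> = rng \<Lambda> \<rho>" "src \<Lambda> \<alpha> = rng \<Lambda> \<sigma>" "\<nu> \<diamondop> \<rho> = \<alpha> \<diamondop> \<sigma>" "x = s \<rho> \<otimes> star A (s \<sigma>)"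
      unfolding cext_def by blast
    have "s \<mu> \<otimes> x \<otimes> star A (s \<beta>) = s (\<mu> \<diamondop> \<rho>) \<otimes> star A (s (\<beta> \<diamondop> \<sigma>))"
      using mn ab rs by (simp add: s_comp star_mult mult_assoc)
    moreover have "zdeg (deg \<Lambda> (\<mu> \<diamondop> \<rho>)) - zdeg (deg \<Lambda> (\<beta> \<diamondop> \<sigma>)) = d + d'"
    proof -
      \<comment> \<open>\<nu> \<rho> and \<alpha> \<sigma> are one and the same path, which makes
        the differences of degrees additive.\<close>
      have "zdeg (deg \<Lambda> \<nu>) + zdeg (deg \<Lambda> \<rho>) = zdeg (deg \<Lambda> \<alpha>) + zdeg (deg \<Lambda> \<sigma>)"
        using deg_cmp[of \<nu> \<rho>] deg_cmp[of \<alpha> \<sigma>] mn ab rs by (simp flip: zdeg_add)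
      then show ?thesis using mn ab rs by (auto simp: algebra_simps)
    qed
    ultimately have "s \<mu> \<otimes> x \<otimes> star A (s \<beta>) \<in> G (d + d')"
      using mn(1-3) ab(1-3) rs(1-6) unfolding G_def
      by (intro CollectI exI[of _ "\<mu> \<diamondop> \<rho>"] exI[of _ "\<beta> \<diamondop> \<sigma>"]) simp
    then show "s \<mu> \<otimes> x \<otimes> star A (s \<beta>) \<in> lin (G (d + d'))" by (rule lin_base[OF G_closed])
  next
    fix c x assume "x \<in> carrier A"
    then have "s \<mu> \<otimes> (c \<odot> x) \<otimes> star A (s \<beta>) = c \<odot> (s \<mu> \<otimes> x \<otimes> star A (s \<beta>))"
      using mn ab by (simp add: mult_smult_r mult_smult_l)
    then show "\<exists>d. s \<mu> \<otimes> (c \<odot> x) \<otimes> star A (s \<beta>) = d \<odot> (s \<mu> \<otimes> x \<otimes> star A (s \<beta>))" by blast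
  qed (use mn(1) ab(2) in \<open>simp_all add: mult_l_distr mult_r_distr\<close>)
  then show ?thesis using mn ab by (simp add: mult_assoc)
qed

lemma lin_G_mult: "\<lbrakk>x \<in> lin (G d); y \<in> lin (G d')\<rbrakk> \<Longrightarrow> x \<otimes> y \<in> lin (G (d + d'))"
  by (rule lin_mult[OF G_closed G_closed G_closed]) (auto intro: G_mult)

lemma lin_G_star: "x \<in> lin (G d) \<Longrightarrow> star A x \<in> lin (G (- d))"
  by (rule lin_star[OF G_closed G_closed]) (auto intro: G_star lin_base[OF G_closed])

text \<open>CK4 at the common source of the legs, in degree n - d(\<mu>), lengthens both legs by the
  same path and leaves the difference of their degrees unchanged.\<close>

lemma G_align:
  assumes "g \<in> G d" shows "\<exists>n0. \<forall>n\<ge>n0. g \<in> lin (GN n d)"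
proof -
  obtain \<mu> \<nu> where mn: "\<mu> \<in> mor \<Lambda>" "\<nu> \<in> mor \<Lambda>" "src \<Lambda> \<mu> = src \<Lambda> \<nu>"
    "zdeg (deg \<Lambda> \<mu>) - zdeg (deg \<Lambda> \<nu>) = d" "g = s \<mu> \<otimes> star A (s \<nu>)" using assms by (auto simp: G_def)
  have "g \<in> lin (GN n d)" if n: "n \<ge> deg \<Lambda> \<mu>" for n
  proof -
    define T where "T = paths_to \<Lambda> (src \<Lambda> \<mu>) (n - deg \<Lambda> \<mu>)"
    have nd: "deg \<Lambda> \<mu> + (n - deg \<Lambda> \<mu>) = n" using n by (simp add: vec_eq_iff less_eq_vec_def)
    have T: "\<alpha> \<in> mor \<Lambda>" "deg \<Lambda> \<alpha> = n - deg \<Lambda> \<mu>" "rng \<Lambda> \<alpha> = src \<Lambda> \<mu>" "rng \<Lambda> \<alpha> = src \<Lambda> \<nu>" if "\<alpha> \<in> T" for \<alpha>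
      using that mn by (auto simp: T_def paths_to_def paths_def)
    have "g = s \<mu> \<otimes> s (src \<Lambda> \<mu>) \<otimes> star A (s \<nu>)" unfolding mn(5) s_src[OF mn(1)] ..
    also have "s (src \<Lambda> \<mu>) = (\<Oplus>\<alpha>\<in>T. s \<alpha> \<otimes> star A (s \<alpha>))"
      unfolding T_def using mn by (intro s_vertex_sum) simp
    also have "s \<mu> \<otimes> \<dots> \<otimes> star A (s \<nu>) = (\<Oplus>\<alpha>\<in>T. s \<mu> \<otimes> (s \<alpha> \<otimes> star A (s \<alpha>)) \<otimes> star A (s \<nu>))"
      using mn(1,2) T(1) by (simp add: finsum_mult_left finsum_mult_right T_def Pi_iff)
    also have "\<dots> \<in> lin (GN n d)"
    proof (rule lin_finsum[OF GN_closed])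
      fix \<alpha> assume \<alpha>: "\<alpha> \<in> T"
      have "s \<mu> \<otimes> (s \<alpha> \<otimes> star A (s \<alpha>)) \<otimes> star A (s \<nu>) = s (\<mu> \<diamondop> \<alpha>) \<otimes> star A (s (\<nu> \<diamondop> \<alpha>))"
        using mn(1,2) T[OF \<alpha>] by (simp add: s_comp star_mult mult_assoc)
      moreover have "deg \<Lambda> (\<mu> \<diamondop> \<alpha>) = n" "zdeg n - zdeg (deg \<Lambda> (\<nu> \<diamondop> \<alpha>)) = d"
      proof -
        show 1: "deg \<Lambda> (\<mu> \<diamondop> \<alpha>) = n" using mn T[OF \<alpha>] nd by simp
        have "zdeg n = zdeg (deg \<Lambda> \<mu>) + zdeg (deg \<Lambda> \<alpha>)" using mn T[OF \<alpha>] unfolding 1[symmetric] by simp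
        then show "zdeg n - zdeg (deg \<Lambda> (\<nu> \<diamondop> \<alpha>)) = d" using mn T(1,4)[OF \<alpha>] by auto
      qed
      ultimately have "s \<mu> \<otimes> (s \<alpha> \<otimes> star A (s \<alpha>)) \<otimes> star A (s \<nu>) \<in> GN n d"
        unfolding GN_def using mn(1,2) T(1,3,4)[OF \<alpha>]
        by (intro CollectI exI[of _ "\<mu> \<diamondop> \<alpha>"] exI[of _ "\<nu> \<diamondop> \<alpha>"]) simp
      then show "s \<mu> \<otimes> (s \<alpha> \<otimes> star A (s \<alpha>)) \<otimes> star A (s \<nu>) \<in> lin (GN n d)" by (rule lin_base[OF GN_closed])
    qed (simp add: T_def)
    finally show ?thesis .
  qed
  then show ?thesis by blast
qed

lemma le_vec_add: "(n0 :: nat ^ 'k) + n1 \<le> n \<Longrightarrow> n0 \<le> n" "(n0 :: nat ^ 'k) + n1 \<le> n \<Longrightarrow> n1 \<le> n"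
  by (auto simp: less_eq_vec_def intro: add_leD1 add_leD2)

lemma lin_G_align: "x \<in> lin (G d) \<Longrightarrow> \<exists>n0. \<forall>n\<ge>n0. x \<in> lin (GN n d)"
proof (induction rule: lin.induct)
  case (lin_step g y c)
  then obtain n0 n1 where n: "\<And>n. n \<ge> n0 \<Longrightarrow> g \<in> lin (GN n d)" "\<And>n. n \<ge> n1 \<Longrightarrow> y \<in> lin (GN n d)"
    using G_align by blast
  have "c \<odot> g \<oplus> y \<in> lin (GN n d)" if "n \<ge> n0 + n1" for n
    using n le_vec_add[OF that] by (intro lin_add lin_smult GN_closed) auto
  then show ?case by blast
qed (auto simp: lin_zero)

lemma lin_G_align_finite:
  assumes "finite I" "\<And>i. i \<in> I \<Longrightarrow> x i \<in> lin (G (d i))"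
  shows "\<exists>n0. \<forall>n\<ge>n0. \<forall>i\<in>I. x i \<in> lin (GN n (d i))"
  using assms
proof (induction I)
  case (insert i I)
  then obtain n0 n1 where "\<And>n. n \<ge> n0 \<Longrightarrow> \<forall>i\<in>I. x i \<in> lin (GN n (d i))" "\<And>n. n \<ge> n1 \<Longrightarrow> x i \<in> lin (GN n (d i))"
    using lin_G_align[of "x i" "d i"] by auto
  then have "\<forall>i\<in>insert i I. x i \<in> lin (GN n (d i))" if "n \<ge> n0 + n1" for n
    using le_vec_add[OF that] by auto
  then show ?case by blast
qed simp

end

context cstar_algebra begin

lemma lin_empty: "x \<in> lin {} \<Longrightarrow> x = \<zero>"
  by (cases rule: lin.cases) auto

lemma finsum_zeros: "(\<And>i. i \<in> I \<Longrightarrow> f i = \<zero>) \<Longrightarrow> (\<Oplus>i\<in>I. f i) = \<zero>"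
  by (subst finsum_cong'[of I I "\<lambda>_. \<zero>"]) auto

end

context CK_rep begin

lemma s_mult_same_deg:
  assumes "\<mu> \<in> mor \<Lambda>" "\<nu> \<in> mor \<Lambda>" "deg \<Lambda> \<mu> = deg \<Lambda> \<nu>"
  shows "star A (s \<mu>) \<otimes> s \<nu> = (if \<mu> = \<nu> then s (src \<Lambda> \<mu>) else \<zero>)"
  using s_orth[OF assms] star_s_s[OF assms(1)] by auto

section \<open>Compression by a segment \<kappa> placed after degree n\<close>

context
  fixes n :: "nat ^ 'k" and v \<kappa> :: 'p
  assumes \<kappa>: "\<kappa> \<in> mor \<Lambda>" "rng \<Lambda> \<kappa> = v"
begin

definition T :: "'p set" where "T = {\<mu> \<in> paths \<Lambda> n. src \<Lambda> \<mu> = v}"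
text \<open>On infinite paths this would be the projection onto those that pass through v at
  position n and continue with \<kappa>.\<close>

definition R :: 'a where "R = (\<Oplus>\<mu>\<in>T. s (\<mu> \<diamondop> \<kappa>) \<otimes> star A (s (\<mu> \<diamondop> \<kappa>)))"

lemma finite_T [simp]: "finite T" by (simp add: T_def)

lemma T_D: "\<mu> \<in> T \<Longrightarrow> \<mu> \<in> mor \<Lambda>" "\<mu> \<in> T \<Longrightarrow> deg \<Lambda> \<mu> = n" "\<mu> \<in> T \<Longrightarrow> src \<Lambda> \<mu> = rng \<Lambda> \<kappa>"
    "\<mu> \<in> T \<Longrightarrow> \<mu> \<diamondop> \<kappa> \<in> mor \<Lambda>"
  using \<kappa> by (simp_all add: T_def paths_def)

lemma T_orth:
  assumes "\<mu> \<in> T" "\<nu> \<in> T" "\<mu> \<noteq> \<nu>"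
  shows "star A (s (\<mu> \<diamondop> \<kappa>)) \<otimes> s (\<nu> \<diamondop> \<kappa>) = \<zero>"
proof (rule s_orth)
  show "\<mu> \<diamondop> \<kappa> \<noteq> \<nu> \<diamondop> \<kappa>"
    using factor_unique(1)[of \<mu> \<kappa> \<nu> \<kappa>] T_D[OF assms(1)] T_D[OF assms(2)] \<kappa>(1) assms(3) by metis
  show "deg \<Lambda> (\<mu> \<diamondop> \<kappa>) = deg \<Lambda> (\<nu> \<diamondop> \<kappa>)"
    using T_D[OF assms(1)] T_D[OF assms(2)] \<kappa>(1) by (simp only: deg_cmp)
qed (use T_D assms in auto)

lemma R_terms: "(\<lambda>\<mu>. s (\<mu> \<diamondop> \<kappa>) \<otimes> star A (s (\<mu> \<diamondop> \<kappa>))) \<in> T \<rightarrow> carrier A"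
  using T_D(4) by auto

lemma R_closed [simp]: "R \<in> carrier A"
  unfolding R_def by (rule finsum_closed[OF R_terms])

lemma R_star [simp]: "star A R = R"
proof -
  have "star A R = (\<Oplus>\<mu>\<in>T. star A (s (\<mu> \<diamondop> \<kappa>) \<otimes> star A (s (\<mu> \<diamondop> \<kappa>))))"
    unfolding R_def by (rule star_finsum[OF finite_T R_terms])
  also have "\<dots> = R"
    unfolding R_def by (rule finsum_cong'[OF refl R_terms]) (simp add: star_mult T_D(4))
  finally show ?thesis .
qed

lemma R_mult: "x \<in> carrier A \<Longrightarrow> R \<otimes> x = (\<Oplus>\<mu>\<in>T. s (\<mu> \<diamondop> \<kappa>) \<otimes> (star A (s (\<mu> \<diamondop> \<kappa>)) \<otimes> x))"
  unfolding R_def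
  by (subst finsum_mult_right[OF finite_T R_terms], assumption, rule finsum_cong'[OF refl])
     (auto simp: mult_assoc T_D(4))

lemma R_s:
  assumes \<mu>: "\<mu> \<in> T" shows "R \<otimes> s (\<mu> \<diamondop> \<kappa>) = s (\<mu> \<diamondop> \<kappa>)"
proof -
  have m: "\<mu> \<diamondop> \<kappa> \<in> mor \<Lambda>" by (rule T_D(4)[OF \<mu>])
  have "R \<otimes> s (\<mu> \<diamondop> \<kappa>) = s (\<mu> \<diamondop> \<kappa>) \<otimes> (star A (s (\<mu> \<diamondop> \<kappa>)) \<otimes> s (\<mu> \<diamondop> \<kappa>))"
    unfolding R_mult[OF s_closed[OF m]]
    by (rule finsum_single[OF \<mu> finite_T]) (simp_all add: T_orth \<mu> m T_D(4))
  also have "\<dots> = s (\<mu> \<diamondop> \<kappa>)" by (simp only: star_s_s[OF m] s_src[OF m])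
  finally show ?thesis .
qed

lemma s_R:
  assumes \<mu>: "\<mu> \<in> T" shows "star A (s (\<mu> \<diamondop> \<kappa>)) \<otimes> R = star A (s (\<mu> \<diamondop> \<kappa>))"
  using arg_cong[OF R_s[OF \<mu>], of "star A"] star_mult[of R "s (\<mu> \<diamondop> \<kappa>)"] T_D(4)[OF \<mu>] by simp

lemma R_idem: "R \<otimes> R = R"
proof -
  have "R \<otimes> R = (\<Oplus>\<mu>\<in>T. s (\<mu> \<diamondop> \<kappa>) \<otimes> (star A (s (\<mu> \<diamondop> \<kappa>)) \<otimes> R))" by (rule R_mult[OF R_closed])
  also have "\<dots> = R"
    by (rule trans[OF finsum_cong'[OF refl R_terms] R_def[symmetric]]) (simp only: s_R)
  finally show ?thesis .
qed

lemma R_projection: "projection A R"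
  unfolding projection_def by (intro conjI R_closed R_star R_idem)

text \<open>Only the summand of \<alpha> meets s_alpha, and it appends \<kappa> to both
  legs.\<close>

lemma R_gen:
  assumes m: "\<alpha> \<in> mor \<Lambda>" "\<beta> \<in> mor \<Lambda>" "src \<Lambda> \<alpha> = src \<Lambda> \<beta>" "deg \<Lambda> \<alpha> = n"
  shows "R \<otimes> (s \<alpha> \<otimes> star A (s \<beta>)) = (if src \<Lambda> \<alpha> = v then s (\<alpha> \<diamondop> \<kappa>) \<otimes> star A (s (\<beta> \<diamondop> \<kappa>)) else \<zero>)"
proof -
  have eq: "star A (s (\<mu> \<diamondop> \<kappa>)) \<otimes> (s \<alpha> \<otimes> star A (s \<beta>)) = star A (s \<kappa>) \<otimes> ((star A (s \<mu>) \<otimes> s \<alpha>) \<otimes> star A (s \<beta>))"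
    if "\<mu> \<in> T" for \<mu>
    using T_D[OF that] m \<kappa>(1) by (simp add: s_comp star_mult mult_assoc)
  have zero: "star A (s (\<mu> \<diamondop> \<kappa>)) \<otimes> (s \<alpha> \<otimes> star A (s \<beta>)) = \<zero>" if "\<mu> \<in> T" "\<mu> \<noteq> \<alpha>" for \<mu>
    unfolding eq[OF that(1)] using T_D[OF that(1)] m that(2) \<kappa>(1) s_orth[of \<mu> \<alpha>] by simp
  have R: "R \<otimes> (s \<alpha> \<otimes> star A (s \<beta>)) = (\<Oplus>\<mu>\<in>T. s (\<mu> \<diamondop> \<kappa>) \<otimes> (star A (s (\<mu> \<diamondop> \<kappa>)) \<otimes> (s \<alpha> \<otimes> star A (s \<beta>))))"
    by (rule R_mult) (simp add: m)
  show ?thesis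
  proof (cases "src \<Lambda> \<alpha> = v")
    case True
    then have \<alpha>: "\<alpha> \<in> T" using m by (simp add: T_def paths_def)
    have \<beta>: "src \<Lambda> \<beta> = rng \<Lambda> \<kappa>" using True m \<kappa> by simp
    have "R \<otimes> (s \<alpha> \<otimes> star A (s \<beta>)) = s (\<alpha> \<diamondop> \<kappa>) \<otimes> (star A (s (\<alpha> \<diamondop> \<kappa>)) \<otimes> (s \<alpha> \<otimes> star A (s \<beta>)))"
      unfolding R by (rule finsum_single[OF \<alpha> finite_T]) (simp_all add: zero T_D(4) \<alpha> m)
    also have "star A (s (\<alpha> \<diamondop> \<kappa>)) \<otimes> (s \<alpha> \<otimes> star A (s \<beta>)) = star A (s \<kappa>) \<otimes> (s (src \<Lambda> \<beta>) \<otimes> star A (s \<beta>))"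
      unfolding eq[OF \<alpha>] star_s_s[OF m(1)] m(3) ..
    also have "\<dots> = star A (s (\<beta> \<diamondop> \<kappa>))"
      unfolding star_s_src[OF m(2)] using m \<kappa>(1) \<beta> by (simp add: s_comp star_mult)
    finally show ?thesis using True by simp
  next
    case False
    then have "\<alpha> \<notin> T" by (simp add: T_def)
    then have "R \<otimes> (s \<alpha> \<otimes> star A (s \<beta>)) = \<zero>"
      unfolding R by (intro finsum_zeros) (metis zero mult_zero_right s_closed T_D(4))
    then show ?thesis using False by simp
  qed
qed

text \<open>For a generator g both legs have degree n, so \<open>R_gen\<close> covers g and g^*
  alike, with results adjoint to each other; and g R is the adjoint of R g^*.\<close>

lemma R_comm: "w \<in> lin (GN n 0) \<Longrightarrow> R \<otimes> w = w \<otimes> R"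
proof (induction rule: lin.induct)
  case (lin_step g y c)
  obtain \<alpha> \<beta> where m: "\<alpha> \<in> mor \<Lambda>" "\<beta> \<in> mor \<Lambda>" "src \<Lambda> \<alpha> = src \<Lambda> \<beta>" "deg \<Lambda> \<alpha> = n"
      "deg \<Lambda> \<beta> = n" "g = s \<alpha> \<otimes> star A (s \<beta>)"
    using lin_step(1) unfolding GN_def by auto
  have y: "y \<in> carrier A" using lin_closed[OF GN_closed lin_step(2)] .
  have g: "g \<in> carrier A" using m by simp
  have "g \<otimes> R = star A (R \<otimes> (s \<beta> \<otimes> star A (s \<alpha>)))"
    using m by (simp add: star_mult)
  also have "\<dots> = R \<otimes> g"
    unfolding m(6) R_gen[OF m(1-4)] R_gen[OF m(2,1) m(3)[symmetric] m(5)]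
    using m \<kappa> by (auto simp: star_mult)
  finally have "R \<otimes> g = g \<otimes> R" by simp
  then show ?case using lin_step(3) y g
    by (simp add: mult_l_distr mult_r_distr mult_smult_l mult_smult_r)
qed simp

text \<open>By \<open>R_gen\<close> the product R g ends in the leg \<beta> \<kappa>, whereas the
  terms of the second R begin with some \<nu> \<kappa>, where \<nu> has degree n. The hypothesis
  denies these two paths a common extension, so the span that contains the product of the two legs
  is trivial.\<close>

lemma R_kill:
  assumes ap: "\<And>\<beta> \<nu> \<rho> \<rho>'. \<lbrakk>\<beta> \<in> mor \<Lambda>; \<nu> \<in> mor \<Lambda>; \<rho> \<in> mor \<Lambda>; \<rho>' \<in> mor \<Lambda>; zdeg n - zdeg (deg \<Lambda> \<beta>) = d;
      deg \<Lambda> \<nu> = n; src \<Lambda> \<beta> = v; src \<Lambda> \<nu> = v; rng \<Lambda> \<rho> = src \<Lambda> \<kappa>; rng \<Lambda> \<rho>' = src \<Lambda> \<kappa>\<rbrakk>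
      \<Longrightarrow> (\<beta> \<diamondop> \<kappa>) \<diamondop> \<rho> \<noteq> (\<nu> \<diamondop> \<kappa>) \<diamondop> \<rho>'"
    and w: "w \<in> lin (GN n d)"
  shows "R \<otimes> w \<otimes> R = \<zero>"
  using w
proof (induction rule: lin.induct)
  case (lin_step g y c)
  obtain \<alpha> \<beta> where m: "\<alpha> \<in> mor \<Lambda>" "\<beta> \<in> mor \<Lambda>" "src \<Lambda> \<alpha> = src \<Lambda> \<beta>" "deg \<Lambda> \<alpha> = n"
      "zdeg n - zdeg (deg \<Lambda> \<beta>) = d" "g = s \<alpha> \<otimes> star A (s \<beta>)"
    using lin_step(1) unfolding GN_def by auto
  have y: "y \<in> carrier A" using lin_closed[OF GN_closed lin_step(2)] .
  have g: "g \<in> carrier A" using m by simp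
  have "R \<otimes> g \<otimes> R = \<zero>"
  proof (cases "src \<Lambda> \<alpha> = v")
    case True
    have b: "src \<Lambda> \<beta> = rng \<Lambda> \<kappa>" "\<beta> \<diamondop> \<kappa> \<in> mor \<Lambda>" "\<alpha> \<diamondop> \<kappa> \<in> mor \<Lambda>"
      using True m \<kappa> by simp_all
    have disjoint: "star A (s (\<nu> \<diamondop> \<kappa>)) \<otimes> s (\<beta> \<diamondop> \<kappa>) = \<zero>" if \<nu>: "\<nu> \<in> T" for \<nu>
    proof -
      have \<nu>': "\<nu> \<in> mor \<Lambda>" "deg \<Lambda> \<nu> = n" "src \<Lambda> \<nu> = v" "\<nu> \<diamondop> \<kappa> \<in> mor \<Lambda>"
        "src \<Lambda> (\<nu> \<diamondop> \<kappa>) = src \<Lambda> \<kappa>" "src \<Lambda> (\<beta> \<diamondop> \<kappa>) = src \<Lambda> \<kappa>"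
        using T_D[OF \<nu>] \<kappa> m b by simp_all
      have "cext (\<nu> \<diamondop> \<kappa>) (\<beta> \<diamondop> \<kappa>) = {}"
      proof -
        have False if "\<rho> \<in> mor \<Lambda>" "\<sigma> \<in> mor \<Lambda>" "src \<Lambda> (\<nu> \<diamondop> \<kappa>) = rng \<Lambda> \<rho>" "src \<Lambda> (\<beta> \<diamondop> \<kappa>) = rng \<Lambda> \<sigma>"
          "(\<nu> \<diamondop> \<kappa>) \<diamondop> \<rho> = (\<beta> \<diamondop> \<kappa>) \<diamondop> \<sigma>" for \<rho> \<sigma>
          using ap[OF m(2) \<nu>'(1) that(2,1) m(5) \<nu>'(2) _ \<nu>'(3)] that \<nu>'(5,6) b(1) \<kappa>(2) by simp
        then show ?thesis unfolding cext_def by blast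
      qed
      then show ?thesis using star_s_s_cext[OF \<nu>'(4) b(2)] by (simp add: lin_empty)
    qed
    have "R \<otimes> s (\<beta> \<diamondop> \<kappa>) = \<zero>"
      unfolding R_mult[OF s_closed[OF b(2)]]
      by (rule finsum_zeros) (simp add: disjoint T_D(4))
    then have "star A (s (\<beta> \<diamondop> \<kappa>)) \<otimes> R = \<zero>"
      using arg_cong[of "R \<otimes> s (\<beta> \<diamondop> \<kappa>)" \<zero> "star A"] star_mult[of R "s (\<beta> \<diamondop> \<kappa>)"] b by simp
    then show ?thesis
      unfolding m(6) R_gen[OF m(1-4)] using True b by (simp add: mult_assoc)
  next
    case False
    then show ?thesis unfolding m(6) R_gen[OF m(1-4)] by simp
  qed
  then show ?case using lin_step(3) y g
    by (simp add: mult_l_distr mult_r_distr mult_smult_l mult_smult_r)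
qed simp

end

section \<open>Matrix corners of the core of level n\<close>

lemma core_corner:
  assumes w: "w \<in> lin (GN n 0)" and m: "\<mu> \<in> paths \<Lambda> n" "\<nu> \<in> paths \<Lambda> n"
  shows "\<exists>c. star A (s \<mu>) \<otimes> w \<otimes> s \<nu> = c \<odot> (if src \<Lambda> \<mu> = src \<Lambda> \<nu> then s (src \<Lambda> \<mu>) else \<zero>)"
  using w
proof (induction rule: lin.induct)
  case lin_zero
  then show ?case using m by (intro exI[of _ 0]) (simp add: paths_def)
next
  case (lin_step g y c)
  have m': "\<mu> \<in> mor \<Lambda>" "\<nu> \<in> mor \<Lambda>" "deg \<Lambda> \<mu> = n" "deg \<Lambda> \<nu> = n" using m by (simp_all add: paths_def)
  obtain \<alpha> \<beta> where ab: "\<alpha> \<in> mor \<Lambda>" "\<beta> \<in> mor \<Lambda>" "src \<Lambda> \<alpha> = src \<Lambda> \<beta>" "deg \<Lambda> \<alpha> = n"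
      "deg \<Lambda> \<beta> = n" "g = s \<alpha> \<otimes> star A (s \<beta>)"
    using lin_step(1) unfolding GN_def by auto
  let ?e = "if src \<Lambda> \<mu> = src \<Lambda> \<nu> then s (src \<Lambda> \<mu>) else \<zero>"
  have e: "?e \<in> carrier A" using m' by simp
  have y: "y \<in> carrier A" using lin_closed[OF GN_closed lin_step(2)] .
  have g: "g \<in> carrier A" using ab by simp
  have "star A (s \<mu>) \<otimes> g \<otimes> s \<nu> = (star A (s \<mu>) \<otimes> s \<alpha>) \<otimes> (star A (s \<beta>) \<otimes> s \<nu>)"
    using ab m' by (simp add: mult_assoc)
  \<comment> \<open>A generator acts as a matrix unit: its corner is a vertex projection when its
    legs are \<mu> and \<nu>, and zero otherwise.\<close>
  also have "\<dots> = (if \<mu> = \<alpha> \<and> \<beta> = \<nu> then 1 else 0) \<odot> ?e"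
  proof (cases "\<mu> = \<alpha> \<and> \<beta> = \<nu>")
    case True
    have "s (src \<Lambda> \<nu>) \<otimes> s (src \<Lambda> \<nu>) = s (src \<Lambda> \<nu>)"
      using s_vertex[OF src_vertex[OF m'(2)]] unfolding projection_def by blast
    then show ?thesis using True ab(3) m' by (simp add: star_s_s smult_one)
  next
    case False
    then have "star A (s \<mu>) \<otimes> s \<alpha> = \<zero> \<or> star A (s \<beta>) \<otimes> s \<nu> = \<zero>"
      using s_orth[OF m'(1) ab(1)] s_orth[OF ab(2) m'(2)] ab(4,5) m'(3,4) by auto
    then show ?thesis using False ab(1,2) m'(1,2) e by auto
  qed
  finally obtain c' where c': "star A (s \<mu>) \<otimes> g \<otimes> s \<nu> = c' \<odot> ?e" by blast
  obtain c'' where c'': "star A (s \<mu>) \<otimes> y \<otimes> s \<nu> = c'' \<odot> ?e" using lin_step(3) by blast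
  have "star A (s \<mu>) \<otimes> (c \<odot> g \<oplus> y) \<otimes> s \<nu> = c \<odot> (star A (s \<mu>) \<otimes> g \<otimes> s \<nu>) \<oplus> star A (s \<mu>) \<otimes> y \<otimes> s \<nu>"
    using m' y g by (simp add: mult_l_distr mult_r_distr mult_smult_l mult_smult_r)
  also have "\<dots> = (c * c' + c'') \<odot> ?e"
    unfolding c' c'' smult_assoc[OF e, symmetric] smult_l_distr[OF e] ..
  finally show ?case by blast
qed

text \<open>On a generator only the range projection of its own leg survives. The use is to cut a
  core element into its corners.\<close>

lemma core_unit:
  defines "U n \<equiv> (\<Oplus>\<mu>\<in>paths \<Lambda> n. s \<mu> \<otimes> star A (s \<mu>))"
  assumes w: "w \<in> lin (GN n 0)"
  shows "U n \<otimes> w = w" "w \<otimes> U n = w"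
proof -
  have p: "\<mu> \<in> mor \<Lambda>" "deg \<Lambda> \<mu> = n" if "\<mu> \<in> paths \<Lambda> n" for \<mu> using that by (simp_all add: paths_def)
  have Pi: "(\<lambda>\<mu>. s \<mu> \<otimes> star A (s \<mu>)) \<in> paths \<Lambda> n \<rightarrow> carrier A" using p by auto
  have Uc: "U n \<in> carrier A" unfolding U_def by (rule finsum_closed[OF Pi])
  have Ustar: "star A (U n) = U n"
    unfolding U_def star_finsum[OF finite_paths Pi]
    by (rule finsum_cong'[OF refl Pi]) (simp add: star_mult p(1))
  have U_s: "U n \<otimes> s \<alpha> = s \<alpha>" if \<alpha>: "\<alpha> \<in> mor \<Lambda>" "deg \<Lambda> \<alpha> = n" for \<alpha>
  proof -
    have \<alpha>': "\<alpha> \<in> paths \<Lambda> n" using \<alpha> by (simp add: paths_def)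
    have "U n \<otimes> s \<alpha> = (\<Oplus>\<mu>\<in>paths \<Lambda> n. s \<mu> \<otimes> star A (s \<mu>) \<otimes> s \<alpha>)"
      unfolding U_def by (rule finsum_mult_right[OF finite_paths Pi s_closed[OF \<alpha>(1)]])
    also have "\<dots> = s \<alpha> \<otimes> star A (s \<alpha>) \<otimes> s \<alpha>"
      by (rule finsum_single[OF \<alpha>' finite_paths]) (use p \<alpha> in \<open>simp_all add: mult_assoc s_mult_same_deg\<close>)
    also have "\<dots> = s \<alpha>" using \<alpha> by (simp add: mult_assoc star_s_s)
    finally show ?thesis .
  qed
  have "U n \<otimes> w = w \<and> w \<otimes> U n = w"
    using w
  proof (induction rule: lin.induct)
    case (lin_step g y c)
    obtain \<alpha> \<beta> where ab: "\<alpha> \<in> mor \<Lambda>" "\<beta> \<in> mor \<Lambda>" "src \<Lambda> \<alpha> = src \<Lambda> \<beta>" "deg \<Lambda> \<alpha> = n"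
        "deg \<Lambda> \<beta> = n" "g = s \<alpha> \<otimes> star A (s \<beta>)"
      using lin_step(1) unfolding GN_def by auto
    have y: "y \<in> carrier A" using lin_closed[OF GN_closed lin_step(2)] .
    have g: "g \<in> carrier A" using ab by simp
    have gen: "U n \<otimes> (s \<alpha> \<otimes> star A (s \<beta>)) = s \<alpha> \<otimes> star A (s \<beta>)"
      if "\<alpha> \<in> mor \<Lambda>" "\<beta> \<in> mor \<Lambda>" "deg \<Lambda> \<alpha> = n" for \<alpha> \<beta>
      using that Uc by (simp add: mult_assoc[symmetric] U_s)
    have "g \<otimes> U n = star A (U n \<otimes> (s \<beta> \<otimes> star A (s \<alpha>)))"
      using ab Uc Ustar by (simp add: star_mult)
    also have "\<dots> = g" using ab by (simp add: gen star_mult)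
    finally have "g \<otimes> U n = g" .
    moreover have "U n \<otimes> g = g" unfolding ab(6) by (rule gen[OF ab(1,2,4)])
    ultimately show ?case using lin_step(3) y g Uc
      by (simp add: mult_l_distr mult_r_distr mult_smult_l mult_smult_r)
  qed (use Uc in simp)
  then show "U n \<otimes> w = w" "w \<otimes> U n = w" by auto
qed

text \<open>A crude triangle inequality over all matrix entries. The factor depends on n alone, so
  it disappears when roots of high powers are taken.\<close>

lemma core_nrm_le:
  assumes w: "w \<in> lin (GN n 0)"
    and b: "\<And>\<mu> \<nu>. \<lbrakk>\<mu> \<in> paths \<Lambda> n; \<nu> \<in> paths \<Lambda> n\<rbrakk> \<Longrightarrow> nrm A (star A (s \<mu>) \<otimes> w \<otimes> s \<nu>) \<le> b"
  shows "nrm A w \<le> real (card (paths \<Lambda> n)) * (real (card (paths \<Lambda> n)) * b)"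
proof -
  let ?P = "paths \<Lambda> n"
  define U where "U = (\<Oplus>\<mu>\<in>?P. s \<mu> \<otimes> star A (s \<mu>))"
  have p: "\<mu> \<in> mor \<Lambda>" if "\<mu> \<in> ?P" for \<mu> using that by (simp add: paths_def)
  have Pi: "(\<lambda>\<mu>. s \<mu> \<otimes> star A (s \<mu>)) \<in> ?P \<rightarrow> carrier A" using p by auto
  have Uc: "U \<in> carrier A" unfolding U_def by (rule finsum_closed[OF Pi])
  have wc: "w \<in> carrier A" using lin_closed[OF GN_closed w] .
  have term_le: "nrm A (s \<mu> \<otimes> star A (s \<mu>) \<otimes> w \<otimes> (s \<nu> \<otimes> star A (s \<nu>))) \<le> b" if mn: "\<mu> \<in> ?P" "\<nu> \<in> ?P" for \<mu> \<nu>
  proof -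
    let ?z = "star A (s \<mu>) \<otimes> w \<otimes> s \<nu>"
    have z: "?z \<in> carrier A" using p mn wc by simp
    have "s \<mu> \<otimes> star A (s \<mu>) \<otimes> w \<otimes> (s \<nu> \<otimes> star A (s \<nu>)) = s \<mu> \<otimes> (?z \<otimes> star A (s \<nu>))"
      using p[OF mn(1)] p[OF mn(2)] wc by (simp add: mult_assoc)
    also have "nrm A \<dots> \<le> nrm A (s \<mu>) * (nrm A ?z * nrm A (s \<nu>))"
      using p[OF mn(1)] p[OF mn(2)] z nrm_mult[of ?z "star A (s \<nu>)"]
      by (intro order_trans[OF nrm_mult] mult_left_mono) auto
    also have "\<dots> \<le> 1 * (nrm A ?z * 1)"
      using p[OF mn(1)] p[OF mn(2)] z by (intro mult_mono mult_left_mono nrm_s_le) auto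
    finally show ?thesis using b[OF mn] by simp
  qed
  have "w = U \<otimes> w \<otimes> U" using core_unit[OF w] by (simp add: U_def)
  also have "\<dots> = (\<Oplus>\<mu>\<in>?P. s \<mu> \<otimes> star A (s \<mu>) \<otimes> w) \<otimes> U"
    unfolding U_def finsum_mult_right[OF finite_paths Pi wc] ..
  also have "\<dots> = (\<Oplus>\<mu>\<in>?P. s \<mu> \<otimes> star A (s \<mu>) \<otimes> w \<otimes> U)"
    using p wc Uc by (intro finsum_mult_right) auto
  also have "\<dots> = (\<Oplus>\<mu>\<in>?P. \<Oplus>\<nu>\<in>?P. s \<mu> \<otimes> star A (s \<mu>) \<otimes> w \<otimes> (s \<nu> \<otimes> star A (s \<nu>)))"
    unfolding U_def using p wc
    by (intro finsum_cong' finsum_mult_left refl) (auto intro!: finsum_closed)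
  finally have eq: "w = (\<Oplus>\<mu>\<in>?P. \<Oplus>\<nu>\<in>?P. s \<mu> \<otimes> star A (s \<mu>) \<otimes> w \<otimes> (s \<nu> \<otimes> star A (s \<nu>)))" .
  have "nrm A w \<le> (\<Sum>\<mu>\<in>?P. \<Sum>\<nu>\<in>?P. b)"
    using p wc
    by (subst eq, intro order_trans[OF nrm_finsum_le] sum_mono term_le finite_paths)
       (auto intro!: finsum_closed)
  then show ?thesis by simp
qed

end

section \<open>Uniqueness of the norm for aperiodic graphs\<close>

text \<open>Meant for the norm of the image under a star-homomorphism. Domination by
  \<open>nrm A\<close> is required only up to a constant, which is the form that
  \<open>star_hom_seminorm\<close> supplies.\<close>

locale cstar_seminorm = cstar_algebra A for A :: "'a cstar" (structure) +
  fixes N :: "'a \<Rightarrow> real" and C :: real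
  assumes N_nonneg [simp]: "x \<in> carrier A \<Longrightarrow> 0 \<le> N x"
    and N_triangle: "\<lbrakk>x \<in> carrier A; y \<in> carrier A\<rbrakk> \<Longrightarrow> N (x \<oplus> y) \<le> N x + N y"
    and N_smult: "x \<in> carrier A \<Longrightarrow> N (c \<odot> x) = cmod c * N x"
    and N_mult: "\<lbrakk>x \<in> carrier A; y \<in> carrier A\<rbrakk> \<Longrightarrow> N (x \<otimes> y) \<le> N x * N y"
    and N_cstar: "x \<in> carrier A \<Longrightarrow> N (star A x \<otimes> x) = (N x)\<^sup>2"
    and N_le: "x \<in> carrier A \<Longrightarrow> N x \<le> C * nrm A x"
    and C_nonneg: "0 \<le> C"
begin

lemma N_star [simp]:
  assumes x: "x \<in> carrier A" shows "N (star A x) = N x"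
proof -
  have le: "N y \<le> N (star A y)" if y: "y \<in> carrier A" for y
  proof (cases "N y = 0")
    case False
    have "N y * N y \<le> N (star A y) * N y"
      using N_cstar[OF y] N_mult[of "star A y" y] y by (simp add: power2_eq_square)
    moreover have "N y > 0" using False N_nonneg[OF y] by linarith
    ultimately show ?thesis by simp
  qed (use y in simp)
  show ?thesis using le[OF x] le[of "star A x"] x by simp
qed

lemma N_projection: "projection A p \<Longrightarrow> N p = 0 \<or> N p = 1"
  using N_cstar[of p] unfolding projection_def by (auto simp: power2_eq_square)

lemma N_sqi:
  assumes "h \<in> carrier A" "star A h = h" shows "N (sqi j h) = N h ^ (2 ^ j)"
proof (induction j)
  case (Suc j)
  have "N (sqi (Suc j) h) = (N (sqi j h))\<^sup>2"
    using sqi_self_adjoint[OF assms, of j] N_cstar[of "sqi j h"] by simp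
  then show ?case using Suc by (simp add: power_mult[symmetric] mult.commute)
qed simp

end

context CK_rep begin

lemma core_star:
  assumes "w \<in> lin (GN n 0)" shows "star A w \<in> lin (GN n 0)"
proof (rule lin_star[OF GN_closed GN_closed assms])
  fix g assume g: "g \<in> GN n 0"
  obtain \<alpha> \<beta> where ab: "\<alpha> \<in> mor \<Lambda>" "\<beta> \<in> mor \<Lambda>" "src \<Lambda> \<alpha> = src \<Lambda> \<beta>" "deg \<Lambda> \<alpha> = n"
      "deg \<Lambda> \<beta> = n" "g = s \<alpha> \<otimes> star A (s \<beta>)"
    using g unfolding GN_def by auto
  have "star A g = s \<beta> \<otimes> star A (s \<alpha>)" using ab by (simp add: star_mult)
  moreover have "s \<beta> \<otimes> star A (s \<alpha>) \<in> GN n 0"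
    using ab unfolding GN_def by (intro CollectI exI[of _ \<beta>] exI[of _ \<alpha>]) simp
  ultimately show "star A g \<in> lin (GN n 0)" using lin_base[OF GN_closed] by simp
qed

lemma core_mult:
  assumes "a \<in> lin (GN n 0)" "b \<in> lin (GN n 0)" shows "a \<otimes> b \<in> lin (GN n 0)"
proof (rule lin_mult[OF GN_closed GN_closed GN_closed assms])
  fix g h assume g: "g \<in> GN n 0" and h: "h \<in> GN n 0"
  obtain \<alpha> \<beta> where ab: "\<alpha> \<in> mor \<Lambda>" "\<beta> \<in> mor \<Lambda>" "src \<Lambda> \<alpha> = src \<Lambda> \<beta>" "deg \<Lambda> \<alpha> = n"
      "deg \<Lambda> \<beta> = n" "g = s \<alpha> \<otimes> star A (s \<beta>)"
    using g unfolding GN_def by auto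
  obtain \<gamma> \<delta> where cd: "\<gamma> \<in> mor \<Lambda>" "\<delta> \<in> mor \<Lambda>" "src \<Lambda> \<gamma> = src \<Lambda> \<delta>" "deg \<Lambda> \<gamma> = n"
      "deg \<Lambda> \<delta> = n" "h = s \<gamma> \<otimes> star A (s \<delta>)"
    using h unfolding GN_def by auto
  have eq: "g \<otimes> h = s \<alpha> \<otimes> ((star A (s \<beta>) \<otimes> s \<gamma>) \<otimes> star A (s \<delta>))"
    unfolding ab(6) cd(6) using ab(1,2) cd(1,2) by (simp add: mult_assoc)
  show "g \<otimes> h \<in> lin (GN n 0)"
  proof (cases "\<beta> = \<gamma>")
    case True
    then have "g \<otimes> h = s \<alpha> \<otimes> star A (s \<delta>)"
      unfolding eq using cd(1) star_s_src[OF cd(2)] by (simp add: star_s_s cd(3))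
    moreover have "s \<alpha> \<otimes> star A (s \<delta>) \<in> GN n 0"
      using ab(1,3,4) cd(2,3,5) True unfolding GN_def by (intro CollectI exI[of _ \<alpha>] exI[of _ \<delta>]) simp
    ultimately show ?thesis using lin_base[OF GN_closed] by simp
  next
    case False
    then have "star A (s \<beta>) \<otimes> s \<gamma> = \<zero>" using ab(2,5) cd(1,4) by (intro s_orth) simp_all
    then have "g \<otimes> h = \<zero>" unfolding eq using ab(1) cd(2) by simp
    then show ?thesis by (simp add: lin_zero)
  qed
qed

end

locale CK_seminorm = CK_rep \<Lambda> A s + cstar_seminorm A N C
  for \<Lambda> :: "('p, 'k::finite) kgraph" and A :: "'a cstar" (structure) and s N C +
  assumes N_vertex: "v \<in> vertices \<Lambda> \<Longrightarrow> N (s v) \<noteq> 0"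
    and aperiodic: "aperiodic \<Lambda>"
begin

lemma N_s_le: "\<mu> \<in> mor \<Lambda> \<Longrightarrow> N (s \<mu>) \<le> 1"
proof -
  assume \<mu>: "\<mu> \<in> mor \<Lambda>"
  have "(N (s \<mu>))\<^sup>2 = N (s (src \<Lambda> \<mu>))"
    unfolding star_s_s[OF \<mu>, symmetric] by (rule N_cstar[OF s_closed[OF \<mu>], symmetric])
  also have "\<dots> \<le> 1" using N_projection[OF s_vertex[OF src_vertex[OF \<mu>]]] by auto
  finally show ?thesis using \<mu> by (simp add: power_le_one_iff)
qed

lemma N_vertex_1: "v \<in> vertices \<Lambda> \<Longrightarrow> N (s v) = 1"
  using N_projection[OF s_vertex] N_vertex by blast

text \<open>Compression by a suitable R kills every component except y = \<open>x i0\<close> and is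
  multiplicative on the core, so the compressed powers of y^* y are bounded by the same powers of
  \<open>N\<close> at the sum. A corner of such a power is a scalar times a vertex projection; the
  compression still sees this scalar, and \<open>N\<close> of the projection is 1. Bounds for the
  corners bound the norm up to a factor depending on n alone, which taking roots removes.\<close>

lemma core_estimate:
  assumes I: "finite I" "i0 \<in> I" and x: "\<And>i. i \<in> I \<Longrightarrow> x i \<in> lin (G (d i))"
    and d0: "d i0 = 0" and d: "\<And>i. \<lbrakk>i \<in> I; i \<noteq> i0\<rbrakk> \<Longrightarrow> d i \<noteq> 0"
  shows "nrm A (x i0) \<le> N (\<Oplus>i\<in>I. x i)"
proof -
  define X where "X = (\<Oplus>i\<in>I. x i)"
  define y where "y = x i0"
  have xc: "x i \<in> carrier A" if "i \<in> I" for i using lin_closed[OF G_closed x[OF that]] .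
  have Xc: "X \<in> carrier A" unfolding X_def using xc by (intro finsum_closed) auto
  have yc: "y \<in> carrier A" using xc I(2) by (simp add: y_def)
  have "\<exists>n0. \<forall>n\<ge>n0. \<forall>i\<in>I. x i \<in> lin (GN n (d i))" by (rule lin_G_align_finite[OF I(1) x])
  then obtain n where "\<forall>m\<ge>n. \<forall>i\<in>I. x i \<in> lin (GN m (d i))" by (rule exE)
  then have n: "x i \<in> lin (GN n (d i))" if "i \<in> I" for i using that by (simp only: order_refl)
  \<comment> \<open>The pairs of degrees to be separated by an aperiodic path. The truncation by
    \<open>nat\<close> is harmless, because \<open>inP\<close> only speaks of paths whose degree
    realises the difference; the intersection removes the pair (n, n).\<close>
  define P where "P = (\<lambda>i. ((\<chi> j. nat (int (n $ j) - d i $ j)) :: nat ^ 'k, n)) ` I \<inter> {(p, q). p \<noteq> q}"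
  have P: "finite P" "\<forall>z\<in>P. fst z \<noteq> snd z" using I(1) by (auto simp: P_def)
  have inP: "(deg \<Lambda> \<beta>, n) \<in> P" if "i \<in> I" "i \<noteq> i0" "zdeg n - zdeg (deg \<Lambda> \<beta>) = d i" for \<beta> i
  proof -
    have "deg \<Lambda> \<beta> $ j = nat (int (n $ j) - d i $ j)" for j
      unfolding that(3)[symmetric] by (simp add: zdeg_def)
    then have "deg \<Lambda> \<beta> = (\<chi> j. nat (int (n $ j) - d i $ j))" by (simp add: vec_eq_iff)
    moreover have "deg \<Lambda> \<beta> \<noteq> n" using d[OF that(1,2)] that(3) by auto
    ultimately show ?thesis using that(1) by (auto simp: P_def)
  qed
  have "nrm A (star A (s \<mu>) \<otimes> sqi j (star A y \<otimes> y) \<otimes> s \<nu>) \<le> (N X)\<^sup>2 ^ (2 ^ j)"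
    if mn: "\<mu> \<in> paths \<Lambda> n" "\<nu> \<in> paths \<Lambda> n" for \<mu> \<nu> j
  proof -
    have m: "\<mu> \<in> mor \<Lambda>" "\<nu> \<in> mor \<Lambda>" "deg \<Lambda> \<mu> = n" "deg \<Lambda> \<nu> = n" using mn by (simp_all add: paths_def)
    define v where "v = src \<Lambda> \<mu>"
    have v: "v \<in> vertices \<Lambda>" using m by (simp add: v_def)
    from aperiodic_segment[OF aperiodic v P]
    obtain \<kappa> where \<kappa>: "\<kappa> \<in> mor \<Lambda>" "rng \<Lambda> \<kappa> = v" and ap: "\<forall>\<beta>\<in>mor \<Lambda>. \<forall>\<nu>\<in>mor \<Lambda>. \<forall>\<rho>\<in>mor \<Lambda>. \<forall>\<rho>'\<in>mor \<Lambda>.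
        (deg \<Lambda> \<beta>, deg \<Lambda> \<nu>) \<in> P \<longrightarrow> src \<Lambda> \<beta> = v \<longrightarrow> src \<Lambda> \<nu> = v \<longrightarrow> rng \<Lambda> \<rho> = src \<Lambda> \<kappa> \<longrightarrow> rng \<Lambda> \<rho>' = src \<Lambda> \<kappa> \<longrightarrow>
        (\<beta> \<diamondop> \<kappa>) \<diamondop> \<rho> \<noteq> (\<nu> \<diamondop> \<kappa>) \<diamondop> \<rho>'"
      by (elim bexE conjE)
    let ?R = "R n v \<kappa>"
    note Rc = R_closed[OF \<kappa>, of n] and Rs = R_star[OF \<kappa>, of n] and Ri = R_idem[OF \<kappa>, of n]
      and Rcomm = R_comm[OF \<kappa>, of _ n]
    define f where "f w = ?R \<otimes> w \<otimes> ?R" for w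
    have fc [simp]: "f w \<in> carrier A" if "w \<in> carrier A" for w using that Rc by (simp add: f_def)
    \<comment> \<open>R commutes with the left factor and is idempotent, so an extra R may stand
      between the factors.\<close>
    have f_mult: "f (w \<otimes> w') = f w \<otimes> f w'" if w: "w \<in> lin (GN n 0)" "w' \<in> carrier A" for w w'
    proof -
      have wc: "w \<in> carrier A" using lin_closed[OF GN_closed w(1)] .
      have "f w \<otimes> f w' = ?R \<otimes> (w \<otimes> (?R \<otimes> ?R)) \<otimes> w' \<otimes> ?R"
        unfolding f_def using Rc wc w(2) by (simp only: mult_assoc mult_closed)
      also have "\<dots> = ?R \<otimes> (?R \<otimes> w) \<otimes> w' \<otimes> ?R" unfolding Ri Rcomm[OF w(1)] ..
      also have "\<dots> = (?R \<otimes> ?R) \<otimes> w \<otimes> w' \<otimes> ?R"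
        using Rc wc w(2) by (simp only: mult_assoc mult_closed)
      also have "\<dots> = f (w \<otimes> w')" unfolding Ri f_def using Rc wc w(2) by (simp only: mult_assoc mult_closed)
      finally show ?thesis by simp
    qed
    have f_star: "f (star A w) = star A (f w)" if "w \<in> carrier A" for w
      using that Rc Rs by (simp add: f_def star_mult mult_assoc)
    have f_add: "f (w \<oplus> w') = f w \<oplus> f w'" if "w \<in> carrier A" "w' \<in> carrier A" for w w'
      using that Rc by (simp add: f_def mult_l_distr mult_r_distr)
    have f_sum: "f X = f y"
    proof -
      have "f X = (\<Oplus>i\<in>I. f (x i))"
      proof -
        have "f X = (\<Oplus>i\<in>I. ?R \<otimes> x i) \<otimes> ?R"
          unfolding f_def X_def using I(1) xc Rc by (subst finsum_mult_left) auto
        also have "\<dots> = (\<Oplus>i\<in>I. f (x i))"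
          unfolding f_def using I(1) xc Rc by (intro finsum_mult_right) auto
        finally show ?thesis .
      qed
      also have "\<dots> = f (x i0)"
      proof (rule finsum_single[OF I(2,1)])
        fix i assume i: "i \<in> I" "i \<noteq> i0"
        show "f (x i) = \<zero>"
          unfolding f_def
        proof (rule R_kill[OF \<kappa> _ n[OF i(1)]])
          fix \<beta> \<nu> \<rho> \<rho>'
          assume a: "\<beta> \<in> mor \<Lambda>" "\<nu> \<in> mor \<Lambda>" "\<rho> \<in> mor \<Lambda>" "\<rho>' \<in> mor \<Lambda>" "zdeg n - zdeg (deg \<Lambda> \<beta>) = d i"
            "deg \<Lambda> \<nu> = n" "src \<Lambda> \<beta> = v" "src \<Lambda> \<nu> = v" "rng \<Lambda> \<rho> = src \<Lambda> \<kappa>" "rng \<Lambda> \<rho>' = src \<Lambda> \<kappa>"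
          have "(deg \<Lambda> \<beta>, deg \<Lambda> \<nu>) \<in> P" unfolding a(6) by (rule inP[OF i a(5)])
          then show "(\<beta> \<diamondop> \<kappa>) \<diamondop> \<rho> \<noteq> (\<nu> \<diamondop> \<kappa>) \<diamondop> \<rho>'"
            by (rule ap[rule_format, OF a(1-4) _ a(7-10)])
        qed
      qed (use xc I(2) in simp)
      finally show ?thesis by (simp add: y_def)
    qed
    have NR: "N ?R \<le> 1" using N_projection[OF R_projection[OF \<kappa>, of n]] by auto
    have Nf: "N (f X) \<le> N X"
    proof -
      have "N (f X) \<le> N ?R * N X * N ?R"
        unfolding f_def using Rc Xc by (intro order_trans[OF N_mult] mult_right_mono N_mult) auto
      also have "\<dots> \<le> 1 * N X * 1" using NR Xc Rc by (intro mult_mono) auto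
      finally show ?thesis by simp
    qed
    let ?w = "star A y \<otimes> y"
    have y0: "y \<in> lin (GN n 0)" using n[OF I(2)] d0 by (simp add: y_def)
    have w0: "?w \<in> lin (GN n 0)"
      by (rule core_mult[OF core_star[OF y0] y0])
    have wj: "sqi j ?w \<in> lin (GN n 0)" for j
      by (rule sqi_invariant[OF w0 core_mult])
    have wjc: "sqi j ?w \<in> carrier A" for j using lin_closed[OF GN_closed wj] .
    have fj: "N (f (sqi j ?w)) \<le> (N X)\<^sup>2 ^ (2 ^ j)" for j
    proof (induction j)
      case 0
      have "f ?w = star A (f y) \<otimes> f y"
        using f_mult[OF core_star[OF y0] yc] f_star[OF yc] by simp
      then have "N (f ?w) = (N (f X))\<^sup>2" unfolding f_sum using yc by (simp add: N_cstar)
      also have "\<dots> \<le> (N X)\<^sup>2" using Nf Xc by (intro power_mono) auto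
      finally show ?case by simp
    next
      case (Suc j)
      have "N (f (sqi (Suc j) ?w)) \<le> N (f (sqi j ?w)) * N (f (sqi j ?w))"
        unfolding sqi_simps f_mult[OF wj wjc] using wjc by (intro N_mult) auto
      also have "\<dots> \<le> (N X)\<^sup>2 ^ (2 ^ j) * (N X)\<^sup>2 ^ (2 ^ j)" using Suc wjc by (intro mult_mono) auto
      also have "\<dots> = (N X)\<^sup>2 ^ (2 ^ Suc j)" by (simp only: power_add[symmetric] power_Suc mult_2)
      finally show ?case .
    qed
    let ?W = "sqi j ?w"
    obtain c where c: "star A (s \<mu>) \<otimes> ?W \<otimes> s \<nu> = c \<odot> (if src \<Lambda> \<mu> = src \<Lambda> \<nu> then s (src \<Lambda> \<mu>) else \<zero>)"
      using core_corner[OF wj mn] by blast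
    show ?thesis
    proof (cases "src \<Lambda> \<mu> = src \<Lambda> \<nu>")
      case False
      then show ?thesis using c by simp
    next
      case True
      have cv: "star A (s \<mu>) \<otimes> ?W \<otimes> s \<nu> = c \<odot> s v" using c True by (simp add: v_def)
      have T: "\<mu> \<in> T n v" "\<nu> \<in> T n v" unfolding T_def[OF \<kappa>] using mn True by (simp_all add: v_def)
      have k: "src \<Lambda> \<mu> = rng \<Lambda> \<kappa>" "src \<Lambda> \<nu> = rng \<Lambda> \<kappa>" "\<mu> \<diamondop> \<kappa> \<in> mor \<Lambda>" "\<nu> \<diamondop> \<kappa> \<in> mor \<Lambda>"
        using True \<kappa> m by (simp_all add: v_def)
      \<comment> \<open>Moving the scalar from v to the source of \<kappa> turns the corner at
        \<mu>, \<nu> into the corner at \<mu> \<kappa>, \<nu> \<kappa>, where R acts as the identity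
        and can be inserted.\<close>
      have "c \<odot> s (src \<Lambda> \<kappa>) = star A (s \<kappa>) \<otimes> (c \<odot> s v) \<otimes> s \<kappa>"
      proof -
        have "star A (s \<kappa>) \<otimes> (c \<odot> s v) \<otimes> s \<kappa> = c \<odot> (star A (s \<kappa>) \<otimes> (s v \<otimes> s \<kappa>))"
          using v \<kappa>(1) by (simp add: mult_smult_l mult_smult_r mult_assoc)
        also have "s v \<otimes> s \<kappa> = s \<kappa>" using s_rng[OF \<kappa>(1)] \<kappa>(2) by simp
        finally show ?thesis using \<kappa>(1) by (simp add: star_s_s)
      qed
      also have "\<dots> = star A (s (\<mu> \<diamondop> \<kappa>)) \<otimes> ?W \<otimes> s (\<nu> \<diamondop> \<kappa>)"
        unfolding cv[symmetric] using m(1,2) \<kappa>(1) k wjc by (simp add: s_comp star_mult mult_assoc)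
      also have "\<dots> = (star A (s (\<mu> \<diamondop> \<kappa>)) \<otimes> ?R) \<otimes> ?W \<otimes> (?R \<otimes> s (\<nu> \<diamondop> \<kappa>))"
        unfolding s_R[OF \<kappa> T(1)] R_s[OF \<kappa> T(2)] ..
      also have "\<dots> = star A (s (\<mu> \<diamondop> \<kappa>)) \<otimes> f ?W \<otimes> s (\<nu> \<diamondop> \<kappa>)"
        unfolding f_def using k(3,4) Rc wjc by (simp only: mult_assoc mult_closed s_closed star_closed)
      finally have eq: "c \<odot> s (src \<Lambda> \<kappa>) = star A (s (\<mu> \<diamondop> \<kappa>)) \<otimes> f ?W \<otimes> s (\<nu> \<diamondop> \<kappa>)" .
      \<comment> \<open>The decisive comparison: at a vertex projection \<open>nrm A\<close> is at
        most 1 and \<open>N\<close> is exactly 1.\<close>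
      have "nrm A (star A (s \<mu>) \<otimes> ?W \<otimes> s \<nu>) \<le> cmod c * 1"
        unfolding cv using v projection_nrm_le[OF s_vertex[OF v]] by (simp add: nrm_smult mult_left_le)
      also have "\<dots> = N (c \<odot> s (src \<Lambda> \<kappa>))" using \<kappa>(1) by (simp add: N_smult N_vertex_1)
      also have "\<dots> \<le> N (s (\<mu> \<diamondop> \<kappa>)) * N (f ?W) * N (s (\<nu> \<diamondop> \<kappa>))"
        unfolding eq using k(3,4) wjc N_mult[of "star A (s (\<mu> \<diamondop> \<kappa>))" "f ?W"]
        by (intro order_trans[OF N_mult] mult_right_mono) auto
      also have "\<dots> \<le> 1 * N (f ?W) * 1"
        using k(3,4) wjc by (intro mult_mono N_s_le) auto
      also have "\<dots> \<le> (N X)\<^sup>2 ^ (2 ^ j)" using fj[of j] by simp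
      finally show ?thesis .
    qed
  qed
  note corner = this
  let ?w = "star A y \<otimes> y"
  let ?k = "real (card (paths \<Lambda> n))"
  have yn: "y \<in> lin (GN n 0)" using n[OF I(2)] d0 by (simp add: y_def)
  \<comment> \<open>The factor 2^j and the exponent 1 are slack that matches the form expected by
    \<open>le_of_power_le\<close>.\<close>
  have "nrm A ?w ^ (2 ^ j) \<le> (?k * ?k * 2 ^ j) ^ 1 * (N X)\<^sup>2 ^ (2 ^ j)" for j
  proof -
    have "sqi j ?w \<in> lin (GN n 0)"
      by (rule sqi_invariant[OF core_mult[OF core_star[OF yn] yn] core_mult])
    from core_nrm_le[OF this corner] have "nrm A (sqi j ?w) \<le> ?k * (?k * (N X)\<^sup>2 ^ (2 ^ j))" .
    also have "\<dots> = (?k * ?k * 1) * (N X)\<^sup>2 ^ (2 ^ j)" by simp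
    also have "\<dots> \<le> (?k * ?k * 2 ^ j) * (N X)\<^sup>2 ^ (2 ^ j)"
      by (intro mult_right_mono mult_left_mono) auto
    finally show ?thesis using yc by (simp add: nrm_sqi star_mult)
  qed
  then have "nrm A ?w \<le> (N X)\<^sup>2" by (rule le_of_power_le[OF zero_le_power2])
  then have "(nrm A y)\<^sup>2 \<le> (N X)\<^sup>2" using cstar_identity[OF yc] by simp
  then have "nrm A y \<le> N X" by (rule power2_le_imp_le) (use Xc in simp)
  then show ?thesis by (simp add: y_def X_def)
qed

end

section \<open>Boxes of integer degrees\<close>

definition int_box :: "nat \<Rightarrow> (int ^ 'k::finite) set" where
  "int_box r = {d. \<forall>i. \<bar>d $ i\<bar> \<le> int r}"

lemma int_box_subset: "int_box r \<subseteq> vec_lambda ` (PiE (UNIV :: 'k::finite set) (\<lambda>_. {- int r..int r}))"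
proof
  fix d :: "int ^ 'k" assume d: "d \<in> int_box r"
  show "d \<in> vec_lambda ` (PiE UNIV (\<lambda>_. {- int r..int r}))"
  proof (rule image_eqI[of _ _ "\<lambda>i. d $ i"])
    have "- int r \<le> d $ i \<and> d $ i \<le> int r" for i
    proof -
      have "\<bar>d $ i\<bar> \<le> int r" using d by (simp add: int_box_def)
      then show ?thesis by linarith
    qed
    then show "(\<lambda>i. d $ i) \<in> PiE UNIV (\<lambda>_. {- int r..int r})" by (simp add: PiE_UNIV_domain)
  qed simp
qed

lemma finite_int_box [simp]: "finite (int_box r :: (int ^ 'k::finite) set)"
  by (rule finite_subset[OF int_box_subset]) (intro finite_imageI finite_PiE, auto)

lemma card_int_box_le: "card (int_box r :: (int ^ 'k::finite) set) \<le> (2 * r + 1) ^ CARD('k)"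
proof -
  have "card (int_box r :: (int ^ 'k) set) \<le> card (PiE (UNIV :: 'k set) (\<lambda>_. {- int r..int r}))"
    by (rule order_trans[OF card_mono[OF _ int_box_subset] card_image_le]) (intro finite_imageI finite_PiE, auto)+
  also have "\<dots> = (2 * r + 1) ^ CARD('k)" 
  proof -
    have "nat (int r + int r + 1) = 2 * r + 1" by linarith
    then show ?thesis by (simp add: card_PiE nat_add_distrib nat_mult_distrib)
  qed
  finally show ?thesis .
qed

lemma int_box_add: "d \<in> int_box r \<Longrightarrow> d' \<in> int_box r' \<Longrightarrow> d + d' \<in> int_box (r + r')"
  unfolding int_box_def by (auto intro: order_trans[OF abs_triangle_ineq] add_mono)

lemma int_box_uminus: "d \<in> int_box r \<Longrightarrow> - d \<in> int_box r"
  by (simp add: int_box_def)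

lemma int_box_mono: "r \<le> r' \<Longrightarrow> int_box r \<subseteq> int_box r'"
  unfolding int_box_def by (auto intro: order_trans)

lemma in_some_int_box: "\<exists>r. (d :: int ^ 'k::finite) \<in> int_box r"
proof
  show "d \<in> int_box (nat (\<Sum>i\<in>UNIV. \<bar>d $ i\<bar>))"
    unfolding int_box_def using member_le_sum[of _ UNIV "\<lambda>i. \<bar>d $ i\<bar>"] by (auto simp: sum_nonneg)
qed

section \<open>Norm closure of a star-subalgebra\<close>

context cstar_algebra begin

lemma minus_add_cancel: "\<lbrakk>x \<in> carrier A; y \<in> carrier A\<rbrakk> \<Longrightarrow> (x \<ominus> y) \<oplus> y = x"
  by (simp add: a_minus_def a_assoc l_neg)

lemma minus_add_minus:
  "\<lbrakk>x \<in> carrier A; y \<in> carrier A; z \<in> carrier A\<rbrakk> \<Longrightarrow> (x \<ominus> y) \<oplus> (y \<ominus> z) = x \<ominus> z"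
  by (simp add: a_minus_def a_assoc r_neg1)

lemma nrm_minus_commute: "\<lbrakk>x \<in> carrier A; y \<in> carrier A\<rbrakk> \<Longrightarrow> nrm A (x \<ominus> y) = nrm A (y \<ominus> x)"
proof -
  assume xy: "x \<in> carrier A" "y \<in> carrier A"
  have "(-1) \<odot> (y \<ominus> x) = x \<ominus> y"
    using xy smult_assoc[of x "-1" "-1"] by (simp add: minus_smult smult_r_distr smult_one a_comm)
  then show ?thesis using xy nrm_smult[of "y \<ominus> x" "-1"] by simp
qed

definition near :: "'a set \<Rightarrow> 'a set" where
  "near S = {x \<in> carrier A. \<forall>e>0. \<exists>y\<in>S. nrm A (x \<ominus> y) < e}"

lemma nearD: "\<lbrakk>x \<in> near S; e > 0\<rbrakk> \<Longrightarrow> \<exists>y\<in>S. nrm A (x \<ominus> y) < e"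
  by (simp add: near_def)

lemma near_subalgebra:
  assumes S: "S \<subseteq> carrier A" "\<zero> \<in> S"
    and star: "\<And>x. x \<in> S \<Longrightarrow> star A x \<in> S" and smult: "\<And>c x. x \<in> S \<Longrightarrow> c \<odot> x \<in> S"
    and add: "\<And>x y. \<lbrakk>x \<in> S; y \<in> S\<rbrakk> \<Longrightarrow> x \<oplus> y \<in> S" and mult: "\<And>x y. \<lbrakk>x \<in> S; y \<in> S\<rbrakk> \<Longrightarrow> x \<otimes> y \<in> S"
  shows "cstar_subalgebra A (near S)" "S \<subseteq> near S"
proof -
  have near_closed: "x \<in> carrier A" if "x \<in> near S" for x using that by (simp add: near_def)
  have Sc: "x \<in> carrier A" if "x \<in> S" for x using that S by blast
  have nearI: "x \<in> near S" if "x \<in> carrier A" "\<And>e. e > 0 \<Longrightarrow> \<exists>y\<in>S. nrm A (x \<ominus> y) < e" for x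
    using that unfolding near_def by simp
  have self: "nrm A (x \<ominus> x) = 0" if "x \<in> carrier A" for x
    using that by (simp add: a_minus_def r_neg)
  show sub: "S \<subseteq> near S"
  proof
    fix x assume x: "x \<in> S"
    show "x \<in> near S" by (rule nearI[OF Sc[OF x]], rule bexI[OF _ x]) (simp add: self Sc[OF x])
  qed
  have near_star: "star A x \<in> near S" if x: "x \<in> near S" for x
  proof (rule nearI)
    fix e :: real assume "e > 0"
    then obtain y where y: "y \<in> S" "nrm A (x \<ominus> y) < e" using nearD[OF x] by blast
    have "star A x \<ominus> star A y = star A (x \<ominus> y)"
      using near_closed[OF x] Sc[OF y(1)] by (simp add: minus_smult star_add star_smult)
    then show "\<exists>y\<in>S. nrm A (star A x \<ominus> y) < e"
      using y near_closed[OF x] Sc[OF y(1)] by (intro bexI[OF _ star[OF y(1)]]) simp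
  qed (use near_closed[OF x] in simp)
  have near_smult: "c \<odot> x \<in> near S" if x: "x \<in> near S" for c x
  proof (rule nearI)
    fix e :: real assume e: "e > 0"
    then have "e / (cmod c + 1) > 0" by (simp add: add_nonneg_pos)
    then obtain y where y: "y \<in> S" "nrm A (x \<ominus> y) < e / (cmod c + 1)" using nearD[OF x] by blast
    have "c \<odot> x \<ominus> c \<odot> y = c \<odot> (x \<ominus> y)"
      using near_closed[OF x] Sc[OF y(1)] smult_assoc[of y c "-1"] smult_assoc[of y "-1" c]
      by (simp add: minus_smult smult_r_distr)
    then have "nrm A (c \<odot> x \<ominus> c \<odot> y) = cmod c * nrm A (x \<ominus> y)"
      using near_closed[OF x] Sc[OF y(1)] by (simp add: nrm_smult)
    also have "\<dots> \<le> cmod c * (e / (cmod c + 1))" using y(2) by (intro mult_left_mono) auto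
    also have "\<dots> < e" using e by (simp add: divide_simps add_nonneg_pos)
    finally show "\<exists>y\<in>S. nrm A (c \<odot> x \<ominus> y) < e" by (rule bexI[OF _ smult[OF y(1)]])
  qed (use near_closed[OF x] in simp)
  have near_add: "x \<oplus> x' \<in> near S" if x: "x \<in> near S" "x' \<in> near S" for x x'
  proof (rule nearI)
    fix e :: real assume "e > 0"
    then have "e / 2 > 0" by simp
    then obtain y y' where y: "y \<in> S" "nrm A (x \<ominus> y) < e / 2" and y': "y' \<in> S" "nrm A (x' \<ominus> y') < e / 2"
      using nearD[OF x(1)] nearD[OF x(2)] by meson
    note c = near_closed[OF x(1)] near_closed[OF x(2)] Sc[OF y(1)] Sc[OF y'(1)]
    have "x \<oplus> x' \<ominus> (y \<oplus> y') = (x \<ominus> y) \<oplus> (x' \<ominus> y')"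
      using c by (simp add: minus_smult smult_r_distr a_ac)
    then have "nrm A (x \<oplus> x' \<ominus> (y \<oplus> y')) \<le> nrm A (x \<ominus> y) + nrm A (x' \<ominus> y')"
      using c by (simp add: nrm_triangle)
    also have "\<dots> < e" using y y' by simp
    finally show "\<exists>y\<in>S. nrm A (x \<oplus> x' \<ominus> y) < e" by (rule bexI[OF _ add[OF y(1) y'(1)]])
  qed (use near_closed[OF x(1)] near_closed[OF x(2)] in simp)
  have near_mult: "x \<otimes> x' \<in> near S" if x: "x \<in> near S" "x' \<in> near S" for x x'
  proof (rule nearI)
    fix e :: real assume e: "e > 0"
    note xc = near_closed[OF x(1)] near_closed[OF x(2)]
    \<comment> \<open>An approximant within 1 of x has norm at most B, and the choice of h makes
      each of the two error terms at most e/2.\<close>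
    define B where "B = nrm A x + nrm A x' + 2"
    have B: "B \<ge> 2" using xc by (simp add: B_def)
    define h where "h = min 1 (e / (2 * B))"
    have h: "h > 0" "h \<le> 1" using e B by (simp_all add: h_def)
    have "h * B \<le> e / (2 * B) * B" using B by (intro mult_right_mono) (simp_all add: h_def)
    then have hB: "h * B \<le> e / 2" using B by simp
    obtain y y' where y: "y \<in> S" "nrm A (x \<ominus> y) < h" and y': "y' \<in> S" "nrm A (x' \<ominus> y') < h"
      using nearD[OF x(1) h(1)] nearD[OF x(2) h(1)] by blast
    note c = xc Sc[OF y(1)] Sc[OF y'(1)]
    have "nrm A y \<le> nrm A (y \<ominus> x) + nrm A x"
      using nrm_triangle[of "y \<ominus> x" x] minus_add_cancel[of y x] c by simp
    moreover have "nrm A (y \<ominus> x) < h" using y(2) c nrm_minus_commute[of x y] by simp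
    ultimately have ny: "nrm A y \<le> B" using h(2) nrm_nonneg[OF xc(2)] unfolding B_def by linarith
    have "(x \<ominus> y) \<otimes> x' \<oplus> y \<otimes> (x' \<ominus> y') = (x \<otimes> x' \<ominus> y \<otimes> x') \<oplus> (y \<otimes> x' \<ominus> y \<otimes> y')"
      using c by (simp add: minus_smult mult_l_distr mult_r_distr mult_smult_l mult_smult_r)
    also have "\<dots> = x \<otimes> x' \<ominus> y \<otimes> y'" using c by (intro minus_add_minus) auto
    finally have "nrm A (x \<otimes> x' \<ominus> y \<otimes> y') \<le> nrm A ((x \<ominus> y) \<otimes> x') + nrm A (y \<otimes> (x' \<ominus> y'))"
      using nrm_triangle[of "(x \<ominus> y) \<otimes> x'" "y \<otimes> (x' \<ominus> y')"] c by simp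
    also have "\<dots> \<le> nrm A (x \<ominus> y) * nrm A x' + nrm A y * nrm A (x' \<ominus> y')"
      using c by (intro add_mono nrm_mult) auto
    also have "\<dots> \<le> nrm A (x \<ominus> y) * B + B * nrm A (x' \<ominus> y')"
      using c ny by (intro add_mono mult_left_mono mult_right_mono) (auto simp: B_def)
    also have "\<dots> < h * B + B * h"
      using y(2) y'(2) B by (intro add_strict_mono mult_strict_right_mono mult_strict_left_mono) auto
    also have "\<dots> \<le> e" using hB by (simp add: mult.commute)
    finally show "\<exists>y\<in>S. nrm A (x \<otimes> x' \<ominus> y) < e" by (rule bexI[OF _ mult[OF y(1) y'(1)]])
  qed (use near_closed[OF x(1)] near_closed[OF x(2)] in simp)
  have near_limit: "l \<in> near S" if l: "l \<in> carrier A" and a: "\<And>n. a n \<in> near S"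
    and lim: "(\<lambda>n. nrm A (a n \<ominus> l)) \<longlonglongrightarrow> 0" for a :: "nat \<Rightarrow> 'a" and l
  proof (rule nearI[OF l])
    fix e :: real assume e: "e > 0"
    then obtain n where n: "nrm A (a n \<ominus> l) < e / 2"
      using order_tendstoD(2)[OF lim, of "e/2"] by (auto simp: eventually_sequentially)
    obtain y where y: "y \<in> S" "nrm A (a n \<ominus> y) < e / 2" using nearD[OF a, of "e/2"] e by force
    note c = l near_closed[OF a[of n]] Sc[OF y(1)]
    have "nrm A (l \<ominus> y) \<le> nrm A (l \<ominus> a n) + nrm A (a n \<ominus> y)"
      using nrm_triangle[of "l \<ominus> a n" "a n \<ominus> y"] minus_add_minus[of l "a n" y] c by simp
    also have "\<dots> < e" using n y(2) nrm_minus_commute[of l "a n"] c by simp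
    finally show "\<exists>y\<in>S. nrm A (l \<ominus> y) < e" by (rule bexI[OF _ y(1)])
  qed
  show "cstar_subalgebra A (near S)"
    unfolding cstar_subalgebra_def
  proof (intro conjI ballI allI impI near_star near_smult near_add near_mult)
    show "near S \<subseteq> carrier A" using near_closed by blast
    show "\<zero> \<in> near S" using S(2) sub by blast
    show "l \<in> near S" if "l \<in> carrier A" "\<forall>n. a n \<in> near S" "(\<lambda>n. nrm A (a n \<ominus> l)) \<longlonglongrightarrow> 0"
      for a :: "nat \<Rightarrow> 'a" and l
      by (rule near_limit[OF that(1) spec[OF that(2)] that(3)])
  qed
qed

end

section \<open>Comparison of \<open>nrm A\<close> and \<open>N\<close> on the graded span\<close>

context CK_seminorm begin

lemma component_estimate:
  assumes I: "finite I" "i0 \<in> I" and x: "\<And>i. i \<in> I \<Longrightarrow> x i \<in> lin (G (d i))" and inj: "inj_on d I"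
  shows "nrm A (x i0) \<le> C * N (\<Oplus>i\<in>I. x i)"
proof -
  define X where "X = (\<Oplus>i\<in>I. x i)"
  define y where "y = x i0"
  have xc: "x i \<in> carrier A" if "i \<in> I" for i using lin_closed[OF G_closed x[OF that]] .
  have Xc: "X \<in> carrier A" unfolding X_def using xc by (intro finsum_closed) auto
  have yc: "y \<in> carrier A" using xc I(2) by (simp add: y_def)
  have yG: "star A y \<in> lin (G (- d i0))" unfolding y_def by (rule lin_G_star[OF x[OF I(2)]])
  have "nrm A (star A y \<otimes> x i0) \<le> N (\<Oplus>i\<in>I. star A y \<otimes> x i)"
  proof (rule core_estimate[OF I, where d="\<lambda>i. - d i0 + d i"])
    show "star A y \<otimes> x i \<in> lin (G (- d i0 + d i))" if "i \<in> I" for i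
      by (rule lin_G_mult[OF yG x[OF that]])
    show "- d i0 + d i \<noteq> 0" if "i \<in> I" "i \<noteq> i0" for i
    proof
      assume "- d i0 + d i = 0"
      then have "d i = d i0" by (simp add: add_eq_0_iff)
      then show False using inj_onD[OF inj _ that(1) I(2)] that(2) by blast
    qed
  qed simp
  also have "(\<Oplus>i\<in>I. star A y \<otimes> x i) = star A y \<otimes> X"
    unfolding X_def using I(1) xc yc by (intro finsum_mult_left[symmetric]) auto
  also have "N \<dots> \<le> N (star A y) * N X" using yc Xc by (intro N_mult) auto
  also have "\<dots> \<le> (C * nrm A y) * N X" using N_le[OF yc] yc Xc by (intro mult_right_mono) auto
  finally have "nrm A (star A y \<otimes> y) \<le> (C * nrm A y) * N X" unfolding y_def .
  then have "nrm A y * nrm A y \<le> nrm A y * (C * N X)"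
    unfolding cstar_identity[OF yc] by (simp add: power2_eq_square ac_simps)
  moreover have "0 \<le> C * N X" using C_nonneg Xc by simp
  ultimately have "nrm A y \<le> C * N X"
    using nrm_nonneg[OF yc] mult_le_cancel_left_pos[of "nrm A y" "nrm A y" "C * N X"]
    by (cases "nrm A y = 0") simp_all
  then show ?thesis by (simp add: X_def y_def)
qed

definition W :: "nat \<Rightarrow> 'a set" where "W r = lin (\<Union>d\<in>int_box r. G d)"

lemma WG_closed: "(\<Union>d\<in>S. G d) \<subseteq> carrier A" using G_closed by blast

lemma W_closed: "x \<in> W r \<Longrightarrow> x \<in> carrier A" unfolding W_def by (rule lin_closed[OF WG_closed])

lemma lin_G_W: "x \<in> lin (G d) \<Longrightarrow> d \<in> int_box r \<Longrightarrow> x \<in> W r"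
  unfolding W_def by (rule lin_mono[OF G_closed WG_closed], assumption, rule lin_base[OF WG_closed], blast)

lemma W_star: "x \<in> W r \<Longrightarrow> star A x \<in> W r"
proof -
  assume x: "x \<in> W r"
  show ?thesis
    unfolding W_def
  proof (rule lin_star[OF WG_closed WG_closed x[unfolded W_def]])
    fix g assume "g \<in> (\<Union>d\<in>int_box r. G d)"
    then obtain d where "d \<in> int_box r" "g \<in> G d" by blast
    then have "star A g \<in> (\<Union>d\<in>int_box r. G d)" using G_star int_box_uminus by blast
    then show "star A g \<in> lin (\<Union>d\<in>int_box r. G d)" by (rule lin_base[OF WG_closed])
  qed
qed

lemma W_mult: "x \<in> W r \<Longrightarrow> y \<in> W r' \<Longrightarrow> x \<otimes> y \<in> W (r + r')"
proof -
  assume x: "x \<in> W r" and y: "y \<in> W r'"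
  have "x \<otimes> y \<in> lin (\<Union>d\<in>int_box (r + r'). G d)"
  proof (rule lin_mult[OF WG_closed WG_closed WG_closed x[unfolded W_def] y[unfolded W_def]])
    fix g h assume "g \<in> (\<Union>d\<in>int_box r. G d)" "h \<in> (\<Union>d\<in>int_box r'. G d)"
    then obtain d d' where d: "d \<in> int_box r" "g \<in> G d" "d' \<in> int_box r'" "h \<in> G d'" by blast
    show "g \<otimes> h \<in> lin (\<Union>d\<in>int_box (r + r'). G d)"
      by (rule lin_G_W[OF G_mult[OF d(2,4)] int_box_add[OF d(1,3)], unfolded W_def])
  qed
  then show ?thesis by (simp add: W_def)
qed

lemma W_estimate:
  assumes x: "x \<in> W r"
  shows "nrm A x \<le> real ((2 * r + 1) ^ CARD('k)) * (C * N x)"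
proof -
  obtain f where f: "\<And>d. d \<in> int_box r \<Longrightarrow> f d \<in> lin (G d)" and xf: "x = (\<Oplus>d\<in>int_box r. f d)"
    using lin_Union[OF G_closed finite_int_box x[unfolded W_def]] by blast
  have fc: "f d \<in> carrier A" if "d \<in> int_box r" for d using lin_closed[OF G_closed f[OF that]] .
  have "nrm A x \<le> (\<Sum>d\<in>(int_box r :: (int ^ 'k) set). nrm A (f d))"
    unfolding xf using fc by (intro nrm_finsum_le) auto
  also have "\<dots> \<le> (\<Sum>d\<in>(int_box r :: (int ^ 'k) set). C * N x)"
    unfolding xf by (intro sum_mono component_estimate[where d="\<lambda>d. d"] f) auto
  also have "\<dots> = real (card (int_box r :: (int ^ 'k) set)) * (C * N x)" by simp
  also have "\<dots> \<le> real ((2 * r + 1) ^ CARD('k)) * (C * N x)"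
    using card_int_box_le[where 'k='k] C_nonneg W_closed[OF x] by (intro mult_right_mono of_nat_mono) auto
  finally show ?thesis .
qed

text \<open>
  The factor in \<open>W_estimate\<close> grows only polynomially when \<open>x\<close> is replaced by a power of \<open>x\<^sup>* x\<close>, so it
  disappears in the limit of the roots.
\<close>

lemma W_nrm_le:
  assumes b: "b \<in> W r" shows "nrm A b \<le> N b"
proof -
  define w where "w = star A b \<otimes> b"
  have bc: "b \<in> carrier A" by (rule W_closed[OF b])
  have w: "w \<in> carrier A" "star A w = w" using bc by (simp_all add: w_def star_mult)
  \<comment> \<open>The inner factor 2 comes from b^* b, and each squaring doubles the radius of the
    box.\<close>
  have wj: "sqi j w \<in> W (2 ^ j * (2 * r))" for j
  proof (induction j)
    case 0 then show ?case using W_mult[OF W_star[OF b] b] by (simp add: w_def mult_2)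
  next
    case (Suc j) then show ?case using W_mult[OF Suc Suc] by (simp add: mult_2[symmetric] mult.assoc)
  qed
  have "nrm A w ^ (2 ^ j) \<le> ((C + 1) * (4 * real r + 1) * 2 ^ j) ^ CARD('k) * N w ^ (2 ^ j)" for j
  proof -
    let ?k = "CARD('k)"
    have k: "?k \<ge> 1" by (simp add: Suc_leI)
    have "nrm A w ^ (2 ^ j) \<le> real ((2 * (2 ^ j * (2 * r)) + 1) ^ ?k) * (C * N w ^ (2 ^ j))"
      using W_estimate[OF wj] unfolding nrm_sqi[OF w] N_sqi[OF w] .
    also have "\<dots> = C * (4 * real r * 2 ^ j + 1) ^ ?k * N w ^ (2 ^ j)"
      by (simp add: ac_simps)
    \<comment> \<open>Weakened to the shape (c 2^j)^k, with one constant c for all j.\<close>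
    also have "\<dots> \<le> (C + 1) ^ ?k * ((4 * real r + 1) * 2 ^ j) ^ ?k * N w ^ (2 ^ j)"
    proof (intro mult_right_mono mult_mono)
      have "C \<le> C + 1" by simp
      also have "\<dots> \<le> (C + 1) ^ ?k" using k C_nonneg by (intro self_le_power) auto
      finally show "C \<le> (C + 1) ^ ?k" .
      show "(4 * real r * 2 ^ j + 1) ^ ?k \<le> ((4 * real r + 1) * 2 ^ j) ^ ?k"
        by (intro power_mono) (auto simp: distrib_right)
    qed (use C_nonneg w in auto)
    also have "\<dots> = ((C + 1) * (4 * real r + 1) * 2 ^ j) ^ ?k * N w ^ (2 ^ j)"
      by (simp add: power_mult_distrib)
    finally show ?thesis .
  qed
  then have "nrm A w \<le> N w" by (rule le_of_power_le[OF N_nonneg[OF w(1)]])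
  then have "(nrm A b)\<^sup>2 \<le> (N b)\<^sup>2" unfolding w_def cstar_identity[OF bc] N_cstar[OF bc] .
  then show ?thesis by (rule power2_le_imp_le) (simp add: bc)
qed

lemma in_some_W: "x \<in> lin (\<Union>d. G d) \<Longrightarrow> \<exists>r. x \<in> W r"
proof (induction rule: lin.induct)
  case lin_zero
  then show ?case by (auto simp: W_def intro: lin.lin_zero)
next
  case (lin_step g y c)
  obtain d where d: "g \<in> G d" using lin_step(1) by blast
  obtain r where r: "d \<in> int_box r" using in_some_int_box by blast
  obtain r' where r': "y \<in> W r'" using lin_step(3) by blast
  have 1: "g \<in> W (r + r')"
    by (rule lin_G_W[OF lin_base[OF G_closed d]]) (use r int_box_mono[of r "r + r'"] in auto)
  have "y \<in> lin (\<Union>d\<in>int_box (r + r'). G d)"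
  proof (rule lin_mono[OF WG_closed WG_closed r'[unfolded W_def]])
    fix g assume "g \<in> (\<Union>d\<in>int_box r'. G d)"
    then have "g \<in> (\<Union>d\<in>int_box (r + r'). G d)" using int_box_mono[of r' "r + r'"] by auto
    then show "g \<in> lin (\<Union>d\<in>int_box (r + r'). G d)" by (rule lin_base[OF WG_closed])
  qed
  then have "c \<odot> g \<oplus> y \<in> W (r + r')"
    using 1 unfolding W_def by (intro lin_add[OF WG_closed] lin_smult[OF WG_closed])
  then show ?case by blast
qed

text \<open>The span of the homogeneous generators is a star-subalgebra containing every
  \<open>s \<mu>\<close>, so its closure is the whole algebra. The inequality extends from it by
  continuity, for which \<open>N_le\<close> is needed.\<close>

theorem nrm_le_N:
  assumes gen: "cstar_generated A (s ` mor \<Lambda>) = carrier A" and x: "x \<in> carrier A"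
  shows "nrm A x \<le> N x"
proof -
  let ?S = "lin (\<Union>d. G d)"
  have UG: "(\<Union>d. G d) \<subseteq> carrier A" using G_closed by blast
  have S: "?S \<subseteq> carrier A" using lin_closed[OF UG] by blast
  have S_star: "star A x \<in> ?S" if "x \<in> ?S" for x
    by (rule lin_star[OF UG UG that]) (use G_star lin_base[OF UG] in blast)
  have S_mult: "x \<otimes> y \<in> ?S" if "x \<in> ?S" "y \<in> ?S" for x y
  proof (rule lin_mult[OF UG UG UG that])
    fix g h assume "g \<in> (\<Union>d. G d)" "h \<in> (\<Union>d. G d)"
    then obtain d d' where "g \<in> G d" "h \<in> G d'" by blast
    then have "g \<otimes> h \<in> lin (G (d + d'))" by (rule G_mult)
    then show "g \<otimes> h \<in> ?S" by (rule lin_mono[OF G_closed UG]) (use lin_base[OF UG] in blast)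
  qed
  have sub: "cstar_subalgebra A (near ?S)" "?S \<subseteq> near ?S"
    by (rule near_subalgebra[OF S lin_zero S_star lin_smult[OF UG] lin_add[OF UG] S_mult]; assumption)+
  have "s ` mor \<Lambda> \<subseteq> ?S"
  proof
    fix y assume "y \<in> s ` mor \<Lambda>"
    then obtain \<mu> where \<mu>: "\<mu> \<in> mor \<Lambda>" "y = s \<mu>" by blast
    have "s \<mu> = s \<mu> \<otimes> star A (s (src \<Lambda> \<mu>))" using \<mu>(1) by simp
    then have "s \<mu> \<in> G (zdeg (deg \<Lambda> \<mu>) - zdeg (deg \<Lambda> (src \<Lambda> \<mu>)))"
      unfolding G_def using \<mu>(1) by (intro CollectI exI[of _ \<mu>] exI[of _ "src \<Lambda> \<mu>"]) simp
    then show "y \<in> ?S" unfolding \<mu>(2) using lin_base[OF UG] by blast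
  qed
  then have "near ?S \<in> {K. cstar_subalgebra A K \<and> s ` mor \<Lambda> \<subseteq> K}" using sub by blast
  then have "cstar_generated A (s ` mor \<Lambda>) \<subseteq> near ?S" unfolding cstar_generated_def by (rule Inter_lower)
  then have near: "x \<in> near ?S" using x gen by blast
  show ?thesis
  proof (rule field_le_epsilon)
    fix e :: real assume e: "e > 0"
    have C: "C + 1 > 0" using C_nonneg by simp
    \<comment> \<open>The approximation error enters once through \<open>nrm A\<close> and C times
      through \<open>N\<close>.\<close>
    then have "e / (C + 1) > 0" using e by simp
    then obtain y where y: "y \<in> ?S" "nrm A (x \<ominus> y) < e / (C + 1)" using nearD[OF near] by blast
    have yc: "y \<in> carrier A" using y(1) S by blast
    have "nrm A y \<le> N y" using in_some_W[OF y(1)] W_nrm_le by blast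
    also have "\<dots> \<le> N (y \<ominus> x) + N x"
      using N_triangle[of "y \<ominus> x" x] minus_add_cancel[of y x] x yc by simp
    also have "N (y \<ominus> x) \<le> C * nrm A (x \<ominus> y)"
      using N_le[of "y \<ominus> x"] x yc nrm_minus_commute[of x y] by simp
    finally have "nrm A y \<le> C * nrm A (x \<ominus> y) + N x" by simp
    moreover have "nrm A x \<le> nrm A (x \<ominus> y) + nrm A y"
      using nrm_triangle[of "x \<ominus> y" y] minus_add_cancel[of x y] x yc by simp
    ultimately have "nrm A x \<le> (C + 1) * nrm A (x \<ominus> y) + N x" by (simp add: distrib_right)
    also have "(C + 1) * nrm A (x \<ominus> y) \<le> e" using y(2) C by (simp add: pos_less_divide_eq mult.commute)
    finally show "nrm A x \<le> N x + e" by simp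
  qed
qed

end

section \<open>Boundedness of star-homomorphisms into operators\<close>

context cstar_algebra begin

lemma half_double: "x \<in> carrier A \<Longrightarrow> (1/2) \<odot> x \<oplus> (1/2) \<odot> x = x"
  using smult_l_distr[of x "1/2" "1/2"] by (simp add: smult_one)

text \<open>As x and y need not commute, the difference of squares is split as x (x - y) + (x - y)
  y.\<close>

lemma sq_diff_le:
  assumes x: "x \<in> carrier A" and y: "y \<in> carrier A"
  shows "nrm A (x \<otimes> x \<ominus> y \<otimes> y) \<le> (nrm A x + nrm A y) * nrm A (x \<ominus> y)"
proof -
  have "x \<otimes> (x \<ominus> y) \<oplus> (x \<ominus> y) \<otimes> y = (x \<otimes> x \<ominus> x \<otimes> y) \<oplus> (x \<otimes> y \<ominus> y \<otimes> y)"
    using x y by (simp add: minus_smult mult_l_distr mult_r_distr mult_smult_l mult_smult_r)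
  also have "\<dots> = x \<otimes> x \<ominus> y \<otimes> y" using x y by (intro minus_add_minus) auto
  finally have "nrm A (x \<otimes> x \<ominus> y \<otimes> y) \<le> nrm A (x \<otimes> (x \<ominus> y)) + nrm A ((x \<ominus> y) \<otimes> y)"
    using nrm_triangle[of "x \<otimes> (x \<ominus> y)" "(x \<ominus> y) \<otimes> y"] x y by simp
  also have "\<dots> \<le> nrm A x * nrm A (x \<ominus> y) + nrm A (x \<ominus> y) * nrm A y"
    using x y by (intro add_mono nrm_mult) auto
  finally show ?thesis by (simp add: algebra_simps)
qed

text \<open>A square root of \<open>1 - h\<close>, written as \<open>1 - g\<close>, by Banach iteration; this form makes sense without a unit.\<close>

lemma quasi_sqrt:
  assumes h: "h \<in> carrier A" "star A h = h" and small: "nrm A h \<le> 1/4"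
  shows "\<exists>g\<in>carrier A. star A g = g \<and> g \<oplus> g = h \<oplus> g \<otimes> g"
proof -
  \<comment> \<open>A fixed point g satisfies 2 g = h + g^2, that is, (1 - g)^2 = 1 - h.\<close>
  define F where "F g = (1/2) \<odot> (h \<oplus> g \<otimes> g)" for g
  define G where "G n = (F ^^ n) \<zero>" for n
  have G_Suc: "G (Suc n) = F (G n)" for n by (simp add: G_def)
  have F_closed: "F g \<in> carrier A" if "g \<in> carrier A" for g using that h by (simp add: F_def)
  have F_diff: "nrm A (F x \<ominus> F y) \<le> 1/2 * ((nrm A x + nrm A y) * nrm A (x \<ominus> y))"
    if "x \<in> carrier A" "y \<in> carrier A" for x y
  proof -
    have "F x \<ominus> F y = (1/2) \<odot> h \<oplus> ((1/2) \<odot> (x \<otimes> x) \<oplus> ((-1) \<odot> ((1/2) \<odot> h) \<oplus> (-1) \<odot> ((1/2) \<odot> (y \<otimes> y))))"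
      using that h by (simp add: F_def minus_smult smult_r_distr a_assoc)
    also have "\<dots> = ((1/2) \<odot> (x \<otimes> x) \<ominus> (1/2) \<odot> (y \<otimes> y)) \<oplus> ((1/2) \<odot> h \<ominus> (1/2) \<odot> h)"
      using that h by (simp add: minus_smult a_ac)
    also have "(1/2) \<odot> h \<ominus> (1/2) \<odot> h = \<zero>" using h by (simp add: a_minus_def r_neg)
    also have "((1/2) \<odot> (x \<otimes> x) \<ominus> (1/2) \<odot> (y \<otimes> y)) \<oplus> \<zero> = (1/2) \<odot> (x \<otimes> x \<ominus> y \<otimes> y)"
      using that smult_assoc[of "y \<otimes> y" "1/2" "-1"] smult_assoc[of "y \<otimes> y" "-1" "1/2"]
      by (simp add: minus_smult smult_r_distr)
    finally have "nrm A (F x \<ominus> F y) = 1/2 * nrm A (x \<otimes> x \<ominus> y \<otimes> y)"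
      using that by (simp add: nrm_smult)
    then show ?thesis using sq_diff_le[OF that] by simp
  qed
  \<comment> \<open>F preserves the ball of radius 1/2 for self-adjoint elements, and there it has
    Lipschitz constant 1/2 by \<open>F_diff\<close>.\<close>
  have G: "G n \<in> carrier A \<and> star A (G n) = G n \<and> nrm A (G n) \<le> 1/2" for n
  proof (induction n)
    case (Suc n)
    have "nrm A (F (G n)) \<le> 1/2 * (nrm A h + nrm A (G n) * nrm A (G n))"
      using Suc h nrm_triangle[of h "G n \<otimes> G n"] nrm_mult[of "G n" "G n"] by (simp add: F_def nrm_smult)
    also have "\<dots> \<le> 1/2 * (1/4 + 1/2 * (1/2))"
      using Suc small by (intro mult_left_mono add_mono mult_mono) auto
    finally have "nrm A (F (G n)) \<le> 1/2" by simp
    then show ?case using Suc h by (simp add: G_Suc F_closed) (simp add: F_def star_smult star_add star_mult)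
  qed (simp add: G_def)
  have step: "nrm A (G (Suc n) \<ominus> G n) \<le> (1/2) ^ n" for n
  proof (induction n)
    case 0
    have "nrm A (G (Suc 0) \<ominus> \<zero>) \<le> 1" using G[of "Suc 0"] by (simp add: minus_smult)
    then show ?case by (simp add: G_def)
  next
    case (Suc n)
    have "nrm A (G (Suc (Suc n)) \<ominus> G (Suc n)) \<le> 1/2 * ((nrm A (G (Suc n)) + nrm A (G n)) * nrm A (G (Suc n) \<ominus> G n))"
      using F_diff[of "G (Suc n)" "G n"] G[of "Suc n"] G[of n] by (simp only: G_Suc)
    also have "\<dots> \<le> 1/2 * ((1/2 + 1/2) * (1/2) ^ n)"
      using G[of n] G[of "Suc n"] Suc by (intro mult_left_mono mult_mono add_mono) auto
    finally show ?case by simp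
  qed
  have tail: "nrm A (G (n + k) \<ominus> G n) \<le> 2 * (1/2) ^ n" for n k
  proof -
    \<comment> \<open>The factor 1 - 2^(-k) is the exact partial geometric sum and lets the
      induction close.\<close>
    have "nrm A (G (n + k) \<ominus> G n) \<le> 2 * (1/2) ^ n * (1 - (1/2) ^ k)"
    proof (induction k)
      case 0 then show ?case using G[of n] by (simp add: a_minus_def r_neg)
    next
      case (Suc k)
      have "nrm A (G (Suc (n + k)) \<ominus> G n) \<le> nrm A (G (Suc (n + k)) \<ominus> G (n + k)) + nrm A (G (n + k) \<ominus> G n)"
        using G nrm_triangle[of "G (Suc (n + k)) \<ominus> G (n + k)" "G (n + k) \<ominus> G n"]
          minus_add_minus[of "G (Suc (n + k))" "G (n + k)" "G n"] by simp
      also have "\<dots> \<le> (1/2) ^ (n + k) + 2 * (1/2) ^ n * (1 - (1/2) ^ k)" by (intro add_mono step Suc)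
      also have "\<dots> = 2 * (1/2) ^ n * (1 - (1/2) ^ Suc k)" by (simp add: power_add algebra_simps)
      finally show ?case by simp
    qed
    also have "\<dots> \<le> 2 * (1/2) ^ n * 1" by (intro mult_left_mono) auto
    finally show ?thesis by simp
  qed
  have cauchy: "\<forall>e>0. \<exists>M. \<forall>m\<ge>M. \<forall>n\<ge>M. nrm A (G m \<ominus> G n) < e"
  proof (intro allI impI)
    fix e :: real assume e: "e > 0"
    then obtain M where M: "(1/2) ^ M < e / 4" using real_arch_pow_inv[of "e/4" "1/2"] by auto
    have "nrm A (G m \<ominus> G n) < e" if "m \<ge> M" "n \<ge> M" for m n
    proof -
      have "nrm A (G m \<ominus> G n) \<le> nrm A (G m \<ominus> G M) + nrm A (G M \<ominus> G n)"
        using G nrm_triangle[of "G m \<ominus> G M" "G M \<ominus> G n"] minus_add_minus[of "G m" "G M" "G n"] by simp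
      also have "\<dots> \<le> 2 * (1/2) ^ M + 2 * (1/2) ^ M"
        using tail[of M "m - M"] tail[of M "n - M"] that nrm_minus_commute[of "G M" "G n"] G by (intro add_mono) auto
      also have "\<dots> < e" using M by simp
      finally show ?thesis .
    qed
    then show "\<exists>M. \<forall>m\<ge>M. \<forall>n\<ge>M. nrm A (G m \<ominus> G n) < e" by blast
  qed
  have Gc: "G n \<in> carrier A" for n using G by blast
  obtain g where g: "g \<in> carrier A" and lim: "(\<lambda>n. nrm A (G n \<ominus> g)) \<longlonglongrightarrow> 0"
    using complete[OF Gc cauchy] by blast
  \<comment> \<open>The index map f is there because the fixed point equation is tested on the
    shifted sequence.\<close>
  have lim_unique: "l = l'" if "l \<in> carrier A" "l' \<in> carrier A" "(\<lambda>n. nrm A (G (f n) \<ominus> l)) \<longlonglongrightarrow> 0"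
    "(\<lambda>n. nrm A (G (f n) \<ominus> l')) \<longlonglongrightarrow> 0" for l l' and f :: "nat \<Rightarrow> nat"
  proof -
    have "nrm A (l \<ominus> l') \<le> nrm A (G (f n) \<ominus> l) + nrm A (G (f n) \<ominus> l')" for n
      using nrm_triangle[of "l \<ominus> G (f n)" "G (f n) \<ominus> l'"] minus_add_minus[of l "G (f n)" l'] that(1,2) Gc
        nrm_minus_commute[of l "G (f n)"] by simp
    then have "nrm A (l \<ominus> l') \<le> 0 + 0"
      by (intro LIMSEQ_le_const[OF tendsto_add[OF that(3,4)]]) blast
    moreover have c: "l \<ominus> l' \<in> carrier A" using that(1,2) by simp
    ultimately have "nrm A (l \<ominus> l') = 0" using nrm_nonneg[OF c] by linarith
    then have "l \<ominus> l' = \<zero>" by (rule iffD1[OF nrm_eq_0[OF c]])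
    then show ?thesis by (rule diff_eq_0[OF that(1,2)])
  qed
  have "star A g = g"
  proof (rule lim_unique[of _ _ "\<lambda>n. n", OF _ g _ lim])
    have "G n \<ominus> star A g = star A (G n \<ominus> g)" for n
      using G[of n] g by (simp add: minus_smult star_add star_smult)
    then show "(\<lambda>n. nrm A (G n \<ominus> star A g)) \<longlonglongrightarrow> 0" using lim g Gc by simp
  qed (use g in simp)
  moreover have "g = F g"
  proof (rule lim_unique[of _ _ Suc, OF g F_closed[OF g]])
    show "(\<lambda>n. nrm A (G (Suc n) \<ominus> g)) \<longlonglongrightarrow> 0" by (rule LIMSEQ_Suc[OF lim])
    show "(\<lambda>n. nrm A (G (Suc n) \<ominus> F g)) \<longlonglongrightarrow> 0"
    proof (rule Lim_null_comparison)
      show "(\<lambda>n. 1/2 * ((1/2 + nrm A g) * nrm A (G n \<ominus> g))) \<longlonglongrightarrow> 0"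
        by (intro tendsto_mult_right_zero lim)
      have "nrm A (G (Suc n) \<ominus> F g) \<le> 1/2 * ((1/2 + nrm A g) * nrm A (G n \<ominus> g))" for n
        unfolding G_Suc using G[of n] g
        by (intro order_trans[OF F_diff] mult_left_mono mult_right_mono add_right_mono) auto
      then show "\<forall>\<^sub>F n in sequentially. norm (nrm A (G (Suc n) \<ominus> F g)) \<le> 1/2 * ((1/2 + nrm A g) * nrm A (G n \<ominus> g))"
        using g Gc F_closed[OF g] by (intro always_eventually allI) simp
    qed
  qed
  then have "g \<oplus> g = h \<oplus> g \<otimes> g" using half_double[of "h \<oplus> g \<otimes> g"] h g by (simp add: F_def)
  ultimately show ?thesis using g by blast
qed

end

lemma star_homD:
  assumes "star_hom A B \<pi>" "x \<in> carrier A"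
  shows "\<pi> x \<in> carrier B" "\<pi> (star A x) = star B (\<pi> x)" "\<pi> (c \<odot>\<^bsub>A\<^esub> x) = c \<odot>\<^bsub>B\<^esub> \<pi> x"
    "y \<in> carrier A \<Longrightarrow> \<pi> (x \<oplus>\<^bsub>A\<^esub> y) = \<pi> x \<oplus>\<^bsub>B\<^esub> \<pi> y" "y \<in> carrier A \<Longrightarrow> \<pi> (x \<otimes>\<^bsub>A\<^esub> y) = \<pi> x \<otimes>\<^bsub>B\<^esub> \<pi> y"
  using bspec[OF assms(1)[unfolded star_hom_def] assms(2)] by simp_all

text \<open>For h = a^* a the element 1 - h has the square root 1 - g. With T and S the images of a
  and g, this says that 1 - T^* T is the square of the self-adjoint 1 - S; in inner products, |x|^2
  - |T x|^2 = |x - S x|^2 >= 0.\<close>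

lemma star_hom_contraction:
  assumes "cstar_algebra A" "hilbert H" and hom: "star_hom A (B_of H) \<pi>"
    and a: "a \<in> carrier A" and small: "nrm A a \<le> 1/2"
  shows "nrm (B_of H) (\<pi> a) \<le> 1"
proof -
  interpret A: cstar_algebra A by fact
  interpret hilbert H by fact
  let ?h = "star A a \<otimes>\<^bsub>A\<^esub> a"
  have h: "?h \<in> carrier A" "star A ?h = ?h" using a by (simp_all add: A.star_mult)
  have "nrm A a * nrm A a \<le> 1/2 * (1/2)" using small a by (intro mult_mono) auto
  then have "nrm A ?h \<le> 1/4" using A.cstar_identity[OF a] by (simp add: power2_eq_square)
  from A.quasi_sqrt[OF h this] obtain g where g: "g \<in> carrier A" "star A g = g" "g \<oplus>\<^bsub>A\<^esub> g = ?h \<oplus>\<^bsub>A\<^esub> g \<otimes>\<^bsub>A\<^esub> g"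
    by blast
  define T S where "T = \<pi> a" and "S = \<pi> g"
  have T: "T \<in> bounded_operators H" and S: "S \<in> bounded_operators H"
    using star_homD(1)[OF hom] a g by (auto simp: T_def S_def)
  have S_adj: "adjoint_op H S = S" using star_homD(2)[OF hom g(1)] g(2) by (simp add: S_def)
  have "\<pi> (g \<oplus>\<^bsub>A\<^esub> g) = \<pi> (?h \<oplus>\<^bsub>A\<^esub> g \<otimes>\<^bsub>A\<^esub> g)" using g(3) by simp
  then have eq: "S \<oplus>\<^bsub>B_of H\<^esub> S = (adjoint_op H T \<otimes>\<^bsub>B_of H\<^esub> T) \<oplus>\<^bsub>B_of H\<^esub> (S \<otimes>\<^bsub>B_of H\<^esub> S)"
    using star_homD(4)[OF hom g(1) g(1)] star_homD(4)[OF hom h(1) A.mult_closed[OF g(1) g(1)]]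
      star_homD(5)[OF hom A.star_closed[OF a] a] star_homD(5)[OF hom g(1) g(1)] star_homD(2)[OF hom a]
    by (simp only: B_sel(6) T_def S_def)
  have "vnorm H (T x) \<le> 1 * vnorm H x" if x: "x \<in> carrier H" for x
  proof -
    have Sx: "S x \<in> carrier H" and Tx: "T x \<in> carrier H" using S T x by auto
    have "vinner H (S x) x + vinner H (S x) x = vinner H ((S \<oplus>\<^bsub>B_of H\<^esub> S) x) x"
      using x Sx by (simp add: inner_simps)
    also have "\<dots> = vinner H (T x) (T x) + vinner H (S x) (S x)"
      unfolding eq using x S T Sx Tx adjoint_left[OF T Tx x] adjoint_left[OF S Sx x, unfolded S_adj]
      by (simp add: inner_simps)
    finally have "Re (vinner H (S x) x + vinner H (S x) x) = Re (vinner H (T x) (T x) + vinner H (S x) (S x))"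
      by (rule arg_cong)
    then have 1: "Re (vinner H (S x) x) + Re (vinner H (S x) x) = Re (vinner H (T x) (T x)) + Re (vinner H (S x) (S x))"
      by (simp only: plus_complex.sel(1))
    have "0 \<le> Re (vinner H (vdiff x (S x)) (vdiff x (S x)))" using x Sx by (intro inner_ge_zero) auto
    also have "\<dots> = Re (vinner H x x) - (Re (vinner H (S x) x) + Re (vinner H (S x) x)) + Re (vinner H (S x) (S x))"
      using x Sx Re_inner_commute[OF x Sx] by (simp add: inner_simps)
    finally have "(vnorm H (T x))\<^sup>2 \<le> (vnorm H x)\<^sup>2" using 1 x Tx by (simp add: vnorm_sq)
    then have "vnorm H (T x) \<le> vnorm H x" by (rule power2_le_imp_le[OF _ vnorm_nonneg[OF x]])
    then show ?thesis by simp
  qed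
  then have "opnorm T \<le> 1" by (intro opnorm_leI) auto
  then show ?thesis by (simp add: T_def)
qed

lemma star_hom_seminorm:
  assumes A: "cstar_algebra A" and H: "hilbert H" and hom: "star_hom A (B_of H) \<pi>"
  shows "cstar_seminorm A (\<lambda>x. nrm (B_of H) (\<pi> x)) 2"
proof -
  interpret A: cstar_algebra A by fact
  interpret B: cstar_algebra "B_of H" by (rule hilbert.cstar_algebra_B[OF H])
  note contr = star_hom_contraction[OF A H hom]
  note hom = star_homD[OF hom]
  show ?thesis
  proof
    fix x assume x: "x \<in> carrier A"
    show "nrm (B_of H) (\<pi> x) \<le> 2 * nrm A x"
    proof (cases "nrm A x = 0")
      case True
      then have "x = 0 \<odot>\<^bsub>A\<^esub> x" using A.nrm_eq_0[OF x] x by simp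
      then have "\<pi> x = 0 \<odot>\<^bsub>B_of H\<^esub> \<pi> x" using hom(3)[OF x, of 0] by simp
      then have "\<pi> x = \<zero>\<^bsub>B_of H\<^esub>" using B.smult_zero_left[OF hom(1)[OF x]] by simp
      then show ?thesis using True by simp
    next
      case False
      then have p: "nrm A x > 0" using A.nrm_nonneg[OF x] by linarith
      \<comment> \<open>Rescaling to norm 1/2, where \<open>star_hom_contraction\<close> applies, is
        the origin of the constant 2.\<close>
      let ?c = "complex_of_real (1 / (2 * nrm A x))"
      have "cmod ?c = 1 / (2 * nrm A x)" using p by (simp add: norm_divide)
      moreover have "nrm (B_of H) (\<pi> (?c \<odot>\<^bsub>A\<^esub> x)) \<le> 1"
        by (rule contr) (use x p \<open>cmod ?c = _\<close> in \<open>simp_all add: A.nrm_smult\<close>)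
      ultimately have "1 / (2 * nrm A x) * nrm (B_of H) (\<pi> x) \<le> 1"
        using B.nrm_smult[OF hom(1)[OF x], of ?c] unfolding hom(3)[OF x] by simp
      then show ?thesis using p by (simp add: field_simps)
    qed
    show "nrm (B_of H) (\<pi> (star A x \<otimes>\<^bsub>A\<^esub> x)) = (nrm (B_of H) (\<pi> x))\<^sup>2"
      using x by (simp only: hom A.star_closed B.cstar_identity)
    show "nrm (B_of H) (\<pi> (c \<odot>\<^bsub>A\<^esub> x)) = cmod c * nrm (B_of H) (\<pi> x)" for c
      using x by (simp only: hom B.nrm_smult)
    show "0 \<le> nrm (B_of H) (\<pi> x)" using x by (intro B.nrm_nonneg hom)
    fix y assume y: "y \<in> carrier A"
    show "nrm (B_of H) (\<pi> (x \<oplus>\<^bsub>A\<^esub> y)) \<le> nrm (B_of H) (\<pi> x) + nrm (B_of H) (\<pi> y)"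
      using x y by (simp only: hom B.nrm_triangle)
    show "nrm (B_of H) (\<pi> (x \<otimes>\<^bsub>A\<^esub> y)) \<le> nrm (B_of H) (\<pi> x) * nrm (B_of H) (\<pi> y)"
      using x y by (simp only: hom B.nrm_mult)
  qed simp
qed

section \<open>Operators on square integrable functions\<close>

definition lift_op :: "'x measure \<Rightarrow> (('x \<Rightarrow> complex) \<Rightarrow> ('x \<Rightarrow> complex)) \<Rightarrow> 'x L2_op" where
  "lift_op M F = (\<lambda>P\<in>carrier (L2 M). \<Union>\<xi>\<in>P. L2_class M (F \<xi>))"

locale L2_map =
  fixes M :: "'x measure" and F :: "('x \<Rightarrow> complex) \<Rightarrow> ('x \<Rightarrow> complex)"
  assumes F_closed: "\<xi> \<in> L2_fun M \<Longrightarrow> F \<xi> \<in> L2_fun M"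
    and F_cong: "\<lbrakk>\<xi> \<in> L2_fun M; \<eta> \<in> L2_fun M; AE x in M. \<xi> x = \<eta> x\<rbrakk> \<Longrightarrow> AE x in M. F \<xi> x = F \<eta> x"
    and F_add: "F (\<lambda>x. \<xi> x + \<eta> x) = (\<lambda>x. F \<xi> x + F \<eta> x)"
    and F_scale: "F (\<lambda>x. c * \<xi> x) = (\<lambda>x. c * F \<xi> x)"
    and F_le: "\<xi> \<in> L2_fun M \<Longrightarrow> (\<integral>\<^sup>+x. ennreal ((cmod (F \<xi> x))\<^sup>2) \<partial>M) \<le> (\<integral>\<^sup>+x. ennreal ((cmod (\<xi> x))\<^sup>2) \<partial>M)"
begin

lemma lift_op_class: "\<xi> \<in> L2_fun M \<Longrightarrow> lift_op M F (L2_class M \<xi>) = L2_class M (F \<xi>)"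
proof -
  assume \<xi>: "\<xi> \<in> L2_fun M"
  have "(\<Union>\<eta>\<in>L2_class M \<xi>. L2_class M (F \<eta>)) = L2_class M (F \<xi>)"
  proof (rule UN_L2_class[OF \<xi>])
    fix \<eta> assume \<eta>: "\<eta> \<in> L2_fun M" and eq: "AE x in M. \<xi> x = \<eta> x"
    from eq have "AE x in M. \<eta> x = \<xi> x" by (rule eventually_mono) simp
    then show "L2_class M (F \<eta>) = L2_class M (F \<xi>)"
      unfolding L2_class_eq[OF F_closed[OF \<eta>] F_closed[OF \<xi>]] by (rule F_cong[OF \<eta> \<xi>])
  qed
  then show ?thesis using \<xi> by (simp add: lift_op_def)
qed

lemma lift_op_bounded: "lift_op M F \<in> bounded_operators (L2 M)"
proof (rule hilbert.opI[OF hilbert_L2, where K=1])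
  fix P assume "P \<in> carrier (L2 M)"
  then obtain \<xi> where \<xi>: "\<xi> \<in> L2_fun M" "P = L2_class M \<xi>" unfolding L2_carrier by blast
  show "lift_op M F P \<in> carrier (L2 M)" unfolding \<xi>(2) lift_op_class[OF \<xi>(1)] by (rule L2_class_carrier[OF F_closed[OF \<xi>(1)]])
  have "ennreal (\<integral>x. (cmod (F \<xi> x))\<^sup>2 \<partial>M) \<le> ennreal (\<integral>x. (cmod (\<xi> x))\<^sup>2 \<partial>M)"
    unfolding L2_sq_integral[OF \<xi>(1)] L2_sq_integral[OF F_closed[OF \<xi>(1)]] by (rule F_le[OF \<xi>(1)])
  then have "(\<integral>x. (cmod (F \<xi> x))\<^sup>2 \<partial>M) \<le> (\<integral>x. (cmod (\<xi> x))\<^sup>2 \<partial>M)"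
    by (rule ennreal_le_iff[THEN iffD1, rotated]) (rule Bochner_Integration.integral_nonneg, simp)
  then show "vnorm (L2 M) (lift_op M F P) \<le> 1 * vnorm (L2 M) P"
    unfolding \<xi>(2) lift_op_class[OF \<xi>(1)] vnorm_L2[OF \<xi>(1)] vnorm_L2[OF F_closed[OF \<xi>(1)]] by simp
  show "lift_op M F (vscale (L2 M) c P) = vscale (L2 M) c (lift_op M F P)" for c
    unfolding \<xi>(2) lift_op_class[OF \<xi>(1)] L2_scale[OF \<xi>(1)] L2_scale[OF F_closed[OF \<xi>(1)]]
      lift_op_class[OF L2_fun_scale[OF \<xi>(1)]] F_scale ..
  fix Q assume "Q \<in> carrier (L2 M)"
  then obtain \<eta> where \<eta>: "\<eta> \<in> L2_fun M" "Q = L2_class M \<eta>" unfolding L2_carrier by blast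
  show "lift_op M F (vadd (L2 M) P Q) = vadd (L2 M) (lift_op M F P) (lift_op M F Q)"
    unfolding \<xi>(2) \<eta>(2) lift_op_class[OF \<xi>(1)] lift_op_class[OF \<eta>(1)] L2_add[OF \<xi>(1) \<eta>(1)]
      L2_add[OF F_closed[OF \<xi>(1)] F_closed[OF \<eta>(1)]] lift_op_class[OF L2_fun_add[OF \<xi>(1) \<eta>(1)]] F_add ..
next
  show "lift_op M F P = undefined" if "P \<notin> carrier (L2 M)" for P
    using that by (simp add: lift_op_def)
qed

end

lemma L2_op_eqI:
  assumes "T \<in> bounded_operators (L2 M)" "U \<in> bounded_operators (L2 M)"
    and "\<And>\<xi>. \<xi> \<in> L2_fun M \<Longrightarrow> T (L2_class M \<xi>) = U (L2_class M \<xi>)"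
  shows "T = U"
  by (rule hilbert.op_ext[OF hilbert_L2 assms(1,2)]) (use assms(3) in \<open>auto simp: L2_carrier\<close>)

text \<open>Almost everywhere uniqueness of densities can fail when the measure is not
  \<sigma>-finite. The weight |\<xi>|^2 makes the measure finite, and its null sets are those of M
  on the set where \<xi> does not vanish.\<close>

lemma density_eq_AE:
  assumes [measurable]: "f \<in> borel_measurable M" "g \<in> borel_measurable M"
    and eq: "density M f = density M g" and \<xi>: "\<xi> \<in> L2_fun M"
  shows "AE x in M. \<xi> x \<noteq> 0 \<longrightarrow> f x = g x"
proof -
  let ?w = "\<lambda>x. ennreal ((cmod (\<xi> x))\<^sup>2)"
  have [measurable]: "\<xi> \<in> borel_measurable M" using L2_fun_measurable[OF \<xi>] .
  interpret finite_measure "density M ?w"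
    by (rule finite_measureI) (use \<xi> in \<open>auto simp: emeasure_density L2_fun_iff cong: nn_integral_cong\<close>)
  have "density (density M f) ?w = density (density M g) ?w" by (simp only: eq)
  then have "density (density M ?w) f = density (density M ?w) g"
    by (simp add: density_density_eq mult.commute)
  then have "AE x in density M ?w. f x = g x" by (intro density_unique) auto
  then have "AE x in M. 0 < ?w x \<longrightarrow> f x = g x" by (simp add: AE_density)
  then show ?thesis by (rule eventually_mono) auto
qed

section \<open>The operator of a single prefixing map\<close>

locale prefix_map =
  fixes M :: "'x measure" and D :: "'x set" and \<tau> c :: "'x \<Rightarrow> 'x" and \<Phi> :: "'x \<Rightarrow> real"
  assumes D_sets [measurable]: "D \<in> sets M" and \<tau>_meas: "\<tau> \<in> restrict_space M D \<rightarrow>\<^sub>M M"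
    and c_meas [measurable]: "c \<in> M \<rightarrow>\<^sub>M M" and RN: "RN_derivative_of_map M D \<tau> \<Phi>"
    and \<Phi>_pos: "AE x in M. x \<in> D \<longrightarrow> \<Phi> x > 0" and c_\<tau>: "x \<in> D \<Longrightarrow> c (\<tau> x) = x"
begin

definition R where "R = \<tau> ` D"
text \<open>Measurability is given on D only. Extension by 0, and of \<tau> by the identity, gives
  functions that are measurable on the whole space.\<close>

definition \<Phi>' where "\<Phi>' x = (if x \<in> D then \<Phi> x else 0)"
definition \<tau>' where "\<tau>' x = (if x \<in> D then \<tau> x else x)"

lemma D_space: "x \<in> D \<Longrightarrow> x \<in> space M"
  using sets.sets_into_space[OF D_sets] by blast

lemma \<Phi>'_meas [measurable]: "\<Phi>' \<in> borel_measurable M"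
proof -
  have "\<Phi> \<in> borel_measurable (restrict_space M D)" using RN unfolding RN_derivative_of_map_def by (rule conjunct1)
  moreover have "D \<inter> space M \<in> sets M" by simp
  ultimately have "(\<lambda>x. indicator D x *\<^sub>R \<Phi> x) \<in> borel_measurable M"
    using borel_measurable_restrict_space_iff by blast
  moreover have "(\<lambda>x. indicator D x *\<^sub>R \<Phi> x) = \<Phi>'" by (auto simp: \<Phi>'_def fun_eq_iff)
  ultimately show ?thesis by simp
qed

lemma \<tau>'_meas [measurable]: "\<tau>' \<in> M \<rightarrow>\<^sub>M M"
proof -
  have "{x \<in> space M. x \<in> D} \<in> sets M" by measurable
  moreover have "\<tau> \<in> restrict_space M {x. x \<in> D} \<rightarrow>\<^sub>M M" using \<tau>_meas by simp
  moreover have "(\<lambda>x. x) \<in> restrict_space M {x. x \<notin> D} \<rightarrow>\<^sub>M M" by (intro measurable_restrict_space1) simp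
  ultimately have "(\<lambda>x. if x \<in> D then \<tau> x else x) \<in> M \<rightarrow>\<^sub>M M"
    by (subst measurable_If_restrict_space_iff) auto
  then show ?thesis by (simp add: \<tau>'_def[abs_def])
qed

lemma image_sets: "\<lbrakk>E \<in> sets M; E \<subseteq> D\<rbrakk> \<Longrightarrow> \<tau> ` E \<in> sets M"
  and image_emeasure: "\<lbrakk>E \<in> sets M; E \<subseteq> D\<rbrakk> \<Longrightarrow> emeasure M (\<tau> ` E) = (\<integral>\<^sup>+x\<in>E. ennreal (\<Phi> x) \<partial>M)"
  using RN unfolding RN_derivative_of_map_def by simp_all

lemma R_sets [measurable]: "R \<in> sets M"
  unfolding R_def by (rule image_sets) simp_all

lemma RD: "x \<in> R \<Longrightarrow> c x \<in> D" "x \<in> R \<Longrightarrow> \<tau> (c x) = x" "x \<in> R \<Longrightarrow> x \<in> space M"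
  using c_\<tau> sets.sets_into_space[OF R_sets] unfolding R_def by auto

lemma R_I: "y \<in> D \<Longrightarrow> \<tau> y \<in> R" unfolding R_def by simp

lemma image_eq: "\<tau> ` (E \<inter> D) = {x \<in> R. c x \<in> E}"
proof (rule equalityI; rule subsetI)
  fix x assume "x \<in> \<tau> ` (E \<inter> D)"
  then obtain y where y: "y \<in> E" "y \<in> D" "x = \<tau> y" by blast
  then show "x \<in> {x \<in> R. c x \<in> E}" using R_I[OF y(2)] c_\<tau>[OF y(2)] by simp
next
  fix x assume "x \<in> {x \<in> R. c x \<in> E}"
  then have x: "x \<in> R" "c x \<in> E" by simp_all
  show "x \<in> \<tau> ` (E \<inter> D)" using RD(1,2)[OF x(1)] x(2) by (intro image_eqI[of _ _ "c x"]) simp_all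
qed

lemma change_of_variables:
  "distr (density M (\<lambda>x. ennreal (indicator R x))) M c = density M (\<lambda>x. ennreal (\<Phi>' x))"
proof (rule measure_eqI)
  fix E assume "E \<in> sets (distr (density M (\<lambda>x. ennreal (indicator R x))) M c)"
  then have E [measurable]: "E \<in> sets M" by simp
  have "emeasure (distr (density M (\<lambda>x. ennreal (indicator R x))) M c) E
      = emeasure (density M (\<lambda>x. ennreal (indicator R x))) (c -` E \<inter> space M)"
    by (subst emeasure_distr) simp_all
  also have "\<dots> = (\<integral>\<^sup>+x. ennreal (indicator R x) * indicator (c -` E \<inter> space M) x \<partial>M)"
    by (subst emeasure_density) simp_all
  also have "\<dots> = (\<integral>\<^sup>+x. indicator (\<tau> ` (E \<inter> D)) x \<partial>M)"
    unfolding image_eq by (rule nn_integral_cong) (simp split: split_indicator)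
  also have "\<dots> = emeasure M (\<tau> ` (E \<inter> D))" by (rule nn_integral_indicator, rule image_sets) simp_all
  also have "\<dots> = (\<integral>\<^sup>+x\<in>E \<inter> D. ennreal (\<Phi> x) \<partial>M)" by (rule image_emeasure) simp_all
  also have "\<dots> = emeasure (density M (\<lambda>x. ennreal (\<Phi>' x))) E"
    by (subst emeasure_density, simp_all, rule nn_integral_cong) (simp add: \<Phi>'_def split: split_indicator)
  finally show "emeasure (distr (density M (\<lambda>x. ennreal (indicator R x))) M c) E
      = emeasure (density M (\<lambda>x. ennreal (\<Phi>' x))) E" .
qed simp

lemma nn_cov:
  assumes [measurable]: "f \<in> borel_measurable M"
  shows "(\<integral>\<^sup>+x. ennreal (indicator R x) * f (c x) \<partial>M) = (\<integral>\<^sup>+x. ennreal (\<Phi>' x) * f x \<partial>M)"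
proof -
  have "(\<integral>\<^sup>+x. ennreal (indicator R x) * f (c x) \<partial>M) = (\<integral>\<^sup>+x. f (c x) \<partial>density M (\<lambda>x. ennreal (indicator R x)))"
    by (subst nn_integral_density) simp_all
  also have "\<dots> = (\<integral>\<^sup>+x. f x \<partial>distr (density M (\<lambda>x. ennreal (indicator R x))) M c)"
    by (subst nn_integral_distr) simp_all
  also have "\<dots> = (\<integral>\<^sup>+x. ennreal (\<Phi>' x) * f x \<partial>M)"
    unfolding change_of_variables by (subst nn_integral_density) simp_all
  finally show ?thesis .
qed

lemma \<Phi>'_pos: "AE x in M. x \<in> D \<longrightarrow> \<Phi>' x > 0"
  using \<Phi>_pos by (rule eventually_mono) (simp add: \<Phi>'_def)

lemma \<Phi>'_nonneg: "AE x in M. 0 \<le> \<Phi>' x"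
  using \<Phi>_pos by (rule eventually_mono) (simp add: \<Phi>'_def less_imp_le)

lemma integral_cov:
  fixes f :: "'x \<Rightarrow> complex"
  assumes [measurable]: "f \<in> borel_measurable M"
  shows "(\<integral>x. indicator R x *\<^sub>R f (c x) \<partial>M) = (\<integral>x. \<Phi>' x *\<^sub>R f x \<partial>M)"
proof -
  have "(\<integral>x. indicator R x *\<^sub>R f (c x) \<partial>M) = (\<integral>x. f (c x) \<partial>density M (\<lambda>x. ennreal (indicator R x)))"
    by (subst integral_density) simp_all
  also have "\<dots> = (\<integral>x. f x \<partial>distr (density M (\<lambda>x. ennreal (indicator R x))) M c)"
    by (subst integral_distr) simp_all
  also have "\<dots> = (\<integral>x. \<Phi>' x *\<^sub>R f x \<partial>M)"
    unfolding change_of_variables by (rule integral_density) (simp_all add: \<Phi>'_nonneg)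
  finally show ?thesis .
qed

text \<open>By \<open>change_of_variables\<close> the coding map carries the measure on R to one
  that has a density, so preimages of null sets inside R are null.\<close>

lemma AE_pull:
  assumes "AE x in M. P x" shows "AE x in M. x \<in> R \<longrightarrow> P (c x)"
proof -
  have "AE x in density M (\<lambda>x. ennreal (\<Phi>' x)). P x"
    using assms by (subst AE_density) (auto elim: eventually_mono)
  then have "AE x in distr (density M (\<lambda>x. ennreal (indicator R x))) M c. P x"
    unfolding change_of_variables .
  then have "AE x in density M (\<lambda>x. ennreal (indicator R x)). P (c x)"
    by (rule AE_distrD[rotated]) simp
  then have "AE x in M. 0 < ennreal (indicator R x) \<longrightarrow> P (c x)" by (simp add: AE_density)
  then show ?thesis by (rule eventually_mono) (simp split: split_indicator)
qed

text \<open>Positivity of \<Phi> enters here: a measurable subset of D is null as soon as its image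
  is. The exceptional set is first enlarged to a measurable Z.\<close>

lemma AE_push:
  assumes "AE x in M. P x" shows "AE x in M. x \<in> D \<longrightarrow> P (\<tau> x)"
proof -
  obtain Z where Z: "{x \<in> space M. \<not> P x} \<subseteq> Z" "emeasure M Z = 0" "Z \<in> sets M"
    using assms by (rule AE_E)
  note [measurable] = Z(3)
  have "AE x in M. x \<notin> Z" using Z(2,3) by (intro AE_not_in) (simp add: null_setsI)
  then have "AE x in M. 0 < ennreal (indicator R x) \<longrightarrow> \<tau>' (c x) \<notin> Z"
    by (rule eventually_mono) (auto split: split_indicator simp: \<tau>'_def RD)
  then have "AE x in density M (\<lambda>x. ennreal (indicator R x)). \<tau>' (c x) \<notin> Z"
    by (simp add: AE_density)
  then have "AE x in distr (density M (\<lambda>x. ennreal (indicator R x))) M c. \<tau>' x \<notin> Z"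
    by (subst AE_distr_iff) simp_all
  then have "AE x in M. 0 < ennreal (\<Phi>' x) \<longrightarrow> \<tau>' x \<notin> Z"
    unfolding change_of_variables by (simp add: AE_density)
  with \<Phi>'_pos AE_space show ?thesis
  proof eventually_elim
    case (elim x)
    show ?case
    proof
      assume x: "x \<in> D"
      have "\<tau> x \<in> space M" by (rule RD(3)[OF R_I[OF x]])
      moreover have "\<tau> x \<notin> Z" using elim x by (simp add: \<tau>'_def)
      ultimately show "P (\<tau> x)" using Z(1) by blast
    qed
  qed
qed

definition S where
  "S \<xi> x = indicator (\<tau> ` D) x * complex_of_real (\<Phi> (c x) powr (-1/2)) * \<xi> (c x)" for \<xi> :: "'x \<Rightarrow> complex"

definition S_adj where
  "S_adj \<eta> x = indicator D x * complex_of_real (\<Phi> x powr (1/2)) * \<eta> (\<tau> x)" for \<eta> :: "'x \<Rightarrow> complex"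

lemma S_eq: "S \<xi> x = indicator R x * (complex_of_real (\<Phi>' (c x) powr (-1/2)) * \<xi> (c x))"
  using RD(1)[of x] by (simp add: S_def R_def[symmetric] \<Phi>'_def split: split_indicator)

lemma S_adj_eq: "S_adj \<eta> x = indicator D x * (complex_of_real (\<Phi>' x powr (1/2)) * \<eta> (\<tau>' x))"
  by (simp add: S_adj_def \<Phi>'_def \<tau>'_def split: split_indicator)

lemma S_meas [measurable]:
  assumes [measurable]: "\<xi> \<in> borel_measurable M" shows "S \<xi> \<in> borel_measurable M"
  unfolding S_eq[abs_def] by measurable

lemma S_adj_meas [measurable]:
  assumes [measurable]: "\<eta> \<in> borel_measurable M" shows "S_adj \<eta> \<in> borel_measurable M"
  unfolding S_adj_eq[abs_def] by measurable

lemma powr_half_sq: "p > 0 \<Longrightarrow> (p powr (1/2))\<^sup>2 = (p::real)" "p > 0 \<Longrightarrow> p * (p powr (-1/2))\<^sup>2 = 1"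
  "p > 0 \<Longrightarrow> p * p powr (-1/2) = p powr (1/2)" "p > 0 \<Longrightarrow> p powr (1/2) * p powr (-1/2) = 1"
proof -
  assume p: "p > 0"
  show "(p powr (1/2))\<^sup>2 = p" using p by (simp add: power2_eq_square powr_add[symmetric])
  have "p * (p powr (-1/2))\<^sup>2 = p powr 1 * (p powr (-1/2) * p powr (-1/2))" using p by (simp add: power2_eq_square)
  also have "\<dots> = p powr (1 + (-1/2 + -1/2))" by (simp only: powr_add)
  finally show "p * (p powr (-1/2))\<^sup>2 = 1" using p by simp
  have "p * p powr (-1/2) = p powr 1 * p powr (-1/2)" using p by simp
  also have "\<dots> = p powr (1 + -1/2)" by (simp only: powr_add)
  finally show "p * p powr (-1/2) = p powr (1/2)" by simp
  have "p powr (1/2) * p powr (-1/2) = p powr (1/2 + -1/2)" by (simp only: powr_add)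
  then show "p powr (1/2) * p powr (-1/2) = 1" using p by simp
qed

text \<open>The square of \<Phi>^(-1/2) cancels the density \<Phi> of the change of variables, so S
  is isometric on functions living on D and kills the rest.\<close>

lemma S_nn:
  assumes [measurable]: "\<xi> \<in> borel_measurable M"
  shows "(\<integral>\<^sup>+x. ennreal ((cmod (S \<xi> x))\<^sup>2) \<partial>M) = (\<integral>\<^sup>+x. indicator D x * ennreal ((cmod (\<xi> x))\<^sup>2) \<partial>M)"
proof -
  have "(\<integral>\<^sup>+x. ennreal ((cmod (S \<xi> x))\<^sup>2) \<partial>M) =
      (\<integral>\<^sup>+x. ennreal (indicator R x) * ennreal ((\<Phi>' (c x) powr (-1/2))\<^sup>2 * (cmod (\<xi> (c x)))\<^sup>2) \<partial>M)"
    by (intro nn_integral_cong) (simp add: S_eq norm_mult power_mult_distrib split: split_indicator)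
  also have "\<dots> = (\<integral>\<^sup>+x. ennreal (\<Phi>' x) * ennreal ((\<Phi>' x powr (-1/2))\<^sup>2 * (cmod (\<xi> x))\<^sup>2) \<partial>M)"
    by (rule nn_cov) measurable
  also have "\<dots> = (\<integral>\<^sup>+x. indicator D x * ennreal ((cmod (\<xi> x))\<^sup>2) \<partial>M)"
  proof (rule nn_integral_cong_AE, use \<Phi>'_pos in eventually_elim)
    case (elim x)
    show ?case
    proof (cases "x \<in> D")
      case True
      then have "\<Phi>' x > 0" using elim by simp
      then show ?thesis using True powr_half_sq(2)[of "\<Phi>' x"]
        by (simp add: ennreal_mult[symmetric] mult.assoc[symmetric])
    qed (simp add: \<Phi>'_def)
  qed
  finally show ?thesis .
qed

lemma S_adj_nn:
  assumes [measurable]: "\<eta> \<in> borel_measurable M"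
  shows "(\<integral>\<^sup>+x. ennreal ((cmod (S_adj \<eta> x))\<^sup>2) \<partial>M) = (\<integral>\<^sup>+x. ennreal (indicator R x) * ennreal ((cmod (\<eta> x))\<^sup>2) \<partial>M)"
proof -
  have "(\<integral>\<^sup>+x. ennreal ((cmod (S_adj \<eta> x))\<^sup>2) \<partial>M) = (\<integral>\<^sup>+x. ennreal (\<Phi>' x) * ennreal ((cmod (\<eta> (\<tau>' x)))\<^sup>2) \<partial>M)"
  proof (rule nn_integral_cong_AE, use \<Phi>'_pos in eventually_elim)
    case (elim x)
    show ?case
    proof (cases "x \<in> D")
      case True
      then have "\<Phi>' x > 0" using elim by simp
      then show ?thesis using True powr_half_sq(1)[of "\<Phi>' x"]
        by (simp add: S_adj_eq norm_mult power_mult_distrib ennreal_mult)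
    qed (simp add: \<Phi>'_def S_adj_eq)
  qed
  also have "\<dots> = (\<integral>\<^sup>+x. ennreal (indicator R x) * ennreal ((cmod (\<eta> (\<tau>' (c x))))\<^sup>2) \<partial>M)"
    by (rule nn_cov[symmetric]) measurable
  also have "\<dots> = (\<integral>\<^sup>+x. ennreal (indicator R x) * ennreal ((cmod (\<eta> x))\<^sup>2) \<partial>M)"
    by (intro nn_integral_cong) (simp add: \<tau>'_def RD split: split_indicator)
  finally show ?thesis .
qed

lemma S_map: "L2_map M S"
proof
  have le: "(\<integral>\<^sup>+x. ennreal ((cmod (S \<xi> x))\<^sup>2) \<partial>M) \<le> (\<integral>\<^sup>+x. ennreal ((cmod (\<xi> x))\<^sup>2) \<partial>M)"
    if "\<xi> \<in> L2_fun M" for \<xi>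
    unfolding S_nn[OF L2_fun_measurable[OF that]]
    by (intro nn_integral_mono) (simp split: split_indicator)
  fix \<xi> assume \<xi>: "\<xi> \<in> L2_fun M"
  show "(\<integral>\<^sup>+x. ennreal ((cmod (S \<xi> x))\<^sup>2) \<partial>M) \<le> (\<integral>\<^sup>+x. ennreal ((cmod (\<xi> x))\<^sup>2) \<partial>M)"
    by (rule le[OF \<xi>])
  show "S \<xi> \<in> L2_fun M"
    using \<xi> le[OF \<xi>] S_meas[OF L2_fun_measurable[OF \<xi>]] unfolding L2_fun_iff by (auto intro: le_less_trans)
  fix \<eta> assume "AE x in M. \<xi> x = \<eta> x"
  then have "AE x in M. x \<in> R \<longrightarrow> \<xi> (c x) = \<eta> (c x)" by (rule AE_pull)
  then show "AE x in M. S \<xi> x = S \<eta> x"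
    by (rule eventually_mono) (simp add: S_eq split: split_indicator)
qed (simp_all add: S_def fun_eq_iff algebra_simps)

lemma S_adj_map: "L2_map M S_adj"
proof
  have le: "(\<integral>\<^sup>+x. ennreal ((cmod (S_adj \<xi> x))\<^sup>2) \<partial>M) \<le> (\<integral>\<^sup>+x. ennreal ((cmod (\<xi> x))\<^sup>2) \<partial>M)"
    if "\<xi> \<in> L2_fun M" for \<xi>
    unfolding S_adj_nn[OF L2_fun_measurable[OF that]]
    by (intro nn_integral_mono) (simp split: split_indicator)
  fix \<xi> assume \<xi>: "\<xi> \<in> L2_fun M"
  show "(\<integral>\<^sup>+x. ennreal ((cmod (S_adj \<xi> x))\<^sup>2) \<partial>M) \<le> (\<integral>\<^sup>+x. ennreal ((cmod (\<xi> x))\<^sup>2) \<partial>M)"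
    by (rule le[OF \<xi>])
  show "S_adj \<xi> \<in> L2_fun M"
    using \<xi> le[OF \<xi>] S_adj_meas[OF L2_fun_measurable[OF \<xi>]] unfolding L2_fun_iff by (auto intro: le_less_trans)
  fix \<eta> assume "AE x in M. \<xi> x = \<eta> x"
  then have "AE x in M. x \<in> D \<longrightarrow> \<xi> (\<tau> x) = \<eta> (\<tau> x)" by (rule AE_push)
  then show "AE x in M. S_adj \<xi> x = S_adj \<eta> x"
    by (rule eventually_mono) (simp add: S_adj_def split: split_indicator)
qed (simp_all add: S_adj_def fun_eq_iff algebra_simps)

lemma S_adjoint_integral:
  assumes [measurable]: "\<xi> \<in> borel_measurable M" "\<eta> \<in> borel_measurable M"
  shows "(\<integral>x. S \<xi> x * cnj (\<eta> x) \<partial>M) = (\<integral>x. \<xi> x * cnj (S_adj \<eta> x) \<partial>M)"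
proof -
  \<comment> \<open>On R a point x is recovered as \<tau> (c x), so the whole integrand is a
    function of c x.\<close>
  define f where "f x = complex_of_real (\<Phi>' x powr (-1/2)) * \<xi> x * cnj (\<eta> (\<tau>' x))" for x
  have [measurable]: "f \<in> borel_measurable M" unfolding f_def[abs_def] by measurable
  have "(\<integral>x. S \<xi> x * cnj (\<eta> x) \<partial>M) = (\<integral>x. indicator R x *\<^sub>R f (c x) \<partial>M)"
    by (intro Bochner_Integration.integral_cong) (simp_all add: S_eq f_def \<tau>'_def RD split: split_indicator)
  also have "\<dots> = (\<integral>x. \<Phi>' x *\<^sub>R f x \<partial>M)" by (rule integral_cov) simp
  also have "\<dots> = (\<integral>x. \<xi> x * cnj (S_adj \<eta> x) \<partial>M)"
  proof (rule integral_cong_AE)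
    show "AE x in M. \<Phi>' x *\<^sub>R f x = \<xi> x * cnj (S_adj \<eta> x)"
      using \<Phi>'_pos
    proof eventually_elim
      case (elim x)
      show ?case
      proof (cases "x \<in> D")
        case True
        then have "\<Phi>' x > 0" using elim by simp
        have "\<Phi>' x *\<^sub>R f x = complex_of_real (\<Phi>' x * \<Phi>' x powr (-1/2)) * (\<xi> x * cnj (\<eta> (\<tau>' x)))"
          by (simp add: f_def scaleR_conv_of_real)
        also have "\<dots> = \<xi> x * cnj (S_adj \<eta> x)"
          unfolding powr_half_sq(3)[OF \<open>\<Phi>' x > 0\<close>] using True by (simp add: S_adj_eq)
        finally show ?thesis .
      qed (simp add: \<Phi>'_def S_adj_eq)
    qed
  qed measurable
  finally show ?thesis .
qed

lemma adjoint_S: "adjoint_op (L2 M) (lift_op M S) = lift_op M S_adj"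
proof (rule hilbert.adjoint_eqI[OF hilbert_L2 L2_map.lift_op_bounded[OF S_adj_map]])
  fix P Q assume "P \<in> carrier (L2 M)" "Q \<in> carrier (L2 M)"
  then obtain \<xi> \<eta> where *: "\<xi> \<in> L2_fun M" "P = L2_class M \<xi>" "\<eta> \<in> L2_fun M" "Q = L2_class M \<eta>"
    unfolding L2_carrier by blast
  show "vinner (L2 M) (lift_op M S P) Q = vinner (L2 M) P (lift_op M S_adj Q)"
    unfolding *(2,4) L2_map.lift_op_class[OF S_map *(1)] L2_map.lift_op_class[OF S_adj_map *(3)]
      L2_inner[OF L2_map.F_closed[OF S_map *(1)] *(3)] L2_inner[OF *(1) L2_map.F_closed[OF S_adj_map *(3)]]
    by (rule S_adjoint_integral[OF L2_fun_measurable[OF *(1)] L2_fun_measurable[OF *(3)]])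
qed

lemma S_adj_S: "AE x in M. S_adj (S \<xi>) x = indicator D x * \<xi> x"
  using \<Phi>'_pos
proof eventually_elim
  case (elim x)
  show ?case
  proof (cases "x \<in> D")
    case True
    then have p: "\<Phi>' x > 0" using elim by simp
    have "S_adj (S \<xi>) x = complex_of_real (\<Phi>' x powr (1/2) * \<Phi>' x powr (-1/2)) * \<xi> x"
      using True R_I[OF True] c_\<tau>[OF True] by (simp add: S_adj_eq S_eq \<tau>'_def)
    then show ?thesis unfolding powr_half_sq(4)[OF p] using True by simp
  qed (simp add: S_adj_eq)
qed

lemma S_S_adj: "AE x in M. S (S_adj \<eta>) x = indicator R x * \<eta> x"
  using AE_pull[OF \<Phi>'_pos]
proof eventually_elim
  case (elim x)
  show ?case
  proof (cases "x \<in> R")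
    case True
    then have p: "\<Phi>' (c x) > 0" using elim RD(1)[OF True] by simp
    have "S (S_adj \<eta>) x = complex_of_real (\<Phi>' (c x) powr (1/2) * \<Phi>' (c x) powr (-1/2)) * \<eta> x"
      using True RD[OF True] by (simp add: S_adj_eq S_eq \<tau>'_def)
    then show ?thesis unfolding powr_half_sq(4)[OF p] using True by simp
  qed (simp add: S_eq)
qed

end

section \<open>The Cuntz--Krieger family of a semibranching function system\<close>

lemma AE_not_in_null: "A \<in> sets M \<Longrightarrow> emeasure M A = 0 \<Longrightarrow> AE x in M. x \<notin> A"
  by (rule AE_not_in) (simp add: null_setsI)

text \<open>\<open>ennreal\<close> sends negative reals to 0, so a positive product certifies that
  both real factors are positive.\<close>

lemma ennreal_mult_eqD:
  fixes x y p :: real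
  assumes "ennreal x * ennreal y = ennreal p" "p > 0"
  shows "x > 0" "y > 0" "x * y = p"
proof -
  have "ennreal x \<noteq> 0" "ennreal y \<noteq> 0" using assms by auto
  then show xy: "x > 0" "y > 0" by (simp_all add: ennreal_eq_0_iff not_le)
  have "ennreal (x * y) = ennreal p" using assms(1) xy by (simp add: ennreal_mult)
  then show "x * y = p" using xy assms(2) by simp
qed

lemma lift_op_comp:
  assumes F: "L2_map M F" and G: "L2_map M G" and K: "L2_map M K"
    and eq: "\<And>\<xi>. \<xi> \<in> L2_fun M \<Longrightarrow> AE x in M. F (G \<xi>) x = K \<xi> x"
  shows "lift_op M F \<otimes>\<^bsub>B_of (L2 M)\<^esub> lift_op M G = lift_op M K"
proof (rule L2_op_eqI)
  interpret hilbert "L2 M" by (rule hilbert_L2)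
  show "lift_op M F \<otimes>\<^bsub>B_of (L2 M)\<^esub> lift_op M G \<in> bounded_operators (L2 M)"
    by (rule B_closed(4)[OF L2_map.lift_op_bounded[OF F] L2_map.lift_op_bounded[OF G]])
  fix \<xi> assume \<xi>: "\<xi> \<in> L2_fun M"
  note G\<xi> = L2_map.F_closed[OF G \<xi>]
  have "L2_class M (F (G \<xi>)) = L2_class M (K \<xi>)"
    unfolding L2_class_eq[OF L2_map.F_closed[OF F G\<xi>] L2_map.F_closed[OF K \<xi>]] by (rule eq[OF \<xi>])
  then show "(lift_op M F \<otimes>\<^bsub>B_of (L2 M)\<^esub> lift_op M G) (L2_class M \<xi>) = lift_op M K (L2_class M \<xi>)"
    unfolding B_apply(4)[OF L2_class_carrier[OF \<xi>]] L2_map.lift_op_class[OF G \<xi>] L2_map.lift_op_class[OF F G\<xi>]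
      L2_map.lift_op_class[OF K \<xi>] .
qed (rule L2_map.lift_op_bounded[OF K])

lemma lift_op_eqI:
  assumes F: "L2_map M F" and K: "L2_map M K"
    and eq: "\<And>\<xi>. \<xi> \<in> L2_fun M \<Longrightarrow> AE x in M. F \<xi> x = K \<xi> x"
  shows "lift_op M F = lift_op M K"
proof (rule L2_op_eqI[OF L2_map.lift_op_bounded[OF F] L2_map.lift_op_bounded[OF K]])
  fix \<xi> assume \<xi>: "\<xi> \<in> L2_fun M"
  show "lift_op M F (L2_class M \<xi>) = lift_op M K (L2_class M \<xi>)"
    unfolding L2_map.lift_op_class[OF F \<xi>] L2_map.lift_op_class[OF K \<xi>]
      L2_class_eq[OF L2_map.F_closed[OF F \<xi>] L2_map.F_closed[OF K \<xi>]] by (rule eq[OF \<xi>])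
qed

text \<open>The common form of the initial and the range projections of the operators under
  study.\<close>

definition cutoff :: "'x set \<Rightarrow> ('x \<Rightarrow> complex) \<Rightarrow> 'x \<Rightarrow> complex" where
  "cutoff E \<xi> x = indicator E x * \<xi> x"

lemma cutoff_map: "E \<in> sets M \<Longrightarrow> L2_map M (cutoff E)"
proof
  assume E [measurable]: "E \<in> sets M"
  fix \<xi> assume \<xi>: "\<xi> \<in> L2_fun M"
  have [measurable]: "\<xi> \<in> borel_measurable M" by (rule L2_fun_measurable[OF \<xi>])
  show le: "(\<integral>\<^sup>+x. ennreal ((cmod (cutoff E \<xi> x))\<^sup>2) \<partial>M) \<le> (\<integral>\<^sup>+x. ennreal ((cmod (\<xi> x))\<^sup>2) \<partial>M)"
    by (intro nn_integral_mono) (simp add: cutoff_def split: split_indicator)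
  have "cutoff E \<xi> \<in> borel_measurable M" unfolding cutoff_def[abs_def] by measurable
  then show "cutoff E \<xi> \<in> L2_fun M" using \<xi> le unfolding L2_fun_iff by (auto intro: le_less_trans)
  fix \<eta> assume "AE x in M. \<xi> x = \<eta> x"
  then show "AE x in M. cutoff E \<xi> x = cutoff E \<eta> x" by (rule eventually_mono) (simp add: cutoff_def)
qed (simp_all add: cutoff_def fun_eq_iff algebra_simps)

text \<open>Square integrability of the partial sums is carried through the induction, because
  addition of classes can be evaluated only with it.\<close>

lemma finsum_cutoff:
  assumes "finite I" "\<And>i. i \<in> I \<Longrightarrow> E i \<in> sets M" and \<xi>: "\<xi> \<in> L2_fun M"
  shows "(\<lambda>x. (\<Sum>i\<in>I. indicator (E i) x) * \<xi> x) \<in> L2_fun M \<and>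
    (\<Oplus>\<^bsub>B_of (L2 M)\<^esub>i\<in>I. lift_op M (cutoff (E i))) (L2_class M \<xi>) = L2_class M (\<lambda>x. (\<Sum>i\<in>I. indicator (E i) x) * \<xi> x)"
  using assms(1,2)
proof (induction I)
  interpret hilbert "L2 M" by (rule hilbert_L2)
  interpret B: cstar_algebra "B_of (L2 M)" by (rule cstar_algebra_B)
  case empty
  show ?case using \<xi> by (simp add: L2_zero)
next
  interpret hilbert "L2 M" by (rule hilbert_L2)
  interpret B: cstar_algebra "B_of (L2 M)" by (rule cstar_algebra_B)
  case (insert i I)
  let ?T = "\<lambda>i. lift_op M (cutoff (E i))"
  have T: "?T j \<in> carrier (B_of (L2 M))" if "j \<in> insert i I" for j
    using L2_map.lift_op_bounded[OF cutoff_map[OF insert.prems[OF that]]] by simp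
  have IH: "(\<lambda>x. (\<Sum>i\<in>I. indicator (E i) x) * \<xi> x) \<in> L2_fun M"
    "(\<Oplus>\<^bsub>B_of (L2 M)\<^esub>i\<in>I. ?T i) (L2_class M \<xi>) = L2_class M (\<lambda>x. (\<Sum>i\<in>I. indicator (E i) x) * \<xi> x)"
    using insert by simp_all
  have m: "L2_map M (cutoff (E i))" by (rule cutoff_map) (use insert.prems in simp)
  have eq: "(\<lambda>x. cutoff (E i) \<xi> x + (\<Sum>i\<in>I. indicator (E i) x) * \<xi> x) = (\<lambda>x. (\<Sum>i\<in>insert i I. indicator (E i) x) * \<xi> x)"
    using insert(1,2) by (simp add: cutoff_def distrib_right fun_eq_iff)
  have "(\<Oplus>\<^bsub>B_of (L2 M)\<^esub>i\<in>insert i I. ?T i) = ?T i \<oplus>\<^bsub>B_of (L2 M)\<^esub> (\<Oplus>\<^bsub>B_of (L2 M)\<^esub>i\<in>I. ?T i)"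
    by (rule B.finsum_insert[OF insert(1,2)]) (use T in auto)
  then have "(\<Oplus>\<^bsub>B_of (L2 M)\<^esub>i\<in>insert i I. ?T i) (L2_class M \<xi>) = L2_class M (\<lambda>x. cutoff (E i) \<xi> x + (\<Sum>i\<in>I. indicator (E i) x) * \<xi> x)"
    using B_apply(2)[OF L2_class_carrier[OF \<xi>]] L2_add[OF L2_map.F_closed[OF m \<xi>] IH(1)]
    by (simp only: IH(2) L2_map.lift_op_class[OF m \<xi>])
  moreover have "(\<lambda>x. cutoff (E i) \<xi> x + (\<Sum>i\<in>I. indicator (E i) x) * \<xi> x) \<in> L2_fun M"
    by (rule L2_fun_add[OF L2_map.F_closed[OF m \<xi>] IH(1)])
  ultimately show ?case unfolding eq by blast
qed

section \<open>The Cuntz-Krieger relations for the operators \<open>U \<mu>\<close>\<close>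

locale semibranching_kgraph = k_graph \<Lambda> + Lambda_semibranching_system \<Lambda> M D \<tau> code \<Phi>
  for \<Lambda> :: "('p, 'k::finite) kgraph" and M :: "'x measure" and D \<tau> code \<Phi>
begin

abbreviation F where "F \<equiv> S_fun \<Lambda> D \<tau> code \<Phi>"
abbreviation Fadj where "Fadj \<mu> \<equiv> prefix_map.S_adj (D \<mu>) (\<tau> \<mu>) (\<Phi> \<mu>)"
abbreviation U where "U \<equiv> S_op \<Lambda> M D \<tau> code \<Phi>"
abbreviation Rg where "Rg \<mu> \<equiv> \<tau> \<mu> ` D \<mu>"

lemma systemD:
  assumes "\<mu> \<in> paths \<Lambda> n"
  shows "D \<mu> \<in> sets M" "\<tau> \<mu> \<in> restrict_space M (D \<mu>) \<rightarrow>\<^sub>M M" "RN_derivative_of_map M (D \<mu>) (\<tau> \<mu>) (\<Phi> \<mu>)"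
    "AE x in M. x \<in> D \<mu> \<longrightarrow> \<Phi> \<mu> x > 0"
    "\<nu> \<in> paths \<Lambda> n \<Longrightarrow> \<mu> \<noteq> \<nu> \<Longrightarrow> emeasure M (Rg \<mu> \<inter> Rg \<nu>) = 0"
  using system[of n] assms unfolding semibranching_system_def by auto

lemma prefix: "\<mu> \<in> mor \<Lambda> \<Longrightarrow> prefix_map M (D \<mu>) (\<tau> \<mu>) (code (deg \<Lambda> \<mu>)) (\<Phi> \<mu>)"
proof
  assume "\<mu> \<in> mor \<Lambda>"
  then have p: "\<mu> \<in> paths \<Lambda> (deg \<Lambda> \<mu>)" by (simp add: paths_def)
  note c = coding[of "deg \<Lambda> \<mu>", unfolded coding_map_def]
  show "code (deg \<Lambda> \<mu>) \<in> M \<rightarrow>\<^sub>M M" by (rule conjunct1[OF c])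
  show "x \<in> D \<mu> \<Longrightarrow> code (deg \<Lambda> \<mu>) (\<tau> \<mu> x) = x" for x using bspec[OF conjunct2[OF c] p] by blast
qed (rule systemD, simp add: paths_def)+

lemma F_eq: "\<mu> \<in> mor \<Lambda> \<Longrightarrow> F \<mu> = prefix_map.S (D \<mu>) (\<tau> \<mu>) (code (deg \<Lambda> \<mu>)) (\<Phi> \<mu>)"
  by (simp add: fun_eq_iff S_fun_def prefix_map.S_def[OF prefix])

lemma F_map: "\<mu> \<in> mor \<Lambda> \<Longrightarrow> L2_map M (F \<mu>)"
  using prefix_map.S_map[OF prefix] F_eq by simp

lemma U_eq: "U \<mu> = lift_op M (F \<mu>)"
  by (simp add: S_op_def lift_op_def)

lemma U_bounded: "\<mu> \<in> mor \<Lambda> \<Longrightarrow> U \<mu> \<in> bounded_operators (L2 M)"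
  unfolding U_eq by (rule L2_map.lift_op_bounded[OF F_map])

lemma U_star: "\<mu> \<in> mor \<Lambda> \<Longrightarrow> star (B_of (L2 M)) (U \<mu>) = lift_op M (Fadj \<mu>)"
  unfolding U_eq using prefix_map.adjoint_S[OF prefix] F_eq by (simp add: hilbert.B_sel(6)[OF hilbert_L2])

lemma D_sets: "\<mu> \<in> mor \<Lambda> \<Longrightarrow> D \<mu> \<in> sets M"
  by (rule prefix_map.D_sets[OF prefix])

lemma Rg_sets: "\<mu> \<in> mor \<Lambda> \<Longrightarrow> Rg \<mu> \<in> sets M"
  using prefix_map.R_sets[OF prefix] prefix_map.R_def[OF prefix] by simp

lemma U_star_U: "\<mu> \<in> mor \<Lambda> \<Longrightarrow> star (B_of (L2 M)) (U \<mu>) \<otimes>\<^bsub>B_of (L2 M)\<^esub> U \<mu> = lift_op M (cutoff (D \<mu>))"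
  unfolding U_star unfolding U_eq
  by (rule lift_op_comp[OF prefix_map.S_adj_map[OF prefix] F_map cutoff_map[OF D_sets]])
     (simp_all add: F_eq cutoff_def prefix_map.S_adj_S[OF prefix])

lemma U_U_star: "\<mu> \<in> mor \<Lambda> \<Longrightarrow> U \<mu> \<otimes>\<^bsub>B_of (L2 M)\<^esub> star (B_of (L2 M)) (U \<mu>) = lift_op M (cutoff (Rg \<mu>))"
  unfolding U_star unfolding U_eq
  by (rule lift_op_comp[OF F_map prefix_map.S_adj_map[OF prefix] cutoff_map[OF Rg_sets]])
     (use prefix_map.S_S_adj[OF prefix] prefix_map.R_def[OF prefix] in \<open>simp_all add: F_eq cutoff_def\<close>)

lemma U_partial_isometry:
  assumes \<mu>: "\<mu> \<in> mor \<Lambda>" shows "partial_isometry (B_of (L2 M)) (U \<mu>)"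
proof -
  have "U \<mu> \<otimes>\<^bsub>B_of (L2 M)\<^esub> star (B_of (L2 M)) (U \<mu>) \<otimes>\<^bsub>B_of (L2 M)\<^esub> U \<mu> = U \<mu>"
    unfolding U_U_star[OF \<mu>] unfolding U_eq
    by (rule lift_op_comp[OF cutoff_map[OF Rg_sets[OF \<mu>]] F_map[OF \<mu>] F_map[OF \<mu>]])
       (simp add: cutoff_def S_fun_def split: split_indicator)
  then show ?thesis using U_bounded[OF \<mu>] by (simp add: partial_isometry_def hilbert.B_sel(1)[OF hilbert_L2])
qed

lemma Rg_vertex: "v \<in> vertices \<Lambda> \<Longrightarrow> Rg v = D v"
  using vertex_id by (auto simp: image_iff)

lemma AE_range: "AE x in M. \<exists>\<mu>\<in>paths \<Lambda> n. x \<in> Rg \<mu>"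
proof -
  have "finite (paths \<Lambda> n)" and null: "emeasure M (space M - (\<Union>\<mu>\<in>paths \<Lambda> n. Rg \<mu>)) = 0"
    using system[of n] unfolding semibranching_system_def by auto
  have "(\<Union>\<mu>\<in>paths \<Lambda> n. Rg \<mu>) \<in> sets M"
    by (rule sets.finite_UN[OF \<open>finite (paths \<Lambda> n)\<close>]) (rule Rg_sets, simp add: paths_def)
  then have "AE x in M. x \<notin> space M - (\<Union>\<mu>\<in>paths \<Lambda> n. Rg \<mu>)"
    by (intro AE_not_in_null null) simp
  with AE_space show ?thesis by eventually_elim blast
qed

lemma AE_disjoint:
  assumes "\<mu> \<in> mor \<Lambda>" "\<nu> \<in> mor \<Lambda>" "deg \<Lambda> \<mu> = deg \<Lambda> \<nu>" "\<mu> \<noteq> \<nu>"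
  shows "AE x in M. \<not> (x \<in> Rg \<mu> \<and> x \<in> Rg \<nu>)"
proof -
  have "emeasure M (Rg \<mu> \<inter> Rg \<nu>) = 0"
    using assms by (intro systemD(5)[of \<mu> "deg \<Lambda> \<mu>"]) (simp_all add: paths_def)
  then have "AE x in M. x \<notin> Rg \<mu> \<inter> Rg \<nu>"
    using Rg_sets assms by (intro AE_not_in_null) simp_all
  then show ?thesis by (rule eventually_mono) blast
qed

lemma AE_prefix_range:
  assumes "\<mu> \<in> mor \<Lambda>" "\<nu> \<in> mor \<Lambda>" "src \<Lambda> \<mu> = rng \<Lambda> \<nu>"
  shows "AE x in M. x \<in> Rg \<nu> \<longrightarrow> x \<in> D \<mu>"
proof -
  have "AE x in M. x \<notin> Rg \<nu> - D \<mu>"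
    by (rule AE_not_in_null[OF _ prefix_range[OF assms]]) (intro sets.Diff Rg_sets D_sets assms)
  then show ?thesis by (rule eventually_mono) blast
qed

text \<open>One inclusion is the range condition for the vertex s(\<mu>), the other is the agreement
  of domains for \<mu> s(\<mu>) = \<mu>. This is what CK3 amounts to.\<close>

lemma AE_D_src:
  assumes \<mu>: "\<mu> \<in> mor \<Lambda>" shows "AE x in M. x \<in> D \<mu> \<longleftrightarrow> x \<in> D (src \<Lambda> \<mu>)"
proof -
  have "AE x in M. x \<in> D (src \<Lambda> \<mu>) \<longrightarrow> x \<in> D \<mu>"
    using AE_prefix_range[OF \<mu> src_closed[OF \<mu>]] \<mu> Rg_vertex[OF src_vertex[OF \<mu>]] by simp
  moreover have "AE x in M. (x \<in> D (src \<Lambda> \<mu>) \<and> \<tau> (src \<Lambda> \<mu>) x \<in> D \<mu> \<longleftrightarrow> x \<in> D \<mu>)"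
    using prefix_comp[OF \<mu> src_closed[OF \<mu>]] \<mu> by (auto elim: eventually_mono)
  ultimately show ?thesis by eventually_elim blast
qed

text \<open>As \<tau>_v is the identity, \<Phi>_v is a density of the measure restricted to
  \<open>D v\<close>, hence equal to 1 almost everywhere on \<open>D v\<close> where a given square
  integrable function does not vanish.\<close>

lemma U_vertex:
  assumes v: "v \<in> vertices \<Lambda>" shows "U v = lift_op M (cutoff (D v))"
proof -
  have vm: "v \<in> mor \<Lambda>" and dv: "deg \<Lambda> v = 0" using v by (auto simp: vertices_iff)
  interpret p: prefix_map M "D v" "\<tau> v" "code (deg \<Lambda> v)" "\<Phi> v" by (rule prefix[OF vm])
  have code: "code (deg \<Lambda> v) x = x" if "x \<in> D v" for x
    using p.c_\<tau>[OF that] vertex_id[OF v that] by simp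
  show ?thesis
    unfolding U_eq
  proof (rule lift_op_eqI[OF F_map[OF vm] cutoff_map[OF D_sets[OF vm]]])
    fix \<xi> assume \<xi>: "\<xi> \<in> L2_fun M"
    have "density M (\<lambda>x. ennreal (p.\<Phi>' x)) = density M (\<lambda>x. ennreal (indicator (D v) x))"
    proof (rule measure_eqI)
      fix E assume "E \<in> sets (density M (\<lambda>x. ennreal (p.\<Phi>' x)))"
      then have [measurable]: "E \<in> sets M" by simp
      have im: "\<tau> v ` (E \<inter> D v) = E \<inter> D v" using vertex_id[OF v] by (auto simp: image_iff)
      have "emeasure (density M (\<lambda>x. ennreal (p.\<Phi>' x))) E = (\<integral>\<^sup>+x\<in>E \<inter> D v. ennreal (\<Phi> v x) \<partial>M)"
        by (subst emeasure_density, simp_all, rule nn_integral_cong) (simp add: p.\<Phi>'_def split: split_indicator)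
      also have "\<dots> = emeasure M (E \<inter> D v)"
        using p.image_emeasure[of "E \<inter> D v"] by (simp add: im)
      also have "\<dots> = (\<integral>\<^sup>+x. indicator (E \<inter> D v) x \<partial>M)" by (rule nn_integral_indicator[symmetric]) simp
      also have "\<dots> = emeasure (density M (\<lambda>x. ennreal (indicator (D v) x))) E"
        by (subst emeasure_density)
           (auto intro!: nn_integral_cong simp del: nn_integral_indicator split: split_indicator)
      finally show "emeasure (density M (\<lambda>x. ennreal (p.\<Phi>' x))) E = emeasure (density M (\<lambda>x. ennreal (indicator (D v) x))) E" .
    qed simp
    then have "AE x in M. \<xi> x \<noteq> 0 \<longrightarrow> ennreal (p.\<Phi>' x) = ennreal (indicator (D v) x)"
      by (intro density_eq_AE \<xi>) simp_all
    then show "AE x in M. F v \<xi> x = cutoff (D v) \<xi> x"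
      using p.\<Phi>'_pos
    proof eventually_elim
      case (elim x)
      show ?case
      proof (cases "x \<in> D v \<and> \<xi> x \<noteq> 0")
        case True
        then have "p.\<Phi>' x > 0" "ennreal (p.\<Phi>' x) = ennreal 1" using elim by auto
        then have "p.\<Phi>' x = 1" by (metis ennreal_inj less_imp_le zero_le_one)
        then have "\<Phi> v x = 1" using True by (simp add: p.\<Phi>'_def)
        then show ?thesis using True code[of x] by (simp add: S_fun_def Rg_vertex[OF v] cutoff_def)
      next
        case False
        then show ?thesis using code[of x] by (auto simp: S_fun_def Rg_vertex[OF v] cutoff_def split: split_indicator)
      qed
    qed
  qed
qed

text \<open>
  The measure need not be \<open>\<sigma>\<close>-finite, so the chain rule for the Radon--Nikodym derivatives holds only where
  some square integrable function does not vanish.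
\<close>

lemma chain_rule:
  assumes m: "\<mu> \<in> mor \<Lambda>" "\<nu> \<in> mor \<Lambda>" "src \<Lambda> \<mu> = rng \<Lambda> \<nu>" and \<xi>: "\<xi> \<in> L2_fun M"
  shows "AE z in M. z \<in> D (\<mu> \<diamondop> \<nu>) \<longrightarrow> \<xi> z \<noteq> 0 \<longrightarrow>
    \<Phi> \<mu> (\<tau> \<nu> z) > 0 \<and> \<Phi> \<nu> z > 0 \<and> \<Phi> (\<mu> \<diamondop> \<nu>) z = \<Phi> \<mu> (\<tau> \<nu> z) * \<Phi> \<nu> z"
proof -
  have mn: "\<mu> \<diamondop> \<nu> \<in> mor \<Lambda>" using m by simp
  interpret a: prefix_map M "D \<mu>" "\<tau> \<mu>" "code (deg \<Lambda> \<mu>)" "\<Phi> \<mu>" by (rule prefix[OF m(1)])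
  interpret b: prefix_map M "D \<nu>" "\<tau> \<nu>" "code (deg \<Lambda> \<nu>)" "\<Phi> \<nu>" by (rule prefix[OF m(2)])
  interpret ab: prefix_map M "D (\<mu> \<diamondop> \<nu>)" "\<tau> (\<mu> \<diamondop> \<nu>)" "code (deg \<Lambda> (\<mu> \<diamondop> \<nu>))" "\<Phi> (\<mu> \<diamondop> \<nu>)" by (rule prefix[OF mn])
  obtain Z where Z: "{x \<in> space M. \<not> ((x \<in> D \<nu> \<and> \<tau> \<nu> x \<in> D \<mu> \<longleftrightarrow> x \<in> D (\<mu> \<diamondop> \<nu>)) \<and>
      (x \<in> D (\<mu> \<diamondop> \<nu>) \<longrightarrow> \<tau> \<mu> (\<tau> \<nu> x) = \<tau> (\<mu> \<diamondop> \<nu>) x))} \<subseteq> Z" "emeasure M Z = 0" "Z \<in> sets M"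
    using prefix_comp[OF m] by (rule AE_E)
  note [measurable] = Z(3)
  \<comment> \<open>Off the null set Z the composition law holds at each point, so the image under
    the composite map can be computed in two steps.\<close>
  define E0 where "E0 = D (\<mu> \<diamondop> \<nu>) - Z"
  have E0 [measurable]: "E0 \<in> sets M" by (simp add: E0_def)
  have good: "x \<in> D (\<mu> \<diamondop> \<nu>)" "x \<in> D \<nu>" "\<tau> \<nu> x \<in> D \<mu>" "\<tau> \<mu> (\<tau> \<nu> x) = \<tau> (\<mu> \<diamondop> \<nu>) x" if "x \<in> E0" for x
  proof -
    have x: "x \<in> D (\<mu> \<diamondop> \<nu>)" "x \<notin> Z" using that by (simp_all add: E0_def)
    then have "x \<in> space M" by (intro ab.D_space)
    then show "x \<in> D (\<mu> \<diamondop> \<nu>)" "x \<in> D \<nu>" "\<tau> \<nu> x \<in> D \<mu>" "\<tau> \<mu> (\<tau> \<nu> x) = \<tau> (\<mu> \<diamondop> \<nu>) x"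
      using Z(1) x by blast+
  qed
  define f where "f x = indicator E0 x * ennreal (ab.\<Phi>' x)" for x
  \<comment> \<open>On E0 this is the product on the right of the chain rule, in the form in which
    the change of variables for \<nu> produces it from an integral of \<open>\<Phi> \<mu>\<close>
    over an image under \<open>\<tau> \<nu>\<close>.\<close>
  define g where "g x = ennreal (b.\<Phi>' x) * (indicator E0 x * ennreal (a.\<Phi>' (b.\<tau>' x)))" for x
  have fg [measurable]: "f \<in> borel_measurable M" "g \<in> borel_measurable M"
    unfolding f_def[abs_def] g_def[abs_def] by measurable
  have "density M f = density M g"
  proof (rule measure_eqI)
    fix E assume "E \<in> sets (density M f)"
    then have E [measurable]: "E \<in> sets M" by simp
    let ?E = "E \<inter> E0"
    have sub: "?E \<subseteq> D (\<mu> \<diamondop> \<nu>)" "?E \<subseteq> D \<nu>" "\<tau> \<nu> ` ?E \<subseteq> D \<mu>" using good by blast+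
    have "emeasure (density M f) E = (\<integral>\<^sup>+x\<in>?E. ennreal (\<Phi> (\<mu> \<diamondop> \<nu>) x) \<partial>M)"
      by (subst emeasure_density, simp_all, rule nn_integral_cong)
         (use good(1) in \<open>simp add: f_def ab.\<Phi>'_def split: split_indicator\<close>)
    also have "\<dots> = emeasure M (\<tau> (\<mu> \<diamondop> \<nu>) ` ?E)" by (rule ab.image_emeasure[symmetric]) (simp, rule sub)
    also have "\<tau> (\<mu> \<diamondop> \<nu>) ` ?E = \<tau> \<mu> ` (\<tau> \<nu> ` ?E)"
      unfolding image_image by (rule image_cong[OF refl]) (simp add: good(4))
    also have "emeasure M (\<tau> \<mu> ` (\<tau> \<nu> ` ?E)) = (\<integral>\<^sup>+y\<in>\<tau> \<nu> ` ?E. ennreal (\<Phi> \<mu> y) \<partial>M)"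
      by (rule a.image_emeasure) (rule b.image_sets, simp, rule sub(2), rule sub(3))
    also have "\<dots> = (\<integral>\<^sup>+y. ennreal (indicator b.R y) *
        (indicator ?E (code (deg \<Lambda> \<nu>) y) * ennreal (a.\<Phi>' (b.\<tau>' (code (deg \<Lambda> \<nu>) y)))) \<partial>M)"
    proof (rule nn_integral_cong)
      fix y assume "y \<in> space M"
      have "\<tau> \<nu> ` ?E = {y \<in> b.R. code (deg \<Lambda> \<nu>) y \<in> ?E}"
        using b.image_eq[of ?E] sub(2) by (simp add: Int_absorb2)
      then have iff: "y \<in> \<tau> \<nu> ` ?E \<longleftrightarrow> y \<in> b.R \<and> code (deg \<Lambda> \<nu>) y \<in> ?E" by blast
      show "ennreal (\<Phi> \<mu> y) * indicator (\<tau> \<nu> ` ?E) y = ennreal (indicator b.R y) *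
          (indicator ?E (code (deg \<Lambda> \<nu>) y) * ennreal (a.\<Phi>' (b.\<tau>' (code (deg \<Lambda> \<nu>) y))))"
      proof (cases "y \<in> \<tau> \<nu> ` ?E")
        case True
        then have y: "y \<in> b.R" "code (deg \<Lambda> \<nu>) y \<in> ?E" and yD: "y \<in> D \<mu>" using iff sub(3) by blast+
        have "a.\<Phi>' (b.\<tau>' (code (deg \<Lambda> \<nu>) y)) = \<Phi> \<mu> y"
          using b.RD(1,2)[OF y(1)] yD by (simp add: b.\<tau>'_def a.\<Phi>'_def)
        then show ?thesis using True y by simp
      next
        case False
        then show ?thesis using iff by (auto split: split_indicator)
      qed
    qed
    also have "\<dots> = (\<integral>\<^sup>+x. ennreal (b.\<Phi>' x) * (indicator ?E x * ennreal (a.\<Phi>' (b.\<tau>' x))) \<partial>M)"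
      by (rule b.nn_cov) measurable
    also have "\<dots> = emeasure (density M g) E"
      by (subst emeasure_density, simp_all, rule nn_integral_cong) (simp add: g_def split: split_indicator)
    finally show "emeasure (density M f) E = emeasure (density M g) E" .
  qed simp
  then have "AE x in M. \<xi> x \<noteq> 0 \<longrightarrow> f x = g x" by (rule density_eq_AE[OF fg _ \<xi>])
  moreover have "AE x in M. x \<notin> Z" by (rule AE_not_in_null[OF Z(3,2)])
  ultimately show ?thesis
    using ab.\<Phi>'_pos
  proof eventually_elim
    case (elim z)
    show ?case
    proof (intro impI)
      assume z: "z \<in> D (\<mu> \<diamondop> \<nu>)" "\<xi> z \<noteq> 0"
      then have zE: "z \<in> E0" using elim by (simp add: E0_def)
      have pos: "\<Phi> (\<mu> \<diamondop> \<nu>) z > 0" using elim z by (simp add: ab.\<Phi>'_def)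
      have "ennreal (\<Phi> \<nu> z) * ennreal (\<Phi> \<mu> (\<tau> \<nu> z)) = ennreal (\<Phi> (\<mu> \<diamondop> \<nu>) z)"
        using elim z zE good[OF zE] by (simp add: f_def g_def a.\<Phi>'_def b.\<Phi>'_def ab.\<Phi>'_def b.\<tau>'_def)
      from ennreal_mult_eqD[OF this pos]
      show "\<Phi> \<mu> (\<tau> \<nu> z) > 0 \<and> \<Phi> \<nu> z > 0 \<and> \<Phi> (\<mu> \<diamondop> \<nu>) z = \<Phi> \<mu> (\<tau> \<nu> z) * \<Phi> \<nu> z"
        by (simp add: mult.commute)
    qed
  qed
qed

text \<open>The laws for \<tau> and \<Phi> hold at almost every z. \<open>AE_pull\<close> transports
  them to x separately along the two-step and the one-step coding, because agreement of the two
  ranges is itself part of the claim.\<close>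

lemma U_comp:
  assumes m: "\<mu> \<in> mor \<Lambda>" "\<nu> \<in> mor \<Lambda>" "src \<Lambda> \<mu> = rng \<Lambda> \<nu>"
  shows "U \<mu> \<otimes>\<^bsub>B_of (L2 M)\<^esub> U \<nu> = U (\<mu> \<diamondop> \<nu>)"
proof -
  have mn: "\<mu> \<diamondop> \<nu> \<in> mor \<Lambda>" using m by simp
  interpret a: prefix_map M "D \<mu>" "\<tau> \<mu>" "code (deg \<Lambda> \<mu>)" "\<Phi> \<mu>" by (rule prefix[OF m(1)])
  interpret b: prefix_map M "D \<nu>" "\<tau> \<nu>" "code (deg \<Lambda> \<nu>)" "\<Phi> \<nu>" by (rule prefix[OF m(2)])
  interpret ab: prefix_map M "D (\<mu> \<diamondop> \<nu>)" "\<tau> (\<mu> \<diamondop> \<nu>)" "code (deg \<Lambda> (\<mu> \<diamondop> \<nu>))" "\<Phi> (\<mu> \<diamondop> \<nu>)" by (rule prefix[OF mn])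
  show ?thesis
    unfolding U_eq
  proof (rule lift_op_comp[OF F_map[OF m(1)] F_map[OF m(2)] F_map[OF mn]])
    fix \<xi> assume \<xi>: "\<xi> \<in> L2_fun M"
    define P where "P z \<longleftrightarrow> (z \<in> D \<nu> \<and> \<tau> \<nu> z \<in> D \<mu> \<longleftrightarrow> z \<in> D (\<mu> \<diamondop> \<nu>)) \<and>
      (z \<in> D (\<mu> \<diamondop> \<nu>) \<longrightarrow> \<tau> \<mu> (\<tau> \<nu> z) = \<tau> (\<mu> \<diamondop> \<nu>) z) \<and> (z \<in> D (\<mu> \<diamondop> \<nu>) \<longrightarrow> \<xi> z \<noteq> 0 \<longrightarrow>
        \<Phi> \<mu> (\<tau> \<nu> z) > 0 \<and> \<Phi> \<nu> z > 0 \<and> \<Phi> (\<mu> \<diamondop> \<nu>) z = \<Phi> \<mu> (\<tau> \<nu> z) * \<Phi> \<nu> z)" for z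
    have P: "AE z in M. P z"
      using prefix_comp[OF m] chain_rule[OF m \<xi>] unfolding P_def by eventually_elim blast
    have "AE x in M. x \<in> a.R \<longrightarrow> code (deg \<Lambda> \<mu>) x \<in> b.R \<longrightarrow> P (code (deg \<Lambda> \<nu>) (code (deg \<Lambda> \<mu>) x))"
      by (rule a.AE_pull[OF b.AE_pull[OF P]])
    moreover have "AE x in M. x \<in> ab.R \<longrightarrow> P (code (deg \<Lambda> (\<mu> \<diamondop> \<nu>)) x)" by (rule ab.AE_pull[OF P])
    ultimately show "AE x in M. F \<mu> (F \<nu> \<xi>) x = F (\<mu> \<diamondop> \<nu>) \<xi> x"
      using AE_space
    proof eventually_elim
      case (elim x)
      define y where "y = code (deg \<Lambda> \<mu>) x"
      define z where "z = code (deg \<Lambda> \<nu>) y"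
      have zc: "code (deg \<Lambda> (\<mu> \<diamondop> \<nu>)) x = z"
        using code_comp[OF elim(3), of "deg \<Lambda> \<nu>" "deg \<Lambda> \<mu>"] m by (simp add: z_def y_def add.commute)
      have iff: "x \<in> a.R \<and> y \<in> b.R \<longleftrightarrow> x \<in> ab.R"
      proof
        assume xy: "x \<in> a.R \<and> y \<in> b.R"
        then have "P z" using elim(1) by (simp add: y_def z_def)
        moreover have "z \<in> D \<nu>" "\<tau> \<nu> z = y" "y \<in> D \<mu>" "\<tau> \<mu> y = x"
          using b.RD(1,2)[of y] a.RD(1,2)[of x] xy by (simp_all add: y_def z_def)
        ultimately have "z \<in> D (\<mu> \<diamondop> \<nu>)" "\<tau> (\<mu> \<diamondop> \<nu>) z = x" unfolding P_def by auto
        then show "x \<in> ab.R" using ab.R_I by metis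
      next
        assume x: "x \<in> ab.R"
        then have "P z" using elim(2) zc by simp
        moreover have zD: "z \<in> D (\<mu> \<diamondop> \<nu>)" "\<tau> (\<mu> \<diamondop> \<nu>) z = x" using ab.RD(1,2)[OF x] zc by simp_all
        ultimately have *: "z \<in> D \<nu>" "\<tau> \<nu> z \<in> D \<mu>" "\<tau> \<mu> (\<tau> \<nu> z) = x" unfolding P_def by auto
        then have "y = \<tau> \<nu> z" using a.c_\<tau>[OF *(2)] by (simp add: y_def)
        then show "x \<in> a.R \<and> y \<in> b.R" using a.R_I[OF *(2)] b.R_I[OF *(1)] *(3) by simp
      qed
      have lhs: "F \<mu> (F \<nu> \<xi>) x = indicator a.R x * complex_of_real (\<Phi> \<mu> y powr (-1/2)) *
          (indicator b.R y * complex_of_real (\<Phi> \<nu> z powr (-1/2)) * \<xi> z)"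
        by (simp add: S_fun_def a.R_def b.R_def y_def z_def)
      have rhs: "F (\<mu> \<diamondop> \<nu>) \<xi> x = indicator ab.R x * complex_of_real (\<Phi> (\<mu> \<diamondop> \<nu>) z powr (-1/2)) * \<xi> z"
        unfolding S_fun_def zc ab.R_def ..
      show ?case
      proof (cases "x \<in> ab.R \<and> \<xi> z \<noteq> 0")
        case True
        then have xab: "x \<in> a.R" "y \<in> b.R" using iff by auto
        have "P z" using True elim(2) zc by simp
        moreover have "z \<in> D (\<mu> \<diamondop> \<nu>)" using ab.RD(1)[of x] True zc by simp
        ultimately have "\<Phi> \<mu> (\<tau> \<nu> z) > 0" "\<Phi> \<nu> z > 0" "\<Phi> (\<mu> \<diamondop> \<nu>) z = \<Phi> \<mu> (\<tau> \<nu> z) * \<Phi> \<nu> z"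
          using True unfolding P_def by auto
        moreover have "\<tau> \<nu> z = y" using b.RD(2)[OF xab(2)] by (simp add: z_def)
        ultimately show ?thesis unfolding lhs rhs using True xab by (simp add: powr_mult)
      next
        case False
        then show ?thesis unfolding lhs rhs using iff by (auto split: split_indicator)
      qed
    qed
  qed
qed

text \<open>Almost every x lies in the range of exactly one \<mu> of degree n, and then in
  \<open>D (rng \<Lambda> \<mu>)\<close>. Since the sets \<open>D v\<close> are disjoint up to null
  sets, this \<mu> has range v exactly when x lies in \<open>D v\<close>.\<close>

lemma U_vertex_sum:
  assumes v: "v \<in> vertices \<Lambda>"
  shows "U v = (\<Oplus>\<^bsub>B_of (L2 M)\<^esub>\<mu>\<in>paths_to \<Lambda> v n. U \<mu> \<otimes>\<^bsub>B_of (L2 M)\<^esub> star (B_of (L2 M)) (U \<mu>))"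
proof -
  interpret hilbert "L2 M" by (rule hilbert_L2)
  interpret B: cstar_algebra "B_of (L2 M)" by (rule cstar_algebra_B)
  have pm: "\<mu> \<in> mor \<Lambda>" "deg \<Lambda> \<mu> = n" if "\<mu> \<in> paths \<Lambda> n" for \<mu> using that by (simp_all add: paths_def)
  have tm: "\<mu> \<in> mor \<Lambda>" "rng \<Lambda> \<mu> = v" "\<mu> \<in> paths \<Lambda> n" if "\<mu> \<in> paths_to \<Lambda> v n" for \<mu>
    using that by (simp_all add: paths_to_def paths_def)
  have finp: "finite (paths \<Lambda> n)" and fin0: "finite (paths \<Lambda> 0)" using system unfolding semibranching_system_def by auto
  have fin: "finite (paths_to \<Lambda> v n)" by (rule finite_subset[OF _ finp]) (auto simp: paths_to_def)
  have vm: "v \<in> mor \<Lambda>" using v by simp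
  have closed: "lift_op M (cutoff (Rg \<mu>)) \<in> carrier (B_of (L2 M))" if "\<mu> \<in> paths_to \<Lambda> v n" for \<mu>
    using L2_map.lift_op_bounded[OF cutoff_map[OF Rg_sets[OF tm(1)[OF that]]]] by simp
  have eq: "(\<Oplus>\<^bsub>B_of (L2 M)\<^esub>\<mu>\<in>paths_to \<Lambda> v n. U \<mu> \<otimes>\<^bsub>B_of (L2 M)\<^esub> star (B_of (L2 M)) (U \<mu>))
      = (\<Oplus>\<^bsub>B_of (L2 M)\<^esub>\<mu>\<in>paths_to \<Lambda> v n. lift_op M (cutoff (Rg \<mu>)))"
    by (rule B.finsum_cong'[OF refl]) (use closed U_U_star tm(1) in auto)
  have "AE x in M. \<forall>\<mu>\<in>paths \<Lambda> n. \<forall>\<nu>\<in>paths \<Lambda> n. \<mu> \<noteq> \<nu> \<longrightarrow> \<not> (x \<in> Rg \<mu> \<and> x \<in> Rg \<nu>)"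
  proof (intro AE_finite_allI[OF finp])
    fix \<mu> \<nu> assume "\<mu> \<in> paths \<Lambda> n" "\<nu> \<in> paths \<Lambda> n"
    then show "AE x in M. \<mu> \<noteq> \<nu> \<longrightarrow> \<not> (x \<in> Rg \<mu> \<and> x \<in> Rg \<nu>)"
      using AE_disjoint[of \<mu> \<nu>] pm by (cases "\<mu> = \<nu>") simp_all
  qed
  moreover have "AE x in M. \<forall>\<mu>\<in>paths \<Lambda> n. x \<in> Rg \<mu> \<longrightarrow> x \<in> D (rng \<Lambda> \<mu>)"
  proof (intro AE_finite_allI[OF finp])
    fix \<mu> assume "\<mu> \<in> paths \<Lambda> n"
    then show "AE x in M. x \<in> Rg \<mu> \<longrightarrow> x \<in> D (rng \<Lambda> \<mu>)"
      using pm by (intro AE_prefix_range) simp_all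
  qed
  moreover have "AE x in M. \<forall>w\<in>paths \<Lambda> 0. w \<noteq> v \<longrightarrow> \<not> (x \<in> D w \<and> x \<in> D v)"
  proof (intro AE_finite_allI[OF fin0])
    fix w assume "w \<in> paths \<Lambda> 0"
    then have w: "w \<in> vertices \<Lambda>" by (simp add: vertices_paths)
    have "AE x in M. \<not> (x \<in> Rg w \<and> x \<in> Rg v)" if "w \<noteq> v"
      using v w that by (intro AE_disjoint) (auto simp: vertices_iff)
    then show "AE x in M. w \<noteq> v \<longrightarrow> \<not> (x \<in> D w \<and> x \<in> D v)"
      unfolding Rg_vertex[OF w] Rg_vertex[OF v] by (cases "w = v") simp_all
  qed
  ultimately have ind: "AE x in M. (\<Sum>\<mu>\<in>paths_to \<Lambda> v n. indicator (Rg \<mu>) x) = (indicator (D v) x :: complex)"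
    using AE_range[of n]
  proof eventually_elim
    case (elim x)
    obtain \<mu> where \<mu>: "\<mu> \<in> paths \<Lambda> n" "x \<in> Rg \<mu>" using elim(4) by blast
    have uniq: "x \<in> Rg \<nu> \<longleftrightarrow> \<nu> = \<mu>" if "\<nu> \<in> paths \<Lambda> n" for \<nu> using elim(1) \<mu> that by blast
    have xr: "x \<in> D (rng \<Lambda> \<mu>)" using elim(2) \<mu> by blast
    have rv: "rng \<Lambda> \<mu> \<in> paths \<Lambda> 0" using pm(1)[OF \<mu>(1)] by (simp add: vertices_paths[symmetric])
    have "(\<Sum>\<nu>\<in>paths_to \<Lambda> v n. indicator (Rg \<nu>) x :: complex) = (\<Sum>\<nu>\<in>paths_to \<Lambda> v n. if \<nu> = \<mu> then 1 else 0)"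
      using uniq tm(3) by (intro sum.cong refl) (simp add: indicator_def)
    also have "\<dots> = (if \<mu> \<in> paths_to \<Lambda> v n then 1 else 0)" using fin by simp
    also have "\<mu> \<in> paths_to \<Lambda> v n \<longleftrightarrow> x \<in> D v"
    proof
      assume "x \<in> D v"
      then have "rng \<Lambda> \<mu> = v" using elim(3) rv xr by blast
      then show "\<mu> \<in> paths_to \<Lambda> v n" using \<mu>(1) by (simp add: paths_to_def)
    qed (use tm(2) xr in simp)
    finally show ?case by (simp add: indicator_def)
  qed
  show ?thesis
    unfolding eq
  proof (rule L2_op_eqI[OF U_bounded[OF vm]])
    show "(\<Oplus>\<^bsub>B_of (L2 M)\<^esub>\<mu>\<in>paths_to \<Lambda> v n. lift_op M (cutoff (Rg \<mu>))) \<in> bounded_operators (L2 M)"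
      using B.finsum_closed[of "\<lambda>\<mu>. lift_op M (cutoff (Rg \<mu>))" "paths_to \<Lambda> v n"] closed by simp
    fix \<xi> assume \<xi>: "\<xi> \<in> L2_fun M"
    have cm: "L2_map M (cutoff (D v))" by (rule cutoff_map[OF D_sets[OF vm]])
    have fc: "(\<lambda>x. (\<Sum>\<mu>\<in>paths_to \<Lambda> v n. indicator (Rg \<mu>) x) * \<xi> x) \<in> L2_fun M \<and>
        (\<Oplus>\<^bsub>B_of (L2 M)\<^esub>\<mu>\<in>paths_to \<Lambda> v n. lift_op M (cutoff (Rg \<mu>))) (L2_class M \<xi>)
          = L2_class M (\<lambda>x. (\<Sum>\<mu>\<in>paths_to \<Lambda> v n. indicator (Rg \<mu>) x) * \<xi> x)"
      by (rule finsum_cutoff[OF fin Rg_sets[OF tm(1)] \<xi>])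
    have "AE x in M. cutoff (D v) \<xi> x = (\<Sum>\<mu>\<in>paths_to \<Lambda> v n. indicator (Rg \<mu>) x) * \<xi> x"
      using ind by (rule eventually_mono) (simp add: cutoff_def)
    then have "L2_class M (cutoff (D v) \<xi>) = L2_class M (\<lambda>x. (\<Sum>\<mu>\<in>paths_to \<Lambda> v n. indicator (Rg \<mu>) x) * \<xi> x)"
      unfolding L2_class_eq[OF L2_map.F_closed[OF cm \<xi>] conjunct1[OF fc]] .
    then show "U v (L2_class M \<xi>) = (\<Oplus>\<^bsub>B_of (L2 M)\<^esub>\<mu>\<in>paths_to \<Lambda> v n. lift_op M (cutoff (Rg \<mu>))) (L2_class M \<xi>)"
      unfolding U_vertex[OF v] L2_map.lift_op_class[OF cm \<xi>] conjunct2[OF fc] .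
  qed
qed

theorem U_CK_family: "CK_family \<Lambda> (B_of (L2 M)) U"
proof -
  interpret hilbert "L2 M" by (rule hilbert_L2)
  interpret B: cstar_algebra "B_of (L2 M)" by (rule cstar_algebra_B)
  have U_src: "star (B_of (L2 M)) (U \<mu>) \<otimes>\<^bsub>B_of (L2 M)\<^esub> U \<mu> = U (src \<Lambda> \<mu>)" if \<mu>: "\<mu> \<in> mor \<Lambda>" for \<mu>
    unfolding U_star_U[OF \<mu>] U_vertex[OF src_vertex[OF \<mu>]]
  proof (rule lift_op_eqI[OF cutoff_map[OF D_sets[OF \<mu>]] cutoff_map[OF D_sets[OF src_closed[OF \<mu>]]]])
    show "AE x in M. cutoff (D \<mu>) \<xi> x = cutoff (D (src \<Lambda> \<mu>)) \<xi> x" for \<xi>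
      using AE_D_src[OF \<mu>] by (rule eventually_mono) (simp add: cutoff_def indicator_def)
  qed
  have proj: "projection (B_of (L2 M)) (U v)" if v: "v \<in> vertices \<Lambda>" for v
  proof -
    have vm: "v \<in> mor \<Lambda>" and sv: "src \<Lambda> v = v" using v by simp_all
    have Uc: "U v \<in> carrier (B_of (L2 M))" using U_bounded[OF vm] by simp
    have eq: "star (B_of (L2 M)) (U v) \<otimes>\<^bsub>B_of (L2 M)\<^esub> U v = U v" using U_src[OF vm] sv by simp
    \<comment> \<open>A vertex is its own source, so CK3 exhibits \<open>U v\<close> as T^* T with T
      = \<open>U v\<close>. It is therefore self-adjoint, and then idempotent.\<close>
    have "star (B_of (L2 M)) (U v) = star (B_of (L2 M)) (star (B_of (L2 M)) (U v) \<otimes>\<^bsub>B_of (L2 M)\<^esub> U v)"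
      by (simp only: eq)
    also have "\<dots> = star (B_of (L2 M)) (U v) \<otimes>\<^bsub>B_of (L2 M)\<^esub> U v"
      unfolding B.star_mult[OF B.star_closed[OF Uc] Uc] B.star_star[OF Uc] ..
    finally have star: "star (B_of (L2 M)) (U v) = U v" unfolding eq .
    show ?thesis unfolding projection_def using Uc star eq[unfolded star] by blast
  qed
  have orth: "U v \<otimes>\<^bsub>B_of (L2 M)\<^esub> U w = \<zero>\<^bsub>B_of (L2 M)\<^esub>" if v: "v \<in> vertices \<Lambda>" "w \<in> vertices \<Lambda>" "v \<noteq> w" for v w
  proof (rule L2_op_eqI)
    have vm: "v \<in> mor \<Lambda>" "w \<in> mor \<Lambda>" using v by simp_all
    note cv = cutoff_map[OF D_sets[OF vm(1)]] and cw = cutoff_map[OF D_sets[OF vm(2)]]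
    show "U v \<otimes>\<^bsub>B_of (L2 M)\<^esub> U w \<in> bounded_operators (L2 M)"
      by (rule B_closed(4)[OF U_bounded[OF vm(1)] U_bounded[OF vm(2)]])
    show "\<zero>\<^bsub>B_of (L2 M)\<^esub> \<in> bounded_operators (L2 M)" by simp
    fix \<xi> assume \<xi>: "\<xi> \<in> L2_fun M"
    have "AE x in M. \<not> (x \<in> Rg v \<and> x \<in> Rg w)" using v vm by (intro AE_disjoint) (auto simp: vertices_iff)
    then have "AE x in M. cutoff (D v) (cutoff (D w) \<xi>) x = 0"
      unfolding Rg_vertex[OF v(1)] Rg_vertex[OF v(2)] by (rule eventually_mono) (auto simp: cutoff_def indicator_def)
    then have "L2_class M (cutoff (D v) (cutoff (D w) \<xi>)) = L2_class M (\<lambda>x. 0)"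
      unfolding L2_class_eq[OF L2_map.F_closed[OF cv L2_map.F_closed[OF cw \<xi>]] L2_fun_zero] .
    then show "(U v \<otimes>\<^bsub>B_of (L2 M)\<^esub> U w) (L2_class M \<xi>) = \<zero>\<^bsub>B_of (L2 M)\<^esub> (L2_class M \<xi>)"
      unfolding B_apply[OF L2_class_carrier[OF \<xi>]] U_vertex[OF v(1)] U_vertex[OF v(2)]
        L2_map.lift_op_class[OF cw \<xi>] L2_map.lift_op_class[OF cv L2_map.F_closed[OF cw \<xi>]] L2_zero .
  qed
  show ?thesis
    unfolding CK_family_def
    by (intro conjI ballI allI impI B.cstar_algebra_axioms U_partial_isometry proj orth U_comp U_src U_vertex_sum)
qed

text \<open>If \<open>D v\<close> has infinite measure, semifiniteness supplies a subset of finite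
  positive measure. Its indicator is a nonzero vector fixed by \<open>U v\<close>.\<close>

lemma U_vertex_nonzero:
  assumes sf: "semifinite M" and v: "v \<in> vertices \<Lambda>"
  shows "nrm (B_of (L2 M)) (U v) \<noteq> 0"
proof
  interpret hilbert "L2 M" by (rule hilbert_L2)
  interpret B: cstar_algebra "B_of (L2 M)" by (rule cstar_algebra_B)
  have vm: "v \<in> mor \<Lambda>" using v by simp
  note cm = cutoff_map[OF D_sets[OF vm]]
  assume "nrm (B_of (L2 M)) (U v) = 0"
  then have zero: "U v = \<zero>\<^bsub>B_of (L2 M)\<^esub>" using B.nrm_eq_0[of "U v"] U_bounded[OF vm] by simp
  have "\<exists>E\<in>sets M. E \<subseteq> D v \<and> 0 < emeasure M E \<and> emeasure M E < \<infinity>"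
  proof (cases "emeasure M (D v) = \<infinity>")
    case True
    then show ?thesis using sf D_sets[OF vm] unfolding semifinite_def by blast
  next
    case False
    then show ?thesis using vertex_pos[OF v] D_sets[OF vm] by (intro bexI[of _ "D v"]) (auto simp: less_top)
  qed
  then obtain E where E: "E \<in> sets M" "E \<subseteq> D v" "0 < emeasure M E" "emeasure M E < \<infinity>" by blast
  define \<xi> where "\<xi> x = (indicator E x :: complex)" for x
  have \<xi>: "\<xi> \<in> L2_fun M"
  proof -
    have "(\<integral>\<^sup>+x. ennreal ((cmod (\<xi> x))\<^sup>2) \<partial>M) = (\<integral>\<^sup>+x. indicator E x \<partial>M)"
      by (rule nn_integral_cong) (simp add: \<xi>_def indicator_def)
    then show ?thesis using E by (simp add: L2_fun_iff \<xi>_def[abs_def])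
  qed
  have "cutoff (D v) \<xi> = \<xi>" using E(2) by (auto simp: cutoff_def \<xi>_def fun_eq_iff split: split_indicator)
  then have "L2_class M \<xi> = \<zero>\<^bsub>B_of (L2 M)\<^esub> (L2_class M \<xi>)"
    using L2_map.lift_op_class[OF cm \<xi>] U_vertex[OF v] zero by simp
  also have "\<dots> = L2_class M (\<lambda>x. 0)" unfolding B_apply(1)[OF L2_class_carrier[OF \<xi>]] L2_zero ..
  finally have "AE x in M. \<xi> x = 0" unfolding L2_class_eq[OF \<xi> L2_fun_zero] .
  then have "AE x in M. x \<notin> E" by (rule eventually_mono) (simp add: \<xi>_def indicator_def split: if_splits)
  then have "E \<in> null_sets M" using E(1) by (simp add: AE_iff_null_sets)
  then show False using E(3) by (simp add: null_sets_def)
qed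

end

theorem theorem3p5:
  fixes \<Lambda> :: "('p, 'k::finite) kgraph"
    and M :: "'x measure"
    and D :: "'p \<Rightarrow> 'x set" and \<tau> :: "'p \<Rightarrow> 'x \<Rightarrow> 'x" and code :: "nat ^ 'k \<Rightarrow> 'x \<Rightarrow> 'x"
    and \<Phi> :: "'p \<Rightarrow> 'x \<Rightarrow> real"
    and A :: "'a cstar" and s :: "'p \<Rightarrow> 'a"
  defines "S \<equiv> S_op \<Lambda> M D \<tau> code \<Phi>"
  assumes "k_graph \<Lambda>" and "finite_kgraph \<Lambda>" and "no_sources \<Lambda>"
    and "Lambda_semibranching_system \<Lambda> M D \<tau> code \<Phi>"
    and "is_graph_cstar TYPE('a) \<Lambda> A s"
    and "is_graph_cstar TYPE('x L2_op) \<Lambda> A s"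
  shows
    "(\<forall>\<mu>\<in>mor \<Lambda>. S \<mu> \<in> bounded_operators (L2 M) \<and>
        (\<forall>\<xi>\<in>L2_fun M. S \<mu> (L2_class M \<xi>) = L2_class M (S_fun \<Lambda> D \<tau> code \<Phi> \<mu> \<xi>))) \<and>
     CK_family \<Lambda> (B_of (L2 M)) S \<and>
     (\<exists>\<pi>. star_hom A (B_of (L2 M)) \<pi> \<and> (\<forall>\<mu>\<in>mor \<Lambda>. \<pi> (s \<mu>) = S \<mu>)) \<and>
     (aperiodic \<Lambda> \<and> semifinite M \<longrightarrow>
        (\<forall>\<pi>. star_hom A (B_of (L2 M)) \<pi> \<and> (\<forall>\<mu>\<in>mor \<Lambda>. \<pi> (s \<mu>) = S \<mu>) \<longrightarrow>
             inj_on \<pi> (carrier A)))"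
proof -
  interpret semibranching_kgraph \<Lambda> M D \<tau> code \<Phi>
    using assms(2,5) by (simp add: semibranching_kgraph_def)
  note univ = assms(7)[unfolded is_graph_cstar_def]
  have CK_A: "CK_family \<Lambda> A s" by (rule conjunct1[OF univ])
  have gen: "cstar_generated A (s ` mor \<Lambda>) = carrier A" by (rule conjunct1[OF conjunct2[OF univ]])
  have A: "cstar_algebra A" using CK_A unfolding CK_family_def by (rule conjunct1)
  have 1: "S \<mu> \<in> bounded_operators (L2 M) \<and> (\<forall>\<xi>\<in>L2_fun M. S \<mu> (L2_class M \<xi>) = L2_class M (S_fun \<Lambda> D \<tau> code \<Phi> \<mu> \<xi>))"
    if "\<mu> \<in> mor \<Lambda>" for \<mu>
    unfolding S_def using U_bounded[OF that] L2_map.lift_op_class[OF F_map[OF that]] U_eq by simp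
  have 2: "CK_family \<Lambda> (B_of (L2 M)) S" unfolding S_def by (rule U_CK_family)
  \<comment> \<open>The universal property of \<open>A\<close> at the element type of operators on
    the space of square integrable functions, applied to the family \<open>S\<close>.\<close>
  have 3: "\<exists>\<pi>. star_hom A (B_of (L2 M)) \<pi> \<and> (\<forall>\<mu>\<in>mor \<Lambda>. \<pi> (s \<mu>) = S \<mu>)"
    using conjunct2[OF conjunct2[OF univ]] 2 by blast
  have 4: "inj_on \<pi> (carrier A)"
    if ap: "aperiodic \<Lambda>" and sf: "semifinite M" and hom: "star_hom A (B_of (L2 M)) \<pi>" and \<pi>: "\<forall>\<mu>\<in>mor \<Lambda>. \<pi> (s \<mu>) = S \<mu>" for \<pi>
  proof -
    interpret B: cstar_algebra "B_of (L2 M)" by (rule hilbert.cstar_algebra_B[OF hilbert_L2])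
    interpret CK_rep \<Lambda> A s
      by (intro CK_rep.intro CK_rep_axioms.intro assms(2,3) A CK_A)
    interpret cstar_seminorm A "\<lambda>x. nrm (B_of (L2 M)) (\<pi> x)" 2
      by (rule star_hom_seminorm[OF A hilbert_L2 hom])
    interpret CK_seminorm \<Lambda> A s "\<lambda>x. nrm (B_of (L2 M)) (\<pi> x)" 2
    proof
      show "nrm (B_of (L2 M)) (\<pi> (s v)) \<noteq> 0" if "v \<in> vertices \<Lambda>" for v
        using U_vertex_nonzero[OF sf that] bspec[OF \<pi> vertexD(3)[OF that]] by (simp add: S_def)
    qed (rule ap)
    show ?thesis
    proof (rule inj_onI)
      fix x y assume xy: "x \<in> carrier A" "y \<in> carrier A" "\<pi> x = \<pi> y"
      \<comment> \<open>Elements with the same image differ by an element at which the seminorm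
        vanishes, and \<open>nrm_le_N\<close> then makes its norm zero.\<close>
      let ?d = "x \<oplus>\<^bsub>A\<^esub> (-1) \<odot>\<^bsub>A\<^esub> y"
      have d: "?d \<in> carrier A" using xy by simp
      have py: "\<pi> y \<in> carrier (B_of (L2 M))" by (rule star_homD(1)[OF hom xy(2)])
      have "\<pi> ?d = \<pi> y \<oplus>\<^bsub>B_of (L2 M)\<^esub> (-1) \<odot>\<^bsub>B_of (L2 M)\<^esub> \<pi> y"
        using star_homD(4)[OF hom xy(1) smult_closed[OF xy(2)]] star_homD(3)[OF hom xy(2)] xy(3) by simp
      also have "\<dots> = \<pi> y \<ominus>\<^bsub>B_of (L2 M)\<^esub> \<pi> y" by (rule B.minus_smult[OF py, symmetric])
      also have "\<dots> = \<zero>\<^bsub>B_of (L2 M)\<^esub>" unfolding a_minus_def by (rule B.r_neg[OF py])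
      finally have "nrm A ?d \<le> 0" using nrm_le_N[OF gen d] B.nrm_zero by simp
      then have "nrm A ?d = 0" using nrm_nonneg[OF d] by linarith
      then have "x \<ominus>\<^bsub>A\<^esub> y = \<zero>\<^bsub>A\<^esub>" using nrm_eq_0[OF d] minus_smult[OF xy(2)] by simp
      then show "x = y" by (rule diff_eq_0[OF xy(1,2)])
    qed
  qed
  show ?thesis using 1 2 3 4 by blast
qed

end
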